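(* Let $\lambda_m,c_m$ and $\lambda_s,c_s$ be the time and space constants of given middle product and short product algorithms, and let $c=\max(c_m+3,c_s+2)$. There is an algorithm which, given $A,B\in\mathbb{K}[X]$ of respective sizes $m+n$ and $n$ with $m\ge n$, such that the leading coefficient of $B$ (its coefficient of degree $n-1$) is invertible, computes $Q,R\in\mathbb{K}[X]$ of respective sizes $m+1$ and $n-1$ such that $A=BQ+R$, using $O(1)$ extra space and $$\left(\lambda_m\Big(\frac{c+1}{2}+\frac1c\Big)+\lambda_s\Big(2+\frac1c\Big)\right)\mathsf{M}(m)+O(m\log n)$$ operations in $\mathbb{K}$.
   Context: Model. $\mathbb{K}$ is the coefficient ring (commutative with unit). A size-$n$ polynomial is a polynomial of degree at most $n-1$, stored by its $n$ coefficients, one per register. A register may contain either an element of $\mathbb{K}$ or a pointer to the input or output space. The input space is read-only; the output space (here $m+1$ registers for $Q$ and $n-1$ registers for $R$) is pre-allocated and its registers may be read and written any number of times. The (extra) space of an algorithm is the number of registers used besides the input and output registers. Time is the number of arithmetic operations in $\mathbb{K}$. Underlying products. $\mathsf{M}(n)$ is a bound on the number of operations in $\mathbb{K}$ to multiply two size-$n$ polynomials, with $\alpha\mathsf{M}(n)\le\mathsf{M}(\alpha n)$ for any constant $\alpha\ge 1$. The middle product of a size-$(m+n-1)$ polynomial $F$ and a size-$n$ polynomial $G$ is the size-$m$ polynomial $\mathsf{MP}(F,G)=(FG \operatorname{div} X^{n-1})\bmod X^m$; $\lambda_m\mathsf{M}(n)$ and $c_m n$ denote the time and extra space of middle products of size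 $(2n-1,n)$; a middle product in size $(m+n-1,n)$ with $m<n$ then costs $\lceil n/m\rceil\lambda_m\mathsf{M}(m)$ operations and $(c_m+1)m$ extra space. The short product of two size-$n$ polynomials is $\mathsf{SP}(F,G)=FG\bmod X^n$, with time $\lambda_s\mathsf{M}(n)$ and extra space $c_s n$. It is known that full and short products can be computed in $O(\mathsf{M}(n))$ operations with $O(1)$ extra space. Logarithms are in base 2. *)

theory Defs
  imports Complex_Main "HOL-Computational_Algebra.Polynomial"
begin

section \<open>Polynomials of a given size\<close>

text \<open>Size \<open>n\<close> means degree at most \<open>n - 1\<close>; in particular only \<open>0\<close> has size \<open>0\<close>.\<close>

definition poly_of_size :: "nat \<Rightarrow> 'a::zero poly \<Rightarrow> bool" where
  "poly_of_size n p \<longleftrightarrow> p = 0 \<or> degree p < n"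

definition coeff_list :: "nat \<Rightarrow> 'a::zero poly \<Rightarrow> 'a list" where
  "coeff_list n p = map (coeff p) [0..<n]"

text \<open>Over a ring, \<open>poly_shift k p\<close> is \<open>p div X ^ k\<close> and \<open>poly_cutoff k p\<close> is
  \<open>p mod X ^ k\<close>.\<close>

definition middle_product :: "nat \<Rightarrow> nat \<Rightarrow> 'a::comm_ring_1 poly \<Rightarrow> 'a poly \<Rightarrow> 'a poly" where
  "middle_product m n F G = poly_cutoff m (poly_shift (n - 1) (F * G))"

definition short_product :: "nat \<Rightarrow> 'a::comm_ring_1 poly \<Rightarrow> 'a poly \<Rightarrow> 'a poly" where
  "short_product n F G = poly_cutoff n (F * G)"

section \<open>The register machine\<close>

text \<open>
  A single program serves all sizes: the sizes of the operands are passed as parameters, which,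
  like the coefficients of the operands, are read-only and are not counted as extra space.
  A register holds either a ring element or a pointer. A pointer is represented by an index,
  that is an offset into one of the three areas; the area is fixed by the instruction that
  uses the index. Besides the input and output areas there is the work area, which consists
  of the extra registers; it can be addressed indirectly as well, as algorithms that use
  linear extra space require.
\<close>

datatype area = Input | Output | Work

datatype 'a cell = Elt 'a | Idx nat

datatype iexp =
    Num nat
  | Param nat
  | Stored area iexp
  | IAdd iexp iexp
  | ISub iexp iexp
  | IMul iexp iexp
  | IDiv iexp iexp

datatype bexp = Less iexp iexp | BNot bexp | BAnd bexp bexp

type_synonym address = "area \<times> iexp"

datatype ring_op = Add | Sub | Mul | Div

text \<open>Control depends on indices only: there are no tests on ring elements.\<close>

datatype 'a com =
    Skip
  | Seq "'a com" "'a com"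
  | Cond bexp "'a com" "'a com"
  | While bexp "'a com"
  | Move address address
  | SetIdx address iexp
  | SetElt address 'a
  | Arith ring_op address address address

text \<open>The contents of the output area and of the work area. The lengths of the lists are the
  numbers of available registers; an access outside of them blocks execution.\<close>

type_synonym 'a mem = "'a cell list \<times> 'a cell list"

fun read_cell :: "'a list \<Rightarrow> 'a mem \<Rightarrow> area \<Rightarrow> nat \<Rightarrow> 'a cell option" where
  "read_cell inp (out, work) Input i = (if i < length inp then Some (Elt (inp ! i)) else None)"
| "read_cell inp (out, work) Output i = (if i < length out then Some (out ! i) else None)"
| "read_cell inp (out, work) Work i = (if i < length work then Some (work ! i) else None)"

fun write_cell :: "'a mem \<Rightarrow> area \<Rightarrow> nat \<Rightarrow> 'a cell \<Rightarrow> 'a mem option" where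
  "write_cell (out, work) Input i v = None"
| "write_cell (out, work) Output i v =
    (if i < length out then Some (out[i := v], work) else None)"
| "write_cell (out, work) Work i v =
    (if i < length work then Some (out, work[i := v]) else None)"

fun lift_option2 :: "('b \<Rightarrow> 'c \<Rightarrow> 'd) \<Rightarrow> 'b option \<Rightarrow> 'c option \<Rightarrow> 'd option" where
  "lift_option2 f (Some x) (Some y) = Some (f x y)"
| "lift_option2 f _ _ = None"

fun ieval :: "nat list \<Rightarrow> 'a list \<Rightarrow> 'a mem \<Rightarrow> iexp \<Rightarrow> nat option" where
  "ieval ps inp s (Num k) = Some k"
| "ieval ps inp s (Param j) = (if j < length ps then Some (ps ! j) else None)"
| "ieval ps inp s (Stored a e) =
    (case ieval ps inp s e of
       None \<Rightarrow> None
     | Some i \<Rightarrow> (case read_cell inp s a i of Some (Idx k) \<Rightarrow> Some k | _ \<Rightarrow> None))"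
| "ieval ps inp s (IAdd e f) = lift_option2 (+) (ieval ps inp s e) (ieval ps inp s f)"
| "ieval ps inp s (ISub e f) = lift_option2 (-) (ieval ps inp s e) (ieval ps inp s f)"
| "ieval ps inp s (IMul e f) = lift_option2 (*) (ieval ps inp s e) (ieval ps inp s f)"
| "ieval ps inp s (IDiv e f) = lift_option2 (div) (ieval ps inp s e) (ieval ps inp s f)"

fun beval :: "nat list \<Rightarrow> 'a list \<Rightarrow> 'a mem \<Rightarrow> bexp \<Rightarrow> bool option" where
  "beval ps inp s (Less e f) = lift_option2 (<) (ieval ps inp s e) (ieval ps inp s f)"
| "beval ps inp s (BNot b) = map_option Not (beval ps inp s b)"
| "beval ps inp s (BAnd b c) = lift_option2 (\<and>) (beval ps inp s b) (beval ps inp s c)"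

definition load :: "nat list \<Rightarrow> 'a list \<Rightarrow> 'a mem \<Rightarrow> address \<Rightarrow> 'a cell option" where
  "load ps inp s ae = Option.bind (ieval ps inp s (snd ae)) (read_cell inp s (fst ae))"

definition store ::
  "nat list \<Rightarrow> 'a list \<Rightarrow> 'a mem \<Rightarrow> address \<Rightarrow> 'a cell \<Rightarrow> 'a mem option" where
  "store ps inp s ae v =
     Option.bind (ieval ps inp s (snd ae)) (\<lambda>i. write_cell s (fst ae) i v)"

text \<open>Division is defined when the divisor is invertible, and the quotient is then unique.\<close>

fun ring_apply :: "ring_op \<Rightarrow> 'a::comm_ring_1 \<Rightarrow> 'a \<Rightarrow> 'a option" where
  "ring_apply Add x y = Some (x + y)"
| "ring_apply Sub x y = Some (x - y)"
| "ring_apply Mul x y = Some (x * y)"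
| "ring_apply Div x y = (if y dvd 1 then Some (THE z. z * y = x) else None)"

text \<open>An index stored in a register cannot exceed the total number of registers. Without a
  bound, a single register could encode an unbounded amount of pointer data.\<close>

fun max_index :: "'a list \<Rightarrow> 'a mem \<Rightarrow> nat" where
  "max_index inp (out, work) = length inp + length out + length work"

text \<open>\<open>exec ps inp c s t s'\<close>: started in \<open>s\<close> with parameters \<open>ps\<close> and input \<open>inp\<close>, the program
  \<open>c\<close> terminates without error in \<open>s'\<close> after \<open>t\<close> arithmetic operations in the ring. Copies,
  constants, pointer manipulation and control are not counted.\<close>

inductive exec :: "nat list \<Rightarrow> 'a::comm_ring_1 list \<Rightarrow> 'a com \<Rightarrow> 'a mem \<Rightarrow> nat \<Rightarrow> 'a mem \<Rightarrow> bool"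
  for ps :: "nat list" and inp :: "'a list"
where
  Skip: "exec ps inp Skip s 0 s"
| Seq: "exec ps inp (Seq c d) s (t + u) s''"
    if "exec ps inp c s t s'" and "exec ps inp d s' u s''"
| CondTrue: "exec ps inp (Cond b c d) s t s'"
    if "beval ps inp s b = Some True" and "exec ps inp c s t s'"
| CondFalse: "exec ps inp (Cond b c d) s t s'"
    if "beval ps inp s b = Some False" and "exec ps inp d s t s'"
| WhileFalse: "exec ps inp (While b c) s 0 s"
    if "beval ps inp s b = Some False"
| WhileTrue: "exec ps inp (While b c) s (t + u) s''"
    if "beval ps inp s b = Some True" and "exec ps inp c s t s'"
      and "exec ps inp (While b c) s' u s''"
| Move: "exec ps inp (Move d a) s 0 s'"
    if "load ps inp s a = Some v" and "store ps inp s d v = Some s'"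
| SetIdx: "exec ps inp (SetIdx d e) s 0 s'"
    if "ieval ps inp s e = Some i" and "i \<le> max_index inp s"
      and "store ps inp s d (Idx i) = Some s'"
| SetElt: "exec ps inp (SetElt d x) s 0 s'"
    if "store ps inp s d (Elt x) = Some s'"
| Arith: "exec ps inp (Arith f d a b) s 1 s'"
    if "load ps inp s a = Some (Elt x)" and "load ps inp s b = Some (Elt y)"
      and "ring_apply f x y = Some z" and "store ps inp s d (Elt z) = Some s'"

text \<open>\<open>computes c ps inp k w T P\<close>: on parameters \<open>ps\<close> and input \<open>inp\<close>, with \<open>k\<close> output registers
  and \<open>w\<close> extra registers, all of them with arbitrary initial contents, \<open>c\<close> performs at most \<open>T\<close>
  arithmetic operations and leaves in the output registers ring elements that satisfy \<open>P\<close>.\<close>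

definition computes ::
  "'a::comm_ring_1 com \<Rightarrow> nat list \<Rightarrow> 'a list \<Rightarrow> nat \<Rightarrow> nat \<Rightarrow> real \<Rightarrow> ('a list \<Rightarrow> bool) \<Rightarrow> bool" where
  "computes c ps inp k w T P \<longleftrightarrow>
     (\<forall>out work. length out = k \<longrightarrow> length work = w \<longrightarrow>
        (\<exists>t ys work'. exec ps inp c (out, work) t (map Elt ys, work') \<and> real t \<le> T \<and> P ys))"

section \<open>The underlying products\<close>

definition superlinear :: "(nat \<Rightarrow> real) \<Rightarrow> bool" where
  "superlinear M \<longleftrightarrow>
     (\<forall>(\<alpha>::real) n n'. 1 \<le> \<alpha> \<longrightarrow> 1 \<le> n \<longrightarrow> real n' = \<alpha> * real n \<longrightarrow> \<alpha> * M n \<le> M n')"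

definition multiplication_algorithm :: "'a::comm_ring_1 com \<Rightarrow> (nat \<Rightarrow> real) \<Rightarrow> bool" where
  "multiplication_algorithm c M \<longleftrightarrow>
     (\<forall>n\<ge>1. \<exists>w. \<forall>F G. poly_of_size n F \<longrightarrow> poly_of_size n G \<longrightarrow>
        computes c [n] (coeff_list n F @ coeff_list n G) (2 * n - 1) w (M n)
          (\<lambda>ys. ys = coeff_list (2 * n - 1) (F * G)))"

text \<open>The space constant \<open>\<sigma>\<close> is the coefficient of the linear term: a bounded number of further
  registers (loop counters, pointers) is allowed, so that \<open>\<sigma> = 0\<close> means constant space.\<close>

definition middle_product_algorithm ::
  "'a::comm_ring_1 com \<Rightarrow> (nat \<Rightarrow> real) \<Rightarrow> real \<Rightarrow> real \<Rightarrow> bool" where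
  "middle_product_algorithm c M \<tau> \<sigma> \<longleftrightarrow>
     (\<exists>d. \<forall>n\<ge>1. \<exists>w. real w \<le> \<sigma> * real n + d \<and>
        (\<forall>F G. poly_of_size (2 * n - 1) F \<longrightarrow> poly_of_size n G \<longrightarrow>
           computes c [n] (coeff_list (2 * n - 1) F @ coeff_list n G) n w (\<tau> * M n)
             (\<lambda>ys. ys = coeff_list n (middle_product n n F G))))"

definition short_product_algorithm ::
  "'a::comm_ring_1 com \<Rightarrow> (nat \<Rightarrow> real) \<Rightarrow> real \<Rightarrow> real \<Rightarrow> bool" where
  "short_product_algorithm c M \<tau> \<sigma> \<longleftrightarrow>
     (\<exists>d. \<forall>n\<ge>1. \<exists>w. real w \<le> \<sigma> * real n + d \<and>
        (\<forall>F G. poly_of_size n F \<longrightarrow> poly_of_size n G \<longrightarrow>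
           computes c [n] (coeff_list n F @ coeff_list n G) n w (\<tau> * M n)
             (\<lambda>ys. ys = coeff_list n (short_product n F G))))"

section \<open>Division with remainder\<close>

text \<open>The input is \<open>A\<close> followed by \<open>B\<close>, the output is \<open>Q\<close> followed by \<open>R\<close>; \<open>w\<close> is the number of
  extra registers and \<open>T\<close> bounds the number of operations.\<close>

definition divides_within ::
  "'a::comm_ring_1 com \<Rightarrow> nat \<Rightarrow> nat \<Rightarrow> nat \<Rightarrow> real \<Rightarrow> bool" where
  "divides_within c m n w T \<longleftrightarrow>
     (\<forall>A B. poly_of_size (m + n) A \<longrightarrow> poly_of_size n B \<longrightarrow> coeff B (n - 1) dvd 1 \<longrightarrow>
        computes c [m, n] (coeff_list (m + n) A @ coeff_list n B) ((m + 1) + (n - 1)) w T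
          (\<lambda>ys. \<exists>Q R. poly_of_size (m + 1) Q \<and> poly_of_size (n - 1) R \<and> A = B * Q + R \<and>
                 ys = coeff_list (m + 1) Q @ coeff_list (n - 1) R))"

end

(* Idea. Work with reversed coefficient lists, so that the quotient consists of the first m + 1
   coefficients of the power series A / B, and keep two things in the output area: the
   quotient coefficients found so far and, behind them, the residual of A that they leave.
   The next block of quotient coefficients is the short product of that residual with the
   inverse of B to a small precision k; middle products of size k update the residual inside the
   block, and everything needed for this fits into the part of the output not yet used.
   Afterwards the residual is recomputed in place: it is determined by its remainders modulo
   polynomials (X^a - 1) / (X - 1) with pairwise coprime a just below n / L, each of which costs one
   cyclic product of size a. The remainders are combined by a mixed radix (Garner) scheme in which
   division by X^a - 1 is a walk along an orbit of a rotation. Two or three blocks suffice, and the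
   costs of the block sizes chosen are strictly below the bound, which leaves room for all
   lower-order terms. *)
theory Submission
  imports Defs "HOL-Computational_Algebra.Formal_Power_Series" "HOL-Number_Theory.Cong" "HOL-Computational_Algebra.Polynomial_FPS"
begin


text \<open>The obstacle is the residual. It has n - 1 coefficients, but a product program may only
  borrow cells that are free at that moment, a constant fraction of n, and recomputing the residual
  by middle products of size k would take a number of them quadratic in n / k. The sizes a, in
  contrast, add up to about n, so at a linearised rate all cyclic products together cost as much as
  one product of size n. The polynomials X^a - 1 share the factor X - 1; over an arbitrary ring it
  is the quotients by X - 1 that become comaximal for coprime a. The last modulus still needs room
  for its own product, so the residues miss a few top coefficients of the residual. Those come from
  middle products of geometrically shrinking size. The time bound must hold for every ratio of the
  two product rates. A cyclic product costs one middle or two short products, whichever is cheaper,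
  so three ratios decide; they lead to the numeric estimates. The number of blocks is taken from a
  rational slightly above c, which keeps a reserve of space proportional to n for rounding and for
  the constant part of the work areas.\<close>

section \<open>Programs, abstract states, and the relocation of a given program\<close>

abbreviation V :: "nat \<Rightarrow> iexp" where "V x \<equiv> Stored Work (Num x)"

notation IAdd (infixl "[+]" 65) and ISub (infixl "[-]" 65) and IMul (infixl "[*]" 70)
  and IDiv (infixl "[div]" 70)

abbreviation seq_com (infixr ";;" 60) where "c ;; d \<equiv> Seq c d"

abbreviation setv (infix ":==" 61) where "x :== e \<equiv> SetIdx (Work, Num x) e"

definition Mod :: "iexp \<Rightarrow> iexp \<Rightarrow> iexp" where
  "Mod e f = e [-] f [*] (e [div] f)"

text \<open>The bound \<open>e\<close> is evaluated afresh before every round; the rules for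
  \<open>For\<close> therefore ask that it keeps its value.\<close>

definition For :: "nat \<Rightarrow> iexp \<Rightarrow> 'a com \<Rightarrow> 'a com" where
  "For x e c = (x :== Num 0 ;; While (Less (V x) e) (c ;; x :== V x [+] Num 1))"

text \<open>The components are the output cells, the values of the index registers 0 to 49, and the
  general cells 50 to 53 of the work area. Keeping index registers as numbers guarantees that
  expressions over them can be evaluated.\<close>

type_synonym 'a state = "(nat \<Rightarrow> 'a cell) \<times> (nat \<Rightarrow> nat) \<times> (nat \<Rightarrow> 'a cell)"

text \<open>Relocation of the addresses of an inner program: register 40 holds its only parameter,
  registers 41 and 42 the bases of its output and work areas, both of which lie in the output area.
  The image of \<open>Stored Input\<close> is arbitrary, since input cells never hold an index and
  such an expression has no value.\<close>

fun te :: "iexp \<Rightarrow> iexp" where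
  "te (Num k) = Num k"
| "te (Param j) = V 40"
| "te (Stored Input e) = Num 0"
| "te (Stored Output e) = Stored Output (V 41 [+] te e)"
| "te (Stored Work e) = Stored Output (V 42 [+] te e)"
| "te (IAdd e f) = IAdd (te e) (te f)"
| "te (ISub e f) = ISub (te e) (te f)"
| "te (IMul e f) = IMul (te e) (te f)"
| "te (IDiv e f) = IDiv (te e) (te f)"

fun teb :: "bexp \<Rightarrow> bexp" where
  "teb (Less e f) = Less (te e) (te f)"
| "teb (BNot b) = BNot (teb b)"
| "teb (BAnd b c) = BAnd (teb b) (teb c)"

fun ta :: "address \<Rightarrow> address" where
  "ta (Input, e) = (Input, Num 0)"
| "ta (Output, e) = (Output, V 41 [+] te e)"
| "ta (Work, e) = (Output, V 42 [+] te e)"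

text \<open>The input of the inner program is virtual: the index goes to register 43, and the fetch
  program \<open>F\<close> leaves the element in cell 50. Operands move on to cells 51 and 52
  because one instruction may require two fetches.\<close>

fun get :: "'a com \<Rightarrow> address \<Rightarrow> nat \<Rightarrow> 'a com" where
  "get F (Input, e) k = (43 :== te e ;; F ;; Move (Work, Num (50 + k)) (Work, Num 50))"
| "get F (Output, e) k = Move (Work, Num (50 + k)) (ta (Output, e))"
| "get F (Work, e) k = Move (Work, Num (50 + k)) (ta (Work, e))"

fun tr :: "'a com \<Rightarrow> 'a com \<Rightarrow> 'a com" where
  "tr F Skip = Skip"
| "tr F (Seq c d) = (tr F c ;; tr F d)"
| "tr F (Cond b c d) = Cond (teb b) (tr F c) (tr F d)"
| "tr F (While b c) = While (teb b) (tr F c)"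
| "tr F (Move d a) = (get F a 1 ;; Move (ta d) (Work, Num 51))"
| "tr F (SetIdx d e) = SetIdx (ta d) (te e)"
| "tr F (SetElt d x) = SetElt (ta d) x"
| "tr F (Arith f d a b) = (get F a 1 ;; get F b 2 ;; Arith f (ta d) (Work, Num 51) (Work, Num 52))"

locale machine =
  fixes ps :: "nat list" and inp :: "'a::comm_ring_1 list" and LEN :: nat
begin

fun conc :: "'a state \<Rightarrow> 'a mem" where
  "conc (g, v, z) = (map g [0..<LEN], map (\<lambda>x. Idx (v x)) [0..<50] @ map z [0..<4])"

lemma read_conc [simp]:
  "read_cell inp (conc (g, v, z)) Output i = (if i < LEN then Some (g i) else None)"
  "read_cell inp (conc (g, v, z)) Work i =
     (if i < 50 then Some (Idx (v i)) else if i < 54 then Some (z (i - 50)) else None)"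
  "read_cell inp (conc (g, v, z)) Input i = (if i < length inp then Some (Elt (inp ! i)) else None)"
  by (auto simp: nth_append simp del: upt_rec_numeral)

lemma map_upd_eq: "(map g [0..<n])[i := x] = map (g(i := x)) [0..<n]"
  by (rule nth_equalityI) (simp_all add: nth_list_update)

lemma write_conc_out [simp]:
  "i < LEN \<Longrightarrow> write_cell (conc (g, v, z)) Output i x = Some (conc (g(i := x), v, z))"
  by (simp add: map_upd_eq)

lemma write_conc_idx [simp]:
  assumes "i < 50"
  shows "write_cell (conc (g, v, z)) Work i (Idx k) = Some (conc (g, v(i := k), z))"
proof -
  have "(map (\<lambda>x. Idx (v x)) [0..<50])[i := Idx k] = map (\<lambda>x. Idx ((v(i := k)) x)) [0..<50]"
    by (rule nth_equalityI) (simp_all add: nth_list_update del: upt_rec_numeral)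
  then show ?thesis
    using assms by (simp add: list_update_append del: upt_rec_numeral fun_upd_apply)
qed

lemma write_conc_elt [simp]:
  assumes "i < 4"
  shows "write_cell (conc (g, v, z)) Work (50 + i) x = Some (conc (g, v, z(i := x)))"
  using assms by (simp add: list_update_append map_upd_eq del: upt_rec_numeral)

declare conc.simps [simp del]

lemma max_index_conc [simp]: "max_index inp (conc s) = length inp + LEN + 54"
  by (cases s) (simp add: conc.simps del: upt_rec_numeral)

text \<open>Index expressions over the index registers and the parameters only.\<close>

fun okx :: "iexp \<Rightarrow> bool" where
  "okx (Num k) = True"
| "okx (Param j) = (j < length ps)"
| "okx (Stored a e) = (a = Work \<and> (case e of Num x \<Rightarrow> x < 50 | _ \<Rightarrow> False))"
| "okx (IAdd e f) = (okx e \<and> okx f)"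
| "okx (ISub e f) = (okx e \<and> okx f)"
| "okx (IMul e f) = (okx e \<and> okx f)"
| "okx (IDiv e f) = (okx e \<and> okx f)"

fun val :: "(nat \<Rightarrow> nat) \<Rightarrow> iexp \<Rightarrow> nat" where
  "val v (Num k) = k"
| "val v (Param j) = ps ! j"
| "val v (Stored a e) = (case e of Num x \<Rightarrow> v x | _ \<Rightarrow> 0)"
| "val v (IAdd e f) = val v e + val v f"
| "val v (ISub e f) = val v e - val v f"
| "val v (IMul e f) = val v e * val v f"
| "val v (IDiv e f) = val v e div val v f"

lemma okx_Mod [simp]: "okx (Mod e f) \<longleftrightarrow> okx e \<and> okx f"
  by (auto simp: Mod_def)

lemma val_Mod [simp]: "val v (Mod e f) = val v e mod val v f"
  by (simp add: Mod_def minus_mult_div_eq_mod)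

lemma ieval_conc: "okx e \<Longrightarrow> ieval ps inp (conc (g, v, z)) e = Some (val v e)"
proof (induction e)
  case (Stored a e)
  then show ?case by (cases e) auto
qed auto

fun okb :: "bexp \<Rightarrow> bool" where
  "okb (Less e f) = (okx e \<and> okx f)"
| "okb (BNot b) = okb b"
| "okb (BAnd b c) = (okb b \<and> okb c)"

fun bval :: "(nat \<Rightarrow> nat) \<Rightarrow> bexp \<Rightarrow> bool" where
  "bval v (Less e f) = (val v e < val v f)"
| "bval v (BNot b) = (\<not> bval v b)"
| "bval v (BAnd b c) = (bval v b \<and> bval v c)"

lemma beval_conc: "okb b \<Longrightarrow> beval ps inp (conc (g, v, z)) b = Some (bval v b)"
  by (induction b) (auto simp: ieval_conc)

subsection \<open>Loop-free programs\<close>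

text \<open>Within the work area only the cells 50 to 53 are addressed this way. Index registers are
  read through expressions and written by \<open>SetIdx\<close> alone, so their type cannot be
  destroyed.\<close>

fun aload :: "'a state \<Rightarrow> address \<Rightarrow> 'a cell option" where
  "aload (g, v, z) (Input, e) =
     (if okx e \<and> val v e < length inp then Some (Elt (inp ! val v e)) else None)"
| "aload (g, v, z) (Output, e) = (if okx e \<and> val v e < LEN then Some (g (val v e)) else None)"
| "aload (g, v, z) (Work, e) =
     (if okx e \<and> 50 \<le> val v e \<and> val v e < 54 then Some (z (val v e - 50)) else None)"

fun astore :: "'a state \<Rightarrow> address \<Rightarrow> 'a cell \<Rightarrow> 'a state option" where
  "astore (g, v, z) (Input, e) x = None"
| "astore (g, v, z) (Output, e) x =
     (if okx e \<and> val v e < LEN then Some (g(val v e := x), v, z) else None)"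
| "astore (g, v, z) (Work, e) x =
     (if okx e \<and> 50 \<le> val v e \<and> val v e < 54 then Some (g, v, z(val v e - 50 := x)) else None)"

lemma load_conc: "aload s a = Some x \<Longrightarrow> load ps inp (conc s) a = Some x"
  by (cases s; cases a; cases "fst a")
    (auto simp: load_def ieval_conc split: if_splits)

lemma store_conc: "astore s a x = Some s' \<Longrightarrow> store ps inp (conc s) a x = Some (conc s')"
proof -
  assume *: "astore s a x = Some s'"
  obtain g v z where s: "s = (g, v, z)" by (cases s)
  obtain r e where a: "a = (r, e)" by (cases a)
  show ?thesis
  proof (cases r)
    case Work
    have "okx e" "50 \<le> val v e" "val v e < 54" "s' = (g, v, z(val v e - 50 := x))"
      using * s a Work by (auto split: if_splits)
    then show ?thesis
      using write_conc_elt[of "val v e - 50" g v z x] by (simp add: store_def ieval_conc s a Work)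
  qed (use * s a in \<open>auto simp: store_def ieval_conc split: if_splits\<close>)
qed

text \<open>Symbolic execution by rewriting, with a count of the operations. \<open>None\<close>
  stands for an error as well as for a form that is not covered, so soundness is a single
  implication.\<close>

fun sx :: "'a com \<Rightarrow> 'a state \<Rightarrow> (nat \<times> 'a state) option" where
  "sx Skip s = Some (0, s)"
| "sx (Seq c d) s = (case sx c s of None \<Rightarrow> None | Some (t, s1) \<Rightarrow>
     (case sx d s1 of None \<Rightarrow> None | Some (u, s2) \<Rightarrow> Some (t + u, s2)))"
| "sx (Cond b c d) (g, v, z) =
     (if okb b then if bval v b then sx c (g, v, z) else sx d (g, v, z) else None)"
| "sx (While b c) s = None"
| "sx (Move d a) s = (case aload s a of None \<Rightarrow> None | Some x \<Rightarrow> map_option (Pair 0) (astore s d x))"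
| "sx (SetIdx d e) (g, v, z) = (case d of (Work, Num x) \<Rightarrow>
     (if x < 50 \<and> okx e \<and> val v e \<le> length inp + LEN + 54 then Some (0, (g, v(x := val v e), z)) else None)
     | _ \<Rightarrow> None)"
| "sx (SetElt d x) s = map_option (Pair 0) (astore s d (Elt x))"
| "sx (Arith f d a b) s = (case aload s a of Some (Elt x) \<Rightarrow> (case aload s b of Some (Elt y) \<Rightarrow>
      (case ring_apply f x y of Some w \<Rightarrow> map_option (Pair 1) (astore s d (Elt w)) | None \<Rightarrow> None)
      | _ \<Rightarrow> None) | _ \<Rightarrow> None)"

lemma sx_sound: "sx c s = Some (t, s') \<Longrightarrow> exec ps inp c (conc s) t (conc s')"
proof (induction c s arbitrary: t s' rule: sx.induct)
  case (3 b c d g v z)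
  then show ?case
    by (cases "okb b"; cases "bval v b") (auto intro: exec.CondTrue exec.CondFalse simp: beval_conc)
next
  case (6 d e g v z)
  then obtain x where "d = (Work, Num x)" "x < 50" "okx e" "val v e \<le> length inp + LEN + 54"
    "t = 0" "s' = (g, v(x := val v e), z)"
    by (auto split: prod.splits area.splits iexp.splits if_splits)
  then show ?case
    by (auto intro!: exec.SetIdx simp: ieval_conc store_def)
next
  case (5 d a s)
  then show ?case
    by (auto intro!: exec.Move load_conc store_conc split: option.splits)
next
  case (8 f d a b s)
  then show ?case
    by (auto intro!: exec.Arith[unfolded One_nat_def] load_conc store_conc split: option.splits cell.splits)
qed (auto intro!: exec.intros store_conc split: option.splits)

text \<open>Total correctness with a cost bound. The bound is real because the costs of the product
  programs enter through real rates.\<close>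

definition WP :: "'a com \<Rightarrow> real \<Rightarrow> ('a state \<Rightarrow> bool) \<Rightarrow> 'a state \<Rightarrow> bool" where
  "WP c C Q s \<longleftrightarrow> (\<exists>t s'. exec ps inp c (conc s) t (conc s') \<and> real t \<le> C \<and> Q s')"

lemma WP_weaken:
  assumes "WP c C Q s" and "\<And>s'. Q s' \<Longrightarrow> Q' s'" and "C \<le> C'"
  shows "WP c C' Q' s"
  using assms unfolding WP_def by (meson order_trans)

lemma WP_seq:
  assumes "WP c C (WP d D Q) s"
  shows "WP (c ;; d) (C + D) Q s"
proof -
  obtain t s1 where 1: "exec ps inp c (conc s) t (conc s1)" "real t \<le> C" "WP d D Q s1"
    using assms unfolding WP_def by blast
  then obtain u s2 where "exec ps inp d (conc s1) u (conc s2)" "real u \<le> D" "Q s2"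
    unfolding WP_def by blast
  then show ?thesis
    unfolding WP_def using 1
    by (intro exI[of _ "t + u"] exI[of _ s2]) (auto intro: exec.Seq)
qed

lemma WP_then:
  assumes "WP c C P s" and "\<And>s'. P s' \<Longrightarrow> WP d D Q s'"
  shows "WP (c ;; d) (C + D) Q s"
  using WP_seq[OF WP_weaken[OF assms(1), of "WP d D Q" C]] assms(2) by simp

lemma WP_sx:
  assumes "sx c s = Some (t, s')" and "real t \<le> C" and "Q s'"
  shows "WP c C Q s"
  using assms sx_sound unfolding WP_def by blast

lemma WP_sx_then:
  assumes "sx c s = Some (0, s')" and "WP d D Q s'"
  shows "WP (c ;; d) D Q s"
  using WP_then[OF WP_sx[OF assms(1), of 0 "\<lambda>x. x = s'"]] assms(2) by simp

lemma WP_cond: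
  assumes "okb b" and "bval v b \<Longrightarrow> WP c C Q (g, v, z)" and "\<not> bval v b \<Longrightarrow> WP d C Q (g, v, z)"
  shows "WP (Cond b c d) C Q (g, v, z)"
proof (cases "bval v b")
  case True
  then show ?thesis
    using assms beval_conc[of b g v z] exec.CondTrue unfolding WP_def by metis
next
  case False
  then show ?thesis
    using assms beval_conc[of b g v z] exec.CondFalse unfolding WP_def by metis
qed

text \<open>\<open>k\<close> is the number of rounds still to come: it indexes the invariant,
  ensures termination, and selects the cost of the current round.\<close>

lemma WP_while:
  assumes "I k s"
    and "\<And>k g v z. I (Suc k) (g, v, z) \<Longrightarrow> okb b \<and> bval v b \<and> WP c (C k) (I k) (g, v, z)"
    and "\<And>g v z. I 0 (g, v, z) \<Longrightarrow> okb b \<and> \<not> bval v b \<and> Q (g, v, z)"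
  shows "WP (While b c) (\<Sum>i<k. C i) Q s"
  using assms(1)
proof (induction k arbitrary: s)
  case 0
  obtain g v z where s: "s = (g, v, z)" by (cases s)
  then have "okb b" "\<not> bval v b" "Q s" using assms(3) 0 by auto
  then show ?case
    unfolding WP_def s by (intro exI[of _ 0] exI[of _ "(g, v, z)"]) (auto intro: exec.WhileFalse simp: beval_conc)
next
  case (Suc k)
  obtain g v z where s: "s = (g, v, z)" by (cases s)
  have *: "okb b" "bval v b" "WP c (C k) (I k) (g, v, z)" using assms(2) Suc.prems s by auto
  then obtain t s1 where 1: "exec ps inp c (conc (g, v, z)) t (conc s1)" "real t \<le> C k" "I k s1"
    unfolding WP_def by blast
  from Suc.IH[OF 1(3)] obtain u s2
    where "exec ps inp (While b c) (conc s1) u (conc s2)" "real u \<le> (\<Sum>i<k. C i)" "Q s2"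
    unfolding WP_def by blast
  then show ?case
    unfolding WP_def s using 1 *
    by (intro exI[of _ "t + u"] exI[of _ s2]) (auto intro: exec.WhileTrue simp: beval_conc)
qed

text \<open>The body must establish the next invariant for the registers as they are after the
  increment of \<open>x\<close>, which the loop performs on its own; hence the update in its
  postcondition.\<close>

lemma WP_for:
  assumes x: "x < 50" and e: "okx e" and n: "n \<le> length inp + LEN + 53"
    and 0: "I 0 (g, v(x := 0), z)"
    and step: "\<And>i g v z. i < n \<Longrightarrow> I i (g, v, z) \<Longrightarrow>
      WP c (C i) (\<lambda>(g, v, z). v x = i \<and> I (Suc i) (g, v(x := Suc i), z)) (g, v, z)"
    and inv: "\<And>i g v z. i \<le> n \<Longrightarrow> I i (g, v, z) \<Longrightarrow> v x = i \<and> val v e = n"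
    and Q: "\<And>s. I n s \<Longrightarrow> Q s"
  shows "WP (For x e c) (\<Sum>i<n. C i) Q (g, v, z)"
proof -
  let ?w = "While (Less (V x) e) (c ;; x :== V x [+] Num 1)"
  \<comment> \<open>\<open>WP_while\<close> counts the remaining rounds, the invariant
    \<open>I\<close> the completed ones.\<close>
  let ?J = "\<lambda>k s. k \<le> n \<and> I (n - k) s"
  have "WP ?w (\<Sum>i<n. C (n - Suc i)) Q (g, v(x := 0), z)"
  proof (rule WP_while[where I = ?J])
    show "?J n (g, v(x := 0), z)" using 0 by simp
  next
    fix k g v z assume J: "?J (Suc k) (g, v, z)"
    then have *: "I (n - Suc k) (g, v, z)" "n - Suc k < n" "Suc (n - Suc k) = n - k" by auto
    have b: "okb (Less (V x) e)" "bval v (Less (V x) e)"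
      using inv[OF _ *(1)] * x e by auto
    have "WP (c ;; x :== V x [+] Num 1) (C (n - Suc k) + 0) (?J k) (g, v, z)"
    proof (rule WP_then[OF step[OF *(2,1)]], clarify)
      fix g v z assume "v x = n - Suc k" "I (Suc (n - Suc k)) (g, v(x := Suc (n - Suc k)), z)"
      then show "WP (x :== V x [+] Num 1) 0 (?J k) (g, v, z)"
        using x n J * by (intro WP_sx[of _ _ 0 "(g, v(x := n - k), z)"]) auto
    qed
    then show "okb (Less (V x) e) \<and> bval v (Less (V x) e) \<and>
        WP (c ;; x :== V x [+] Num 1) (C (n - Suc k)) (?J k) (g, v, z)"
      using b by simp
  next
    fix g v z assume "?J 0 (g, v, z)"
    then show "okb (Less (V x) e) \<and> \<not> bval v (Less (V x) e) \<and> Q (g, v, z)"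
      using inv[of n g v z] Q x e by auto
  qed
  moreover have "(\<Sum>i<n. C (n - Suc i)) = (\<Sum>i<n. C i)"
    by (rule sum.nat_diff_reindex)
  ultimately show ?thesis
    unfolding For_def using x by (intro WP_sx_then[of _ _ "(g, v(x := 0), z)"]) auto
qed

text \<open>For loop-free bodies that change no index register the state after \<open>i\<close>
  rounds is given in closed form by \<open>G\<close> and \<open>Z\<close>, and one symbolic
  execution of the body replaces the invariant.\<close>

lemma WP_for_sx:
  assumes x: "x < 50" and e: "okx e" and n: "n \<le> length inp + LEN + 53"
    and "\<And>i. i \<le> n \<Longrightarrow> val (v(x := i)) e = n"
    and G0: "\<And>y. G 0 y = g y" and Z0: "\<And>y. Z 0 y = z y"
    and "\<And>i. i < n \<Longrightarrow> sx c (G i, v(x := i), Z i) = Some (k, (G (Suc i), v(x := i), Z (Suc i)))"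
    and "real n * real k \<le> C"
    and "Q (G n, v(x := n), Z n)"
  shows "WP (For x e c) C Q (g, v, z)"
proof -
  have [simp]: "G 0 = g" "Z 0 = z"
    using G0 Z0 by auto
  have "WP (For x e c) (\<Sum>i<n. real k) Q (g, v, z)"
  proof (rule WP_for[where I = "\<lambda>i s. s = (G i, v(x := i), Z i)", OF x e n])
    fix i g' v' z' assume i: "i < n" "(g', v', z') = (G i, v(x := i), Z i)"
    show "WP c (real k) (\<lambda>(g, v', z). v' x = i \<and> (g, v'(x := Suc i), z) = (G (Suc i), v(x := Suc i), Z (Suc i)))
        (g', v', z')"
      unfolding i by (rule WP_sx[OF assms(7)[OF i(1)]]) auto
  qed (use assms in auto)
  then show ?thesis
    by (rule WP_weaken) (use assms(8) in auto)
qed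

subsection \<open>Running a program inside the output area\<close>

text \<open>The inner memory is a window of the output area that starts at \<open>ob\<close>: the
  inner output, followed by the inner work area. Outside the window nothing changes, and among the
  index registers only the fetch register 43 may differ; the cells in the last component are scratch
  and stay unconstrained.\<close>

definition sim :: "nat \<Rightarrow> nat \<Rightarrow> nat \<Rightarrow> (nat \<Rightarrow> 'a cell) \<Rightarrow> (nat \<Rightarrow> nat) \<Rightarrow> 'a mem \<Rightarrow> 'a state \<Rightarrow> bool" where
  "sim ob lo lw g0 v0 s \<sigma> \<longleftrightarrow> length (fst s) = lo \<and> length (snd s) = lw \<and>
     (\<forall>i<lo. fst \<sigma> (ob + i) = fst s ! i) \<and> (\<forall>i<lw. fst \<sigma> (ob + lo + i) = snd s ! i) \<and>
     (\<forall>y. y < ob \<or> ob + lo + lw \<le> y \<longrightarrow> fst \<sigma> y = g0 y) \<and>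
     (\<forall>x. x \<noteq> 43 \<longrightarrow> fst (snd \<sigma>) x = v0 x)"

context
  fixes F :: "'a com" and vin :: "'a list" and ob lo lw :: nat
    and g0 :: "nat \<Rightarrow> 'a cell" and v0 :: "nat \<Rightarrow> nat"
  assumes v0: "v0 41 = ob" "v0 42 = ob + lo"
    and LEN: "ob + lo + lw \<le> LEN"
    and vin: "length vin \<le> length inp"
    and F: "\<And>g v z. \<lbrakk>\<And>y. y < ob \<or> ob + lo + lw \<le> y \<Longrightarrow> g y = g0 y; \<And>x. x \<noteq> 43 \<Longrightarrow> v x = v0 x;
        v 43 < length vin\<rbrakk> \<Longrightarrow> sx F (g, v, z) = Some (0, (g, v, z(0 := Elt (vin ! v 43))))"
begin

lemma te_correct:
  assumes "sim ob lo lw g0 v0 s (g, v, z)" and "ieval [v0 40] vin s e = Some k"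
  shows "ieval ps inp (conc (g, v, z)) (te e) = Some k"
  using assms(2)
proof (induction e arbitrary: k)
  case (Stored a e)
  obtain out wk where s: "s = (out, wk)" by (cases s)
  obtain i where i: "ieval [v0 40] vin s e = Some i" "read_cell vin s a i = Some (Idx k)"
    using Stored.prems by (auto split: option.splits cell.splits)
  have v: "v 41 = ob" "v 42 = ob + lo"
    using assms(1) v0 by (auto simp: sim_def)
  show ?case
    using i Stored.IH[OF i(1)] assms(1) v LEN
    by (cases a) (auto simp: s sim_def split: if_splits)
next
  case (IAdd e f)
  then show ?case
    by (cases "ieval [v0 40] vin s e"; cases "ieval [v0 40] vin s f") auto
next
  case (ISub e f)
  then show ?case
    by (cases "ieval [v0 40] vin s e"; cases "ieval [v0 40] vin s f") auto
next
  case (IMul e f)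
  then show ?case
    by (cases "ieval [v0 40] vin s e"; cases "ieval [v0 40] vin s f") auto
next
  case (IDiv e f)
  then show ?case
    by (cases "ieval [v0 40] vin s e"; cases "ieval [v0 40] vin s f") auto
qed (use assms in \<open>auto simp: sim_def split: if_splits\<close>)

lemma teb_correct:
  assumes "sim ob lo lw g0 v0 s (g, v, z)" and "beval [v0 40] vin s b = Some k"
  shows "beval ps inp (conc (g, v, z)) (teb b) = Some k"
  using assms(2)
proof (induction b arbitrary: k)
  case (Less e f)
  then show ?case
    by (cases "ieval [v0 40] vin s e"; cases "ieval [v0 40] vin s f")
      (auto simp: te_correct[OF assms(1)])
next
  case (BAnd b c)
  then show ?case
    by (cases "beval [v0 40] vin s b"; cases "beval [v0 40] vin s c") auto
qed auto

lemma get_correct: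
  assumes sim: "sim ob lo lw g0 v0 s (g, v, z)" and ld: "load [v0 40] vin s a = Some x"
    and k: "k = 1 \<or> k = 2"
  shows "\<exists>v' z'. exec ps inp (get F a k) (conc (g, v, z)) 0 (conc (g, v', z')) \<and>
    sim ob lo lw g0 v0 s (g, v', z') \<and> z' k = x \<and> (\<forall>j. j \<noteq> 0 \<longrightarrow> j \<noteq> k \<longrightarrow> z' j = z j)"
proof -
  obtain r e where a: "a = (r, e)" by (cases a)
  obtain out wk where s: "s = (out, wk)" by (cases s)
  obtain i where i: "ieval [v0 40] vin s e = Some i" "read_cell vin s r i = Some x"
    using ld by (auto simp: load_def a bind_eq_Some_conv)
  note te = te_correct[OF sim i(1)]
  have v: "v 41 = ob" "v 42 = ob + lo"
    using sim v0 by (auto simp: sim_def)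
  have st: "store ps inp (conc (g, w, y)) (Work, Num (50 + k)) x = Some (conc (g, w, y(k := x)))" for w y
    using k write_conc_elt[of 1] write_conc_elt[of 2] by (auto simp: store_def)
  show ?thesis
  proof (cases r)
    case Input
    then have x: "i < length vin" "x = Elt (vin ! i)" using i(2) s by (auto split: if_splits)
    let ?v = "v(43 := i)" and ?z = "z(0 := x)"
    have 1: "exec ps inp (43 :== te e) (conc (g, v, z)) 0 (conc (g, ?v, z))"
      using te x vin by (intro exec.SetIdx[of _ _ _ _ i]) (auto simp: store_def)
    have "sx F (g, ?v, z) = Some (0, (g, ?v, ?z))"
      using F[of g ?v z] sim x by (auto simp: sim_def)
    then have 2: "exec ps inp F (conc (g, ?v, z)) 0 (conc (g, ?v, ?z))"
      by (rule sx_sound)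
    have 3: "exec ps inp (Move (Work, Num (50 + k)) (Work, Num 50)) (conc (g, ?v, ?z)) 0
        (conc (g, ?v, ?z(k := x)))"
      by (intro exec.Move[of _ _ _ _ x]) (auto simp: st, auto simp: load_def)
    show ?thesis
      using exec.Seq[OF 1 exec.Seq[OF 2 3]] sim
      by (intro exI[of _ ?v] exI[of _ "?z(k := x)"]) (auto simp: a Input sim_def)
  next
    case Output
    have "load ps inp (conc (g, v, z)) (ta a) = Some x"
      using i te v sim LEN by (auto simp: a Output load_def s sim_def split: if_splits)
    then show ?thesis
      using sim by (intro exI[of _ v] exI[of _ "z(k := x)"])
        (auto simp: a Output sim_def intro!: exec.Move simp: st)
  next
    case Work
    have "load ps inp (conc (g, v, z)) (ta a) = Some x"
      using i te v sim LEN by (auto simp: a Work load_def s sim_def split: if_splits)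
    then show ?thesis
      using sim by (intro exI[of _ v] exI[of _ "z(k := x)"])
        (auto simp: a Work sim_def intro!: exec.Move simp: st)
  qed
qed

lemma store_correct:
  assumes sim: "sim ob lo lw g0 v0 s (g, v, z)" and st: "store [v0 40] vin s a x = Some s'"
  shows "\<exists>g'. store ps inp (conc (g, v, z)) (ta a) x = Some (conc (g', v, z)) \<and>
    sim ob lo lw g0 v0 s' (g', v, z)"
proof -
  obtain r e where a: "a = (r, e)" by (cases a)
  obtain out wk where s: "s = (out, wk)" by (cases s)
  obtain i where i: "ieval [v0 40] vin s e = Some i" "write_cell s r i x = Some s'"
    using st by (auto simp: store_def a bind_eq_Some_conv)
  note te = te_correct[OF sim i(1)]
  have v: "v 41 = ob" "v 42 = ob + lo"
    using sim v0 by (auto simp: sim_def)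
  show ?thesis
  proof (cases r)
    case Output
    then have "i < lo" "s' = (out[i := x], wk)" using i(2) s sim by (auto simp: sim_def split: if_splits)
    then show ?thesis
      using sim te v LEN s
      by (intro exI[of _ "g(ob + i := x)"]) (auto simp: a Output store_def sim_def nth_list_update)
  next
    case Work
    then have "i < lw" "s' = (out, wk[i := x])" using i(2) s sim by (auto simp: sim_def split: if_splits)
    then show ?thesis
      using sim te v LEN s
      by (intro exI[of _ "g(ob + lo + i := x)"]) (auto simp: a Work store_def sim_def nth_list_update)
  qed (use i s in auto)
qed

lemma tr_correct:
  assumes "exec [v0 40] vin c s t s'" and "sim ob lo lw g0 v0 s \<sigma>"
  shows "\<exists>\<sigma>'. exec ps inp (tr F c) (conc \<sigma>) t (conc \<sigma>') \<and> sim ob lo lw g0 v0 s' \<sigma>'"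
  using assms
proof (induction arbitrary: \<sigma> rule: exec.induct)
  case (Skip s)
  then show ?case by (intro exI[of _ \<sigma>]) (auto intro: exec.Skip)
next
  case (Seq c s t s' d u s'')
  then obtain \<sigma>1 where 1: "exec ps inp (tr F c) (conc \<sigma>) t (conc \<sigma>1)" "sim ob lo lw g0 v0 s' \<sigma>1"
    by blast
  then obtain \<sigma>2 where "exec ps inp (tr F d) (conc \<sigma>1) u (conc \<sigma>2)" "sim ob lo lw g0 v0 s'' \<sigma>2"
    using Seq by blast
  then show ?case
    using exec.Seq[OF 1(1)] by (intro exI[of _ \<sigma>2]) simp
next
  case (CondTrue s b c t s' d)
  obtain g v z where \<sigma>: "\<sigma> = (g, v, z)" by (cases \<sigma>)
  have "beval ps inp (conc \<sigma>) (teb b) = Some True"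
    using teb_correct CondTrue \<sigma> by blast
  moreover obtain \<sigma>1 where "exec ps inp (tr F c) (conc \<sigma>) t (conc \<sigma>1)" "sim ob lo lw g0 v0 s' \<sigma>1"
    using CondTrue by blast
  ultimately show ?case
    by (intro exI[of _ \<sigma>1]) (simp add: exec.CondTrue)
next
  case (CondFalse s b d t s' c)
  obtain g v z where \<sigma>: "\<sigma> = (g, v, z)" by (cases \<sigma>)
  have "beval ps inp (conc \<sigma>) (teb b) = Some False"
    using teb_correct CondFalse \<sigma> by blast
  moreover obtain \<sigma>1 where "exec ps inp (tr F d) (conc \<sigma>) t (conc \<sigma>1)" "sim ob lo lw g0 v0 s' \<sigma>1"
    using CondFalse by blast
  ultimately show ?case
    by (intro exI[of _ \<sigma>1]) (simp add: exec.CondFalse)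
next
  case (WhileFalse s b c)
  obtain g v z where \<sigma>: "\<sigma> = (g, v, z)" by (cases \<sigma>)
  have "beval ps inp (conc \<sigma>) (teb b) = Some False"
    using teb_correct WhileFalse \<sigma> by blast
  then show ?case
    using WhileFalse by (intro exI[of _ \<sigma>]) (simp add: exec.WhileFalse)
next
  case (WhileTrue s b c t s' u s'')
  obtain g v z where \<sigma>: "\<sigma> = (g, v, z)" by (cases \<sigma>)
  obtain \<sigma>1 where 1: "exec ps inp (tr F c) (conc \<sigma>) t (conc \<sigma>1)" "sim ob lo lw g0 v0 s' \<sigma>1"
    using WhileTrue by blast
  then obtain \<sigma>2 where "exec ps inp (tr F (While b c)) (conc \<sigma>1) u (conc \<sigma>2)" "sim ob lo lw g0 v0 s'' \<sigma>2"
    using WhileTrue by blast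
  moreover have "beval ps inp (conc \<sigma>) (teb b) = Some True"
    using teb_correct WhileTrue \<sigma> by blast
  ultimately show ?case
    using exec.WhileTrue[OF _ 1(1)] by (intro exI[of _ \<sigma>2]) simp
next
  case (Move s a x d s')
  obtain g v z where \<sigma>: "\<sigma> = (g, v, z)" by (cases \<sigma>)
  obtain v1 z1 where 1: "exec ps inp (get F a 1) (conc \<sigma>) 0 (conc (g, v1, z1))"
    "sim ob lo lw g0 v0 s (g, v1, z1)" "z1 1 = x"
    using get_correct[of s g v z a x 1] Move \<sigma> by auto
  obtain g2 where 2: "store ps inp (conc (g, v1, z1)) (ta d) x = Some (conc (g2, v1, z1))"
    "sim ob lo lw g0 v0 s' (g2, v1, z1)"
    using store_correct[OF 1(2) Move(2)] by blast
  have "exec ps inp (Move (ta d) (Work, Num 51)) (conc (g, v1, z1)) 0 (conc (g2, v1, z1))"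
    using 1 2 by (intro exec.Move[of _ _ _ _ x]) (auto simp: load_def)
  from exec.Seq[OF 1(1) this] show ?case
    using 2 by (intro exI[of _ "(g2, v1, z1)"]) simp
next
  case (SetIdx s e i d s')
  obtain g v z where \<sigma>: "\<sigma> = (g, v, z)" by (cases \<sigma>)
  obtain g2 where 2: "store ps inp (conc (g, v, z)) (ta d) (Idx i) = Some (conc (g2, v, z))"
    "sim ob lo lw g0 v0 s' (g2, v, z)"
    using store_correct SetIdx \<sigma> by blast
  obtain out wk where s: "s = (out, wk)" by (cases s)
  \<comment> \<open>An index that the inner machine may store is admissible outside, because the
    inner areas and the virtual input are no longer than the outer ones.\<close>
  have "i \<le> length inp + LEN + 54"
    using SetIdx(2) vin LEN SetIdx.prems by (auto simp: s sim_def)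
  then show ?case
    using 2 te_correct[of s g v z e i] SetIdx \<sigma>
    by (intro exI[of _ "(g2, v, z)"]) (simp add: exec.SetIdx)
next
  case (SetElt s d x s')
  obtain g v z where \<sigma>: "\<sigma> = (g, v, z)" by (cases \<sigma>)
  then obtain g2 where "store ps inp (conc (g, v, z)) (ta d) (Elt x) = Some (conc (g2, v, z))"
    "sim ob lo lw g0 v0 s' (g2, v, z)"
    using store_correct SetElt by blast
  then show ?case
    using \<sigma> by (intro exI[of _ "(g2, v, z)"]) (simp add: exec.SetElt)
next
  case (Arith s a x b y f w d s')
  obtain g v z where \<sigma>: "\<sigma> = (g, v, z)" by (cases \<sigma>)
  obtain v1 z1 where 1: "exec ps inp (get F a 1) (conc \<sigma>) 0 (conc (g, v1, z1))"
    "sim ob lo lw g0 v0 s (g, v1, z1)" "z1 1 = Elt x"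
    using get_correct[of s g v z a "Elt x" 1] Arith \<sigma> by auto
  obtain v2 z2 where 2: "exec ps inp (get F b 2) (conc (g, v1, z1)) 0 (conc (g, v2, z2))"
    "sim ob lo lw g0 v0 s (g, v2, z2)" "z2 2 = Elt y" "z2 1 = z1 1"
    using get_correct[of s g v1 z1 b "Elt y" 2] Arith 1 by auto
  obtain g3 where 3: "store ps inp (conc (g, v2, z2)) (ta d) (Elt w) = Some (conc (g3, v2, z2))"
    "sim ob lo lw g0 v0 s' (g3, v2, z2)"
    using store_correct[OF 2(2) Arith(4)] by blast
  have "exec ps inp (Arith f (ta d) (Work, Num 51) (Work, Num 52)) (conc (g, v2, z2)) 1 (conc (g3, v2, z2))"
    using 1 2 3 Arith(3) by (intro exec.Arith[of _ _ _ _ x _ y]) (auto simp: load_def)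
  from exec.Seq[OF 1(1) exec.Seq[OF 2(1) this]] show ?case
    using 3 by (intro exI[of _ "(g3, v2, z2)"]) simp
qed

end

text \<open>\<open>computes\<close> starts from arbitrary contents, so whatever lies in the window
  can serve as uninitialised memory. The fetch program may rely on all cells outside the window,
  since the inner run cannot reach them; this is how operands stored elsewhere in the output area
  are passed.\<close>

lemma WP_box:
  assumes comp: "computes c [v 40] vin k w C P"
    and v: "v 41 = ob" "v 42 = ob + k" and LEN: "ob + k + w \<le> LEN"
    and vin: "length vin \<le> length inp"
    and F: "\<And>g' v' z'. \<lbrakk>\<And>y. y < ob \<or> ob + k + w \<le> y \<Longrightarrow> g' y = g y; \<And>x. x \<noteq> 43 \<Longrightarrow> v' x = v x;
        v' 43 < length vin\<rbrakk> \<Longrightarrow> sx F (g', v', z') = Some (0, (g', v', z'(0 := Elt (vin ! v' 43))))"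
  shows "WP (tr F c) C (\<lambda>(g', v', z'). (\<exists>ys. P ys \<and> length ys = k \<and> (\<forall>i<k. g' (ob + i) = Elt (ys ! i))) \<and>
      (\<forall>y. y < ob \<or> ob + k + w \<le> y \<longrightarrow> g' y = g y) \<and> (\<forall>x. x \<noteq> 43 \<longrightarrow> v' x = v x)) (g, v, z)"
proof -
  let ?out = "map g [ob..<ob + k]" and ?wk = "map g [ob + k..<ob + k + w]"
  obtain t ys wk' where 1: "exec [v 40] vin c (?out, ?wk) t (map Elt ys, wk')" "real t \<le> C" "P ys"
    using comp unfolding computes_def by (metis length_map length_upt add_diff_cancel_left')
  have "sim ob k w g v (?out, ?wk) (g, v, z)"
    by (auto simp: sim_def)
  then have "\<exists>\<sigma>'. exec ps inp (tr F c) (conc (g, v, z)) t (conc \<sigma>') \<and> sim ob k w g v (map Elt ys, wk') \<sigma>'"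
    using tr_correct[where F = F and ?g0.0 = g and ?v0.0 = v and vin = vin and ob = ob and lo = k and lw = w, OF v LEN vin _ 1(1)] F
    by blast
  then obtain g' v' z' where 2: "exec ps inp (tr F c) (conc (g, v, z)) t (conc (g', v', z'))"
    "sim ob k w g v (map Elt ys, wk') (g', v', z')"
    by (metis prod_cases3)
  then show ?thesis
    unfolding WP_def using 1
    by (intro exI[of _ t] exI[of _ "(g', v', z')"]) (auto simp: sim_def)
qed

end


section \<open>Blocks of quotient coefficients by middle and short products\<close>

definition arr :: "(nat \<Rightarrow> 'a cell) \<Rightarrow> nat \<Rightarrow> nat \<Rightarrow> (nat \<Rightarrow> 'a) \<Rightarrow> bool" where
  "arr g b k f \<longleftrightarrow> (\<forall>i<k. g (b + i) = Elt (f i))"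

lemma arrD: "arr g b k f \<Longrightarrow> i < k \<Longrightarrow> g (b + i) = Elt (f i)"
  by (simp add: arr_def)

lemma arr_cong: "arr g b k f \<Longrightarrow> (\<And>i. i < k \<Longrightarrow> g' (b + i) = g (b + i)) \<Longrightarrow>
    (\<And>i. i < k \<Longrightarrow> f i = f' i) \<Longrightarrow> arr g' b k f'"
  by (simp add: arr_def)

abbreviation eN :: iexp where "eN \<equiv> Param 1 [-] Num 1"
abbreviation eT :: iexp where "eT \<equiv> Param 0 [+] Num 1"
abbreviation eL :: iexp where "eL \<equiv> Param 0 [+] Param 1"

text \<open>Virtual input of a middle product. The factor of size \<open>2 * k - 1\<close> is a
  stretch of the reversed divisor from position \<open>V 45\<close> on, read directly from the input
  and continued by zeros; the other factor lies in the output area at \<open>V 46\<close>. Register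
  44 holds the length of the former.\<close>

definition FB :: "'a::zero com" where
  "FB = Cond (Less (V 43) (V 44))
     (Cond (Less (V 45 [+] V 43) (Param 1))
       (Move (Work, Num 50) (Input, (eL [+] eN) [-] (V 45 [+] V 43)))
       (SetElt (Work, Num 50) 0))
     (Move (Work, Num 50) (Output, V 46 [+] (V 43 [-] V 44)))"

definition FA :: "'a com" where
  "FA = Cond (Less (V 43) (V 44))
     (Move (Work, Num 50) (Output, V 45 [+] V 43))
     (Move (Work, Num 50) (Output, V 46 [+] (V 43 [-] V 44)))"

text \<open>\<open>Fm\<close> and \<open>Fs\<close> are costs per coefficient. By superlinearity a
  product of size \<open>k \<le> m\<close> costs at most the fraction k / m of one of size
  \<open>m\<close>, and with these rates every cost becomes linear in the sizes involved. The
  products are specified on coefficient functions, the form in which they are applied to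
  cells.\<close>

locale division = machine ps inp LEN
  for ps :: "nat list" and inp :: "'a::comm_ring_1 list" and LEN :: nat +
  fixes m n :: nat and mp sp :: "'a com" and Fm Fs :: real and wm ws :: "nat \<Rightarrow> nat"
  assumes ps: "ps = [m, n]" and LEN: "LEN = m + n" and inp: "length inp = m + n + n"
    and n: "2 \<le> n" "n \<le> m" and lead: "inp ! (m + n + (n - 1)) dvd 1"
    and Fm: "0 \<le> Fm" and Fs: "0 \<le> Fs"
    and mp: "\<And>k f u. 1 \<le> k \<Longrightarrow> k \<le> m \<Longrightarrow>
      computes mp [k] (map f [0..<2 * k - 1] @ map u [0..<k]) k (wm k) (real k * Fm)
        (\<lambda>ys. ys = map (\<lambda>a. \<Sum>b<k. f (k - 1 + a - b) * u b) [0..<k])"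
    and sp: "\<And>k f u. 1 \<le> k \<Longrightarrow> k \<le> m \<Longrightarrow>
      computes sp [k] (map f [0..<k] @ map u [0..<k]) k (ws k) (real k * Fs)
        (\<lambda>ys. ys = map (\<lambda>a. \<Sum>b\<le>a. f (a - b) * u b) [0..<k])"
begin

lemma ps_simps [simp]: "ps ! 0 = m" "ps ! Suc 0 = n" "length ps = 2"
  by (simp_all add: ps)

definition be :: "nat \<Rightarrow> 'a" where
  "be x = (if x < n then inp ! (m + n + (n - 1) - x) else 0)"

definition al :: "nat \<Rightarrow> 'a" where
  "al x = (if x < m + n then inp ! (m + n - 1 - x) else 0)"

definition ACC :: "'a com" where
  "ACC = (42 :== V 41 [+] V 40 ;; 44 :== Num 2 [*] V 40 [-] Num 1 ;; tr FB mp ;;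
     For 47 (V 40) (Arith Sub (Output, V 48 [+] V 47) (Output, V 48 [+] V 47) (Output, V 41 [+] V 47)))"

text \<open>One middle product carries the effect of \<open>k\<close> consecutive quotient
  coefficients at \<open>p\<close> to \<open>k\<close> consecutive residual positions at
  \<open>tg\<close>; \<open>fo\<close> encodes the distance between the two. The bound on
  \<open>3 * k\<close> accommodates the virtual input of length \<open>3 * k - 1\<close>.\<close>

lemma WP_ACC:
  assumes v: "v 40 = k" "v 41 = ob" "v 45 = fo" "v 46 = p" "v 48 = tg"
    and k: "1 \<le> k" "k \<le> m" "3 * k \<le> length inp + 1"
    and sp: "ob + k + wm k \<le> LEN" "p + k \<le> ob" "tg + k \<le> ob"
    and u: "arr g p k u" and d: "arr g tg k d"
  shows "WP ACC (real k * Fm + real k) (\<lambda>(g', v', z').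
      arr g' tg k (\<lambda>a. d a - (\<Sum>b<k. be (fo + (k - 1) + a - b) * u b)) \<and>
      (\<forall>y. y < ob \<and> (y < tg \<or> tg + k \<le> y) \<longrightarrow> g' y = g y) \<and>
      (\<forall>x. x \<notin> {42, 43, 44, 47} \<longrightarrow> v' x = v x)) (g, v, z)"
proof -
  let ?v = "v(42 := ob + k, 44 := 2 * k - 1)"
  let ?f = "\<lambda>i. be (fo + i)"
  let ?vin = "map ?f [0..<2 * k - 1] @ map u [0..<k]"
  let ?c = "\<lambda>a. \<Sum>b<k. ?f (k - 1 + a - b) * u b"
  let ?P = "\<lambda>(g', v', z' :: nat \<Rightarrow> 'a cell). arr g' ob k ?c \<and> (\<forall>y<ob. g' y = g y) \<and> (\<forall>x. x \<noteq> 43 \<longrightarrow> v' x = ?v x)"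
  have kL: "k + ob \<le> LEN" "k \<le> LEN" "p + k \<le> LEN" using sp by auto
  have 1: "sx (42 :== V 41 [+] V 40) (g, v, z) = Some (0, (g, v(42 := ob + k), z))"
    using v kL by simp
  have 2: "sx (44 :== Num 2 [*] V 40 [-] Num 1) (g, v(42 := ob + k), z) = Some (0, (g, ?v, z))"
    using v k by simp
  have box: "WP (tr FB mp) (real k * Fm) ?P (g, ?v, z)"
  proof (rule WP_weaken[OF WP_box[where k = k and ob = ob and w = "wm k" and vin = ?vin]])
    show "computes mp [?v 40] ?vin k (wm k) (real k * Fm)
        (\<lambda>ys. ys = map (\<lambda>a. \<Sum>b<k. ?f (k - 1 + a - b) * u b) [0..<k])"
      using mp[of k ?f u] k v by simp
  next
    fix g' v' z'
    assume g': "\<And>y. y < ob \<or> ob + k + wm k \<le> y \<Longrightarrow> g' y = g y" and v': "\<And>x. x \<noteq> 43 \<Longrightarrow> v' x = ?v x"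
      and i: "v' 43 < length ?vin"
    show "sx FB (g', v', z') = Some (0, g', v', z'(0 := Elt (?vin ! v' 43)))"
    proof (cases "v' 43 < 2 * k - 1")
      case True
      then show ?thesis
        using v v' n by (auto simp: FB_def be_def nth_append inp ac_simps)
    next
      case False
      then have *: "v' 43 - (2 * k - 1) < k" using i by simp
      have "p + (v' 43 - (2 * k - 1)) < ob" using * sp by linarith
      from g'[OF disjI1[OF this]] have "g' (p + (v' 43 - (2 * k - 1))) = Elt (u (v' 43 - (2 * k - 1)))"
        using arrD[OF u *] by simp
      then show ?thesis
        using v v' False * kL by (auto simp: FB_def nth_append)
    qed
  next
    fix s' :: "'a state"
    assume "case s' of (g', v', z') \<Rightarrow>
         (\<exists>ys. ys = map ?c [0..<k] \<and> length ys = k \<and> (\<forall>i<k. g' (ob + i) = Elt (ys ! i))) \<and>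
         (\<forall>y. y < ob \<or> ob + k + wm k \<le> y \<longrightarrow> g' y = g y) \<and> (\<forall>x. x \<noteq> 43 \<longrightarrow> v' x = ?v x)"
    then show "?P s'"
      by (auto simp: arr_def split: prod.splits)
  qed (use v sp k inp in auto)
  have loop: "WP (For 47 (V 40) (Arith Sub (Output, V 48 [+] V 47) (Output, V 48 [+] V 47) (Output, V 41 [+] V 47)))
      (real k) (\<lambda>(g', v', z'). arr g' tg k (\<lambda>a. d a - ?c a) \<and>
      (\<forall>y. y < ob \<and> (y < tg \<or> tg + k \<le> y) \<longrightarrow> g' y = g y) \<and>
      (\<forall>x. x \<notin> {42, 43, 44, 47} \<longrightarrow> v' x = v x)) (g1, v1, z1)"
    if P: "?P (g1, v1, z1)" for g1 v1 z1
  proof -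
    have a1: "g1 (ob + i) = Elt (?c i)" "g1 (tg + i) = Elt (d i)" if "i < k" for i
      using P that arrD[OF d that] sp by (auto simp: arr_def)
    show ?thesis
    proof (rule WP_for_sx[where n = k and k = 1 and Z = "\<lambda>_. z1" and
          G = "\<lambda>i y. if tg \<le> y \<and> y < tg + i then Elt (d (y - tg) - ?c (y - tg)) else g1 y"])
      fix i assume "i < k"
      then show "sx (Arith Sub (Output, V 48 [+] V 47) (Output, V 48 [+] V 47) (Output, V 41 [+] V 47))
          (\<lambda>y. if tg \<le> y \<and> y < tg + i then Elt (d (y - tg) - ?c (y - tg)) else g1 y, v1(47 := i), z1) =
        Some (1, \<lambda>y. if tg \<le> y \<and> y < tg + Suc i then Elt (d (y - tg) - ?c (y - tg)) else g1 y, v1(47 := i), z1)"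
        using P v sp a1[of i] kL by (auto simp: fun_eq_iff)
    next
      show "case (\<lambda>y. if tg \<le> y \<and> y < tg + k then Elt (d (y - tg) - ?c (y - tg)) else g1 y, v1(47 := k), z1) of
        (g', v', z') \<Rightarrow> arr g' tg k (\<lambda>a. d a - ?c a) \<and>
        (\<forall>y. y < ob \<and> (y < tg \<or> tg + k \<le> y) \<longrightarrow> g' y = g y) \<and>
        (\<forall>x. x \<notin> {42, 43, 44, 47} \<longrightarrow> v' x = v x)"
        using P by (auto simp: arr_def)
    qed (use P v kL in auto)
  qed
  have "WP ACC (real k * Fm + real k) (\<lambda>(g', v', z').
      arr g' tg k (\<lambda>a. d a - ?c a) \<and>
      (\<forall>y. y < ob \<and> (y < tg \<or> tg + k \<le> y) \<longrightarrow> g' y = g y) \<and>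
      (\<forall>x. x \<notin> {42, 43, 44, 47} \<longrightarrow> v' x = v x)) (g, v, z)"
    unfolding ACC_def
    by (rule WP_sx_then[OF 1], rule WP_sx_then[OF 2], rule WP_then[OF box]) (use loop in auto)
  moreover have "?f (k - 1 + a - b) = be (fo + (k - 1) + a - b)" if "b < k" for a b
    using that by (simp add: add.assoc)
  ultimately show ?thesis
    by (simp cong: sum.cong_simp)
qed

definition SPB :: "'a com" where
  "SPB = (42 :== V 41 [+] V 40 ;; 44 :== V 40 ;; tr FA sp)"

lemma WP_SPB:
  assumes v: "v 40 = k" "v 41 = ob" "v 45 = p1" "v 46 = p2"
    and k: "1 \<le> k" "k \<le> m" "2 * k \<le> length inp"
    and sp': "ob + k + ws k \<le> LEN" "p1 + k \<le> ob" "p2 + k \<le> ob"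
    and f: "arr g p1 k f" and u: "arr g p2 k u"
  shows "WP SPB (real k * Fs) (\<lambda>(g', v', z').
      arr g' ob k (\<lambda>a. \<Sum>b\<le>a. f (a - b) * u b) \<and> (\<forall>y<ob. g' y = g y) \<and>
      (\<forall>x. x \<notin> {42, 43, 44} \<longrightarrow> v' x = v x)) (g, v, z)"
proof -
  let ?v = "v(42 := ob + k, 44 := k)"
  let ?vin = "map f [0..<k] @ map u [0..<k]"
  let ?c = "\<lambda>a. \<Sum>b\<le>a. f (a - b) * u b"
  have kL: "k + ob \<le> LEN" "k \<le> LEN" "p1 + k \<le> LEN" "p2 + k \<le> LEN" using sp' by auto
  have 1: "sx (42 :== V 41 [+] V 40) (g, v, z) = Some (0, (g, v(42 := ob + k), z))"
    using v kL by simp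
  have 2: "sx (44 :== V 40) (g, v(42 := ob + k), z) = Some (0, (g, ?v, z))"
    using v kL by simp
  have box: "WP (tr FA sp) (real k * Fs) (\<lambda>(g', v', z').
      arr g' ob k ?c \<and> (\<forall>y<ob. g' y = g y) \<and>
      (\<forall>x. x \<notin> {42, 43, 44} \<longrightarrow> v' x = v x)) (g, ?v, z)"
  proof (rule WP_weaken[OF WP_box[where k = k and ob = ob and w = "ws k" and vin = ?vin]])
    show "computes sp [?v 40] ?vin k (ws k) (real k * Fs) (\<lambda>ys. ys = map ?c [0..<k])"
      using sp[of k f u] k v by simp
  next
    fix g' v' z'
    assume g': "\<And>y. y < ob \<or> ob + k + ws k \<le> y \<Longrightarrow> g' y = g y" and v': "\<And>x. x \<noteq> 43 \<Longrightarrow> v' x = ?v x"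
      and i: "v' 43 < length ?vin"
    show "sx FA (g', v', z') = Some (0, g', v', z'(0 := Elt (?vin ! v' 43)))"
    proof (cases "v' 43 < k")
      case True
      then have "g' (p1 + v' 43) = Elt (f (v' 43))"
        using g' arrD[OF f True] sp' by simp
      then show ?thesis
        using v v' True kL by (auto simp: FA_def nth_append)
    next
      case False
      then have *: "v' 43 - k < k" using i by simp
      then have "g' (p2 + (v' 43 - k)) = Elt (u (v' 43 - k))"
        using g' arrD[OF u *] sp' by simp
      then show ?thesis
        using v v' False * kL by (auto simp: FA_def nth_append)
    qed
  next
    fix s' :: "'a state"
    assume "case s' of (g', v', z') \<Rightarrow>
         (\<exists>ys. ys = map ?c [0..<k] \<and> length ys = k \<and> (\<forall>i<k. g' (ob + i) = Elt (ys ! i))) \<and>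
         (\<forall>y. y < ob \<or> ob + k + ws k \<le> y \<longrightarrow> g' y = g y) \<and> (\<forall>x. x \<noteq> 43 \<longrightarrow> v' x = ?v x)"
    then show "case s' of (g', v', z') \<Rightarrow> arr g' ob k ?c \<and> (\<forall>y<ob. g' y = g y) \<and>
      (\<forall>x. x \<notin> {42, 43, 44} \<longrightarrow> v' x = v x)"
      by (auto simp: arr_def split: prod.splits)
  qed (use v sp' k in auto)
  show ?thesis
    unfolding SPB_def by (rule WP_sx_then[OF 1], rule WP_sx_then[OF 2], rule box)
qed

text \<open>Moves \<open>k\<close> cells upwards or to a disjoint place.\<close>

lemma WP_copy:
  assumes e: "okx e" "okx d" "okx s" "x < 50"
    and k: "k \<le> LEN" "\<And>i. i \<le> k \<Longrightarrow> val (v(x := i)) e = k"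
    and d: "\<And>i. i < k \<Longrightarrow> val (v(x := i)) d = dst + i" "dst + k \<le> LEN"
    and s: "\<And>i. i < k \<Longrightarrow> val (v(x := i)) s = src + i" "src + k \<le> LEN"
    and dis: "dst + k \<le> src \<or> src + k \<le> dst"
    and Q: "Q (\<lambda>y. if dst \<le> y \<and> y < dst + k then g (src + (y - dst)) else g y, v(x := k), z)"
  shows "WP (For x e (Move (Output, d) (Output, s))) 0 Q (g, v, z)"
proof (rule WP_for_sx[where n = k and k = 0 and Z = "\<lambda>_. z" and
      G = "\<lambda>i y. if dst \<le> y \<and> y < dst + i then g (src + (y - dst)) else g y"])
  fix i assume i: "i < k"
  then show "sx (Move (Output, d) (Output, s))
      (\<lambda>y. if dst \<le> y \<and> y < dst + i then g (src + (y - dst)) else g y, v(x := i), z) =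
    Some (0, \<lambda>y. if dst \<le> y \<and> y < dst + Suc i then g (src + (y - dst)) else g y, v(x := i), z)"
    using e d s dis by (auto simp: fun_eq_iff)
qed (use e k Q in auto)

definition ROW :: "'a com" where
  "ROW = (41 :== V 38 ;; 48 :== V 35 ;;
     For 39 (V 36) (45 :== V 39 [*] V 40 [+] Num 1 ;;
       46 :== V 35 [-] (V 39 [+] Num 1) [*] V 40 ;; ACC) ;;
     45 :== V 37 ;; 46 :== V 35 ;; SPB ;;
     For 47 (V 40) (Move (Output, V 48 [+] V 47) (Output, V 41 [+] V 47)))"

text \<open>The effect of the \<open>r\<close> preceding blocks is removed from the residual at
  \<open>X\<close>, one middle product per block. Multiplication by the inverse then needs no more
  than a short product, because within the block the quotient is a truncated power series
  product.\<close>

lemma WP_ROW: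
  assumes v: "v 35 = X" "v 36 = r" "v 37 = IV" "v 38 = TM" "v 40 = k"
    and k: "1 \<le> k" "k \<le> m" "3 * k \<le> length inp + 1" and r: "r * k \<le> X"
    and sp: "TM + k + wm k \<le> LEN" "TM + k + ws k \<le> LEN" "X + k \<le> TM" "IV + k \<le> TM"
      "IV + k \<le> X \<or> X + k \<le> IV"
    and u: "arr g (X - r * k) (r * k) u" and d: "arr g X k d" and iv: "arr g IV k iv"
  shows "WP ROW (real r * (real k * Fm + real k) + real k * Fs) (\<lambda>(g', v', z').
      arr g' X k (\<lambda>a. \<Sum>b\<le>a. iv (a - b) * (d b - (\<Sum>j<r * k. be (r * k + b - j) * u j))) \<and>
      (\<forall>y. y < TM \<and> (y < X \<or> X + k \<le> y) \<longrightarrow> g' y = g y) \<and>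
      (\<forall>x. x < 39 \<or> x = 40 \<longrightarrow> v' x = v x)) (g, v, z)"
proof -
  \<comment> \<open>The residual after the \<open>i\<close> nearest earlier blocks. In this order
    the divisor offset \<open>i * k + 1\<close> depends only on the distance: entry \<open>b\<close>
    of the block that starts at \<open>X - (i + 1) * k\<close> acts on position \<open>X + a\<close>
    through the divisor coefficient \<open>(i + 1) * k + a - b\<close>.\<close>
  define D where "D i b = d b - (\<Sum>j\<in>{(r - i) * k..<r * k}. be (r * k + b - j) * u j)" for i b
  let ?v = "v(41 := TM, 48 := X)"
  have LL: "TM \<le> LEN" "X \<le> LEN" "IV \<le> LEN" "k \<le> LEN" using sp by auto
  have rL: "r \<le> LEN" using r LL(2) k by (metis le_trans mult_le_mono2 nat_mult_1_right)
  have 1: "sx (41 :== V 38) (g, v, z) = Some (0, (g, v(41 := TM), z))"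
    using v LL by simp
  have 2: "sx (48 :== V 35) (g, v(41 := TM), z) = Some (0, (g, ?v, z))"
    using v LL by simp
  let ?I = "\<lambda>i (g', v', z' :: nat \<Rightarrow> 'a cell). arr g' X k (D i) \<and>
      (\<forall>y. y < TM \<and> (y < X \<or> X + k \<le> y) \<longrightarrow> g' y = g y) \<and>
      (\<forall>x. x < 39 \<or> x \<in> {40, 41, 48} \<longrightarrow> v' x = ?v x)"
  have hist: "WP (For 39 (V 36) (45 :== V 39 [*] V 40 [+] Num 1 ;;
       46 :== V 35 [-] (V 39 [+] Num 1) [*] V 40 ;; ACC)) (\<Sum>i<r. real k * Fm + real k) (?I r) (g, ?v, z)"
  proof (rule WP_for[where I = "\<lambda>i (g, v, z). v 39 = i \<and> ?I i (g, v, z)"])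
    show "case (g, ?v(39 := 0), z) of (g, v, z) \<Rightarrow> v 39 = 0 \<and> ?I 0 (g, v, z)"
      using d by (auto simp: D_def arr_def)
  next
    fix i g1 v1 z1
    assume i: "i < r" and I: "case (g1, v1, z1) of (g, v, z) \<Rightarrow> v 39 = i \<and> ?I i (g, v, z)"
    define p where "p = X - (i + 1) * k"
    let ?v1 = "v1(45 := i * k + 1)" let ?v2 = "v1(45 := i * k + 1, 46 := p)"
    have ik: "(i + 1) * k \<le> r * k" using i by (intro mult_le_mono1) simp
    have v1: "v1 39 = i" "v1 40 = k" "v1 35 = X" "v1 36 = r" "v1 41 = TM" "v1 48 = X"
      using I v by auto
    have ikX: "i * k + k \<le> X" using ik r by simp
    have 3: "sx (45 :== V 39 [*] V 40 [+] Num 1) (g1, v1, z1) = Some (0, (g1, ?v1, z1))"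
      using v1 ikX LL k by simp
    have 4: "sx (46 :== V 35 [-] (V 39 [+] Num 1) [*] V 40) (g1, ?v1, z1) = Some (0, (g1, ?v2, z1))"
      using v1 ikX LL k by (simp add: p_def)
    have hu: "arr g1 p k (\<lambda>b. u ((r - Suc i) * k + b))"
    proof (unfold arr_def, intro allI impI)
      fix b assume b: "b < k"
      have e: "(r - Suc i) * k + (i + 1) * k = r * k"
        using i by (simp only: add_mult_distrib[symmetric]) simp
      have "p + b = (X - r * k) + ((r - Suc i) * k + b)"
        using e r ik by (simp add: p_def)
      moreover have "(r - Suc i) * k + b < r * k" using e b by simp
      moreover have "p + b < X" using b ikX by (simp add: p_def)
      ultimately show "g1 (p + b) = Elt (u ((r - Suc i) * k + b))"
        using arrD[OF u, of "(r - Suc i) * k + b"] I sp by (simp add: add.assoc)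
    qed
    have "WP ACC (real k * Fm + real k) (\<lambda>(g', v', z').
      arr g' X k (\<lambda>a. D i a - (\<Sum>b<k. be ((i * k + 1) + (k - 1) + a - b) * u ((r - Suc i) * k + b))) \<and>
      (\<forall>y. y < TM \<and> (y < X \<or> X + k \<le> y) \<longrightarrow> g' y = g1 y) \<and>
      (\<forall>x. x \<notin> {42, 43, 44, 47} \<longrightarrow> v' x = ?v2 x)) (g1, ?v2, z1)"
      by (rule WP_ACC[of _ k TM _ p X]) (use v1 k sp ikX I hu in \<open>auto simp: p_def\<close>)
    then have 5: "WP ACC (real k * Fm + real k)
      (\<lambda>(g, v, z). v 39 = i \<and> (case (g, v(39 := Suc i), z) of (g, v, z) \<Rightarrow> v 39 = Suc i \<and> ?I (Suc i) (g, v, z)))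
      (g1, ?v2, z1)"
    proof (rule WP_weaken)
      fix s' :: "'a state"
      assume a: "case s' of (g', v', z') \<Rightarrow>
        arr g' X k (\<lambda>a. D i a - (\<Sum>b<k. be ((i * k + 1) + (k - 1) + a - b) * u ((r - Suc i) * k + b))) \<and>
        (\<forall>y. y < TM \<and> (y < X \<or> X + k \<le> y) \<longrightarrow> g' y = g1 y) \<and>
        (\<forall>x. x \<notin> {42, 43, 44, 47} \<longrightarrow> v' x = ?v2 x)"
      have DS: "D (Suc i) a = D i a - (\<Sum>b<k. be ((i * k + 1) + (k - 1) + a - b) * u ((r - Suc i) * k + b))" for a
      proof -
        have e: "(r - Suc i) * k + k = (r - i) * k" "(r - i) * k + i * k = r * k"
          using i by (simp_all add: add_mult_distrib[symmetric] Suc_diff_Suc)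
          (metis Suc_diff_Suc add.commute i mult_Suc)
        have "(\<Sum>j\<in>{(r - Suc i) * k..<r * k}. be (r * k + a - j) * u j) =
          (\<Sum>j\<in>{(r - Suc i) * k..<(r - i) * k}. be (r * k + a - j) * u j) +
          (\<Sum>j\<in>{(r - i) * k..<r * k}. be (r * k + a - j) * u j)"
          using i by (intro sum.atLeastLessThan_concat[symmetric]) auto
        also have "(\<Sum>j\<in>{(r - Suc i) * k..<(r - i) * k}. be (r * k + a - j) * u j) =
          (\<Sum>b<k. be (r * k + a - ((r - Suc i) * k + b)) * u ((r - Suc i) * k + b))"
          using sum.shift_bounds_nat_ivl[of "\<lambda>j. be (r * k + a - j) * u j" 0 "(r - Suc i) * k" k] e
          by (simp add: atLeast0LessThan add.commute)
        also have "\<dots> = (\<Sum>b<k. be ((i * k + 1) + (k - 1) + a - b) * u ((r - Suc i) * k + b))"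
        proof (rule sum.cong)
          fix b assume "b \<in> {..<k}"
          then have "r * k + a - ((r - Suc i) * k + b) = (i * k + 1) + (k - 1) + a - b"
            using e by auto
          then show "be (r * k + a - ((r - Suc i) * k + b)) * u ((r - Suc i) * k + b) =
            be ((i * k + 1) + (k - 1) + a - b) * u ((r - Suc i) * k + b)" by simp
        qed simp
        finally show ?thesis unfolding D_def by simp
      qed
      show "case s' of (g, v, z) \<Rightarrow>
         v 39 = i \<and> (case (g, v(39 := Suc i), z) of (g, v, z) \<Rightarrow> v 39 = Suc i \<and> ?I (Suc i) (g, v, z))"
        using a I v1 unfolding DS[abs_def] by auto
    qed simp
    show "WP (45 :== V 39 [*] V 40 [+] Num 1 ;; 46 :== V 35 [-] (V 39 [+] Num 1) [*] V 40 ;; ACC)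
      (real k * Fm + real k)
      (\<lambda>(g, v, z). v 39 = i \<and> (case (g, v(39 := Suc i), z) of (g, v, z) \<Rightarrow> v 39 = Suc i \<and> ?I (Suc i) (g, v, z)))
      (g1, v1, z1)"
      by (rule WP_sx_then[OF 3], rule WP_sx_then[OF 4], rule 5)
  qed (use v rL in auto)
  have fin: "WP (45 :== V 37 ;; 46 :== V 35 ;; SPB ;;
     For 47 (V 40) (Move (Output, V 48 [+] V 47) (Output, V 41 [+] V 47))) (real k * Fs + 0)
     (\<lambda>(g', v', z').
      arr g' X k (\<lambda>a. \<Sum>b\<le>a. iv (a - b) * (d b - (\<Sum>j<r * k. be (r * k + b - j) * u j))) \<and>
      (\<forall>y. y < TM \<and> (y < X \<or> X + k \<le> y) \<longrightarrow> g' y = g y) \<and>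
      (\<forall>x. x < 39 \<or> x = 40 \<longrightarrow> v' x = v x)) (g1, v1, z1)"
    if I: "?I r (g1, v1, z1)" for g1 v1 z1
  proof -
    let ?v1 = "v1(45 := IV)" let ?v2 = "v1(45 := IV, 46 := X)"
    have v1: "v1 40 = k" "v1 35 = X" "v1 37 = IV" "v1 41 = TM" "v1 48 = X"
      using I v by auto
    have 3: "sx (45 :== V 37) (g1, v1, z1) = Some (0, (g1, ?v1, z1))"
      using v1 LL by simp
    have 4: "sx (46 :== V 35) (g1, ?v1, z1) = Some (0, (g1, ?v2, z1))"
      using v1 LL by simp
    have iv1: "arr g1 IV k iv"
      by (rule arr_cong[OF iv]) (use I sp in auto)
    have 5: "WP SPB (real k * Fs) (\<lambda>(g', v', z').
      arr g' TM k (\<lambda>a. \<Sum>b\<le>a. iv (a - b) * D r b) \<and> (\<forall>y<TM. g' y = g1 y) \<and>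
      (\<forall>x. x \<notin> {42, 43, 44} \<longrightarrow> v' x = ?v2 x)) (g1, ?v2, z1)"
      by (rule WP_SPB[of _ k TM IV X]) (use v1 k sp I iv1 in auto)
    have Dr: "D r b = d b - (\<Sum>j<r * k. be (r * k + b - j) * u j)" for b
      by (simp add: D_def atLeast0LessThan)
    show ?thesis
    proof (rule WP_sx_then[OF 3], rule WP_sx_then[OF 4], rule WP_then[OF 5], clarify)
      fix g2 v2 z2
      assume g2: "arr g2 TM k (\<lambda>a. \<Sum>b\<le>a. iv (a - b) * D r b)" "\<forall>y<TM. g2 y = g1 y"
        and v2: "\<forall>x. x \<notin> {42, 43, 44} \<longrightarrow> v2 x = ?v2 x"
      show "WP (For 47 (V 40) (Move (Output, V 48 [+] V 47) (Output, V 41 [+] V 47))) 0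
         (\<lambda>(g', v', z').
          arr g' X k (\<lambda>a. \<Sum>b\<le>a. iv (a - b) * (d b - (\<Sum>j<r * k. be (r * k + b - j) * u j))) \<and>
          (\<forall>y. y < TM \<and> (y < X \<or> X + k \<le> y) \<longrightarrow> g' y = g y) \<and>
          (\<forall>x. x < 39 \<or> x = 40 \<longrightarrow> v' x = v x)) (g2, v2, z2)"
        by (rule WP_copy[where k = k and dst = X and src = TM])
          (use g2 v2 v1 v sp I LL in \<open>auto simp: arr_def Dr\<close>)
    qed
  qed
  show ?thesis
    unfolding ROW_def
    by (rule WP_sx_then[OF 1], rule WP_sx_then[OF 2],
        rule WP_weaken[OF WP_then[OF hist, where D = "real k * Fs + 0"]]) (use fin in auto)
qed

end


section \<open>The residual of a partial quotient, and the inverse of the reversed divisor\<close>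

notation fps_nth (infixl "$" 75)

text \<open>For positive arguments the binary logarithm rounded up, in the form in which the
  doubling loop of \<open>INV\<close> meets it.\<close>

definition lg :: "nat \<Rightarrow> nat" where "lg k = (LEAST j. k \<le> 2 ^ j)"

lemma lg_ge: "k \<le> 2 ^ lg k"
  unfolding lg_def by (rule LeastI[of _ k]) (simp add: less_imp_le)

lemma lg_less: "j < lg k \<Longrightarrow> 2 ^ j < k"
  unfolding lg_def using not_less_Least[of j "\<lambda>j. k \<le> 2 ^ j"] by simp

lemma sum_lessThan_add:
  fixes f :: "nat \<Rightarrow> 'b::comm_monoid_add"
  shows "(\<Sum>i<m + k. f i) = (\<Sum>i<m. f i) + (\<Sum>i<k. f (m + i))"
  by (induction k) (simp_all add: add.assoc)

context division
begin

definition Bf :: "'a fps" where "Bf = Abs_fps be"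

definition ib :: 'a where "ib = (THE z. z * be 0 = 1)"

definition iv :: "'a fps" where "iv = fps_left_inverse Bf ib"

lemma ib: "ib * be 0 = 1"
proof -
  have "be 0 dvd 1" using lead n by (simp add: be_def)
  then obtain w where w: "1 = be 0 * w" by (auto simp: dvd_def)
  have "(THE z. z * be 0 = 1) * be 0 = 1"
  proof (rule theI[of _ w])
    fix z assume "z * be 0 = 1"
    then have "z * (be 0 * w) = w" by (metis mult.assoc mult_1)
    then show "z = w" using w by simp
  qed (use w in \<open>simp add: mult.commute\<close>)
  then show ?thesis by (simp add: ib_def)
qed

lemma iv: "Bf * iv = 1"
  using fps_left_inverse[of ib Bf] ib by (simp add: Bf_def iv_def mult.commute)

lemma iv_0: "iv $ 0 = ib"
  by (simp add: iv_def)

text \<open>The residual left by the first \<open>t\<close> quotient coefficients, taken as a power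
  series so that it is defined at every position and for any dividend, in particular for the
  dividend 1 in the inversion.\<close>

definition res :: "'a fps \<Rightarrow> nat \<Rightarrow> nat \<Rightarrow> 'a" where
  "res A t x = (A - Bf * fps_cutoff t (A * iv)) $ x"

lemma res_eq: "t \<le> Suc x \<Longrightarrow> res A t x = A $ x - (\<Sum>i<t. be (x - i) * (A * iv) $ i)"
proof -
  assume t: "t \<le> Suc x"
  have "(fps_cutoff t (A * iv) * Bf) $ x = (\<Sum>i=0..x. if i < t then (A * iv) $ i * be (x - i) else 0)"
    unfolding fps_mult_nth[of "fps_cutoff t (A * iv)"] by (rule sum.cong) (auto simp: Bf_def)
  also have "\<dots> = (\<Sum>i<t. (A * iv) $ i * be (x - i))"
    using t by (intro sum.mono_neutral_cong_right) auto
  finally show ?thesis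
    by (simp add: res_def mult.commute)
qed

lemma res_0 [simp]: "res A 0 x = A $ x"
  by (simp add: res_def)

lemma res_less: "x < t \<Longrightarrow> res A t x = 0"
proof -
  assume "x < t"
  then have "(fps_cutoff t (A * iv) * Bf) $ x = (A * iv * Bf) $ x"
    by (rule fps_cutoff_left_mult_nth)
  also have "A * iv * Bf = A"
    using iv by (simp add: mult.assoc mult.commute[of iv])
  finally show ?thesis by (simp add: res_def mult.commute[of Bf])
qed

lemma res_step: "t + s \<le> x \<Longrightarrow>
    res A (t + s) x = res A t x - (\<Sum>j<s. be (x - (t + j)) * (A * iv) $ (t + j))"
  by (simp add: res_eq sum_lessThan_add)

text \<open>Multiplying the residual by the inverse of \<open>Bf\<close> gives the full quotient
  minus the part already known. As the residual vanishes below \<open>t\<close>, only its entries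
  from \<open>t\<close> on contribute.\<close>

lemma res_quot: "(\<Sum>b\<le>a. iv $ (a - b) * res A t (t + b)) = (A * iv) $ (t + a)"
proof -
  let ?R = "Abs_fps (res A t)"
  have R: "?R = A - Bf * fps_cutoff t (A * iv)"
    by (rule fps_ext) (simp add: res_def)
  have "iv * ?R = A * iv - (Bf * iv) * fps_cutoff t (A * iv)"
    by (simp add: R algebra_simps)
  then have "iv * ?R = A * iv - fps_cutoff t (A * iv)"
    by (simp only: iv mult_1_left)
  then have "(?R * iv) $ (t + a) = (A * iv) $ (t + a)"
    by (simp add: mult.commute[of ?R iv])
  also have "(?R * iv) $ (t + a) = (\<Sum>i=0..t + a. res A t i * iv $ (t + a - i))"
    by (simp add: fps_mult_nth)
  also have "\<dots> = (\<Sum>i<t + Suc a. res A t i * iv $ (t + a - i))"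
    by (rule sum.cong) auto
  also have "\<dots> = (\<Sum>b<Suc a. res A t (t + b) * iv $ (a - b))"
    unfolding sum_lessThan_add by (simp add: res_less)
  finally show ?thesis
    by (simp add: lessThan_Suc_atMost mult.commute)
qed

lemma be_ge [simp]: "n \<le> x \<Longrightarrow> be x = 0"
  by (simp add: be_def)

text \<open>Newton iteration seen as block division of 1: with the first \<open>e\<close>
  coefficients known, one \<open>ROW\<close> with a single history block and a zero block as
  dividend yields the next \<open>e\<close>. Register 29 climbs to the least power of two that is at
  least \<open>k\<close> and descends again, so the precisions are \<open>k\<close> divided by
  powers of two and rounded up.\<close>

definition INV :: "'a com" where
  "INV = (SetElt (Work, Num 53) 1 ;; Arith Div (Output, V 37) (Work, Num 53) (Input, eL [+] eN) ;;
     29 :== Num 1 ;; While (Less (V 29) (V 31)) (29 :== Num 2 [*] V 29) ;;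
     While (Less (Num 1) (V 29))
       (40 :== (V 31 [+] V 29 [-] Num 1) [div] V 29 ;; 29 :== V 29 [div] Num 2 ;;
        35 :== V 37 [+] V 40 ;; 36 :== Num 1 ;; For 47 (V 40) (SetElt (Output, V 35 [+] V 47) 0) ;; ROW) ;;
     40 :== V 31)"

text \<open>The block sizes form a geometric series with sum at most \<open>k\<close>; rounding up
  adds at most one per round, hence \<open>lg k\<close>. The final 1 is the division by the leading
  coefficient.\<close>

lemma WP_INV:
  assumes v: "v 31 = k" "v 37 = IV" "v 38 = TM" and TM: "TM = IV + k + 1"
    and k: "1 \<le> k" "k \<le> m" "3 * k \<le> length inp"
    and sp: "\<And>e. 1 \<le> e \<Longrightarrow> e \<le> k \<Longrightarrow> TM + e + wm e \<le> LEN \<and> TM + e + ws e \<le> LEN"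
  shows "WP INV ((real k + real (lg k)) * (Fm + Fs + 1) + 1) (\<lambda>(g', v', z').
      arr g' IV k (fps_nth iv) \<and> (\<forall>y<IV. g' y = g y) \<and> v' 40 = k \<and>
      (\<forall>x. x < 29 \<or> x \<in> {30, 31, 32, 33, 34, 37, 38} \<longrightarrow> v' x = v x)) (g, v, z)"
proof -
  let ?J = "lg k"
  let ?sz = "\<lambda>j. (k + 2 ^ j - 1) div 2 ^ j"
  have LL: "TM \<le> LEN" "IV < LEN" "k \<le> LEN" using sp[of 1] k TM by auto
  let ?z = "z(3 := Elt 1)" and ?g = "g(IV := Elt ib)"
  let ?X = "{30, 31, 32, 33, 34, 37, 38}"
  have s1: "sx (SetElt (Work, Num 53) 1) (g, v, z) = Some (0, (g, v, ?z))" by simp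
  have s2: "sx (Arith Div (Output, V 37) (Work, Num 53) (Input, eL [+] eN)) (g, v, ?z) = Some (1, (?g, v, ?z))"
    using v LL n inp lead by (simp add: ib_def be_def)
  let ?I1 = "\<lambda>j (g', v', z' :: nat \<Rightarrow> 'a cell). g' = ?g \<and> v' 29 = 2 ^ (?J - j) \<and> j \<le> ?J \<and> (\<forall>x. x \<noteq> 29 \<longrightarrow> v' x = v x)"
  have w1: "WP (While (Less (V 29) (V 31)) (29 :== Num 2 [*] V 29)) 0 (?I1 0) (?g, v(29 := 1), z')" for z'
  proof -
    have "WP (While (Less (V 29) (V 31)) (29 :== Num 2 [*] V 29)) (\<Sum>i<?J. 0) (?I1 0) (?g, v(29 := 1), z')"
    proof (rule WP_while[where I = ?I1])
      fix j g1 v1 z1 assume I: "?I1 (Suc j) (g1, v1, z1)"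
      then have lt: "2 ^ (?J - Suc j) < k" by (intro lg_less) auto
      have e: "2 * 2 ^ (?J - Suc j) = (2::nat) ^ (?J - j)"
        using I by (simp flip: power_Suc add: Suc_diff_Suc)
      show "okb (Less (V 29) (V 31)) \<and> bval v1 (Less (V 29) (V 31)) \<and>
          WP (29 :== Num 2 [*] V 29) 0 (?I1 j) (g1, v1, z1)"
        using I lt e v k
        by (auto intro!: WP_sx[of _ _ 0 "(g1, v1(29 := 2 ^ (?J - j)), z1)"])
    next
      fix g1 v1 z1 assume "?I1 0 (g1, v1, z1)"
      then show "okb (Less (V 29) (V 31)) \<and> \<not> bval v1 (Less (V 29) (V 31)) \<and> ?I1 0 (g1, v1, z1)"
        using lg_ge[of k] v by auto
    qed auto
    then show ?thesis by simp
  qed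
  let ?I2 = "\<lambda>j (g', v', z' :: nat \<Rightarrow> 'a cell). arr g' IV (?sz j) (fps_nth iv) \<and> (\<forall>y<IV. g' y = g y) \<and>
      v' 29 = 2 ^ j \<and> j \<le> ?J \<and> (\<forall>x. x < 29 \<or> x \<in> ?X \<longrightarrow> v' x = v x)"
  let ?C = "\<lambda>j. (real k / 2 ^ Suc j + 1) * (Fm + Fs + 1)"
  let ?w = "While (Less (Num 1) (V 29))
       (40 :== (V 31 [+] V 29 [-] Num 1) [div] V 29 ;; 29 :== V 29 [div] Num 2 ;;
        35 :== V 37 [+] V 40 ;; 36 :== Num 1 ;; For 47 (V 40) (SetElt (Output, V 35 [+] V 47) 0) ;; ROW)"
  have w2: "WP ?w (\<Sum>j<?J. ?C j) (?I2 0) (?g, v1, z1)" if I1: "?I1 0 (?g, v1, z1)" for v1 z1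
  proof (rule WP_while[where I = ?I2])
    have "?sz ?J = 1"
    proof -
      have "k + 2 ^ ?J - 1 < 2 * 2 ^ ?J" "2 ^ ?J \<le> k + 2 ^ ?J - 1" using lg_ge[of k] k by auto
      then show ?thesis by (intro div_nat_eqI) auto
    qed
    then show "?I2 ?J (?g, v1, z1)"
      using I1 v by (auto simp: arr_def iv_0)
  next
    fix j g2 v2 z2 assume I: "?I2 (Suc j) (g2, v2, z2)"
    define e where "e = ?sz (Suc j)"
    define P where "P = (2::nat) ^ j"
    have P: "1 \<le> P" "(2::nat) ^ Suc j = 2 * P" by (simp_all add: P_def)
    have e_eq: "e = (k + 2 * P - 1) div (2 * P)" by (simp add: e_def P_def)
    have e1: "1 \<le> e" using k P(1) by (simp add: e_eq div_greater_zero_iff Suc_le_eq)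
    \<comment> \<open>Doubling a rounded precision may overshoot by one coefficient; the scratch
      area therefore starts at \<open>IV + k + 1\<close>.\<close>
    have e2: "2 * e \<le> k + 1"
    proof (rule ccontr)
      assume "\<not> 2 * e \<le> k + 1"
      then have "P * (k + 2) \<le> P * (2 * e)" by (intro mult_le_mono2) auto
      moreover have "1 * k \<le> P * k" using P(1) by (rule mult_le_mono1)
      moreover have "2 * P * e \<le> k + 2 * P - 1" unfolding e_eq by (rule times_div_less_eq_dividend)
      moreover have "P * (k + 2) = P * k + 2 * P" "P * (2 * e) = 2 * P * e" by simp_all
      ultimately show False using k P(1) by linarith
    qed
    have e3: "?sz j \<le> 2 * e"
    proof -
      have "k + 2 * P - 1 < 2 * P + e * (2 * P)"
        unfolding e_eq using P(1) by (intro dividend_less_div_times) auto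
      moreover have "(2 * e + 1) * P = e * (2 * P) + P" by (simp add: algebra_simps)
      ultimately have "k + P - 1 < (2 * e + 1) * P" using k P(1) by linarith
      then have "(k + P - 1) div P < 2 * e + 1" using P(1) by (subst div_less_iff_less_mult) auto
      then show ?thesis by (simp add: P_def)
    qed
    have e4: "real e \<le> real k / 2 ^ Suc j + 1"
    proof -
      have "2 * P * e \<le> k + 2 * P - 1" unfolding e_eq by (rule times_div_less_eq_dividend)
      then have "2 * P * e \<le> k + 2 * P" by linarith
      then have "real (2 * P * e) \<le> real (k + 2 * P)" by (rule of_nat_mono)
      then have "real e \<le> (real k + 2 * real P) / (2 * real P)" using P(1) by (simp add: field_simps)
      also have "\<dots> = real k / 2 ^ Suc j + 1" using P(1) by (simp add: add_divide_distrib P_def)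
      finally show ?thesis .
    qed
    have v2: "v2 29 = 2 * P" "v2 31 = k" "v2 37 = IV" "v2 38 = TM" using I v P by auto
    let ?v3 = "v2(40 := e)" let ?v4 = "v2(40 := e, 29 := P)" let ?v5 = "v2(40 := e, 29 := P, 35 := IV + e)"
    let ?v6 = "v2(40 := e, 29 := P, 35 := IV + e, 36 := 1)"
    have eL: "e \<le> LEN" "IV + e \<le> LEN" "P \<le> LEN + length inp + 54"
    proof -
      show "e \<le> LEN" "IV + e \<le> LEN" using e2 k LL TM by auto
      have "Suc j \<le> ?J" using I by auto
      then have "P < k" unfolding P_def by (intro lg_less) auto
      then show "P \<le> LEN + length inp + 54" using LL by simp
    qed
    have s3: "sx (40 :== (V 31 [+] V 29 [-] Num 1) [div] V 29) (g2, v2, z2) = Some (0, (g2, ?v3, z2))"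
      using v2 eL by (simp add: e_eq)
    have s4: "sx (29 :== V 29 [div] Num 2) (g2, ?v3, z2) = Some (0, (g2, ?v4, z2))"
      using v2 eL by simp
    have s5: "sx (35 :== V 37 [+] V 40) (g2, ?v4, z2) = Some (0, (g2, ?v5, z2))"
      using v2 eL by simp
    have s6: "sx (36 :== Num 1) (g2, ?v5, z2) = Some (0, (g2, ?v6, z2))"
      by simp
    let ?g3 = "\<lambda>y. if IV + e \<le> y \<and> y < IV + e + e then Elt 0 else g2 y"
    let ?v7 = "v2(40 := e, 29 := P, 35 := IV + e, 36 := 1, 47 := e)"
    have s7: "WP (For 47 (V 40) (SetElt (Output, V 35 [+] V 47) 0)) 0 (\<lambda>s. s = (?g3, ?v7, z2)) (g2, ?v6, z2)"
    proof (rule WP_for_sx[where n = e and k = 0 and Z = "\<lambda>_. z2" and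
          G = "\<lambda>i y. if IV + e \<le> y \<and> y < IV + e + i then Elt 0 else g2 y"])
      fix i assume "i < e"
      then show "sx (SetElt (Output, V 35 [+] V 47) 0)
         (\<lambda>y. if IV + e \<le> y \<and> y < IV + e + i then Elt 0 else g2 y, ?v6(47 := i), z2) =
        Some (0, \<lambda>y. if IV + e \<le> y \<and> y < IV + e + Suc i then Elt 0 else g2 y, ?v6(47 := i), z2)"
        using e2 TM LL by (auto simp: fun_eq_iff)
    qed (use eL in auto)
    have iv2: "arr g2 IV e (fps_nth iv)" using I by (simp add: e_def)
    have s8: "WP ROW (real 1 * (real e * Fm + real e) + real e * Fs) (\<lambda>(g', v', z').
      arr g' (IV + e) e (\<lambda>a. \<Sum>b\<le>a. iv $ (a - b) * (0 - (\<Sum>j<1 * e. be (1 * e + b - j) * iv $ j))) \<and>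
      (\<forall>y. y < TM \<and> (y < IV + e \<or> IV + e + e \<le> y) \<longrightarrow> g' y = ?g3 y) \<and>
      (\<forall>x. x < 39 \<or> x = 40 \<longrightarrow> v' x = ?v7 x)) (?g3, ?v7, z2)"
    proof (rule WP_ROW[where IV = IV])
      show "arr ?g3 (IV + e - 1 * e) (1 * e) (fps_nth iv)" "arr ?g3 IV e (fps_nth iv)"
        using iv2 by (auto simp: arr_def)
      show "arr ?g3 (IV + e) e (\<lambda>_. 0)" by (simp add: arr_def)
      show "TM + e + wm e \<le> LEN" "TM + e + ws e \<le> LEN" using sp[of e] e1 e2 by auto
    qed (use v2 e1 e2 k TM in auto)
    \<comment> \<open>The constant 1 has no coefficient at the positions \<open>e + b\<close>, since
      \<open>e\<close> is positive, so the residual there consists of the history term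
      alone.\<close>
    have r: "(\<Sum>b\<le>a. iv $ (a - b) * (0 - (\<Sum>j<1 * e. be (1 * e + b - j) * iv $ j))) = iv $ (e + a)" for a
    proof -
      have "(\<Sum>b\<le>a. iv $ (a - b) * (0 - (\<Sum>j<1 * e. be (1 * e + b - j) * iv $ j))) =
        (\<Sum>b\<le>a. iv $ (a - b) * res 1 e (e + b))"
        using e1 by (intro sum.cong) (auto simp: res_eq)
      then show ?thesis using res_quot[of a 1 e] by simp
    qed
    have body: "WP (40 :== (V 31 [+] V 29 [-] Num 1) [div] V 29 ;; 29 :== V 29 [div] Num 2 ;;
        35 :== V 37 [+] V 40 ;; 36 :== Num 1 ;; For 47 (V 40) (SetElt (Output, V 35 [+] V 47) 0) ;; ROW)
       (0 + (real 1 * (real e * Fm + real e) + real e * Fs)) (?I2 j) (g2, v2, z2)"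
    proof (rule WP_sx_then[OF s3], rule WP_sx_then[OF s4], rule WP_sx_then[OF s5], rule WP_sx_then[OF s6],
        rule WP_then[OF s7], simp only:, rule WP_weaken[OF s8])
      fix s' :: "'a state"
      assume a: "case s' of (g', v', z') \<Rightarrow>
        arr g' (IV + e) e (\<lambda>a. \<Sum>b\<le>a. iv $ (a - b) * (0 - (\<Sum>j<1 * e. be (1 * e + b - j) * iv $ j))) \<and>
        (\<forall>y. y < TM \<and> (y < IV + e \<or> IV + e + e \<le> y) \<longrightarrow> g' y = ?g3 y) \<and>
        (\<forall>x. x < 39 \<or> x = 40 \<longrightarrow> v' x = ?v7 x)"
      obtain g' v' z' where s': "s' = (g', v', z')" by (cases s')
      have a1: "arr g' (IV + e) e (\<lambda>a. iv $ (e + a))"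
        and a2: "\<And>y. y < TM \<Longrightarrow> y < IV + e \<or> IV + e + e \<le> y \<Longrightarrow> g' y = ?g3 y"
        and a3: "\<And>x. x < 39 \<or> x = 40 \<Longrightarrow> v' x = ?v7 x"
        using a unfolding s' r by blast+
      have "g' (IV + i) = Elt (iv $ i)" if "i < ?sz j" for i
      proof (cases "i < e")
        case True
        then have "g' (IV + i) = g2 (IV + i)" using a2[of "IV + i"] TM e2 by auto
        then show ?thesis using arrD[OF iv2 True] by simp
      next
        case False
        then have "i - e < e" "IV + e + (i - e) = IV + i" "e + (i - e) = i" using that e3 by auto
        then show ?thesis using arrD[OF a1, of "i - e"] by (simp only:)
      qed
      moreover have "g' y = g y" if "y < IV" for y
        using a2[of y] I TM that by auto
      moreover have "v' x = v x" if "x < 29 \<or> x \<in> ?X" for x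
        using a3[of x] I that by auto
      moreover have "v' 29 = 2 ^ j" "j \<le> ?J"
        using a3[of 29] I by (auto simp: P_def)
      ultimately show "?I2 j s'"
        unfolding s' by (simp add: arr_def)
    qed simp
    have "0 + (real 1 * (real e * Fm + real e) + real e * Fs) \<le> ?C j"
    proof -
      have "0 + (real 1 * (real e * Fm + real e) + real e * Fs) = real e * (Fm + Fs + 1)"
        by (simp add: algebra_simps)
      also have "\<dots> \<le> ?C j" using e4 Fm Fs by (intro mult_right_mono) auto
      finally show ?thesis .
    qed
    then show "okb (Less (Num 1) (V 29)) \<and> bval v2 (Less (Num 1) (V 29)) \<and>
      WP (40 :== (V 31 [+] V 29 [-] Num 1) [div] V 29 ;; 29 :== V 29 [div] Num 2 ;;
        35 :== V 37 [+] V 40 ;; 36 :== Num 1 ;; For 47 (V 40) (SetElt (Output, V 35 [+] V 47) 0) ;; ROW)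
       (?C j) (?I2 j) (g2, v2, z2)"
      using WP_weaken[OF body] v2 P by auto
  next
    fix g2 v2 z2 assume "?I2 0 (g2, v2, z2)"
    then show "okb (Less (Num 1) (V 29)) \<and> \<not> bval v2 (Less (Num 1) (V 29)) \<and> ?I2 0 (g2, v2, z2)"
      by auto
  qed
  have C: "(\<Sum>j<J. ?C j) \<le> (real k + real J) * (Fm + Fs + 1)" for J
  proof -
    have "(\<Sum>j<J. real k / 2 ^ Suc j) = real k * (1 - 1 / 2 ^ J)"
      by (induction J) (auto simp: field_simps)
    also have "\<dots> \<le> real k" by (simp add: mult_left_le)
    finally have "(\<Sum>j<J. real k / 2 ^ Suc j + 1) \<le> real k + real J"
      by (simp add: sum.distrib)
    then show ?thesis
      using Fm Fs by (simp only: sum_distrib_right[symmetric]) (intro mult_right_mono, auto)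
  qed
  let ?Q = "\<lambda>(g', v', z' :: nat \<Rightarrow> 'a cell). arr g' IV k (fps_nth iv) \<and> (\<forall>y<IV. g' y = g y) \<and> v' 40 = k \<and>
      (\<forall>x. x < 29 \<or> x \<in> {30, 31, 32, 33, 34, 37, 38} \<longrightarrow> v' x = v x)"
  have e1: "WP (40 :== V 31) 0 ?Q s2" if "?I2 0 s2" for s2
  proof -
    obtain g2 v2 z2 where s2: "s2 = (g2, v2, z2)" by (cases s2)
    have "sx (40 :== V 31) (g2, v2, z2) = Some (0, (g2, v2(40 := k), z2))"
      using that s2 v LL by simp
    then show ?thesis
      unfolding s2 by (rule WP_sx) (use that s2 in auto)
  qed
  have e2: "WP (?w ;; 40 :== V 31) ((\<Sum>j<?J. ?C j) + 0) ?Q s1" if "?I1 0 s1" for s1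
  proof -
    obtain g1 v1 z1 where s1: "s1 = (g1, v1, z1)" by (cases s1)
    have g1: "g1 = ?g" and "?I1 0 (?g, v1, z1)" using that s1 by simp_all
    from w2[OF this(2)] show ?thesis
      unfolding s1 g1 by (rule WP_then) (rule e1)
  qed
  have e3: "WP (29 :== Num 1 ;; While (Less (V 29) (V 31)) (29 :== Num 2 [*] V 29) ;; ?w ;; 40 :== V 31)
        (0 + ((\<Sum>j<?J. ?C j) + 0)) ?Q (?g, v, ?z)"
  proof (rule WP_sx_then)
    show "sx (29 :== Num 1) (?g, v, ?z) = Some (0, (?g, v(29 := 1), ?z))" by simp
    show "WP (While (Less (V 29) (V 31)) (29 :== Num 2 [*] V 29) ;; ?w ;; 40 :== V 31)
        (0 + ((\<Sum>j<?J. ?C j) + 0)) ?Q (?g, v(29 := 1), ?z)"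
      using w1 by (rule WP_then) (rule e2)
  qed
  have e4: "WP (Arith Div (Output, V 37) (Work, Num 53) (Input, eL [+] eN)) 1 (\<lambda>s. s = (?g, v, ?z)) (g, v, ?z)"
    using s2 by (rule WP_sx) simp_all
  have "WP INV (1 + (0 + ((\<Sum>j<?J. ?C j) + 0))) ?Q (g, v, z)"
    unfolding INV_def
  proof (rule WP_sx_then[OF s1])
    show "WP (Arith Div (Output, V 37) (Work, Num 53) (Input, eL [+] eN) ;;
      29 :== Num 1 ;; While (Less (V 29) (V 31)) (29 :== Num 2 [*] V 29) ;; ?w ;; 40 :== V 31)
      (1 + (0 + ((\<Sum>j<?J. ?C j) + 0))) ?Q (g, v, ?z)"
      using e4 by (rule WP_then) (simp only: e3)
  qed
  then show ?thesis
    by (rule WP_weaken) (use C[of ?J] in linarith)+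
qed

text \<open>The inverse is stored directly behind the \<open>p\<close> blocks, followed by one spare
  cell and the scratch. The truncated subtraction \<open>V 33 [-] (V 33 [-] V 34)\<close> is the
  minimum of the two registers.\<close>

definition CHUNK :: "'a com" where
  "CHUNK = (37 :== V 30 [+] V 32 [*] V 31 ;; 38 :== V 37 [+] V 31 [+] Num 1 ;; INV ;;
     34 :== (eN [+] V 31 [-] Num 1) [div] V 31 ;;
     For 33 (V 32) (35 :== V 30 [+] V 33 [*] V 31 ;; 36 :== V 33 [-] (V 33 [-] V 34) ;; ROW))"

text \<open>Block \<open>i\<close> has \<open>i\<close> predecessors, but divisor coefficients
  vanish from index \<open>n\<close> on, so only the nearest (n - 1) / k of them, rounded up, can
  influence it. The minimum in the cost is what makes long phases affordable.\<close>

lemma WP_CHUNK: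
  assumes v: "v 30 = t" "v 31 = k" "v 32 = p"
    and k: "1 \<le> k" "k \<le> m" "3 * k \<le> length inp" and p: "p \<le> LEN"
    and sp: "\<And>e. 1 \<le> e \<Longrightarrow> e \<le> k \<Longrightarrow> t + p * k + k + 1 + e + wm e \<le> LEN \<and> t + p * k + k + 1 + e + ws e \<le> LEN"
    and d: "arr g t (p * k) (\<lambda>i. res A t (t + i))"
  shows "WP CHUNK ((real k + real (lg k)) * (Fm + Fs + 1) + 1 +
      (\<Sum>i<p. real (min i ((n - 1 + k - 1) div k)) * (real k * Fm + real k) + real k * Fs))
    (\<lambda>(g', v', z'). arr g' t (p * k) (\<lambda>i. (A * iv) $ (t + i)) \<and> (\<forall>y<t. g' y = g y) \<and>
      (\<forall>x. x < 29 \<or> x \<in> {30, 31, 32} \<longrightarrow> v' x = v x)) (g, v, z)"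
proof -
  let ?G = "(n - 1 + k - 1) div k"
  let ?IV = "t + p * k" let ?TM = "?IV + k + 1"
  let ?v1 = "v(37 := ?IV)" let ?v2 = "v(37 := ?IV, 38 := ?TM)"
  have LL: "?TM \<le> LEN" "?IV \<le> LEN" "t \<le> LEN" using sp[of 1] k by auto
  have G: "?G \<le> n - 1 + k - 1" "?G \<le> LEN" "n - 1 \<le> ?G * k"
  proof -
    show "?G \<le> n - 1 + k - 1" by (rule div_le_dividend)
    then show "?G \<le> LEN" using LEN k by linarith
    have "n - 1 + k - 1 < k + ?G * k" using k by (intro dividend_less_div_times) auto
    then show "n - 1 \<le> ?G * k" using k by linarith
  qed
  have s1: "sx (37 :== V 30 [+] V 32 [*] V 31) (g, v, z) = Some (0, (g, ?v1, z))"
    using v LL by simp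
  have s2: "sx (38 :== V 37 [+] V 31 [+] Num 1) (g, ?v1, z) = Some (0, (g, ?v2, z))"
    using v LL by simp
  let ?I = "\<lambda>i (g', v', z' :: nat \<Rightarrow> 'a cell). v' 33 = i \<and> arr g' t (i * k) (\<lambda>j. (A * iv) $ (t + j)) \<and>
     (\<forall>y. t + i * k \<le> y \<and> y < ?IV \<longrightarrow> g' y = g y) \<and> arr g' ?IV k (fps_nth iv) \<and> (\<forall>y<t. g' y = g y) \<and>
     v' 34 = ?G \<and> v' 40 = k \<and> (\<forall>x. x < 29 \<or> x \<in> {30, 31, 32, 37, 38} \<longrightarrow> v' x = ?v2 x)"
  let ?C = "\<lambda>i. real (min i ?G) * (real k * Fm + real k) + real k * Fs"
  have loop: "WP (For 33 (V 32) (35 :== V 30 [+] V 33 [*] V 31 ;; 36 :== V 33 [-] (V 33 [-] V 34) ;; ROW))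
     (\<Sum>i<p. ?C i) (?I p) (g1, v1, z1)" if I0: "?I 0 (g1, v1(33 := 0), z1)" for g1 v1 z1
  proof (rule WP_for[where I = ?I])
    fix i g2 v2 z2 assume i: "i < p" and I: "?I i (g2, v2, z2)"
    define X where "X = t + i * k"
    define r where "r = min i ?G"
    have ik: "(i + 1) * k \<le> p * k" using i by (intro mult_le_mono1) simp
    have rk: "r * k \<le> i * k" by (simp add: r_def)
    have rX: "r * k \<le> X" using rk unfolding X_def by linarith
    have v2: "v2 30 = t" "v2 31 = k" "v2 32 = p" "v2 33 = i" "v2 34 = ?G" "v2 37 = ?IV" "v2 38 = ?TM" "v2 40 = k"
      using I v by auto
    let ?w1 = "v2(35 := X)" let ?w2 = "v2(35 := X, 36 := r)"
    have s3: "sx (35 :== V 30 [+] V 33 [*] V 31) (g2, v2, z2) = Some (0, (g2, ?w1, z2))"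
      using v2 LL ik by (simp add: X_def)
    have s4: "sx (36 :== V 33 [-] (V 33 [-] V 34)) (g2, ?w1, z2) = Some (0, (g2, ?w2, z2))"
      using v2 i p G(2) by (simp add: r_def min_def)
    have q1: "arr g2 (X - r * k) (r * k) (\<lambda>j. (A * iv) $ (X - r * k + j))"
    proof (unfold arr_def, intro allI impI)
      fix j assume "j < r * k"
      then have *: "X - r * k + j = t + (i * k - r * k + j)" "i * k - r * k + j < i * k"
        using rk unfolding X_def by linarith+
      from *(2) have "g2 (t + (i * k - r * k + j)) = Elt ((A * iv) $ (t + (i * k - r * k + j)))"
        using I unfolding arr_def by blast
      then show "g2 (X - r * k + j) = Elt ((A * iv) $ (X - r * k + j))"
        by (simp only: *(1))
    qed
    have d2: "arr g2 X k (\<lambda>b. res A t (X + b))"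
    proof (unfold arr_def, intro allI impI)
      fix b assume b: "b < k"
      then have "g2 (X + b) = g (t + (i * k + b))" using I ik by (simp add: X_def add.assoc)
      also have "\<dots> = Elt (res A t (X + b))" using d b ik by (simp add: arr_def X_def add.assoc)
      finally show "g2 (X + b) = Elt (res A t (X + b))" .
    qed
    have "WP ROW (real r * (real k * Fm + real k) + real k * Fs) (\<lambda>(g', v', z').
      arr g' X k (\<lambda>a. \<Sum>b\<le>a. iv $ (a - b) * (res A t (X + b) - (\<Sum>j<r * k. be (r * k + b - j) * (A * iv) $ (X - r * k + j)))) \<and>
      (\<forall>y. y < ?TM \<and> (y < X \<or> X + k \<le> y) \<longrightarrow> g' y = g2 y) \<and>
      (\<forall>x. x < 39 \<or> x = 40 \<longrightarrow> v' x = ?w2 x)) (g2, ?w2, z2)"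
    proof (rule WP_ROW[where IV = ?IV])
      show "r * k \<le> X" by (rule rX)
      show "X + k \<le> ?TM" "?IV + k \<le> ?IV + k + 1" "?IV + k \<le> X \<or> X + k \<le> ?IV"
        using rk ik unfolding X_def by auto
      show "arr g2 ?IV k (fps_nth iv)" using I by auto
    qed (use v2 k sp[of k] q1 d2 in simp_all)
    moreover have "(\<Sum>b\<le>a. iv $ (a - b) * (res A t (X + b) - (\<Sum>j<r * k. be (r * k + b - j) * (A * iv) $ (X - r * k + j)))) =
        (A * iv) $ (X + a)" for a
    proof -
      have "res A t (X + b) - (\<Sum>j<r * k. be (r * k + b - j) * (A * iv) $ (X - r * k + j)) = res A X (X + b)" for b
      proof -
        have "res A X (X + b) = res A t (X + b) - (\<Sum>j<i * k. be (X + b - (t + j)) * (A * iv) $ (t + j))"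
          unfolding X_def by (rule res_step) simp
        also have "(\<Sum>j<i * k. be (X + b - (t + j)) * (A * iv) $ (t + j)) =
           (\<Sum>j<(i * k - r * k) + r * k. be (i * k + b - j) * (A * iv) $ (t + j))"
          using rk by (simp add: X_def)
        also have "\<dots> = (\<Sum>j<i * k - r * k. be (i * k + b - j) * (A * iv) $ (t + j)) +
           (\<Sum>j<r * k. be (i * k + b - ((i * k - r * k) + j)) * (A * iv) $ (t + ((i * k - r * k) + j)))"
          by (rule sum_lessThan_add)
        \<comment> \<open>Blocks are skipped only if \<open>r\<close> is the full count, and then
          they lie at distance at least \<open>n\<close>.\<close>
        also have "(\<Sum>j<i * k - r * k. be (i * k + b - j) * (A * iv) $ (t + j)) = 0"
        proof (rule sum.neutral, rule)
          fix j assume j: "j \<in> {..<i * k - r * k}"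
          then have "r = ?G" by (cases "i \<le> ?G") (auto simp: r_def)
          then have "n - 1 \<le> r * k" using G by simp
          then have "n \<le> i * k + b - j" using j n by auto
          then show "be (i * k + b - j) * (A * iv) $ (t + j) = 0" by simp
        qed
        also have "(\<Sum>j<r * k. be (i * k + b - ((i * k - r * k) + j)) * (A * iv) $ (t + ((i * k - r * k) + j))) =
          (\<Sum>j<r * k. be (r * k + b - j) * (A * iv) $ (X - r * k + j))"
        proof (rule sum.cong)
          fix j assume "j \<in> {..<r * k}"
          then have "i * k + b - ((i * k - r * k) + j) = r * k + b - j"
            "t + ((i * k - r * k) + j) = X - r * k + j" using rk unfolding X_def lessThan_iff by linarith+
          then show "be (i * k + b - ((i * k - r * k) + j)) * (A * iv) $ (t + ((i * k - r * k) + j)) =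
             be (r * k + b - j) * (A * iv) $ (X - r * k + j)" by (simp only:)
        qed simp
        finally show ?thesis by simp
      qed
      then show ?thesis by (simp add: res_quot)
    qed
    ultimately have row: "WP ROW (?C i) (\<lambda>(g', v', z'). arr g' X k (\<lambda>a. (A * iv) $ (X + a)) \<and>
      (\<forall>y. y < ?TM \<and> (y < X \<or> X + k \<le> y) \<longrightarrow> g' y = g2 y) \<and>
      (\<forall>x. x < 39 \<or> x = 40 \<longrightarrow> v' x = ?w2 x)) (g2, ?w2, z2)"
      by (simp only: r_def)
    show "WP (35 :== V 30 [+] V 33 [*] V 31 ;; 36 :== V 33 [-] (V 33 [-] V 34) ;; ROW) (?C i)
      (\<lambda>(g, v, z). v 33 = i \<and> ?I (Suc i) (g, v(33 := Suc i), z)) (g2, v2, z2)"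
    proof (rule WP_sx_then[OF s3], rule WP_sx_then[OF s4], rule WP_weaken[OF row])
      fix s' :: "'a state"
      assume a: "case s' of (g', v', z') \<Rightarrow> arr g' X k (\<lambda>a. (A * iv) $ (X + a)) \<and>
        (\<forall>y. y < ?TM \<and> (y < X \<or> X + k \<le> y) \<longrightarrow> g' y = g2 y) \<and>
        (\<forall>x. x < 39 \<or> x = 40 \<longrightarrow> v' x = ?w2 x)"
      obtain g' v' z' where s': "s' = (g', v', z')" by (cases s')
      have g': "arr g' X k (\<lambda>a. (A * iv) $ (X + a))" "\<And>y. y < ?TM \<Longrightarrow> y < X \<or> X + k \<le> y \<Longrightarrow> g' y = g2 y"
        "\<And>x. x < 39 \<or> x = 40 \<Longrightarrow> v' x = ?w2 x"
        using a unfolding s' by blast+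
      have gI: "arr g2 t (i * k) (\<lambda>j. (A * iv) $ (t + j))"
        "\<And>y. t + i * k \<le> y \<Longrightarrow> y < ?IV \<Longrightarrow> g2 y = g y" "arr g2 ?IV k (fps_nth iv)"
        "\<And>y. y < t \<Longrightarrow> g2 y = g y" "\<And>x. x < 29 \<or> x \<in> {30, 31, 32, 37, 38} \<Longrightarrow> v2 x = ?v2 x"
        using I unfolding prod.case by blast+
      have Xk: "X + k = t + Suc i * k" "X + k \<le> ?IV" "t \<le> X"
        using ik by (auto simp: X_def)
      have "arr g' t (Suc i * k) (\<lambda>j. (A * iv) $ (t + j))"
      proof (unfold arr_def, intro allI impI)
        fix j assume j: "j < Suc i * k"
        show "g' (t + j) = Elt ((A * iv) $ (t + j))"
        proof (cases "j < i * k")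
          case True
          then have "g' (t + j) = g2 (t + j)" using Xk by (intro g'(2)) (auto simp: X_def)
          then show ?thesis using arrD[OF gI(1) True] by simp
        next
          case False
          then have *: "j - i * k < k" "t + j = X + (j - i * k)" using j by (auto simp: X_def)
          show ?thesis using arrD[OF g'(1) *(1)] by (simp only: *(2))
        qed
      qed
      moreover have "arr g' ?IV k (fps_nth iv)"
        by (rule arr_cong[OF gI(3)]) (use g'(2) Xk in auto)
      moreover have "g' y = g y" if "t + Suc i * k \<le> y" "y < ?IV" for y
        using g'(2)[of y] gI(2)[of y] that Xk by (auto simp: X_def)
      moreover have "g' y = g y" if "y < t" for y
        using g'(2)[of y] gI(4)[of y] that Xk LL by auto
      moreover have "v' x = ?v2 x" if "x < 29 \<or> x \<in> {30, 31, 32, 37, 38}" for x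
        using g'(3)[of x] gI(5)[OF that] that by auto
      moreover have "v' 33 = i" "v' 34 = ?G" "v' 40 = k"
        using g'(3)[of 33] g'(3)[of 34] g'(3)[of 40] v2 by simp_all
      ultimately show "case s' of (g, v, z) \<Rightarrow> v 33 = i \<and> ?I (Suc i) (g, v(33 := Suc i), z)"
        unfolding s' by simp
    qed simp
  qed (use v p I0 in auto)
  have "WP CHUNK ((real k + real (lg k)) * (Fm + Fs + 1) + 1 + (\<Sum>i<p. ?C i))
    (\<lambda>(g', v', z'). arr g' t (p * k) (\<lambda>i. (A * iv) $ (t + i)) \<and> (\<forall>y<t. g' y = g y) \<and>
      (\<forall>x. x < 29 \<or> x \<in> {30, 31, 32} \<longrightarrow> v' x = v x)) (g, v, z)"
    unfolding CHUNK_def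
  proof (rule WP_sx_then[OF s1], rule WP_sx_then[OF s2], rule WP_then[OF WP_INV])
    show "?v2 31 = k" "?v2 37 = ?IV" "?v2 38 = ?TM" using v by auto
    fix s1 :: "'a state" assume "case s1 of (g', v', z') \<Rightarrow> arr g' ?IV k (fps_nth iv) \<and> (\<forall>y<?IV. g' y = g y) \<and> v' 40 = k \<and>
      (\<forall>x. x < 29 \<or> x \<in> {30, 31, 32, 33, 34, 37, 38} \<longrightarrow> v' x = ?v2 x)"
    then obtain g1 v1 z1 where s1: "s1 = (g1, v1, z1)" and 1: "arr g1 ?IV k (fps_nth iv)" "\<forall>y<?IV. g1 y = g y"
       "v1 40 = k" "\<forall>x. x < 29 \<or> x \<in> {30, 31, 32, 33, 34, 37, 38} \<longrightarrow> v1 x = ?v2 x" by (cases s1) auto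
    show "WP (34 :== (eN [+] V 31 [-] Num 1) [div] V 31 ;;
     For 33 (V 32) (35 :== V 30 [+] V 33 [*] V 31 ;; 36 :== V 33 [-] (V 33 [-] V 34) ;; ROW))
      (\<Sum>i<p. ?C i) (\<lambda>(g', v', z'). arr g' t (p * k) (\<lambda>i. (A * iv) $ (t + i)) \<and> (\<forall>y<t. g' y = g y) \<and>
      (\<forall>x. x < 29 \<or> x \<in> {30, 31, 32} \<longrightarrow> v' x = v x)) s1"
      unfolding s1
    proof (rule WP_sx_then[of _ _ "(g1, v1(34 := ?G), z1)"])
      show "sx (34 :== (eN [+] V 31 [-] Num 1) [div] V 31) (g1, v1, z1) = Some (0, g1, v1(34 := ?G), z1)"
        using 1 v G(2) by (simp add: trans_le_add2)
      show "WP (For 33 (V 32) (35 :== V 30 [+] V 33 [*] V 31 ;; 36 :== V 33 [-] (V 33 [-] V 34) ;; ROW))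
        (\<Sum>i<p. ?C i) (\<lambda>(g', v', z'). arr g' t (p * k) (\<lambda>i. (A * iv) $ (t + i)) \<and> (\<forall>y<t. g' y = g y) \<and>
        (\<forall>x. x < 29 \<or> x \<in> {30, 31, 32} \<longrightarrow> v' x = v x)) (g1, v1(34 := ?G), z1)"
      proof (rule WP_weaken[OF loop])
        show "?I 0 (g1, (v1(34 := ?G))(33 := 0), z1)"
          using 1 by (auto simp: arr_def)
      qed auto
    qed
  qed (use k sp LL in auto)
  then show ?thesis .
qed

end


section \<open>Residues modulo \<open>X ^ a - 1\<close> and \<open>1 + X + ... + X ^ (a - 1)\<close>\<close>

definition pol :: "nat \<Rightarrow> (nat \<Rightarrow> 'a::comm_ring_1) \<Rightarrow> 'a poly" where
  "pol a w = (\<Sum>k<a. monom (w k) k)"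

definition cg :: "'a::comm_ring_1 poly \<Rightarrow> 'a poly \<Rightarrow> 'a poly \<Rightarrow> bool" where
  "cg P p q \<longleftrightarrow> P dvd p - q"

definition XA :: "nat \<Rightarrow> 'a::comm_ring_1 poly" where "XA a = monom 1 a - 1"

definition SA :: "nat \<Rightarrow> 'a::comm_ring_1 poly" where "SA a = (\<Sum>k<a. monom 1 k)"

definition psize :: "nat \<Rightarrow> 'a::comm_ring_1 poly \<Rightarrow> bool" where
  "psize k p \<longleftrightarrow> (\<forall>i\<ge>k. coeff p i = 0)"

lemma coeff_pol: "coeff (pol a w) k = (if k < a then w k else 0)"
  by (simp add: pol_def coeff_sum sum.delta)

lemma psize_pol: "psize a (pol a w)"
  by (simp add: psize_def coeff_pol)

lemma pol_coeff: "psize a p \<Longrightarrow> pol a (coeff p) = p"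
  by (rule poly_eqI) (auto simp: coeff_pol psize_def)

lemma pol_cong: "(\<And>k. k < a \<Longrightarrow> w k = w' k) \<Longrightarrow> pol a w = pol a w'"
  by (simp add: pol_def)

lemma pol_add: "pol a (\<lambda>k. w k + w' k) = pol a w + pol a w'"
  by (rule poly_eqI) (simp add: coeff_pol)

lemma pol_diff: "pol a (\<lambda>k. w k - w' k) = pol a w - pol a w'"
  by (rule poly_eqI) (simp add: coeff_pol)

lemma pol_upd: "k < a \<Longrightarrow> pol a (w(k := w k + c)) = pol a w + monom c k"
  by (rule poly_eqI) (simp add: coeff_pol)

lemma cg_refl [simp]: "cg P p p"
  by (simp add: cg_def)

lemma cg_sym: "cg P p q \<Longrightarrow> cg P q p"
  using dvd_minus_iff[of P "p - q"] by (simp add: cg_def)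

lemma cg_trans [trans]: "cg P p q \<Longrightarrow> cg P q r \<Longrightarrow> cg P p r"
  using dvd_add[of P "p - q" "q - r"] by (simp add: cg_def)

lemma cg_eq [trans]: "cg P p q \<Longrightarrow> q = r \<Longrightarrow> cg P p r" "p = q \<Longrightarrow> cg P q r \<Longrightarrow> cg P p r"
  by simp_all

lemma cg_add: "cg P p q \<Longrightarrow> cg P p' q' \<Longrightarrow> cg P (p + p') (q + q')"
  using dvd_add[of P "p - q" "p' - q'"] by (simp add: cg_def algebra_simps)

lemma cg_diff: "cg P p q \<Longrightarrow> cg P p' q' \<Longrightarrow> cg P (p - p') (q - q')"
  using dvd_diff[of P "p - q" "p' - q'"] by (simp add: cg_def algebra_simps)

lemma cg_mult_left: "cg P p q \<Longrightarrow> cg P (s * p) (s * q)"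
  unfolding cg_def right_diff_distrib[symmetric] by (rule dvd_mult)

lemma cg_mult: "cg P p q \<Longrightarrow> cg P p' q' \<Longrightarrow> cg P (p * p') (q * q')"
  using cg_trans[of P "p * p'" "p * q'" "q * q'"] cg_mult_left[of P p' q' p] cg_mult_left[of P p q q']
  by (simp add: mult.commute[of q'])

lemma cg_sum: "(\<And>i. i \<in> I \<Longrightarrow> cg P (f i) (h i)) \<Longrightarrow> cg P (sum f I) (sum h I)"
  by (simp add: cg_def sum_subtractf[symmetric] dvd_sum)

lemma XA_SA: "(monom 1 1 - 1) * SA a = (XA a :: 'a::comm_ring_1 poly)"
proof (induction a)
  case (Suc a)
  have "(monom 1 1 - 1) * (SA (Suc a) :: 'a poly) = (monom 1 1 - 1) * SA a + (monom 1 1 - 1) * monom 1 a"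
    by (simp add: SA_def algebra_simps)
  also have "\<dots> = XA (Suc a)"
    by (simp only: Suc) (simp add: XA_def left_diff_distrib mult_monom)
  finally show ?case .
qed (simp add: XA_def SA_def)

lemma cg_XA_SA: "cg (XA a) p q \<Longrightarrow> cg (SA a) p q"
  unfolding cg_def XA_SA[symmetric] by (rule dvd_mult_right)

text \<open>Modulo \<open>XA a\<close> reduction merely rotates exponents, so it pays to multiply a
  congruence modulo \<open>SA a\<close> by X - 1 and to compute there.\<close>

lemma cg_SA_XA: "cg (SA a) p q \<Longrightarrow> cg (XA a) ((monom 1 1 - 1) * p) ((monom 1 1 - 1) * q)"
  unfolding cg_def XA_SA[symmetric] right_diff_distrib[symmetric] by (rule mult_dvd_mono) simp_all

lemma cg_SA_0: "cg (SA a) (SA a * p) 0"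
  by (simp add: cg_def)

lemma cg_monom_mult: "cg (XA a) (monom c (a * q + x)) (monom c x)"
proof (induction q)
  case (Suc q)
  have "monom c (a * Suc q + x) - monom c (a * q + x) = XA a * monom c (a * q + x)"
    by (simp add: XA_def algebra_simps mult_monom)
  then have "cg (XA a) (monom c (a * Suc q + x)) (monom c (a * q + x))"
    by (simp add: cg_def)
  then show ?case using Suc cg_trans by blast
qed simp

lemma cg_monom_mod: "cg (XA a) (monom c x) (monom c (x mod a))"
  using cg_monom_mult[of a c "x div a" "x mod a"] by simp

lemma shift_bij:
  assumes "0 < (a::nat)"
  shows "bij_betw (\<lambda>k. (k + s) mod a) {..<a} {..<a}"
proof -
  have "inj_on (\<lambda>k. (k + s) mod a) {..<a}"
  proof (rule inj_onI)
    fix x y assume "x \<in> {..<a}" "y \<in> {..<a}" "(x + s) mod a = (y + s) mod a"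
    then have "[x + s = y + s] (mod a)" by (simp add: cong_def)
    then have "[x = y] (mod a)" using cong_add_rcancel_nat by blast
    then show "x = y" using \<open>x \<in> _\<close> \<open>y \<in> _\<close> by (simp add: cong_def)
  qed
  moreover have "(\<lambda>k. (k + s) mod a) ` {..<a} \<subseteq> {..<a}" using assms by auto
  ultimately show ?thesis
    by (simp add: bij_betw_def endo_inj_surj)
qed

text \<open>Multiplication by a power of X rotates the coefficients. The source index
  \<open>k + (a - 1) * b\<close> agrees with \<open>k - b\<close> modulo \<open>a\<close> and avoids
  subtraction of natural numbers.\<close>

lemma cg_shift: "0 < a \<Longrightarrow> cg (XA a) (monom 1 b * pol a w) (pol a (\<lambda>k. w ((k + (a - 1) * b) mod a)))"
proof -
  assume a: "0 < a"
  have "monom 1 b * pol a w = (\<Sum>k<a. monom (w k) (k + b))"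
    by (simp add: pol_def sum_distrib_left mult_monom add.commute)
  also have "cg (XA a) \<dots> (\<Sum>k<a. monom (w k) ((k + b) mod a))"
    by (rule cg_sum) (rule cg_monom_mod)
  also have "(\<Sum>k<a. monom (w k) ((k + b) mod a)) =
    (\<Sum>k<a. monom (w ((k + (a - 1) * b) mod a)) (((k + (a - 1) * b) mod a + b) mod a))"
    by (rule sum.reindex_bij_betw[OF shift_bij[OF a], symmetric])
  also have "\<dots> = pol a (\<lambda>k. w ((k + (a - 1) * b) mod a))"
    unfolding pol_def
  proof (rule sum.cong)
    fix k assume k: "k \<in> {..<a}"
    have "((k + (a - 1) * b) mod a + b) mod a = (k + (a - 1) * b + b) mod a" by (rule mod_add_left_eq)
    also have "k + (a - 1) * b + b = k + a * b" using a by (cases a) auto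
    finally have "((k + (a - 1) * b) mod a + b) mod a = k" using k by simp
    then show "monom (w ((k + (a - 1) * b) mod a)) (((k + (a - 1) * b) mod a + b) mod a) =
      monom (w ((k + (a - 1) * b) mod a)) k" by simp
  qed simp
  finally show ?thesis .
qed

lemma cg_cyclic: "0 < a \<Longrightarrow> cg (XA a) (pol a f * pol a u) (pol a (\<lambda>k. \<Sum>b<a. f ((k + a - b) mod a) * u b))"
proof -
  assume a: "0 < a"
  have "pol a f * pol a u = (\<Sum>b<a. [:u b:] * (monom 1 b * pol a f))"
    unfolding pol_def[of a u] sum_distrib_left
  proof (rule sum.cong)
    fix b
    have "monom (u b) b = [:u b:] * monom 1 b" by (simp add: smult_monom)
    then show "pol a f * monom (u b) b = [:u b:] * (monom 1 b * pol a f)"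
      by (simp only: mult.assoc mult.commute mult.left_commute)
  qed simp
  also have "cg (XA a) \<dots> (\<Sum>b<a. [:u b:] * pol a (\<lambda>k. f ((k + (a - 1) * b) mod a)))"
    by (intro cg_sum cg_mult_left cg_shift a)
  also have "\<dots> = pol a (\<lambda>k. \<Sum>b<a. f ((k + a - b) mod a) * u b)"
  proof (rule poly_eqI)
    fix k
    have "(k + (a - 1) * b) mod a = (k + a - b) mod a" if "b < a" for b
    proof -
      have "(k + (a - 1) * b) mod a = (k + (a - 1) * b + a) mod a" by simp
      also have "k + (a - 1) * b + a = (k + a - b) + a * b" using that by (cases a) auto
      finally show ?thesis by simp
    qed
    then show "coeff (\<Sum>b<a. [:u b:] * pol a (\<lambda>k. f ((k + (a - 1) * b) mod a))) k =
      coeff (pol a (\<lambda>k. \<Sum>b<a. f ((k + a - b) mod a) * u b)) k"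
      by (simp add: coeff_sum coeff_pol mult.commute)
  qed
  finally show ?thesis .
qed

text \<open>The leading coefficient of the cofactor survives multiplication by a monic polynomial;
  this replaces the absence of zero divisors.\<close>

lemma monic_dvd_psize:
  assumes "P dvd d" and "coeff P k = 1" and "degree P = k" and "psize k d"
  shows "d = 0"
proof -
  obtain e where d: "d = P * e" using assms by (auto simp: dvd_def)
  have "coeff d (k + degree e) = lead_coeff e"
    using coeff_mult_degree_sum[of P e] assms d by simp
  then have "lead_coeff e = 0" using assms(4) by (simp add: psize_def)
  then show ?thesis by (simp add: d)
qed

lemma XA_monic:
  assumes a: "0 < a"
  shows "degree (XA a :: 'a::comm_ring_1 poly) = a" and "coeff (XA a :: 'a poly) (a) = 1"
proof -
  show 1: "coeff (XA a :: 'a poly) (a) = 1" using a by (simp add: XA_def)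
  have "degree (XA a :: 'a poly) \<le> a" by (rule degree_le) (use a in \<open>auto simp: XA_def\<close>)
  moreover have "a \<le> degree (XA a :: 'a poly)" using 1 by (intro le_degree) simp
  ultimately show "degree (XA a :: 'a poly) = a" by simp
qed

lemma coeff_SA: "coeff (SA a) k = (if k < a then 1 else 0)"
  by (simp add: SA_def coeff_sum sum.delta)

lemma SA_monic:
  assumes a: "0 < a"
  shows "degree (SA a :: 'a::comm_ring_1 poly) = a - 1" and "coeff (SA a :: 'a poly) (a - 1) = 1"
proof -
  show 1: "coeff (SA a :: 'a poly) (a - 1) = 1" using a by (simp add: coeff_SA)
  have "degree (SA a :: 'a poly) \<le> a - 1" by (rule degree_le) (use a in \<open>auto simp: coeff_SA\<close>)
  moreover have "a - 1 \<le> degree (SA a :: 'a poly)" using 1 by (intro le_degree) simp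
  ultimately show "degree (SA a :: 'a poly) = a - 1" by simp
qed

lemma psize_diff: "psize k p \<Longrightarrow> psize k q \<Longrightarrow> psize k (p - q)"
  by (simp add: psize_def)

lemma cg_XA_eq: "0 < a \<Longrightarrow> psize a p \<Longrightarrow> psize a q \<Longrightarrow> cg (XA a) p q \<Longrightarrow> p = q"
  using monic_dvd_psize[of "XA a" "p - q" a] by (simp add: cg_def XA_monic(1) XA_monic(2)[simplified] psize_diff)

lemma cg_SA_eq: "0 < a \<Longrightarrow> psize (a - 1) p \<Longrightarrow> psize (a - 1) q \<Longrightarrow> cg (SA a) p q \<Longrightarrow> p = q"
  using monic_dvd_psize[of "SA a" "p - q" "a - 1"] by (simp add: cg_def SA_monic(1) SA_monic(2)[simplified] psize_diff)

lemma fold_exists: "0 < a \<Longrightarrow> \<exists>w. cg (XA a) p (pol a w)"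
proof (induction p)
  case 0
  then show ?case by (intro exI[of _ "\<lambda>_. 0"]) (simp add: pol_def)
next
  case (pCons c p)
  then obtain w where w: "cg (XA a) p (pol a w)" by auto
  have "pCons c p = monom c 0 + monom 1 1 * p"
    by (simp add: monom_0 monom_Suc)
  also have "cg (XA a) \<dots> (monom c 0 + monom 1 1 * pol a w)"
    by (intro cg_add cg_mult_left w) simp
  also have "cg (XA a) \<dots> (monom c 0 + pol a (\<lambda>k. w ((k + (a - 1) * 1) mod a)))"
    by (intro cg_add cg_shift pCons) simp
  also have "\<dots> = pol a ((\<lambda>k. w ((k + (a - 1) * 1) mod a))(0 := w ((0 + (a - 1) * 1) mod a) + c))"
    using pol_upd[of 0 a "\<lambda>k. w ((k + (a - 1) * 1) mod a)" c] pCons by (simp add: add.commute)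
  finally show ?case by blast
qed

text \<open>\<open>b\<close> is invertible modulo \<open>a\<close>, so its multiples run through all
  residues. The orbit starts at \<open>a - 1\<close>, the position at which representatives are
  normalised to zero.\<close>

lemma orbit_surj:
  assumes "coprime a b" and "k < (a::nat)"
  shows "\<exists>s<a. k = (a - 1 + s * b) mod a"
proof -
  let ?f = "\<lambda>s. (a - 1 + s * b) mod a"
  have "inj_on ?f {..<a}"
  proof (rule inj_onI)
    fix x y assume "x \<in> {..<a}" "y \<in> {..<a}" "?f x = ?f y"
    then have "[x * b = y * b] (mod a)"
      using cong_add_lcancel_nat[of "a - 1" "x * b" "y * b" a] by (simp add: cong_def)
    then have "[x = y] (mod a)"
      using assms by (simp add: cong_mult_rcancel_nat coprime_commute)
    then show "x = y" using \<open>x \<in> _\<close> \<open>y \<in> _\<close> by (simp add: cong_def)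
  qed
  moreover have "?f ` {..<a} \<subseteq> {..<a}" using assms by auto
  ultimately have "?f ` {..<a} = {..<a}" using endo_inj_surj[of "{..<a}" ?f] by blast
  then show ?thesis using assms by blast
qed

text \<open>Division by \<open>SA b\<close> modulo \<open>SA a\<close>: after multiplication by \<open>X - 1\<close> the quotient satisfies
  a recurrence with step \<open>b\<close> on the cyclic group of order \<open>a\<close>, up to an additive constant.\<close>

lemma walk:
  assumes ab: "coprime a b" "0 < a" and w: "cg (SA a) (pol a w) (SA b * y)" and z0: "z (a - 1) = 0"
    and z: "\<And>s. s < a - 1 \<Longrightarrow> z ((a - 1 + Suc s * b) mod a) = z ((a - 1 + s * b) mod a) -
      (w (((a - 1 + Suc s * b) mod a + (a - 1)) mod a) - w ((a - 1 + Suc s * b) mod a))"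
  shows "cg (SA a) (pol a z) y"
proof -
  obtain y0 where y0: "cg (XA a) y (pol a y0)" using fold_exists[OF ab(2)] by blast
  have sh: "cg (XA a) ((monom 1 c - 1) * pol a f) (pol a (\<lambda>k. f ((k + (a - 1) * c) mod a) - f k))" for c f
    unfolding pol_diff left_diff_distrib mult_1_left by (intro cg_diff cg_shift ab cg_refl)
  \<comment> \<open>After multiplication by X - 1 the hypothesis reads (X - 1) w = (X^b - 1) y
    modulo X^a - 1, and either side is a difference of two rotations.\<close>
  have "cg (XA a) (pol a (\<lambda>k. w ((k + (a - 1) * 1) mod a) - w k)) ((monom 1 1 - 1) * pol a w)"
    by (rule cg_sym[OF sh])
  also have "cg (XA a) \<dots> ((monom 1 1 - 1) * (SA b * y))"
    by (rule cg_SA_XA[OF w])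
  also have "(monom 1 1 - 1) * (SA b * y) = (monom 1 b - 1) * y"
    by (simp only: mult.assoc[symmetric] XA_SA) (simp add: XA_def)
  also have "cg (XA a) \<dots> ((monom 1 b - 1) * pol a y0)"
    by (rule cg_mult_left[OF y0])
  also have "cg (XA a) \<dots> (pol a (\<lambda>k. y0 ((k + (a - 1) * b) mod a) - y0 k))"
    by (rule sh)
  finally have "pol a (\<lambda>k. w ((k + (a - 1) * 1) mod a) - w k) = pol a (\<lambda>k. y0 ((k + (a - 1) * b) mod a) - y0 k)"
    by (rule cg_XA_eq[OF ab(2) psize_pol psize_pol])
  then have eq: "w ((k + (a - 1)) mod a) - w k = y0 ((k + (a - 1) * b) mod a) - y0 k" if "k < a" for k
  proof -
    from \<open>pol a _ = pol a _\<close> have "coeff (pol a (\<lambda>k. w ((k + (a - 1) * 1) mod a) - w k)) k =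
      coeff (pol a (\<lambda>k. y0 ((k + (a - 1) * b) mod a) - y0 k)) k" by (simp only:)
    then show ?thesis using that by (simp add: coeff_pol)
  qed
  let ?k = "\<lambda>s. (a - 1 + s * b) mod a"
  \<comment> \<open>Both functions have the same increments along the orbit, so their difference
    keeps the value that it has at the start.\<close>
  have orb: "s < a \<Longrightarrow> z (?k s) - y0 (?k s) = - y0 (a - 1)" for s
  proof (induction s)
    case 0
    then show ?case using z0 ab by simp
  next
    case (Suc s)
    have "(?k (Suc s) + (a - 1) * b) mod a = (a - 1 + Suc s * b + (a - 1) * b) mod a"
      by (rule mod_add_left_eq)
    also have "a - 1 + Suc s * b + (a - 1) * b = (a - 1 + s * b) + a * b"
      using ab by (cases a) auto
    finally have "(?k (Suc s) + (a - 1) * b) mod a = ?k s" by simp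
    then show ?case
      using z[of s] eq[of "?k (Suc s)"] Suc ab by simp
  qed
  have "z k = y0 k + - y0 (a - 1)" if k: "k < a" for k
  proof -
    obtain s where s: "s < a" "k = ?k s" using orbit_surj[OF ab(1) k] by blast
    then have "z k - y0 k = - y0 (a - 1)" using orb[OF s(1)] by (simp only:)
    then show ?thesis by (simp add: algebra_simps)
  qed
  \<comment> \<open>The same constant added to all \<open>a\<close> coefficients is a multiple of
    \<open>SA a\<close> and disappears in the congruence.\<close>
  then have "pol a z = pol a y0 + SA a * [: - y0 (a - 1) :]"
    by (intro poly_eqI) (auto simp: coeff_pol coeff_SA mult.commute)
  moreover have "cg (SA a) (pol a y0 + SA a * [: - y0 (a - 1) :]) (y + 0)"
    by (intro cg_add cg_SA_0 cg_XA_SA cg_sym[OF y0])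
  ultimately show ?thesis by simp
qed

text \<open>Pseudo-division by a polynomial with leading coefficient 1 is division with remainder,
  over any commutative ring.\<close>

lemma monic_division:
  assumes "0 < a"
  shows "\<exists>s u. p = s + SA a * u \<and> psize (a - 1) s"
proof -
  obtain q r where qr: "pseudo_divmod p (SA a) = (q, r)" by (cases "pseudo_divmod p (SA a)")
  have "SA a \<noteq> (0 :: 'a poly)" using SA_monic(2)[OF assms, where 'a = 'a] by auto
  from pseudo_divmod[OF this qr] have "p = SA a * q + r" "r = 0 \<or> degree r < a - 1"
    using SA_monic[OF assms, where 'a = 'a] by simp_all
  then show ?thesis
    by (intro exI[of _ r] exI[of _ q]) (auto simp: psize_def coeff_eq_0)
qed

lemma psize_quot:
  assumes "0 < a" and p: "p = s + SA a * u" and "psize (a - 1) s" and "psize (a - 1 + k) p"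
  shows "psize k u"
proof (cases "u = 0")
  case False
  have "coeff (SA a * u) (a - 1 + degree u) = lead_coeff u"
    using coeff_mult_degree_sum[of "SA a" u] SA_monic[OF assms(1), where 'a = 'a] by simp
  moreover have "coeff (SA a * u) i = 0" if "i \<ge> a - 1 + k" for i
    using assms that by (auto simp: psize_def)
  ultimately have "degree u < k"
    using False by (cases "k \<le> degree u") auto
  then show ?thesis by (auto simp: psize_def coeff_eq_0)
qed (simp add: psize_def)

lemma coeff_SA_mult: "coeff (SA a * u) k = (\<Sum>e<a. if e \<le> k then coeff u (k - e) else 0)"
proof -
  have "SA a * u = (\<Sum>e<a. monom 1 e * u)" by (simp add: SA_def sum_distrib_right)
  then show ?thesis by (auto simp: coeff_sum coeff_monom_mult intro!: sum.cong)
qed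

text \<open>The coefficients of \<open>SA a * u\<close> are sums over a window of length
  \<open>a\<close>; moving the window by one adds one coefficient of \<open>u\<close> and drops
  another. Multiplication by X - 1 expresses exactly this.\<close>

lemma coeff_SA_mult_Suc:
  assumes "0 < a"
  shows "coeff (SA a * u) (Suc k) = coeff (SA a * u) k + coeff u (Suc k) -
    (if a \<le> Suc k then coeff u (Suc k - a) else 0)"
proof -
  have "(monom 1 1 - 1) * (SA a * u) = (monom 1 a - 1) * u"
    by (simp only: mult.assoc[symmetric] XA_SA) (simp add: XA_def)
  then have "coeff ((monom 1 1 - 1) * (SA a * u)) (Suc k) = coeff ((monom 1 a - 1) * u) (Suc k)" by simp
  then show ?thesis
    by (simp add: left_diff_distrib coeff_monom_mult) (auto simp: algebra_simps split: if_splits)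
qed


lemma orbit_inj:
  assumes "coprime a b"
  shows "inj_on (\<lambda>s. (a - 1 + s * b) mod a) {..<(a::nat)}"
proof (rule inj_onI)
  fix x y assume "x \<in> {..<a}" "y \<in> {..<a}" "(a - 1 + x * b) mod a = (a - 1 + y * b) mod a"
  then have "[x * b = y * b] (mod a)"
    using cong_add_lcancel_nat[of "a - 1" "x * b" "y * b" a] by (simp add: cong_def)
  then have "[x = y] (mod a)"
    using assms by (simp add: cong_mult_rcancel_nat coprime_commute)
  then show "x = y" using \<open>x \<in> _\<close> \<open>y \<in> _\<close> by (simp add: cong_def)
qed

text \<open>The recurrence runs along step numbers but has to define a function of positions;
  injectivity of the orbit allows both views. The function specifies in advance what the loop of
  \<open>DIV1\<close> stores.\<close>

lemma orbit_fun:
  fixes d :: "nat \<Rightarrow> 'b::ab_group_add"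
  assumes "coprime a b" and "0 < a"
  obtains zf where "zf (a - 1) = 0"
    and "\<And>s. s < a - 1 \<Longrightarrow> zf ((a - 1 + Suc s * b) mod a) = zf ((a - 1 + s * b) mod a) - d ((a - 1 + Suc s * b) mod a)"
proof -
  let ?k = "\<lambda>s. (a - 1 + s * b) mod a"
  define zf where "zf k = - (\<Sum>s<inv_into {..<a} ?k k. d (?k (Suc s)))" for k
  have zf: "zf (?k s) = - (\<Sum>s'<s. d (?k (Suc s')))" if "s < a" for s
  proof -
    have "inv_into {..<a} ?k (?k s) = s" using that by (intro inv_into_f_f orbit_inj assms) simp
    then show ?thesis by (simp only: zf_def)
  qed
  show thesis
  proof (rule that[of zf])
    show "zf (a - 1) = 0" using zf[of 0] assms by simp
    fix s assume s: "s < a - 1"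
    then have *: "s < a" "Suc s < a" by auto
    show "zf (?k (Suc s)) = zf (?k s) - d (?k (Suc s))"
      unfolding zf[OF *(1)] zf[OF *(2)] by simp
  qed
qed

context division
begin

definition fold_loop :: "ring_op \<Rightarrow> iexp \<Rightarrow> iexp \<Rightarrow> iexp \<Rightarrow> address \<Rightarrow> 'a com" where
  "fold_loop op e me dst src = For 19 e (18 :== Mod me (V 13) ;;
     Arith op (Output, dst [+] V 18) (Output, dst [+] V 18) src)"

text \<open>\<open>\<sigma>\<close> is the sign of the accumulation, 1 or -1. The new contents are
  described through the polynomial that they represent, which hides the order in which monomials
  with the same reduced exponent are added.\<close>

lemma WP_fold:
  assumes op: "\<And>x y. ring_apply op x (y::'a) = Some (x + \<sigma> * y)"
    and ok: "okx e" "okx me" "okx dst"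
    and l: "l \<le> LEN" and a: "0 < a" "v 13 = a" "B + a \<le> LEN"
    and e: "\<And>i k. val (v(18 := k, 19 := i)) e = l"
    and me: "\<And>i k. val (v(18 := k, 19 := i)) me = i + s"
    and dst: "\<And>i k. val (v(18 := k, 19 := i)) dst = B"
    and src: "\<And>g' i k z'. i < l \<Longrightarrow> \<forall>y. y < B \<or> B + a \<le> y \<longrightarrow> g' y = g y \<Longrightarrow>
      aload (g', v(18 := k, 19 := i), z') src = Some (Elt (f i))"
    and w: "arr g B a w"
  shows "WP (fold_loop op e me dst src) (real l) (\<lambda>(g', v', z').
      (\<exists>w'. arr g' B a w' \<and> pol a w' = pol a w + (\<Sum>x<l. monom (\<sigma> * f x) ((x + s) mod a))) \<and>
      (\<forall>y. y < B \<or> B + a \<le> y \<longrightarrow> g' y = g y) \<and> (\<forall>x. x \<noteq> 18 \<longrightarrow> x \<noteq> 19 \<longrightarrow> v' x = v x)) (g, v, z)"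
proof -
  let ?R = "\<lambda>i (g', v', z' :: nat \<Rightarrow> 'a cell).
      (\<exists>w'. arr g' B a w' \<and> pol a w' = pol a w + (\<Sum>x<i. monom (\<sigma> * f x) ((x + s) mod a))) \<and>
      (\<forall>y. y < B \<or> B + a \<le> y \<longrightarrow> g' y = g y) \<and> (\<forall>x. x \<noteq> 18 \<longrightarrow> x \<noteq> 19 \<longrightarrow> v' x = v x)"
  have vv: "v' = v(18 := v' 18, 19 := i)" if "v' 19 = i" "\<forall>x. x \<noteq> 18 \<longrightarrow> x \<noteq> 19 \<longrightarrow> v' x = v x" for v' i
    using that by (intro ext) simp
  have "WP (fold_loop op e me dst src) (\<Sum>i<l. 1) (?R l) (g, v, z)"
    unfolding fold_loop_def
  proof (rule WP_for[where I = "\<lambda>i (g', v', z'). v' 19 = i \<and> ?R i (g', v', z')"])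
    show "case (g, v(19 := 0), z) of (g', v', z') \<Rightarrow> v' 19 = 0 \<and> ?R 0 (g', v', z')"
      unfolding prod.case using w by (intro conjI exI[of _ w]) simp_all
  next
    fix i g1 v1 z1 assume i: "i < l" and "case (g1, v1, z1) of (g', v', z') \<Rightarrow> v' 19 = i \<and> ?R i (g', v', z')"
    then obtain w' where w': "arr g1 B a w'" "pol a w' = pol a w + (\<Sum>x<i. monom (\<sigma> * f x) ((x + s) mod a))"
      and g1: "\<forall>y. y < B \<or> B + a \<le> y \<longrightarrow> g1 y = g y" and v1: "v1 19 = i" "\<forall>x. x \<noteq> 18 \<longrightarrow> x \<noteq> 19 \<longrightarrow> v1 x = v x"
      unfolding prod.case by blast
    define k where "k = (i + s) mod a"
    have k: "k < a" using a by (simp add: k_def)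
    let ?v2 = "v1(18 := k)"
    have v1e: "v1 = v(18 := v1 18, 19 := i)" by (rule vv[OF v1])
    have v2e: "?v2 = v(18 := k, 19 := i)" by (rule ext) (use v1 in simp)
    have ev: "val v1 me = i + s" "val ?v2 dst = B" "v1 13 = a"
      using me[of "v1 18" i] dst[of k i] v1(2) a unfolding v1e[symmetric] v2e[symmetric] by simp_all
    have sr: "aload (g1, ?v2, z1) src = Some (Elt (f i))" unfolding v2e by (rule src[OF i g1])
    let ?g2 = "g1(B + k := Elt (w' k + \<sigma> * f i))"
    have sx1: "sx (18 :== Mod me (V 13) ;; Arith op (Output, dst [+] V 18) (Output, dst [+] V 18) src) (g1, v1, z1) =
      Some (1, (?g2, ?v2, z1))"
      using ok ev sr k a arrD[OF w'(1) k] op by (simp add: k_def[symmetric])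
    show "WP (18 :== Mod me (V 13) ;; Arith op (Output, dst [+] V 18) (Output, dst [+] V 18) src) 1
      (\<lambda>(g, v, z). v 19 = i \<and> (case (g, v(19 := Suc i), z) of (g', v', z') \<Rightarrow> v' 19 = Suc i \<and> ?R (Suc i) (g', v', z')))
      (g1, v1, z1)"
    proof (rule WP_sx[OF sx1])
      have "arr ?g2 B a (w'(k := w' k + \<sigma> * f i))" using w'(1) by (auto simp: arr_def)
      moreover have "pol a (w'(k := w' k + \<sigma> * f i)) = pol a w + (\<Sum>x<Suc i. monom (\<sigma> * f x) ((x + s) mod a))"
        using pol_upd[OF k, of w' "\<sigma> * f i"] w'(2) by (simp add: k_def add.assoc)
      ultimately show "case (?g2, ?v2, z1) of (g, v, z) \<Rightarrow> v 19 = i \<and>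
        (case (g, v(19 := Suc i), z) of (g', v', z') \<Rightarrow> v' 19 = Suc i \<and> ?R (Suc i) (g', v', z'))"
        unfolding prod.case using v1 g1 k by (intro conjI exI[of _ "w'(k := w' k + \<sigma> * f i)"]) simp_all
    qed simp
  next
    fix i g1 v1 z1 assume "i \<le> l" and "case (g1, v1, z1) of (g', v', z') \<Rightarrow> v' 19 = i \<and> ?R i (g', v', z')"
    then have v1: "v1 19 = i" "\<forall>x. x \<noteq> 18 \<longrightarrow> x \<noteq> 19 \<longrightarrow> v1 x = v x" unfolding prod.case by blast+
    then show "v1 19 = i \<and> val v1 e = l" using e[of "v1 18" i] unfolding vv[OF v1, symmetric] by simp
  qed (use ok l in auto)
  then show ?thesis by simp
qed

subsection \<open>Cyclic convolution\<close>

text \<open>Layout above the base address \<open>W\<close> (register 14), with \<open>a\<close> in register 13: the residue,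
  a second array, two periods of the folded divisor, the folded quotient, and the output of the
  product program, followed by its work area.\<close>

definition CYC_MP :: "'a com" where
  "CYC_MP = (40 :== V 13 ;; 41 :== V 14 [+] Num 5 [*] V 13 ;; 42 :== V 41 [+] V 13 ;;
     44 :== Num 2 [*] V 13 [-] Num 1 ;; 45 :== V 14 [+] Num 2 [*] V 13 [+] Num 1 ;;
     46 :== V 14 [+] Num 4 [*] V 13 ;; tr FA mp ;;
     For 47 (V 13) (Arith Sub (Output, V 14 [+] V 47) (Output, V 14 [+] V 47) (Output, V 41 [+] V 47)))"

definition CYC_SP :: "'a com" where
  "CYC_SP = (40 :== V 13 ;; 41 :== V 14 [+] Num 5 [*] V 13 ;;
     45 :== V 14 [+] Num 2 [*] V 13 ;; 46 :== V 14 [+] Num 4 [*] V 13 ;; SPB ;;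
     For 47 (V 13) (Arith Sub (Output, V 14 [+] V 47) (Output, V 14 [+] V 47) (Output, V 41 [+] V 47)) ;;
     For 47 (V 13) (Move (Output, V 14 [+] Num 3 [*] V 13 [+] V 47)
        (Output, V 14 [+] Num 2 [*] V 13 [+] (V 13 [-] Num 1 [-] V 47))) ;;
     For 47 (V 13) (Move (Output, V 14 [+] V 13 [+] V 47)
        (Output, V 14 [+] Num 4 [*] V 13 [+] (V 13 [-] Num 1 [-] V 47))) ;;
     45 :== V 14 [+] Num 3 [*] V 13 ;; 46 :== V 14 [+] V 13 ;; SPB ;;
     For 47 (V 13 [-] Num 1) (Arith Sub (Output, V 14 [+] V 47) (Output, V 14 [+] V 47)
        (Output, V 41 [+] (V 13 [-] Num 2 [-] V 47))))"

text \<open>Common specification of the two ways to subtract a cyclic product, with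
  \<open>\<rho>\<close> as the rate per coefficient. The folded divisor is supplied with two
  periods, so that the wraparound becomes a contiguous stretch of cells.\<close>

definition cyc_spec :: "'a com \<Rightarrow> real \<Rightarrow> bool" where
  "cyc_spec c \<rho> \<longleftrightarrow> (\<forall>g v z a W w fb fq. v 13 = a \<longrightarrow> v 14 = W \<longrightarrow> 2 \<le> a \<longrightarrow> a \<le> m \<longrightarrow> 3 * a \<le> length inp \<longrightarrow>
     W + 6 * a + wm a \<le> LEN \<longrightarrow> W + 6 * a + ws a \<le> LEN \<longrightarrow> arr g W a w \<longrightarrow>
     arr g (W + 2 * a) (2 * a) (\<lambda>i. fb (i mod a)) \<longrightarrow> arr g (W + 4 * a) a fq \<longrightarrow>
     WP c (real a * \<rho> + 2 * real a) (\<lambda>(g', v', z').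
       arr g' W a (\<lambda>k. w k - (\<Sum>b<a. fb ((k + a - b) mod a) * fq b)) \<and> (\<forall>y<W. g' y = g y) \<and>
       (\<forall>x. x < 40 \<longrightarrow> v' x = v x)) (g, v, z))"

lemma WP_sub_loop:
  assumes ok: "okx e" "okx s" and l: "l \<le> LEN" "W + l \<le> LEN"
    and e: "\<And>i. val (v(47 := i)) e = l" "v 14 = W"
    and s: "\<And>i. i < l \<Longrightarrow> okx s \<and> val (v(47 := i)) s = p i \<and> W + l \<le> p i \<and> p i < LEN \<and> g (p i) = Elt (f i)"
    and w: "arr g W a w" "l \<le> a"
    and Q: "\<And>g' v'. arr g' W a (\<lambda>k. if k < l then w k - f k else w k) \<Longrightarrow> \<forall>y. y < W \<or> W + l \<le> y \<longrightarrow> g' y = g y \<Longrightarrow>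
       \<forall>x. x \<noteq> 47 \<longrightarrow> v' x = v x \<Longrightarrow> Q (g', v', z)"
  shows "WP (For 47 e (Arith Sub (Output, V 14 [+] V 47) (Output, V 14 [+] V 47) (Output, s))) (real l) Q (g, v, z)"
proof (rule WP_for_sx[where n = l and k = 1 and Z = "\<lambda>_. z" and
    G = "\<lambda>i y. if W \<le> y \<and> y < W + i then Elt (w (y - W) - f (y - W)) else g y"])
  fix i assume i: "i < l"
  have "g (W + i) = Elt (w i)" using arrD[OF w(1), of i] i w(2) by simp
  then show "sx (Arith Sub (Output, V 14 [+] V 47) (Output, V 14 [+] V 47) (Output, s))
     (\<lambda>y. if W \<le> y \<and> y < W + i then Elt (w (y - W) - f (y - W)) else g y, v(47 := i), z) =
    Some (1, \<lambda>y. if W \<le> y \<and> y < W + Suc i then Elt (w (y - W) - f (y - W)) else g y, v(47 := i), z)"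
    using s[OF i] i e l by (auto simp: fun_eq_iff)
next
  show "Q (\<lambda>y. if W \<le> y \<and> y < W + l then Elt (w (y - W) - f (y - W)) else g y, v(47 := l), z)"
  proof (rule Q)
    show "arr (\<lambda>y. if W \<le> y \<and> y < W + l then Elt (w (y - W) - f (y - W)) else g y) W a (\<lambda>k. if k < l then w k - f k else w k)"
      using w by (auto simp: arr_def)
  qed auto
qed (use ok l e in auto)

text \<open>Every output position of a middle product sees a complete stretch of \<open>a\<close>
  entries of the long factor; if that factor is periodic with period \<open>a\<close>, the result is
  the cyclic product.\<close>

lemma cyc_spec_MP: "cyc_spec CYC_MP Fm"
  unfolding cyc_spec_def
proof (intro allI impI)
  fix g :: "nat \<Rightarrow> 'a cell" and v :: "nat \<Rightarrow> nat" and z :: "nat \<Rightarrow> 'a cell" and a W :: nat and w fb fq :: "nat \<Rightarrow> 'a"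
  assume v: "v 13 = a" "v 14 = W" and a: "2 \<le> a" "a \<le> m" "3 * a \<le> length inp"
    and sp: "W + 6 * a + wm a \<le> LEN" and w: "arr g W a w"
    and fb: "arr g (W + 2 * a) (2 * a) (\<lambda>i. fb (i mod a))" and fq: "arr g (W + 4 * a) a fq"
  let ?ob = "W + 5 * a"
  let ?v = "v(40 := a, 41 := ?ob, 42 := ?ob + a, 44 := 2 * a - 1, 45 := W + 2 * a + 1, 46 := W + 4 * a)"
  \<comment> \<open>The window starts at position 1 of the periodic array: the index
    \<open>a - 1 + k - b\<close> then refers to \<open>k + a - b\<close>.\<close>
  let ?f = "\<lambda>i. fb (Suc i mod a)"
  let ?vin = "map ?f [0..<2 * a - 1] @ map fq [0..<a]"
  let ?c = "\<lambda>k. \<Sum>b<a. ?f (a - 1 + k - b) * fq b"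
  have LL: "W + 6 * a \<le> LEN" using sp by simp
  have s1: "sx (40 :== V 13) (g, v, z) = Some (0, (g, v(40 := a), z))" using v LL by simp
  have s2: "sx (41 :== V 14 [+] Num 5 [*] V 13) (g, v(40 := a), z) = Some (0, (g, v(40 := a, 41 := ?ob), z))"
    using v LL by simp
  have s3: "sx (42 :== V 41 [+] V 13) (g, v(40 := a, 41 := ?ob), z) = Some (0, (g, v(40 := a, 41 := ?ob, 42 := ?ob + a), z))"
    using v LL by simp
  have s4: "sx (44 :== Num 2 [*] V 13 [-] Num 1) (g, v(40 := a, 41 := ?ob, 42 := ?ob + a), z) =
     Some (0, (g, v(40 := a, 41 := ?ob, 42 := ?ob + a, 44 := 2 * a - 1), z))"
    using v LL by simp
  have s5: "sx (45 :== V 14 [+] Num 2 [*] V 13 [+] Num 1) (g, v(40 := a, 41 := ?ob, 42 := ?ob + a, 44 := 2 * a - 1), z) =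
     Some (0, (g, v(40 := a, 41 := ?ob, 42 := ?ob + a, 44 := 2 * a - 1, 45 := W + 2 * a + 1), z))"
    using v LL by simp
  have s6: "sx (46 :== V 14 [+] Num 4 [*] V 13) (g, v(40 := a, 41 := ?ob, 42 := ?ob + a, 44 := 2 * a - 1, 45 := W + 2 * a + 1), z) =
     Some (0, (g, ?v, z))"
    using v LL by simp
  have box: "WP (tr FA mp) (real a * Fm) (\<lambda>(g', v', z'). arr g' ?ob a ?c \<and> (\<forall>y<?ob. g' y = g y) \<and>
      (\<forall>x. x \<noteq> 43 \<longrightarrow> v' x = ?v x)) (g, ?v, z)"
  proof (rule WP_weaken[OF WP_box[where k = a and ob = ?ob and w = "wm a" and vin = ?vin]])
    show "computes mp [?v 40] ?vin a (wm a) (real a * Fm) (\<lambda>ys. ys = map ?c [0..<a])"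
      using mp[of a ?f fq] a by simp
  next
    fix g' v' z'
    assume g': "\<And>y. y < ?ob \<or> ?ob + a + wm a \<le> y \<Longrightarrow> g' y = g y" and v': "\<And>x. x \<noteq> 43 \<Longrightarrow> v' x = ?v x"
      and i: "v' 43 < length ?vin"
    show "sx FA (g', v', z') = Some (0, g', v', z'(0 := Elt (?vin ! v' 43)))"
    proof (cases "v' 43 < 2 * a - 1")
      case True
      have "g (W + 2 * a + Suc (v' 43)) = Elt (?f (v' 43))"
        using True by (intro arrD[OF fb]) simp
      moreover have "g' (W + 2 * a + Suc (v' 43)) = g (W + 2 * a + Suc (v' 43))"
        using True a by (intro g' disjI1) linarith
      ultimately show ?thesis
        using v' True LL by (simp add: FA_def nth_append)
    next
      case False
      then have *: "v' 43 - (2 * a - 1) < a" using i by simp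
      have "g' (W + 4 * a + (v' 43 - (2 * a - 1))) = g (W + 4 * a + (v' 43 - (2 * a - 1)))"
        using * by (intro g') linarith
      then have "g' (W + 4 * a + (v' 43 - (2 * a - 1))) = Elt (fq (v' 43 - (2 * a - 1)))"
        using arrD[OF fq *] by simp
      then show ?thesis
        using v' False * LL by (simp add: FA_def nth_append)
    qed
  next
    fix s' :: "'a state"
    assume "case s' of (g', v', z') \<Rightarrow>
         (\<exists>ys. ys = map ?c [0..<a] \<and> length ys = a \<and> (\<forall>i<a. g' (?ob + i) = Elt (ys ! i))) \<and>
         (\<forall>y. y < ?ob \<or> ?ob + a + wm a \<le> y \<longrightarrow> g' y = g y) \<and> (\<forall>x. x \<noteq> 43 \<longrightarrow> v' x = ?v x)"
    then show "case s' of (g', v', z') \<Rightarrow> arr g' ?ob a ?c \<and> (\<forall>y<?ob. g' y = g y) \<and> (\<forall>x. x \<noteq> 43 \<longrightarrow> v' x = ?v x)"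
      by (auto simp: arr_def split: prod.splits)
  qed (use v sp a in auto)
  have c: "?c k = (\<Sum>b<a. fb ((k + a - b) mod a) * fq b)" for k
  proof (rule sum.cong)
    fix b assume "b \<in> {..<a}"
    then have "Suc (a - 1 + k - b) = k + a - b" by auto
    then show "?f (a - 1 + k - b) * fq b = fb ((k + a - b) mod a) * fq b" by (simp only:)
  qed simp
  have "WP CYC_MP (real a * Fm + real a) (\<lambda>(g', v', z').
       arr g' W a (\<lambda>k. w k - (\<Sum>b<a. fb ((k + a - b) mod a) * fq b)) \<and> (\<forall>y<W. g' y = g y) \<and>
       (\<forall>x. x < 40 \<longrightarrow> v' x = v x)) (g, v, z)"
    unfolding CYC_MP_def
  proof (rule WP_sx_then[OF s1], rule WP_sx_then[OF s2], rule WP_sx_then[OF s3], rule WP_sx_then[OF s4],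
      rule WP_sx_then[OF s5], rule WP_sx_then[OF s6], rule WP_then[OF box], clarify)
    fix g1 v1 z1 assume g1: "arr g1 ?ob a ?c" "\<forall>y<?ob. g1 y = g y" and v1: "\<forall>x. x \<noteq> 43 \<longrightarrow> v1 x = ?v x"
    have w1: "arr g1 W a w" by (rule arr_cong[OF w]) (use g1(2) in auto)
    show "WP (For 47 (V 13) (Arith Sub (Output, V 14 [+] V 47) (Output, V 14 [+] V 47) (Output, V 41 [+] V 47)))
       (real a) (\<lambda>(g', v', z').
       arr g' W a (\<lambda>k. w k - (\<Sum>b<a. fb ((k + a - b) mod a) * fq b)) \<and> (\<forall>y<W. g' y = g y) \<and>
       (\<forall>x. x < 40 \<longrightarrow> v' x = v x)) (g1, v1, z1)"
    proof (rule WP_sub_loop[where l = a and W = W and a = a and w = w and p = "\<lambda>i. ?ob + i" and f = ?c])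
      fix g' :: "nat \<Rightarrow> 'a cell" and v'
      assume "arr g' W a (\<lambda>k. if k < a then w k - ?c k else w k)" "\<forall>y. y < W \<or> W + a \<le> y \<longrightarrow> g' y = g1 y"
        "\<forall>x. x \<noteq> 47 \<longrightarrow> v' x = v1 x"
      then show "case (g', v', z1) of (g', v', z') \<Rightarrow>
        arr g' W a (\<lambda>k. w k - (\<Sum>b<a. fb ((k + a - b) mod a) * fq b)) \<and> (\<forall>y<W. g' y = g y) \<and>
       (\<forall>x. x < 40 \<longrightarrow> v' x = v x)"
        unfolding prod.case c using g1(2) v1 by (simp add: arr_def)
    qed (use v v1 LL w1 arrD[OF g1(1)] in auto)
  qed
  then show "WP CYC_MP (real a * Fm + 2 * real a) (\<lambda>(g', v', z').
       arr g' W a (\<lambda>k. w k - (\<Sum>b<a. fb ((k + a - b) mod a) * fq b)) \<and> (\<forall>y<W. g' y = g y) \<and>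
       (\<forall>x. x < 40 \<longrightarrow> v' x = v x)) (g, v, z)"
    by (rule WP_weaken) auto
qed

text \<open>The low part of the full product is a short product. The part that wraps around is the
  low part of the product of the reversed factors, read backwards, hence a second short
  product.\<close>

lemma cyc_spec_SP: "cyc_spec CYC_SP (2 * Fs)"
  unfolding cyc_spec_def
proof (intro allI impI)
  fix g :: "nat \<Rightarrow> 'a cell" and v :: "nat \<Rightarrow> nat" and z :: "nat \<Rightarrow> 'a cell" and a W :: nat and w fb fq :: "nat \<Rightarrow> 'a"
  assume v: "v 13 = a" "v 14 = W" and a: "2 \<le> a" "a \<le> m" "3 * a \<le> length inp"
    and sp: "W + 6 * a + ws a \<le> LEN" and w: "arr g W a w"
    and fb: "arr g (W + 2 * a) (2 * a) (\<lambda>i. fb (i mod a))" and fq: "arr g (W + 4 * a) a fq"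
  let ?ob = "W + 5 * a"
  let ?v = "v(40 := a, 41 := ?ob, 45 := W + 2 * a, 46 := W + 4 * a)"
  let ?c = "\<lambda>k. \<Sum>b\<le>k. fb (k - b) * fq b"
  let ?c2 = "\<lambda>k. \<Sum>b\<le>k. fb (a - 1 - (k - b)) * fq (a - 1 - b)"
  let ?Q = "\<lambda>(g', v', z' :: nat \<Rightarrow> 'a cell).
       arr g' W a (\<lambda>k. w k - (\<Sum>b<a. fb ((k + a - b) mod a) * fq b)) \<and> (\<forall>y<W. g' y = g y) \<and>
       (\<forall>x. x < 40 \<longrightarrow> v' x = v x)"
  have LL: "W + 6 * a \<le> LEN" using sp by simp
  have fb': "arr g (W + 2 * a) a fb"
    by (rule arr_cong[of g _ _ "\<lambda>i. fb (i mod a)"]) (use fb in \<open>auto simp: arr_def\<close>)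
  have s1: "sx (40 :== V 13) (g, v, z) = Some (0, (g, v(40 := a), z))" using v LL by simp
  have s2: "sx (41 :== V 14 [+] Num 5 [*] V 13) (g, v(40 := a), z) = Some (0, (g, v(40 := a, 41 := ?ob), z))"
    using v LL by simp
  have s3: "sx (45 :== V 14 [+] Num 2 [*] V 13) (g, v(40 := a, 41 := ?ob), z) =
     Some (0, (g, v(40 := a, 41 := ?ob, 45 := W + 2 * a), z))"
    using v LL by simp
  have s4: "sx (46 :== V 14 [+] Num 4 [*] V 13) (g, v(40 := a, 41 := ?ob, 45 := W + 2 * a), z) =
     Some (0, (g, ?v, z))"
    using v LL by simp
  have box1: "WP SPB (real a * Fs) (\<lambda>(g', v', z'). arr g' ?ob a ?c \<and> (\<forall>y<?ob. g' y = g y) \<and>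
      (\<forall>x. x \<notin> {42, 43, 44} \<longrightarrow> v' x = ?v x)) (g, ?v, z)"
    by (rule WP_SPB) (use a sp fb' fq in auto)
  have cyc: "(\<Sum>b<a. fb ((k + a - b) mod a) * fq b) = ?c k + (if k < a - 1 then ?c2 (a - 2 - k) else 0)" if k: "k < a" for k
  proof -
    have "(\<Sum>b<a. fb ((k + a - b) mod a) * fq b) =
      (\<Sum>b<Suc k. fb ((k + a - b) mod a) * fq b) + (\<Sum>b<a - 1 - k. fb ((k + a - (Suc k + b)) mod a) * fq (Suc k + b))"
      using k sum_lessThan_add[of "\<lambda>b. fb ((k + a - b) mod a) * fq b" "Suc k" "a - 1 - k"] by simp
    also have "(\<Sum>b<Suc k. fb ((k + a - b) mod a) * fq b) = ?c k"
    proof (rule sum.cong)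
      fix b assume "b \<in> {..k}"
      then have "k + a - b = (k - b) + a" "k - b < a" using k by auto
      then have "(k + a - b) mod a = k - b" by (metis mod_add_self2 mod_less)
      then show "fb ((k + a - b) mod a) * fq b = fb (k - b) * fq b" by simp
    qed (auto simp: lessThan_Suc_atMost)
    also have "(\<Sum>b<a - 1 - k. fb ((k + a - (Suc k + b)) mod a) * fq (Suc k + b)) =
      (\<Sum>b<a - 1 - k. fb (a - 1 - b) * fq (Suc k + b))"
      by (rule sum.cong) (use k in auto)
    also have "\<dots> = (\<Sum>b<a - 1 - k. fb (a - 1 - (a - 1 - k - Suc b)) * fq (Suc k + (a - 1 - k - Suc b)))"
      by (rule sum.nat_diff_reindex[symmetric])
    \<comment> \<open>Reversed, the wrapped terms form coefficient \<open>a - 2 - k\<close> of the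
      product of the reversed factors; at \<open>k = a - 1\<close> nothing wraps around.\<close>
    also have "\<dots> = (if k < a - 1 then ?c2 (a - 2 - k) else 0)"
    proof (cases "k < a - 1")
      case True
      have "(\<Sum>b<a - 1 - k. fb (a - 1 - (a - 1 - k - Suc b)) * fq (Suc k + (a - 1 - k - Suc b))) = ?c2 (a - 2 - k)"
      proof (rule sum.cong)
        show "{..<a - 1 - k} = {..a - 2 - k}" using True by auto
        fix b assume "b \<in> {..a - 2 - k}"
        then have "a - 1 - k - Suc b = a - 2 - k - b" "Suc k + (a - 1 - k - Suc b) = a - 1 - b" using True by auto
        then show "fb (a - 1 - (a - 1 - k - Suc b)) * fq (Suc k + (a - 1 - k - Suc b)) =
          fb (a - 1 - (a - 2 - k - b)) * fq (a - 1 - b)" by (simp only:)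
      qed
      then show ?thesis using True by simp
    qed simp
    finally show ?thesis .
  qed
  have step2: "WP (For 47 (V 13) (Move (Output, V 14 [+] Num 3 [*] V 13 [+] V 47)
        (Output, V 14 [+] Num 2 [*] V 13 [+] (V 13 [-] Num 1 [-] V 47))) ;;
     For 47 (V 13) (Move (Output, V 14 [+] V 13 [+] V 47)
        (Output, V 14 [+] Num 4 [*] V 13 [+] (V 13 [-] Num 1 [-] V 47))) ;;
     45 :== V 14 [+] Num 3 [*] V 13 ;; 46 :== V 14 [+] V 13 ;; SPB ;;
     For 47 (V 13 [-] Num 1) (Arith Sub (Output, V 14 [+] V 47) (Output, V 14 [+] V 47)
        (Output, V 41 [+] (V 13 [-] Num 2 [-] V 47)))) (0 + (0 + (real a * Fs + real (a - 1)))) ?Q (g2, v2, z2)"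
    if w2: "arr g2 W a (\<lambda>k. w k - ?c k)" and b2: "arr g2 (W + 2 * a) a fb" and q2: "arr g2 (W + 4 * a) a fq"
      and g2: "\<forall>y<W. g2 y = g y" and v2: "v2 13 = a" "v2 14 = W" "v2 40 = a" "v2 41 = ?ob"
      "\<forall>x<40. v2 x = v x" for g2 v2 z2
  proof -
    \<comment> \<open>The second period of the divisor and the auxiliary array at
      \<open>W + a\<close> are free by now and receive the reversed factors.\<close>
    let ?g3 = "\<lambda>y. if W + 3 * a \<le> y \<and> y < W + 3 * a + a then Elt (fb (a - 1 - (y - (W + 3 * a)))) else g2 y"
    let ?g4 = "\<lambda>y. if W + a \<le> y \<and> y < W + a + a then Elt (fq (a - 1 - (y - (W + a)))) else ?g3 y"
    let ?v5 = "v2(47 := a, 45 := W + 3 * a)" let ?v6 = "v2(47 := a, 45 := W + 3 * a, 46 := W + a)"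
    have l1: "WP (For 47 (V 13) (Move (Output, V 14 [+] Num 3 [*] V 13 [+] V 47)
        (Output, V 14 [+] Num 2 [*] V 13 [+] (V 13 [-] Num 1 [-] V 47)))) 0 (\<lambda>s. s = (?g3, v2(47 := a), z2)) (g2, v2, z2)"
    proof (rule WP_for_sx[where n = a and k = 0 and Z = "\<lambda>_. z2" and G = "\<lambda>i y.
        if W + 3 * a \<le> y \<and> y < W + 3 * a + i then Elt (fb (a - 1 - (y - (W + 3 * a)))) else g2 y"])
      fix i assume i: "i < a"
      have "g2 (W + 2 * a + (a - Suc i)) = Elt (fb (a - Suc i))" using arrD[OF b2, of "a - Suc i"] i by simp
      then show "sx (Move (Output, V 14 [+] Num 3 [*] V 13 [+] V 47)
        (Output, V 14 [+] Num 2 [*] V 13 [+] (V 13 [-] Num 1 [-] V 47)))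
        (\<lambda>y. if W + 3 * a \<le> y \<and> y < W + 3 * a + i then Elt (fb (a - 1 - (y - (W + 3 * a)))) else g2 y, v2(47 := i), z2) =
        Some (0, \<lambda>y. if W + 3 * a \<le> y \<and> y < W + 3 * a + Suc i then Elt (fb (a - 1 - (y - (W + 3 * a)))) else g2 y, v2(47 := i), z2)"
        using v2 LL i by (auto simp: fun_eq_iff)
    qed (use v2 LL in auto)
    have l2: "WP (For 47 (V 13) (Move (Output, V 14 [+] V 13 [+] V 47)
        (Output, V 14 [+] Num 4 [*] V 13 [+] (V 13 [-] Num 1 [-] V 47)))) 0 (\<lambda>s. s = (?g4, v2(47 := a), z2)) (?g3, v2(47 := a), z2)"
    proof (rule WP_for_sx[where n = a and k = 0 and Z = "\<lambda>_. z2" and G = "\<lambda>i y.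
        if W + a \<le> y \<and> y < W + a + i then Elt (fq (a - 1 - (y - (W + a)))) else ?g3 y"])
      fix i assume i: "i < a"
      have "g2 (W + 4 * a + (a - Suc i)) = Elt (fq (a - Suc i))" using arrD[OF q2, of "a - Suc i"] i by simp
      then show "sx (Move (Output, V 14 [+] V 13 [+] V 47)
        (Output, V 14 [+] Num 4 [*] V 13 [+] (V 13 [-] Num 1 [-] V 47)))
        (\<lambda>y. if W + a \<le> y \<and> y < W + a + i then Elt (fq (a - 1 - (y - (W + a)))) else ?g3 y, v2(47 := a, 47 := i), z2) =
        Some (0, \<lambda>y. if W + a \<le> y \<and> y < W + a + Suc i then Elt (fq (a - 1 - (y - (W + a)))) else ?g3 y, v2(47 := a, 47 := i), z2)"
        using v2 LL i by (auto simp: fun_eq_iff)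
    qed (use v2 LL in auto)
    have s5: "sx (45 :== V 14 [+] Num 3 [*] V 13) (?g4, v2(47 := a), z2) = Some (0, (?g4, ?v5, z2))"
      using v2 LL by simp
    have s6: "sx (46 :== V 14 [+] V 13) (?g4, ?v5, z2) = Some (0, (?g4, ?v6, z2))"
      using v2 LL by simp
    have box2: "WP SPB (real a * Fs) (\<lambda>(g', v', z').
      arr g' ?ob a (\<lambda>k. \<Sum>b\<le>k. (\<lambda>i. fb (a - 1 - i)) (k - b) * (\<lambda>i. fq (a - 1 - i)) b) \<and> (\<forall>y<?ob. g' y = ?g4 y) \<and>
      (\<forall>x. x \<notin> {42, 43, 44} \<longrightarrow> v' x = ?v6 x)) (?g4, ?v6, z2)"
    proof (rule WP_SPB)
      show "arr ?g4 (W + 3 * a) a (\<lambda>i. fb (a - 1 - i))" "arr ?g4 (W + a) a (\<lambda>i. fq (a - 1 - i))"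
        by (auto simp: arr_def)
    qed (use a sp v2 in auto)
    show ?thesis
    proof (rule WP_then[OF l1], simp only:, rule WP_then[OF l2], simp only:, rule WP_sx_then[OF s5], rule WP_sx_then[OF s6],
        rule WP_then[OF box2], clarify)
      fix g5 v5 z5 assume g5: "arr g5 ?ob a ?c2" "\<forall>y<?ob. g5 y = ?g4 y" and v5: "\<forall>x. x \<notin> {42, 43, 44} \<longrightarrow> v5 x = ?v6 x"
      have w5: "arr g5 W a (\<lambda>k. w k - ?c k)" by (rule arr_cong[OF w2]) (use g5(2) in auto)
      show "WP (For 47 (V 13 [-] Num 1) (Arith Sub (Output, V 14 [+] V 47) (Output, V 14 [+] V 47)
        (Output, V 41 [+] (V 13 [-] Num 2 [-] V 47)))) (real (a - 1)) ?Q (g5, v5, z5)"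
      proof (rule WP_sub_loop[where l = "a - 1" and W = W and a = a and w = "\<lambda>k. w k - ?c k" and
            p = "\<lambda>i. ?ob + (a - 2 - i)" and f = "\<lambda>i. ?c2 (a - 2 - i)"])
        fix g' :: "nat \<Rightarrow> 'a cell" and v'
        assume A: "arr g' W a (\<lambda>k. if k < a - 1 then w k - ?c k - ?c2 (a - 2 - k) else w k - ?c k)"
          "\<forall>y. y < W \<or> W + (a - 1) \<le> y \<longrightarrow> g' y = g5 y" "\<forall>x. x \<noteq> 47 \<longrightarrow> v' x = v5 x"
        have "arr g' W a (\<lambda>k. w k - (\<Sum>b<a. fb ((k + a - b) mod a) * fq b))"
          by (rule arr_cong[OF A(1)]) (auto simp: cyc)
        then show "?Q (g', v', z5)"
          using A(2,3) g5(2) g2 v5 v2(5) by simp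
      next
        fix i assume i: "i < a - 1"
        have "W + (a - 1) \<le> ?ob + (a - 2 - i)" "?ob + (a - 2 - i) < LEN"
          using i LL a by linarith+
        moreover have "g5 (?ob + (a - 2 - i)) = Elt (?c2 (a - 2 - i))"
          using i by (intro arrD[OF g5(1)]) linarith
        moreover have "val (v5(47 := i)) (V 41 [+] (V 13 [-] Num 2 [-] V 47)) = ?ob + (a - 2 - i)"
          using v5 v2 by simp
        ultimately show "okx (V 41 [+] (V 13 [-] Num 2 [-] V 47)) \<and>
          val (v5(47 := i)) (V 41 [+] (V 13 [-] Num 2 [-] V 47)) = ?ob + (a - 2 - i) \<and>
          W + (a - 1) \<le> ?ob + (a - 2 - i) \<and> ?ob + (a - 2 - i) < LEN \<and> g5 (?ob + (a - 2 - i)) = Elt (?c2 (a - 2 - i))"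
          by (simp only: okx.simps) simp
      qed (use v5 v2 LL w5 in auto)
    qed
  qed
  have "WP CYC_SP (real a * Fs + (real a + (0 + (0 + (real a * Fs + real (a - 1)))))) ?Q (g, v, z)"
    unfolding CYC_SP_def
  proof (rule WP_sx_then[OF s1], rule WP_sx_then[OF s2], rule WP_sx_then[OF s3], rule WP_sx_then[OF s4],
      rule WP_then[OF box1], clarify)
    fix g1 v1 z1 assume g1: "arr g1 ?ob a ?c" "\<forall>y<?ob. g1 y = g y" and v1: "\<forall>x. x \<notin> {42, 43, 44} \<longrightarrow> v1 x = ?v x"
    have w1: "arr g1 W a w" by (rule arr_cong[OF w]) (use g1(2) in auto)
    show "WP (For 47 (V 13) (Arith Sub (Output, V 14 [+] V 47) (Output, V 14 [+] V 47) (Output, V 41 [+] V 47)) ;;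
     For 47 (V 13) (Move (Output, V 14 [+] Num 3 [*] V 13 [+] V 47)
        (Output, V 14 [+] Num 2 [*] V 13 [+] (V 13 [-] Num 1 [-] V 47))) ;;
     For 47 (V 13) (Move (Output, V 14 [+] V 13 [+] V 47)
        (Output, V 14 [+] Num 4 [*] V 13 [+] (V 13 [-] Num 1 [-] V 47))) ;;
     45 :== V 14 [+] Num 3 [*] V 13 ;; 46 :== V 14 [+] V 13 ;; SPB ;;
     For 47 (V 13 [-] Num 1) (Arith Sub (Output, V 14 [+] V 47) (Output, V 14 [+] V 47)
        (Output, V 41 [+] (V 13 [-] Num 2 [-] V 47)))) (real a + (0 + (0 + (real a * Fs + real (a - 1))))) ?Q (g1, v1, z1)"
    proof (rule WP_seq, rule WP_sub_loop[where l = a and W = W and a = a and w = w and p = "\<lambda>i. ?ob + i" and f = ?c])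
      fix g' :: "nat \<Rightarrow> 'a cell" and v'
      assume A: "arr g' W a (\<lambda>k. if k < a then w k - ?c k else w k)" "\<forall>y. y < W \<or> W + a \<le> y \<longrightarrow> g' y = g1 y"
        "\<forall>x. x \<noteq> 47 \<longrightarrow> v' x = v1 x"
      show "WP (For 47 (V 13) (Move (Output, V 14 [+] Num 3 [*] V 13 [+] V 47)
        (Output, V 14 [+] Num 2 [*] V 13 [+] (V 13 [-] Num 1 [-] V 47))) ;;
     For 47 (V 13) (Move (Output, V 14 [+] V 13 [+] V 47)
        (Output, V 14 [+] Num 4 [*] V 13 [+] (V 13 [-] Num 1 [-] V 47))) ;;
     45 :== V 14 [+] Num 3 [*] V 13 ;; 46 :== V 14 [+] V 13 ;; SPB ;;
     For 47 (V 13 [-] Num 1) (Arith Sub (Output, V 14 [+] V 47) (Output, V 14 [+] V 47)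
        (Output, V 41 [+] (V 13 [-] Num 2 [-] V 47)))) (0 + (0 + (real a * Fs + real (a - 1)))) ?Q (g', v', z1)"
      proof (rule step2)
        show "arr g' W a (\<lambda>k. w k - ?c k)" by (rule arr_cong[OF A(1)]) auto
        show "arr g' (W + 2 * a) a fb" by (rule arr_cong[OF fb']) (use A(2) g1(2) in auto)
        show "arr g' (W + 4 * a) a fq" by (rule arr_cong[OF fq]) (use A(2) g1(2) in auto)
      qed (use A v1 v g1(2) in auto)
    qed (use v v1 LL w1 arrD[OF g1(1)] in auto)
  qed
  then show "WP CYC_SP (real a * (2 * Fs) + 2 * real a) ?Q (g, v, z)"
    by (rule WP_weaken) (auto simp: algebra_simps)
qed

end


section \<open>Division by \<open>SA b\<close> on a residue, and residues of the residual\<close>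

context division
begin

definition DIV1 :: "'a com" where
  "DIV1 = (fold_loop Sub (V 16 [-] Num 1) (V 19) (V 14) (Output, V 17 [+] V 19) ;;
     SetElt (Output, V 14 [+] V 13 [+] (V 13 [-] Num 1)) 0 ;; 18 :== V 13 [-] Num 1 ;;
     For 19 (V 13 [-] Num 1) (20 :== V 18 ;; 18 :== Mod (V 18 [+] V 16) (V 13) ;;
       Arith Sub (Work, Num 50) (Output, V 14 [+] Mod (V 18 [+] (V 13 [-] Num 1)) (V 13)) (Output, V 14 [+] V 18) ;;
       Arith Sub (Output, V 14 [+] V 13 [+] V 18) (Output, V 14 [+] V 13 [+] V 20) (Work, Num 50)) ;;
     For 47 (V 13) (Move (Output, V 14 [+] V 47) (Output, V 14 [+] V 13 [+] V 47)))"

text \<open>One step of the mixed radix scheme: the known digit \<open>s\<close> is folded and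
  subtracted, and the orbit walk divides the rest by \<open>SA b\<close>. The walk writes to a
  second array because it still reads neighbouring entries of the first; starting from zero at
  \<open>a - 1\<close>, it leaves a normalised representative.\<close>

lemma WP_DIV1:
  assumes v: "v 13 = a" "v 14 = W" "v 16 = b" "v 17 = oi" and a: "2 \<le> a" "1 \<le> b" "coprime a b"
    and sp: "W + 2 * a \<le> LEN" "oi + (b - 1) \<le> W" "b \<le> LEN"
    and w: "arr g W a w" and s: "arr g oi (b - 1) s" and y: "cg (SA a) (pol a w) (pol (b - 1) s + SA b * y)"
  shows "WP DIV1 (real b + 2 * real a) (\<lambda>(g', v', z').
      (\<exists>w'. arr g' W a w' \<and> w' (a - 1) = 0 \<and> cg (SA a) (pol a w') y) \<and> (\<forall>y<W. g' y = g y) \<and>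
      (\<forall>x. x \<notin> {18, 19, 20, 47} \<longrightarrow> v' x = v x)) (g, v, z)"
proof -
  let ?Q = "\<lambda>(g', v', z' :: nat \<Rightarrow> 'a cell).
      (\<exists>w'. arr g' W a w' \<and> w' (a - 1) = 0 \<and> cg (SA a) (pol a w') y) \<and> (\<forall>y<W. g' y = g y) \<and>
      (\<forall>x. x \<notin> {18, 19, 20, 47} \<longrightarrow> v' x = v x)"
  let ?Z = "W + a"
  let ?walk = "(20 :== V 18 ;; 18 :== Mod (V 18 [+] V 16) (V 13) ;;
       Arith Sub (Work, Num 50) (Output, V 14 [+] Mod (V 18 [+] (V 13 [-] Num 1)) (V 13)) (Output, V 14 [+] V 18) ;;
       Arith Sub (Output, V 14 [+] V 13 [+] V 18) (Output, V 14 [+] V 13 [+] V 20) (Work, Num 50)) :: 'a com"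
  let ?copy = "For 47 (V 13) (Move (Output, V 14 [+] V 47) (Output, V 14 [+] V 13 [+] V 47)) :: 'a com"
  have fold: "WP (fold_loop Sub (V 16 [-] Num 1) (V 19) (V 14) (Output, V 17 [+] V 19)) (real (b - 1)) (\<lambda>(g', v', z').
      (\<exists>w'. arr g' W a w' \<and> pol a w' = pol a w + (\<Sum>x<b - 1. monom (- 1 * s x) ((x + 0) mod a))) \<and>
      (\<forall>y. y < W \<or> W + a \<le> y \<longrightarrow> g' y = g y) \<and> (\<forall>x. x \<noteq> 18 \<longrightarrow> x \<noteq> 19 \<longrightarrow> v' x = v x)) (g, v, z)"
  proof (rule WP_fold)
    fix g' i k z' assume i: "i < b - 1" and g': "\<forall>y. y < W \<or> W + a \<le> y \<longrightarrow> g' y = g y"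
    then have "g' (oi + i) = Elt (s i)" using arrD[OF s i] sp i by simp
    then show "aload (g', v(18 := k, 19 := i), z') (Output, V 17 [+] V 19) = Some (Elt (s i))"
      using v sp i by simp
  qed (use v a sp w in auto)
  have main: "WP (SetElt (Output, V 14 [+] V 13 [+] (V 13 [-] Num 1)) 0 ;; 18 :== V 13 [-] Num 1 ;;
     For 19 (V 13 [-] Num 1) ?walk ;; ?copy) (2 * real (a - 1) + 0) ?Q (g1, v1, z1)"
    if w1: "arr g1 W a w1" "pol a w1 = pol a w + (\<Sum>x<b - 1. monom (- 1 * s x) ((x + 0) mod a))"
      and g1: "\<forall>y. y < W \<or> W + a \<le> y \<longrightarrow> g1 y = g y" and v1: "\<forall>x. x \<noteq> 18 \<longrightarrow> x \<noteq> 19 \<longrightarrow> v1 x = v x" for g1 v1 z1 w1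
  proof -
    have "cg (SA a) (pol a w1) (pol a w - pol (b - 1) s)"
    proof -
      have "pol a w1 = pol a w - (\<Sum>x<b - 1. monom (s x) (x mod a))"
        by (simp add: w1(2) minus_monom[symmetric] sum_negf)
      also have "cg (SA a) \<dots> (pol a w - pol (b - 1) s)"
        unfolding pol_def[of "b - 1"]
        by (intro cg_diff cg_refl cg_sum cg_XA_SA cg_sym[OF cg_monom_mod])
      finally show ?thesis .
    qed
    also have "cg (SA a) \<dots> (pol (b - 1) s + SA b * y - pol (b - 1) s)"
      by (intro cg_diff y cg_refl)
    finally have cw: "cg (SA a) (pol a w1) (SA b * y)" by simp
    let ?k = "\<lambda>s. (a - 1 + s * b) mod a"
    \<comment> \<open>The values to be stored are fixed beforehand as a function of the position;
      the invariant then only says which positions of the orbit have been filled.\<close>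
    obtain zf where zf0: "zf (a - 1) = 0"
      and zf: "\<And>s. s < a - 1 \<Longrightarrow> zf (?k (Suc s)) = zf (?k s) - (w1 ((?k (Suc s) + (a - 1)) mod a) - w1 (?k (Suc s)))"
      using orbit_fun[OF a(3), of "\<lambda>k. w1 ((k + (a - 1)) mod a) - w1 k"] a(1) by auto
    have cz: "cg (SA a) (pol a zf) y"
      by (rule walk[OF a(3) _ cw zf0 zf]) (use a in auto)
    have kl: "?k s < a" for s using a by simp
    have v1': "v1 13 = a" "v1 14 = W" "v1 16 = b" using v v1 by simp_all
    let ?g2 = "g1(W + a + (a - 1) := Elt 0)"
    have s1: "sx (SetElt (Output, V 14 [+] V 13 [+] (V 13 [-] Num 1)) 0) (g1, v1, z1) = Some (0, (?g2, v1, z1))"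
      using v1' sp a by simp
    have s2: "sx (18 :== V 13 [-] Num 1) (?g2, v1, z1) = Some (0, (?g2, v1(18 := a - 1), z1))"
      using v1' sp a by simp
    let ?I = "\<lambda>i (g', v', z' :: nat \<Rightarrow> 'a cell). v' 19 = i \<and> v' 18 = ?k i \<and> (\<forall>i'\<le>i. g' (?Z + ?k i') = Elt (zf (?k i'))) \<and>
       (\<forall>y<?Z. g' y = g1 y) \<and> (\<forall>x. x \<notin> {18, 19, 20} \<longrightarrow> v' x = v x)"
    have loop: "WP (For 19 (V 13 [-] Num 1) ?walk) (\<Sum>i<a - 1. 2) (?I (a - 1)) (?g2, v1(18 := a - 1), z1)"
    proof (rule WP_for[where I = ?I])
      show "?I 0 (?g2, (v1(18 := a - 1))(19 := 0), z1)"
        unfolding prod.case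
      proof (intro conjI)
        show "\<forall>y<?Z. ?g2 y = g1 y" by simp
        show "\<forall>x. x \<notin> {18, 19, 20} \<longrightarrow> ((v1(18 := a - 1))(19 := 0)) x = v x" using v1 by simp
        show "\<forall>i'\<le>0. ?g2 (?Z + ?k i') = Elt (zf (?k i'))" using a zf0 by simp
      qed (use a in simp_all)
    next
      fix i g2 v2 z2 assume i: "i < a - 1" and I: "?I i (g2, v2, z2)"
      have I': "v2 19 = i" "v2 18 = ?k i" "\<forall>i'\<le>i. g2 (?Z + ?k i') = Elt (zf (?k i'))" "\<forall>y<?Z. g2 y = g1 y"
        "\<forall>x. x \<notin> {18, 19, 20} \<longrightarrow> v2 x = v x"
        using I unfolding prod.case by blast+
      have v2: "v2 13 = a" "v2 14 = W" "v2 16 = b" using I'(5) v by simp_all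
      have kk: "(?k i + b) mod a = ?k (Suc i)"
        using mod_add_left_eq[of "a - 1 + i * b" a b] by (simp add: ac_simps)
      define k0 where "k0 = ?k i"
      define k1 where "k1 = ?k (Suc i)"
      define k2 where "k2 = (k1 + (a - 1)) mod a"
      have kb: "k0 < a" "k1 < a" "k2 < a" using a by (simp_all add: k0_def k1_def k2_def)
      have e0: "g2 (W + a + k0) = Elt (zf k0)" using I'(3) by (simp add: k0_def)
      have e1: "g2 (W + k1) = Elt (w1 k1)" "g2 (W + k2) = Elt (w1 k2)"
        using I'(4) kb arrD[OF w1(1)] by simp_all
      have z: "zf k1 = zf k0 - (w1 k2 - w1 k1)"
        using zf[OF i] by (simp only: k0_def k1_def k2_def)
      have kk': "(k0 + b) mod a = k1" using kk by (simp only: k0_def k1_def)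
      have sx3: "sx ?walk (g2, v2, z2) = Some (2, (g2(W + a + k1 := Elt (zf k1)), v2(20 := k0, 18 := k1), z2(0 := Elt (w1 k2 - w1 k1))))"
        using v2 I'(2)[folded k0_def] kk' k2_def[symmetric] kb sp e0 e1 z a by (simp add: ac_simps)
      show "WP ?walk 2 (\<lambda>(g, v, z). v 19 = i \<and> ?I (Suc i) (g, v(19 := Suc i), z)) (g2, v2, z2)"
      proof (rule WP_sx[OF sx3], simp, unfold prod.case, intro conjI)
        show "\<forall>i'\<le>Suc i. (g2(W + a + k1 := Elt (zf k1))) (?Z + ?k i') = Elt (zf (?k i'))"
        proof (intro allI impI)
          fix i' assume "i' \<le> Suc i"
          then show "(g2(W + a + k1 := Elt (zf k1))) (?Z + ?k i') = Elt (zf (?k i'))"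
            using I'(3) by (cases "i' = Suc i") (simp_all add: k1_def)
        qed
      qed (use I' k1_def in simp_all)
    next
      fix i g2 v2 z2 assume "?I i (g2, v2, z2)"
      then have "v2 19 = i" "\<forall>x. x \<notin> {18, 19, 20} \<longrightarrow> v2 x = v x" unfolding prod.case by blast+
      then show "v2 19 = i \<and> val v2 (V 13 [-] Num 1) = a - 1" using v by simp
    qed (use sp a in auto)
    have fin: "WP ?copy 0 ?Q s'" if I: "?I (a - 1) s'" for s'
    proof -
      obtain g3 v3 z3 where s': "s' = (g3, v3, z3)" by (cases s')
      have I': "\<forall>i'\<le>a - 1. g3 (?Z + ?k i') = Elt (zf (?k i'))" "\<forall>y<?Z. g3 y = g1 y"
        "\<forall>x. x \<notin> {18, 19, 20} \<longrightarrow> v3 x = v x"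
        using I unfolding s' prod.case by blast+
      have z3: "arr g3 ?Z a zf"
      proof (unfold arr_def, intro allI impI)
        fix k assume "k < a"
        then obtain s where "s < a" "k = ?k s" using orbit_surj[OF a(3)] by blast
        then show "g3 (?Z + k) = Elt (zf k)" using I'(1) by (metis Suc_pred' add_diff_cancel_left' less_Suc_eq_le a(1) le_trans zero_less_iff_neq_zero not_less_eq_eq plus_1_eq_Suc le_add_diff_inverse one_le_numeral)
      qed
      show ?thesis
        unfolding s'
      proof (rule WP_copy[where k = a and dst = W and src = ?Z])
        let ?g4 = "\<lambda>y. if W \<le> y \<and> y < W + a then g3 (?Z + (y - W)) else g3 y"
        have "arr ?g4 W a zf" using z3 by (simp add: arr_def)
        moreover have "?g4 y = g y" if "y < W" for y using that I'(2) g1 by simp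
        ultimately show "?Q (?g4, v3(47 := a), z3)"
          using zf0 cz I'(3) unfolding prod.case by (intro conjI exI[of _ zf]) auto
      qed (use I'(3) v sp in auto)
    qed
    have "WP (For 19 (V 13 [-] Num 1) ?walk ;; ?copy) ((\<Sum>i<a - 1. 2) + 0) ?Q (?g2, v1(18 := a - 1), z1)"
      using loop fin by (rule WP_then)
    then have "WP (For 19 (V 13 [-] Num 1) ?walk ;; ?copy) (2 * real (a - 1) + 0) ?Q (?g2, v1(18 := a - 1), z1)"
      by (rule WP_weaken) auto
    then show ?thesis
      by (intro WP_sx_then[OF s1] WP_sx_then[OF s2])
  qed
  have "WP DIV1 (real (b - 1) + (2 * real (a - 1) + 0)) ?Q (g, v, z)"
    unfolding DIV1_def
  proof (rule WP_then[OF fold])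
    fix s' :: "'a state"
    assume A: "case s' of (g', v', z') \<Rightarrow>
      (\<exists>w'. arr g' W a w' \<and> pol a w' = pol a w + (\<Sum>x<b - 1. monom (- 1 * s x) ((x + 0) mod a))) \<and>
      (\<forall>y. y < W \<or> W + a \<le> y \<longrightarrow> g' y = g y) \<and> (\<forall>x. x \<noteq> 18 \<longrightarrow> x \<noteq> 19 \<longrightarrow> v' x = v x)"
    obtain g' v' z' where s': "s' = (g', v', z')" by (cases s')
    from A obtain w' where "arr g' W a w'" "pol a w' = pol a w + (\<Sum>x<b - 1. monom (- 1 * s x) ((x + 0) mod a))"
      "\<forall>y. y < W \<or> W + a \<le> y \<longrightarrow> g' y = g y" "\<forall>x. x \<noteq> 18 \<longrightarrow> x \<noteq> 19 \<longrightarrow> v' x = v x"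
      unfolding s' prod.case by blast
    from main[OF this] show "WP (SetElt (Output, V 14 [+] V 13 [+] (V 13 [-] Num 1)) 0 ;; 18 :== V 13 [-] Num 1 ;;
     For 19 (V 13 [-] Num 1) ?walk ;; ?copy) (2 * real (a - 1) + 0) ?Q s'"
      unfolding s' .
  qed
  then show ?thesis
    by (rule WP_weaken) auto
qed

definition AL :: "'a fps" where "AL = Abs_fps al"

lemma AL_nth [simp]: "AL $ x = al x"
  by (simp add: AL_def)

text \<open>The window of \<open>n - 1\<close> positions behind the known quotient. Beyond it the
  residual still equals the dividend, so this is all that has to be recomputed.\<close>

definition Rp :: "nat \<Rightarrow> 'a poly" where "Rp t = pol (n - 1) (\<lambda>i. res AL t (t + i))"

text \<open>The divisor times \<open>t\<close> quotient coefficients has no terms from position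
  \<open>t + (n - 1)\<close> on. Cutting the dividend there turns the power series relation into one
  between polynomials, which can be reduced modulo \<open>XA a\<close>.\<close>

lemma residue_identity:
  "pol (t + (n - 1)) al - pol n be * pol t (fps_nth (AL * iv)) = monom 1 t * Rp t"
proof (rule poly_eqI)
  fix x
  have B: "fps_of_poly (pol n be) = Bf"
    by (rule fps_ext) (simp add: coeff_pol Bf_def)
  have Q: "fps_of_poly (pol t (fps_nth (AL * iv))) = fps_cutoff t (AL * iv)"
    by (rule fps_ext) (simp add: coeff_pol)
  have BQ: "coeff (pol n be * pol t (fps_nth (AL * iv))) x = (Bf * fps_cutoff t (AL * iv)) $ x"
  proof -
    have "coeff (pol n be * pol t (fps_nth (AL * iv))) x = fps_of_poly (pol n be * pol t (fps_nth (AL * iv))) $ x"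
      by (rule fps_of_poly_nth[symmetric])
    then show ?thesis by (simp only: fps_of_poly_mult B Q)
  qed
  show "coeff (pol (t + (n - 1)) al - pol n be * pol t (fps_nth (AL * iv))) x = coeff (monom 1 t * Rp t) x"
  proof (cases "x < t + (n - 1)")
    case True
    then have "coeff (pol (t + (n - 1)) al - pol n be * pol t (fps_nth (AL * iv))) x = res AL t x"
      by (simp add: BQ coeff_pol res_def)
    also have "\<dots> = coeff (monom 1 t * Rp t) x"
      using True by (auto simp: coeff_monom_mult Rp_def coeff_pol res_less)
    finally show ?thesis .
  next
    case False
    have "(fps_cutoff t (AL * iv) * Bf) $ x = 0"
      unfolding fps_mult_nth using False n by (intro sum.neutral) (auto simp: Bf_def)
    then show ?thesis
      using False by (auto simp: BQ coeff_pol coeff_monom_mult Rp_def mult.commute[of Bf])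
  qed
qed

text \<open>Modulo X^a - 1 the factor X^t in front of the residual is inverted by X^((a - 1) t).
  Folding dividend and quotient with this shift removes it at no cost.\<close>

lemma cg_residue:
  assumes a: "0 < a"
    and wa: "cg (XA a) pa (\<Sum>x<t + (n - 1). monom (al x) ((x + (a - 1) * t) mod a))"
    and wb: "cg (XA a) pb (\<Sum>x<n. monom (be x) (x mod a))"
    and wq: "cg (XA a) pq (\<Sum>x<t. monom ((AL * iv) $ x) ((x + (a - 1) * t) mod a))"
  shows "cg (XA a) (pa - pb * pq) (Rp t)"
proof -
  have sh: "cg (XA a) (\<Sum>x<l. monom (f x) ((x + s) mod a)) (monom 1 s * pol l f)" for l f s
  proof -
    have eq: "monom 1 s * pol l f = (\<Sum>x<l. monom (f x) (x + s))"
      by (simp add: pol_def sum_distrib_left mult_monom add.commute)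
    show ?thesis
      unfolding eq by (rule cg_sum) (rule cg_sym[OF cg_monom_mod])
  qed
  let ?s = "(a - 1) * t" let ?Q = "pol t (fps_nth (AL * iv))"
  have b: "cg (XA a) pb (pol n be)"
    using cg_trans[OF wb, of "monom 1 0 * pol n be"] sh[of be 0 n] by simp
  have "cg (XA a) (pa - pb * pq) (monom 1 ?s * pol (t + (n - 1)) al - pol n be * (monom 1 ?s * ?Q))"
    by (intro cg_diff cg_mult b cg_trans[OF wa sh] cg_trans[OF wq sh])
  also have "monom 1 ?s * pol (t + (n - 1)) al - pol n be * (monom 1 ?s * ?Q) =
      monom 1 ?s * (pol (t + (n - 1)) al - pol n be * ?Q)"
    by (simp add: algebra_simps)
  also have "\<dots> = monom 1 (a * t + 0) * Rp t"
    unfolding residue_identity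
  proof -
    have "(a - 1) * t + t = a * t + 0" using a by (cases a) auto
    then show "monom 1 ?s * (monom 1 t * Rp t) = monom 1 (a * t + 0) * Rp t"
      by (simp only: mult.assoc[symmetric] mult_monom mult_1)
  qed
  also have "cg (XA a) \<dots> (monom 1 0 * Rp t)"
    by (intro cg_mult cg_monom_mult cg_refl)
  finally show ?thesis by simp
qed

end


text \<open>There are \<open>L\<close> moduli of sizes \<open>D * (q + j) + 1\<close>.
  \<open>E\<close> is chosen such that a middle product of size \<open>k\<close>, together with its
  target, result and work area, fits into \<open>E * k\<close> cells. The \<open>space\<close>
  assumptions say that stage \<open>j\<close> fits behind the digits already stored, inside a window
  of \<open>n - 1\<close> cells.\<close>

locale remainder = division ps inp LEN m n mp sp Fm Fs wm ws
  for ps :: "nat list" and inp :: "'a::comm_ring_1 list" and LEN m n :: nat and mp sp :: "'a com"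
    and Fm Fs :: real and wm ws :: "nat \<Rightarrow> nat" +
  fixes CYC :: "'a com" and \<rho> :: real and L D E q :: nat
  assumes cyc: "cyc_spec CYC \<rho>" and rho: "0 \<le> \<rho>"
    and D: "0 < D" "\<And>i j. i < j \<Longrightarrow> j < L \<Longrightarrow> (j - i) dvd D" and q: "0 < q" and LD: "L \<le> LEN"
    and E: "2 \<le> E" "\<And>k. 1 \<le> k \<Longrightarrow> E * k \<le> n - 1 \<Longrightarrow> 2 * k + wm k \<le> E * k"
    and space: "\<And>j. j < L \<Longrightarrow> (\<Sum>i<j. D * (q + i)) + 6 * (D * (q + j) + 1) + wm (D * (q + j) + 1) \<le> n - 1"
      "\<And>j. j < L \<Longrightarrow> (\<Sum>i<j. D * (q + i)) + 6 * (D * (q + j) + 1) + ws (D * (q + j) + 1) \<le> n - 1"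
begin

definition aj :: "nat \<Rightarrow> nat" where "aj j = D * (q + j) + 1"

definition lenj :: "nat \<Rightarrow> nat" where "lenj j = (\<Sum>i<j. aj i - 1)"

lemma aj_ge: "2 \<le> aj j"
  using D(1) q by (simp add: aj_def Suc_le_eq)

lemma aj_space: "j < L \<Longrightarrow> lenj j + 6 * aj j + wm (aj j) \<le> n - 1" "j < L \<Longrightarrow> lenj j + 6 * aj j + ws (aj j) \<le> n - 1"
  using space[of j] by (simp_all add: aj_def lenj_def)

lemma lenj_Suc: "lenj (Suc j) = lenj j + (aj j - 1)"
  by (simp add: lenj_def)

text \<open>A common divisor of two sizes divides their difference \<open>D * (j - i)\<close>. Each
  size is 1 modulo \<open>D\<close>, hence coprime to \<open>D\<close> and also to
  \<open>j - i\<close>, which divides \<open>D\<close>.\<close>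

lemma aj_coprime: "i < j \<Longrightarrow> j < L \<Longrightarrow> coprime (aj j) (aj i)"
proof -
  assume ij: "i < j" "j < L"
  have 1: "coprime (aj i) D"
  proof (rule coprimeI)
    fix c assume "c dvd aj i" "c dvd D"
    then show "c dvd 1" unfolding aj_def using dvd_add_right_iff[of c "D * (q + i)" 1] by auto
  qed
  moreover have "coprime (aj i) (j - i)"
    using 1 D(2)[OF ij] by (meson coprime_divisors dvd_refl)
  ultimately have 2: "coprime (aj i) (D * (j - i))" by simp
  have "aj j = D * (j - i) + aj i"
    using ij by (simp add: aj_def distrib_left[symmetric])
  then have "gcd (aj j) (aj i) = gcd (D * (j - i)) (aj i)" by simp
  then show "coprime (aj j) (aj i)" using 2 by (simp add: coprime_iff_gcd_eq_1 gcd.commute)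
qed

text \<open>The successive quotients of the mixed radix expansion of the residual in the bases
  \<open>SA (aj 0)\<close>, \<open>SA (aj 1)\<close>, and so on; \<open>DS\<close> gives the digits.
  They are abstract objects chosen from monic division: the program only ever sees residues of
  them.\<close>

primrec U :: "nat \<Rightarrow> nat \<Rightarrow> 'a poly" where
  "U t 0 = Rp t"
| "U t (Suc i) = (SOME u. \<exists>s. U t i = s + SA (aj i) * u \<and> psize (aj i - 1) s)"

declare U.simps(2) [simp del]

definition DS :: "nat \<Rightarrow> nat \<Rightarrow> 'a poly" where "DS t i = U t i - SA (aj i) * U t (Suc i)"

lemma U_DS: "U t i = DS t i + SA (aj i) * U t (Suc i)" "psize (aj i - 1) (DS t i)"
proof -
  have "\<exists>u s. U t i = s + SA (aj i) * u \<and> psize (aj i - 1) s"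
    using monic_division[of "aj i" "U t i"] aj_ge[of i] by fastforce
  then have "\<exists>s. U t i = s + SA (aj i) * U t (Suc i) \<and> psize (aj i - 1) s"
    unfolding U.simps(2) by (rule someI_ex)
  then obtain s where s: "U t i = s + SA (aj i) * U t (Suc i)" "psize (aj i - 1) s" by blast
  then have "DS t i = s" unfolding DS_def by (metis add_diff_cancel_right')
  then show "psize (aj i - 1) (DS t i)" using s by simp
  show "U t i = DS t i + SA (aj i) * U t (Suc i)" by (simp add: DS_def)
qed

definition STAGE :: "'a com" where
  "STAGE = (For 19 (Num 5 [*] V 13) (SetElt (Output, V 14 [+] V 19) 0) ;;
     fold_loop Add (V 10 [+] eN) (V 19 [+] (V 13 [-] Num 1) [*] V 10) (V 14) (Input, (eL [-] Num 1) [-] V 19) ;;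
     fold_loop Add (Param 1) (V 19) (V 14 [+] Num 2 [*] V 13) (Input, (eL [+] eN) [-] V 19) ;;
     fold_loop Add (V 10) (V 19 [+] (V 13 [-] Num 1) [*] V 10) (V 14 [+] Num 4 [*] V 13) (Output, V 19) ;;
     For 19 (V 13) (Move (Output, V 14 [+] Num 3 [*] V 13 [+] V 19) (Output, V 14 [+] Num 2 [*] V 13 [+] V 19)) ;;
     CYC ;;
     Move (Work, Num 53) (Output, V 14 [+] (V 13 [-] Num 1)) ;;
     For 19 (V 13) (Arith Sub (Output, V 14 [+] V 19) (Output, V 14 [+] V 19) (Work, Num 53)) ;;
     17 :== V 10 ;;
     For 15 (V 12) (16 :== Num D [*] (V 11 [+] V 15) [+] Num 1 ;; DIV1 ;; 17 :== V 17 [+] (V 16 [-] Num 1)))"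

text \<open>From the residue of \<open>Rp t\<close> modulo \<open>SA (aj j)\<close> the earlier
  digits are removed one after the other, each by one \<open>DIV1\<close>; what is left is a residue
  of \<open>U t j\<close>, and it determines the digit \<open>DS t j\<close>.\<close>

lemma WP_STAGE:
  assumes v: "v 10 = t" "v 11 = q" "v 12 = j" "v 13 = aj j" "v 14 = t + lenj j"
    and j: "j < L" and t: "t + (n - 1) \<le> LEN"
    and qs: "arr g 0 t (fps_nth (AL * iv))"
    and ds: "\<And>i. i < j \<Longrightarrow> arr g (t + lenj i) (aj i - 1) (coeff (DS t i))"
  shows "WP STAGE (real (aj j) * \<rho> + 2 * real t + 2 * real n + 3 * real (aj j) + 3 * real j * real (aj j))
    (\<lambda>(g', v', z'). arr g' (t + lenj j) (aj j - 1) (coeff (DS t j)) \<and> (\<forall>y<t + lenj j. g' y = g y) \<and>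
      (\<forall>x. x < 15 \<or> 21 \<le> x \<and> x < 40 \<longrightarrow> v' x = v x)) (g, v, z)"
proof -
  define a where "a = aj j"
  define W where "W = t + lenj j"
  let ?q = "fps_nth (AL * iv)"
  let ?X = "\<lambda>v'. \<forall>x. x < 15 \<or> 21 \<le> x \<and> x < 40 \<longrightarrow> v' x = v x"
  let ?fr = "\<lambda>g'. \<forall>y<W. g' y = g y"
  have a: "2 \<le> a" "W + 6 * a + wm a \<le> LEN" "W + 6 * a + ws a \<le> LEN"
    using aj_ge[of j] aj_space[OF j] t by (simp_all add: a_def W_def)
  have aL: "W + 6 * a \<le> LEN" using a(2) by simp
  have tW: "t \<le> W" by (simp add: W_def)
  have an: "6 * a \<le> n - 1" using aj_space(1)[OF j] by (simp add: a_def)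
  have am: "a \<le> m" "3 * a \<le> length inp" using an n inp by auto
  note v' = v[folded a_def W_def]
  let ?Q = "\<lambda>(g', v', z' :: nat \<Rightarrow> 'a cell). arr g' W (a - 1) (coeff (DS t j)) \<and> ?fr g' \<and> ?X v'"
  let ?c9 = "For 15 (V 12) (16 :== Num D [*] (V 11 [+] V 15) [+] Num 1 ;; DIV1 ;; 17 :== V 17 [+] (V 16 [-] Num 1)) :: 'a com"
  let ?c7 = "For 19 (V 13) (Arith Sub (Output, V 14 [+] V 19) (Output, V 14 [+] V 19) (Work, Num 53)) :: 'a com"
  let ?c5 = "For 19 (V 13) (Move (Output, V 14 [+] Num 3 [*] V 13 [+] V 19) (Output, V 14 [+] Num 2 [*] V 13 [+] V 19)) :: 'a com"
  let ?I = "\<lambda>i (g', v', z' :: nat \<Rightarrow> 'a cell). v' 15 = i \<and> v' 17 = t + lenj i \<and>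
      (\<exists>w. arr g' W a w \<and> w (a - 1) = 0 \<and> cg (SA a) (pol a w) (U t i)) \<and> ?fr g' \<and> ?X v'"
  have lenL: "lenj i \<le> lenj j" if "i \<le> j" for i
    using that by (induction j) (auto simp: lenj_Suc le_Suc_eq)
  have ajmono: "aj i \<le> a" if "i < j" for i
    using that by (simp add: a_def aj_def)
  have c9: "WP ?c9 (3 * real j * real a) ?Q (g1, v1, z1)"
    if I0: "?I 0 (g1, v1(15 := 0), z1)" for g1 v1 z1
  proof -
    have "WP ?c9 (\<Sum>i<j. 3 * real a) ?Q (g1, v1, z1)"
    proof (rule WP_for[where I = ?I])
      fix i g2 v2 z2 assume i: "i < j" and I: "?I i (g2, v2, z2)"
      obtain w where w: "arr g2 W a w" "w (a - 1) = 0" "cg (SA a) (pol a w) (U t i)"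
        and I': "v2 15 = i" "v2 17 = t + lenj i" "?fr g2" "?X v2"
        using I unfolding prod.case by blast
      let ?b = "aj i"
      have b: "1 \<le> ?b" "?b \<le> a" using aj_ge[of i] ajmono[OF i] by auto
      have lb: "lenj (Suc i) \<le> lenj j" using i by (intro lenL) simp
      have v2: "v2 10 = t" "v2 11 = q" "v2 13 = a" "v2 14 = W" "v2 12 = j" using I'(4) v' by simp_all
      have s1: "sx (16 :== Num D [*] (V 11 [+] V 15) [+] Num 1) (g2, v2, z2) = Some (0, (g2, v2(16 := ?b), z2))"
      proof -
        have "D * (q + i) + 1 \<le> LEN" using b aL by (simp add: aj_def)
        then show ?thesis using v2 I' by (simp add: aj_def)
      qed
      have dv: "WP DIV1 (real ?b + 2 * real a) (\<lambda>(g', v', z').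
        (\<exists>w'. arr g' W a w' \<and> w' (a - 1) = 0 \<and> cg (SA a) (pol a w') (U t (Suc i))) \<and> (\<forall>y<W. g' y = g2 y) \<and>
        (\<forall>x. x \<notin> {18, 19, 20, 47} \<longrightarrow> v' x = (v2(16 := ?b)) x)) (g2, v2(16 := ?b), z2)"
      proof (rule WP_DIV1)
        show "(v2(16 := ?b)) 17 = t + lenj i" using I' by simp
        show "coprime a ?b" unfolding a_def by (rule aj_coprime[OF i j])
        show "t + lenj i + (?b - 1) \<le> W" using lb by (simp add: W_def lenj_Suc)
        show "arr g2 W a w" by (rule w(1))
        show "arr g2 (t + lenj i) (?b - 1) (coeff (DS t i))"
        proof (rule arr_cong[OF ds[OF i]])
          fix k assume "k < ?b - 1"
          then show "g2 (t + lenj i + k) = g (t + lenj i + k)"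
            using I'(3) lb by (simp add: W_def lenj_Suc)
        qed simp
        show "cg (SA a) (pol a w) (pol (?b - 1) (coeff (DS t i)) + SA ?b * U t (Suc i))"
          by (simp only: pol_coeff[OF U_DS(2)] U_DS(1)[of t i, symmetric] w(3))
      qed (use v2 a b aL in simp_all)
      show "WP (16 :== Num D [*] (V 11 [+] V 15) [+] Num 1 ;; DIV1 ;; 17 :== V 17 [+] (V 16 [-] Num 1))
        (3 * real a) (\<lambda>(g, v, z). v 15 = i \<and> ?I (Suc i) (g, v(15 := Suc i), z)) (g2, v2, z2)"
      proof (rule WP_sx_then[OF s1], rule WP_weaken[where C = "real ?b + 2 * real a + 0"], rule WP_then[OF dv])
        fix s' :: "'a state"
        assume A: "case s' of (g', v', z') \<Rightarrow>
          (\<exists>w'. arr g' W a w' \<and> w' (a - 1) = 0 \<and> cg (SA a) (pol a w') (U t (Suc i))) \<and> (\<forall>y<W. g' y = g2 y) \<and>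
          (\<forall>x. x \<notin> {18, 19, 20, 47} \<longrightarrow> v' x = (v2(16 := ?b)) x)"
        obtain g3 v3 z3 where s': "s' = (g3, v3, z3)" by (cases s')
        have A': "\<exists>w'. arr g3 W a w' \<and> w' (a - 1) = 0 \<and> cg (SA a) (pol a w') (U t (Suc i))" "\<forall>y<W. g3 y = g2 y"
          "\<forall>x. x \<notin> {18, 19, 20, 47} \<longrightarrow> v3 x = (v2(16 := ?b)) x"
          using A unfolding s' prod.case by blast+
        have v3: "v3 17 = t + lenj i" "v3 16 = ?b" "v3 15 = i" using A'(3) I' by simp_all
        have "sx (17 :== V 17 [+] (V 16 [-] Num 1)) (g3, v3, z3) = Some (0, (g3, v3(17 := t + lenj (Suc i)), z3))"
          using v3 lb aL by (simp add: W_def lenj_Suc add.assoc)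
        then show "WP (17 :== V 17 [+] (V 16 [-] Num 1)) 0
          (\<lambda>(g, v, z). v 15 = i \<and> ?I (Suc i) (g, v(15 := Suc i), z)) s'"
          unfolding s'
        proof (rule WP_sx)
          have "(v3(17 := t + lenj (Suc i))) 15 = i" using v3 by simp
          moreover have "?X ((v3(17 := t + lenj (Suc i)))(15 := Suc i))"
            using A'(3) I'(4) by simp
          moreover have "?fr g3" using A'(2) I'(3) by simp
          ultimately show "case (g3, v3(17 := t + lenj (Suc i)), z3) of (g, v, z) \<Rightarrow> v 15 = i \<and> ?I (Suc i) (g, v(15 := Suc i), z)"
            unfolding prod.case using A'(1) by simp
        qed simp
      qed (use b in simp_all)
    next
      fix s' assume "?I j s'"
      moreover obtain g2 v2 z2 where s': "s' = (g2, v2, z2)" by (cases s')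
      ultimately obtain w where w: "arr g2 W a w" "w (a - 1) = 0"
        "cg (SA a) (pol a w) (U t j)" "?fr g2" "?X v2" unfolding s' prod.case by blast
      \<comment> \<open>Modulo \<open>SA (aj j)\<close> only the digit remains. Digit and normalised
        representative both have size \<open>a - 1\<close>, so the congruence is an
        equality.\<close>
      have "cg (SA a) (U t j) (DS t j + 0)"
        unfolding U_DS(1)[of t j] a_def by (intro cg_add cg_SA_0 cg_refl)
      from cg_trans[OF w(3) this] have "cg (SA a) (pol a w) (DS t j)" by simp
      moreover have "psize (a - 1) (pol a w)"
      proof (unfold psize_def, intro allI impI)
        fix i assume "a - 1 \<le> i"
        then show "coeff (pol a w) i = 0"
          using w(2) by (cases "i = a - 1") (auto simp: coeff_pol)
      qed
      ultimately have "pol a w = DS t j"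
        using U_DS(2)[of j t] a by (intro cg_SA_eq[of a]) (simp_all add: a_def)
      then have "w k = coeff (DS t j) k" if "k < a" for k
        using that coeff_pol[of a w k] by simp
      then have "arr g2 W (a - 1) (coeff (DS t j))" using w(1) by (simp add: arr_def)
      then show "?Q s'" unfolding s' prod.case using w by blast
    next
      fix i g2 v2 z2 assume "?I i (g2, v2, z2)"
      then show "v2 15 = i \<and> val v2 (V 12) = j" using v by simp
    qed (use I0 j LD in auto)
    then show ?thesis by (rule WP_weaken) auto
  qed
  have c7: "WP (Move (Work, Num 53) (Output, V 14 [+] (V 13 [-] Num 1)) ;; ?c7 ;; 17 :== V 10 ;; ?c9)
      (real a + 3 * real j * real a) ?Q (g1, v1, z1)"
    if w1: "arr g1 W a w1" "cg (XA a) (pol a w1) (Rp t)" and g1: "?fr g1" and v1: "?X v1" for g1 v1 z1 w1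
  proof -
    have v1': "v1 13 = a" "v1 14 = W" "v1 10 = t" using v1 v' by simp_all
    have ea: "g1 (W + (a - 1)) = Elt (w1 (a - 1))" using arrD[OF w1(1), of "a - 1"] a by simp
    let ?z2 = "z1(3 := Elt (w1 (a - 1)))"
    let ?g3 = "\<lambda>i y. if W \<le> y \<and> y < W + i then Elt (w1 (y - W) - w1 (a - 1)) else g1 y"
    have s1: "sx (Move (Work, Num 53) (Output, V 14 [+] (V 13 [-] Num 1))) (g1, v1, z1) = Some (0, (g1, v1, ?z2))"
      using v1' a(1) aL ea by simp
    have l: "WP ?c7 (real a) (\<lambda>s. s = (?g3 a, v1(19 := a), ?z2)) (g1, v1, ?z2)"
    proof (rule WP_for_sx[where n = a and k = 1 and G = ?g3 and Z = "\<lambda>_. ?z2"])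
      fix i assume i: "i < a"
      have "g1 (W + i) = Elt (w1 i)" by (rule arrD[OF w1(1) i])
      then show "sx (Arith Sub (Output, V 14 [+] V 19) (Output, V 14 [+] V 19) (Work, Num 53)) (?g3 i, v1(19 := i), ?z2) =
        Some (1, ?g3 (Suc i), v1(19 := i), ?z2)"
        using v1' i aL by (auto simp: fun_eq_iff)
    qed (use v1' aL in auto)
    have s2: "sx (17 :== V 10) (?g3 a, v1(19 := a), ?z2) = Some (0, (?g3 a, v1(19 := a, 17 := t), ?z2))"
      using v1' t by simp
    have "WP (?c7 ;; 17 :== V 10 ;; ?c9) (real a + 3 * real j * real a) ?Q (g1, v1, ?z2)"
    proof (rule WP_then[OF l], simp only:, rule WP_sx_then[OF s2], rule c9)
      let ?w = "\<lambda>k. w1 k - w1 (a - 1)"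
      have "arr (?g3 a) W a ?w" by (simp add: arr_def)
      moreover have "cg (SA a) (pol a ?w) (U t 0)"
      proof -
        \<comment> \<open>Subtracting the last coefficient from all of them subtracts a multiple of
          \<open>SA a\<close> and produces the representative whose last coefficient is
          zero.\<close>
        have "pol a ?w = pol a w1 - SA a * [: w1 (a - 1) :]"
          by (rule poly_eqI) (simp add: coeff_pol coeff_SA mult.commute)
        also have "cg (SA a) \<dots> (Rp t - 0)"
          by (intro cg_diff cg_SA_0 cg_XA_SA w1)
        finally show ?thesis by simp
      qed
      ultimately show "?I 0 (?g3 a, (v1(19 := a, 17 := t))(15 := 0), ?z2)"
        unfolding prod.case using v1 g1 by (intro conjI exI[of _ ?w]) (simp_all add: lenj_def)
    qed
    then show ?thesis by (rule WP_sx_then[OF s1])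
  qed
  have c5: "WP (?c5 ;; CYC ;; Move (Work, Num 53) (Output, V 14 [+] (V 13 [-] Num 1)) ;; ?c7 ;; 17 :== V 10 ;; ?c9)
      (0 + ((real a * \<rho> + 2 * real a) + (real a + 3 * real j * real a))) ?Q (g1, v1, z1)"
    if w1: "arr g1 W a w1" "pol a w1 = (\<Sum>x<t + (n - 1). monom (al x) ((x + (a - 1) * t) mod a))"
      and b1: "arr g1 (W + 2 * a) a fb" "pol a fb = (\<Sum>x<n. monom (be x) (x mod a))"
      and q1: "arr g1 (W + 4 * a) a fq" "pol a fq = (\<Sum>x<t. monom (?q x) ((x + (a - 1) * t) mod a))"
      and g1: "?fr g1" and v1: "?X v1" for g1 v1 z1 w1 fb fq
  proof -
    have v1': "v1 13 = a" "v1 14 = W" "v1 10 = t" using v1 v' by simp_all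
    let ?g2 = "\<lambda>y. if W + 3 * a \<le> y \<and> y < W + 3 * a + a then g1 (W + 2 * a + (y - (W + 3 * a))) else g1 y"
    have l: "WP ?c5 0 (\<lambda>s. s = (?g2, v1(19 := a), z1)) (g1, v1, z1)"
      by (rule WP_copy[where k = a and dst = "W + 3 * a" and src = "W + 2 * a"]) (use v1' aL in auto)
    let ?cy = "\<lambda>k. \<Sum>b<a. fb ((k + a - b) mod a) * fq b"
    have C: "WP CYC (real a * \<rho> + 2 * real a) (\<lambda>(g', v', z').
       arr g' W a (\<lambda>k. w1 k - ?cy k) \<and> (\<forall>y<W. g' y = ?g2 y) \<and>
       (\<forall>x. x < 40 \<longrightarrow> v' x = (v1(19 := a)) x)) (?g2, v1(19 := a), z1)"
    proof (rule cyc[unfolded cyc_spec_def, rule_format])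
      show "arr ?g2 W a w1" using w1(1) by (simp add: arr_def)
      show "arr ?g2 (W + 4 * a) a fq" using q1(1) by (simp add: arr_def)
      show "arr ?g2 (W + 2 * a) (2 * a) (\<lambda>i. fb (i mod a))"
      proof (unfold arr_def, intro allI impI)
        fix i assume i: "i < 2 * a"
        show "?g2 (W + 2 * a + i) = Elt (fb (i mod a))"
        proof (cases "i < a")
          case True
          then show ?thesis using b1(1) by (simp add: arr_def)
        next
          case False
          then have "i mod a = i - a" "i - a < a" using i by (simp_all add: mod_if)
          moreover have "?g2 (W + 2 * a + i) = g1 (W + 2 * a + (i - a))" using False i by simp
          ultimately show ?thesis using arrD[OF b1(1), of "i - a"] by simp
        qed
      qed
    qed (use v1' a am in auto)
    show ?thesis
    proof (rule WP_then[OF l], simp only:, rule WP_then[OF C], clarify)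
      fix g3 v3 z3 assume A: "arr g3 W a (\<lambda>k. w1 k - ?cy k)" "\<forall>y<W. g3 y = ?g2 y" "\<forall>x<40. v3 x = (v1(19 := a)) x"
      show "WP (Move (Work, Num 53) (Output, V 14 [+] (V 13 [-] Num 1)) ;; ?c7 ;; 17 :== V 10 ;; ?c9)
         (real a + 3 * real j * real a) ?Q (g3, v3, z3)"
      proof (rule c7[OF A(1)])
        have "cg (XA a) (pol a w1 - pol a ?cy) (pol a w1 - pol a fb * pol a fq)"
          using a by (intro cg_diff cg_refl cg_sym[OF cg_cyclic]) simp
        also have "cg (XA a) \<dots> (Rp t)"
          by (rule cg_residue) (use a w1(2) b1(2) q1(2) in simp_all)
        finally show "cg (XA a) (pol a (\<lambda>k. w1 k - ?cy k)) (Rp t)" by (simp only: pol_diff)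
        show "?fr g3" using A(2) g1 by simp
        show "?X v3" using A(3) v1 by simp
      qed
    qed
  qed
  let ?c0 = "For 19 (Num 5 [*] V 13) (SetElt (Output, V 14 [+] V 19) 0) :: 'a com"
  let ?g0 = "\<lambda>y. if W \<le> y \<and> y < W + 5 * a then Elt 0 else g y"
  have c0: "WP ?c0 0 (\<lambda>s. s = (?g0, v(19 := 5 * a), z)) (g, v, z)"
  proof (rule WP_for_sx[where n = "5 * a" and k = 0 and Z = "\<lambda>_. z" and
      G = "\<lambda>i y. if W \<le> y \<and> y < W + i then Elt 0 else g y"])
    fix i assume "i < 5 * a"
    then show "sx (SetElt (Output, V 14 [+] V 19) 0) (\<lambda>y. if W \<le> y \<and> y < W + i then Elt 0 else g y, v(19 := i), z) =
      Some (0, \<lambda>y. if W \<le> y \<and> y < W + Suc i then Elt 0 else g y, v(19 := i), z)"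
      using v' aL by (auto simp: fun_eq_iff)
  qed (use v' aL in auto)
  let ?v0 = "v(19 := 5 * a)"
  let ?fx = "\<lambda>v1 v2. \<forall>x. x \<noteq> 18 \<longrightarrow> x \<noteq> 19 \<longrightarrow> v2 x = v1 x"
  have pz: "pol a (\<lambda>_. 0) = 0" by (simp add: pol_def)
  have fA: "WP (fold_loop Add (V 10 [+] eN) (V 19 [+] (V 13 [-] Num 1) [*] V 10) (V 14) (Input, (eL [-] Num 1) [-] V 19))
     (real (t + (n - 1))) (\<lambda>(g', v', z'). (\<exists>w'. arr g' W a w' \<and> pol a w' = pol a (\<lambda>_. 0) +
        (\<Sum>x<t + (n - 1). monom (1 * al x) ((x + (a - 1) * t) mod a))) \<and>
      (\<forall>y. y < W \<or> W + a \<le> y \<longrightarrow> g' y = ?g0 y) \<and> ?fx ?v0 v') (?g0, ?v0, z)"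
  proof (rule WP_fold)
    fix g' i k z' assume "i < t + (n - 1)"
    then have i: "i < m + n" using t LEN by simp
    then have "m + n - 1 - i < length inp" using inp by simp
    then show "aload (g', ?v0(18 := k, 19 := i), z') (Input, (eL [-] Num 1) [-] V 19) = Some (Elt (al i))"
      using i by (simp add: al_def)
  qed (use v' a t aL n in \<open>auto simp: arr_def\<close>)
  have fB: "WP (fold_loop Add (Param 1) (V 19) (V 14 [+] Num 2 [*] V 13) (Input, (eL [+] eN) [-] V 19))
     (real n) (\<lambda>(g', v', z'). (\<exists>w'. arr g' (W + 2 * a) a w' \<and> pol a w' = pol a (\<lambda>_. 0) +
        (\<Sum>x<n. monom (1 * be x) ((x + 0) mod a))) \<and>
      (\<forall>y. y < W + 2 * a \<or> W + 2 * a + a \<le> y \<longrightarrow> g' y = g1 y) \<and> ?fx v1 v') (g1, v1, z1)"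
    if z: "arr g1 (W + 2 * a) a (\<lambda>_. 0)" and x: "?fx ?v0 v1" for g1 v1 z1
  proof (rule WP_fold)
    fix g' i k z' assume "i < n"
    then show "aload (g', v1(18 := k, 19 := i), z') (Input, (eL [+] eN) [-] V 19) = Some (Elt (be i))"
      using inp by (simp add: be_def)
  qed (use v' a LEN aL x z in auto)
  have fQ: "WP (fold_loop Add (V 10) (V 19 [+] (V 13 [-] Num 1) [*] V 10) (V 14 [+] Num 4 [*] V 13) (Output, V 19))
     (real t) (\<lambda>(g', v', z'). (\<exists>w'. arr g' (W + 4 * a) a w' \<and> pol a w' = pol a (\<lambda>_. 0) +
        (\<Sum>x<t. monom (1 * ?q x) ((x + (a - 1) * t) mod a))) \<and>
      (\<forall>y. y < W + 4 * a \<or> W + 4 * a + a \<le> y \<longrightarrow> g' y = g1 y) \<and> ?fx v1 v') (g1, v1, z1)"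
    if z: "arr g1 (W + 4 * a) a (\<lambda>_. 0)" and f: "?fr g1" and x: "?fx ?v0 v1" for g1 v1 z1
  proof (rule WP_fold)
    fix g' i k z' assume i: "i < t" and g': "\<forall>y. y < W + 4 * a \<or> W + 4 * a + a \<le> y \<longrightarrow> g' y = g1 y"
    have "g' i = Elt (?q i)" using i g' f tW arrD[OF qs i] by simp
    then show "aload (g', v1(18 := k, 19 := i), z') (Output, V 19) = Some (Elt (?q i))"
      using i t by simp
  qed (use v' a t aL x z in auto)
  have "WP STAGE (0 + (real (t + (n - 1)) + (real n + (real t + (0 + ((real a * \<rho> + 2 * real a) + (real a + 3 * real j * real a)))))))
     ?Q (g, v, z)"
    unfolding STAGE_def
  proof (rule WP_then[OF c0], simp only:, rule WP_then[OF fA], clarify)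
    fix g1 v1 z1 w1 assume w1: "arr g1 W a w1" "pol a w1 = pol a (\<lambda>_. 0) +
        (\<Sum>x<t + (n - 1). monom (1 * al x) ((x + (a - 1) * t) mod a))"
      and g1: "\<forall>y. y < W \<or> W + a \<le> y \<longrightarrow> g1 y = ?g0 y" and v1: "?fx ?v0 v1"
    have z1: "arr g1 (W + 2 * a) a (\<lambda>_. 0)" using g1 by (simp add: arr_def)
    show "WP (fold_loop Add (Param 1) (V 19) (V 14 [+] Num 2 [*] V 13) (Input, (eL [+] eN) [-] V 19) ;;
       fold_loop Add (V 10) (V 19 [+] (V 13 [-] Num 1) [*] V 10) (V 14 [+] Num 4 [*] V 13) (Output, V 19) ;;
       ?c5 ;; CYC ;; Move (Work, Num 53) (Output, V 14 [+] (V 13 [-] Num 1)) ;; ?c7 ;; 17 :== V 10 ;; ?c9)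
       (real n + (real t + (0 + ((real a * \<rho> + 2 * real a) + (real a + 3 * real j * real a))))) ?Q (g1, v1, z1)"
    proof (rule WP_then[OF fB[OF z1 v1]], clarify)
      fix g2 v2 z2 fb assume b2: "arr g2 (W + 2 * a) a fb" "pol a fb = pol a (\<lambda>_. 0) + (\<Sum>x<n. monom (1 * be x) ((x + 0) mod a))"
        and g2: "\<forall>y. y < W + 2 * a \<or> W + 2 * a + a \<le> y \<longrightarrow> g2 y = g1 y" and v2: "?fx v1 v2"
      have z2: "arr g2 (W + 4 * a) a (\<lambda>_. 0)" using g1 g2 by (simp add: arr_def)
      have f2: "?fr g2" using g1 g2 by simp
      have x2: "?fx ?v0 v2" using v1 v2 by simp
      show "WP (fold_loop Add (V 10) (V 19 [+] (V 13 [-] Num 1) [*] V 10) (V 14 [+] Num 4 [*] V 13) (Output, V 19) ;;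
         ?c5 ;; CYC ;; Move (Work, Num 53) (Output, V 14 [+] (V 13 [-] Num 1)) ;; ?c7 ;; 17 :== V 10 ;; ?c9)
         (real t + (0 + ((real a * \<rho> + 2 * real a) + (real a + 3 * real j * real a)))) ?Q (g2, v2, z2)"
      proof (rule WP_then[OF fQ[OF z2 f2 x2]], clarify)
        fix g3 v3 z3 fq assume q3: "arr g3 (W + 4 * a) a fq"
          "pol a fq = pol a (\<lambda>_. 0) + (\<Sum>x<t. monom (1 * ?q x) ((x + (a - 1) * t) mod a))"
          and g3: "\<forall>y. y < W + 4 * a \<or> W + 4 * a + a \<le> y \<longrightarrow> g3 y = g2 y" and v3: "?fx v2 v3"
        show "WP (?c5 ;; CYC ;; Move (Work, Num 53) (Output, V 14 [+] (V 13 [-] Num 1)) ;; ?c7 ;; 17 :== V 10 ;; ?c9)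
         (0 + ((real a * \<rho> + 2 * real a) + (real a + 3 * real j * real a))) ?Q (g3, v3, z3)"
        proof (rule c5)
          show "arr g3 W a w1" by (rule arr_cong[OF w1(1)]) (use g2 g3 in auto)
          show "arr g3 (W + 2 * a) a fb" by (rule arr_cong[OF b2(1)]) (use g3 in auto)
          show "arr g3 (W + 4 * a) a fq" by (rule q3(1))
          show "?fr g3" using f2 g3 by simp
          show "?X v3" using x2 v3 by simp
        qed (use w1(2) b2(2) q3(2) pz in simp_all)
      qed
    qed
  qed
  then show ?thesis
    unfolding a_def W_def by (rule WP_weaken) (use n in auto)
qed

end


section \<open>Loops with a potential, and residual coefficients without a product program\<close>

context machine
begin

text \<open>Amortised rule for loops whose number of rounds is not known beforehand: each round pays
  its cost out of \<open>pot\<close>, while \<open>\<mu>\<close> provides termination.\<close>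

lemma WP_while_pot:
  fixes pot :: "'a state \<Rightarrow> real" and \<mu> :: "'a state \<Rightarrow> nat"
  assumes "I s" and "\<And>g v z. I (g, v, z) \<Longrightarrow> okb b"
    and "\<And>g v z. I (g, v, z) \<Longrightarrow> bval v b \<Longrightarrow>
      \<exists>C. WP c C (\<lambda>s'. I s' \<and> \<mu> s' < \<mu> (g, v, z) \<and> C + pot s' \<le> pot (g, v, z)) (g, v, z)"
    and "\<And>g v z. I (g, v, z) \<Longrightarrow> \<not> bval v b \<Longrightarrow> Q (g, v, z) \<and> 0 \<le> pot (g, v, z)"
  shows "WP (While b c) (pot s) Q s"
  using assms(1)
proof (induction "\<mu> s" arbitrary: s rule: less_induct)
  case less
  obtain g v z where s: "s = (g, v, z)" by (cases s)
  have ok: "beval ps inp (conc (g, v, z)) b = Some (bval v b)"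
    using assms(2) less.prems s by (intro beval_conc) simp
  show ?case
  proof (cases "bval v b")
    case True
    then obtain C where C: "WP c C (\<lambda>s'. I s' \<and> \<mu> s' < \<mu> s \<and> C + pot s' \<le> pot s) s"
      using assms(3) less.prems s by blast
    then obtain t s1 where 1: "exec ps inp c (conc s) t (conc s1)" "real t \<le> C" "I s1" "\<mu> s1 < \<mu> s" "C + pot s1 \<le> pot s"
      unfolding WP_def by blast
    from less.hyps[OF 1(4,3)] obtain u s2
      where 2: "exec ps inp (While b c) (conc s1) u (conc s2)" "real u \<le> pot s1" "Q s2"
      unfolding WP_def by blast
    have "exec ps inp (While b c) (conc s) (t + u) (conc s2)"
      using 1 2 ok True s by (auto intro: exec.WhileTrue)
    moreover have "real (t + u) \<le> pot s" using 1 2 by simp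
    ultimately show ?thesis unfolding WP_def using 2(3) by blast
  next
    case False
    then have "exec ps inp (While b c) (conc s) 0 (conc s)"
      using ok s by (auto intro: exec.WhileFalse)
    moreover have "Q s" "real 0 \<le> pot s" using assms(4) False less.prems s by simp_all
    ultimately show ?thesis unfolding WP_def by blast
  qed
qed

end

context division
begin

text \<open>Schoolbook accumulation with a single scratch cell, for places where no product program
  fits.\<close>

definition NACC :: "iexp \<Rightarrow> 'a com" where
  "NACC e = For 22 e (Arith Mul (Work, Num 50) (Input, (eL [+] eN) [-] (V 23 [+] V 22 [+] Num 1)) (Output, V 24 [-] Num 1 [-] V 22) ;;
     Arith Sub (Output, V 20) (Output, V 20) (Work, Num 50))"

lemma WP_NACC:
  assumes v: "v 20 = x" "v 23 = lo" "v 24 = hi" and e: "okx e" "\<And>i. val (v(22 := i)) e = cnt"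
    and b: "lo + cnt \<le> n - 1" "cnt \<le> hi" "hi \<le> x" "x < LEN"
    and u: "arr g 0 hi u" and d: "g x = Elt d"
    and Q: "\<And>z'. Q (g(x := Elt (d - (\<Sum>e<cnt. be (lo + e + 1) * u (hi - 1 - e)))), v(22 := cnt), z')"
  shows "WP (NACC e) (2 * real cnt) Q (g, v, z)"
  unfolding NACC_def
\<comment> \<open>Cell 50 keeps the latest product, so its contents before the first round need a
  case of their own.\<close>
proof (rule WP_for_sx[where n = cnt and k = 2 and
      Z = "\<lambda>i. if i = 0 then z else z(0 := Elt (be (lo + (i - 1) + 1) * u (hi - 1 - (i - 1))))" and
      G = "\<lambda>i. g(x := Elt (d - (\<Sum>e<i. be (lo + e + 1) * u (hi - 1 - e))))"])
  fix i assume i: "i < cnt"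
  have "g (hi - 1 - i) = Elt (u (hi - 1 - i))" using arrD[OF u, of "hi - 1 - i"] i b by simp
  moreover have "hi - 1 - i \<noteq> x" "hi - 1 - i < LEN" using i b by auto
  moreover have "inp ! (m + n + (n - 1) - (lo + i + 1)) = be (lo + i + 1)" using i b by (simp add: be_def)
  moreover have "m + n + (n - 1) - (lo + i + 1) < length inp" using inp n by simp
  ultimately show "sx (Arith Mul (Work, Num 50) (Input, (eL [+] eN) [-] (V 23 [+] V 22 [+] Num 1)) (Output, V 24 [-] Num 1 [-] V 22) ;;
     Arith Sub (Output, V 20) (Output, V 20) (Work, Num 50))
     (g(x := Elt (d - (\<Sum>e<i. be (lo + e + 1) * u (hi - 1 - e)))), v(22 := i),
       if i = 0 then z else z(0 := Elt (be (lo + (i - 1) + 1) * u (hi - 1 - (i - 1))))) =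
    Some (2, g(x := Elt (d - (\<Sum>e<Suc i. be (lo + e + 1) * u (hi - 1 - e)))), v(22 := i),
       if Suc i = 0 then z else z(0 := Elt (be (lo + (Suc i - 1) + 1) * u (hi - 1 - (Suc i - 1)))))"
    using v b by (auto simp: fun_eq_iff algebra_simps)
next
  show "Q (g(x := Elt (d - (\<Sum>e<cnt. be (lo + e + 1) * u (hi - 1 - e)))), v(22 := cnt),
    if cnt = 0 then z else z(0 := Elt (be (lo + (cnt - 1) + 1) * u (hi - 1 - (cnt - 1)))))"
    by (rule Q)
  show "(g(x := Elt (d - (\<Sum>e<0. be (lo + e + 1) * u (hi - 1 - e))))) y = g y" for y
    using d by simp
qed (use e b in auto)

text \<open>Residual coefficients at the positions \<open>t + (n - 1) - s, ..., t + (n - 1) - 1\<close>, with \<open>s\<close> in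
  register 21.\<close>

definition NRES :: "'a com" where
  "NRES = (24 :== V 10 ;; For 19 (V 21) (20 :== ((V 10 [+] eN) [-] V 21) [+] V 19 ;; 23 :== V 20 [-] V 10 ;;
     Move (Output, V 20) (Input, (eL [-] Num 1) [-] V 20) ;; NACC ((V 10 [+] eN) [-] V 20)))"

lemma sum_tail_eq:
  fixes f :: "nat \<Rightarrow> 'b::comm_monoid_add"
  assumes "c \<le> t"
  shows "(\<Sum>e<c. f (t - 1 - e)) = (\<Sum>j\<in>{t - c..<t}. f j)"
  using assms
proof (induction c)
  case (Suc c)
  have "{t - Suc c..<t} = insert (t - Suc c) {t - c..<t}" using Suc.prems by auto
  then show ?case using Suc by (simp add: add.commute)
qed simp

text \<open>The omitted quotient coefficients lie at distance at least \<open>n\<close> from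
  position \<open>x\<close> and meet zero divisor coefficients.\<close>

lemma res_direct:
  assumes x: "t \<le> Suc x" and c: "c \<le> t" "n \<le> x + 1 + c - t"
  shows "res A t x = A $ x - (\<Sum>j\<in>{t - c..<t}. be (x - j) * (A * iv) $ j)"
proof -
  have "(\<Sum>i<t. be (x - i) * (A * iv) $ i) = (\<Sum>j\<in>{t - c..<t}. be (x - j) * (A * iv) $ j)"
  proof (rule sum.mono_neutral_right)
    show "\<forall>i\<in>{..<t} - {t - c..<t}. be (x - i) * (A * iv) $ i = 0"
      using x c by auto
  qed auto
  then show ?thesis using x by (simp add: res_eq)
qed

lemma WP_NRES:
  assumes v: "v 10 = t" "v 21 = s" and s: "s \<le> n - 1" "s \<le> t" and t: "t + (n - 1) \<le> LEN"
    and q: "arr g 0 t (fps_nth (AL * iv))"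
  shows "WP NRES (2 * real s * real s) (\<lambda>(g', v', z').
      arr g' (t + (n - 1) - s) s (\<lambda>i. res AL t (t + (n - 1) - s + i)) \<and>
      (\<forall>y. y < t + (n - 1) - s \<longrightarrow> g' y = g y) \<and> (\<forall>x. x \<notin> {19, 20, 22, 23, 24} \<longrightarrow> v' x = v x)) (g, v, z)"
proof -
  define B where "B = t + (n - 1) - s"
  have B: "t \<le> B" "B + s = t + (n - 1)" using s by (auto simp: B_def)
  let ?q = "fps_nth (AL * iv)"
  let ?I = "\<lambda>i (g', v', z' :: nat \<Rightarrow> 'a cell). v' 19 = i \<and> v' 24 = t \<and> arr g' B i (\<lambda>i. res AL t (B + i)) \<and>
     (\<forall>y<B. g' y = g y) \<and> (\<forall>x. x \<notin> {19, 20, 22, 23, 24} \<longrightarrow> v' x = v x)"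
  have s0: "sx (24 :== V 10) (g, v, z) = Some (0, (g, v(24 := t), z))" using v t by simp
  have loop: "WP (For 19 (V 21) (20 :== ((V 10 [+] eN) [-] V 21) [+] V 19 ;; 23 :== V 20 [-] V 10 ;;
     Move (Output, V 20) (Input, (eL [-] Num 1) [-] V 20) ;; NACC ((V 10 [+] eN) [-] V 20))) (\<Sum>i<s. 2 * real s)
     (?I s) (g, v(24 := t), z)"
  proof (rule WP_for[where I = ?I])
    show "?I 0 (g, (v(24 := t))(19 := 0), z)" unfolding prod.case by (simp add: arr_def)
  next
    fix i g1 v1 z1 assume i: "i < s" and I: "?I i (g1, v1, z1)"
    have I': "v1 19 = i" "v1 24 = t" "arr g1 B i (\<lambda>i. res AL t (B + i))" "\<forall>y<B. g1 y = g y"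
      "\<forall>x. x \<notin> {19, 20, 22, 23, 24} \<longrightarrow> v1 x = v x" using I unfolding prod.case by blast+
    have v1: "v1 10 = t" "v1 21 = s" using I' v by simp_all
    define x where "x = B + i"
    define c where "c = t + (n - 1) - x"
    have x: "x < LEN" "x < m + n" "t \<le> x" "x + c = t + (n - 1)" "c \<le> s" using i B t LEN by (auto simp: x_def c_def)
    let ?v2 = "v1(20 := x)" let ?v3 = "v1(20 := x, 23 := x - t)"
    let ?g2 = "g1(x := Elt (al x))"
    have s1: "sx (20 :== ((V 10 [+] eN) [-] V 21) [+] V 19) (g1, v1, z1) = Some (0, (g1, ?v2, z1))"
      using v1 I' x by (simp add: x_def B_def)
    have s2: "sx (23 :== V 20 [-] V 10) (g1, ?v2, z1) = Some (0, (g1, ?v3, z1))"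
      using v1 x by simp
    have s3: "sx (Move (Output, V 20) (Input, (eL [-] Num 1) [-] V 20)) (g1, ?v3, z1) = Some (0, (?g2, ?v3, z1))"
      using x inp by (simp add: al_def)
    have N: "WP (NACC ((V 10 [+] eN) [-] V 20)) (2 * real c)
      (\<lambda>(g, v, z). v 19 = i \<and> ?I (Suc i) (g, v(19 := Suc i), z)) (?g2, ?v3, z1)"
    proof (rule WP_NACC[where x = x and lo = "x - t" and hi = t and cnt = c and u = ?q and d = "al x"])
      show "arr ?g2 0 t ?q"
        by (rule arr_cong[OF q]) (use I'(4) x B in auto)
      fix z'
      have r: "al x - (\<Sum>e<c. be (x - t + e + 1) * ?q (t - 1 - e)) = res AL t x"
      proof -
        have "(\<Sum>e<c. be (x - t + e + 1) * ?q (t - 1 - e)) = (\<Sum>e<c. be (x - (t - 1 - e)) * ?q (t - 1 - e))"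
        proof (rule sum.cong)
          fix e assume "e \<in> {..<c}"
          then have "x - t + e + 1 = x - (t - 1 - e)" using x s by auto
          then show "be (x - t + e + 1) * ?q (t - 1 - e) = be (x - (t - 1 - e)) * ?q (t - 1 - e)" by (simp only:)
        qed simp
        also have "\<dots> = (\<Sum>j\<in>{t - c..<t}. be (x - j) * ?q j)"
          by (rule sum_tail_eq) (use x s in simp)
        finally show ?thesis
          using res_direct[of t x c AL] x s n by simp
      qed
      have "arr (?g2(x := Elt (res AL t x))) B (Suc i) (\<lambda>i. res AL t (B + i))"
        using I'(3) by (auto simp: arr_def x_def less_Suc_eq)
      then show "case (?g2(x := Elt (al x - (\<Sum>e<c. be (x - t + e + 1) * ?q (t - 1 - e)))), ?v3(22 := c), z') of
        (g, v, z) \<Rightarrow> v 19 = i \<and> ?I (Suc i) (g, v(19 := Suc i), z)"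
        unfolding prod.case r using I' by (simp add: x_def)
    qed (use v1 I'(2) x s in \<open>auto simp: c_def\<close>)
    show "WP (20 :== ((V 10 [+] eN) [-] V 21) [+] V 19 ;; 23 :== V 20 [-] V 10 ;;
      Move (Output, V 20) (Input, (eL [-] Num 1) [-] V 20) ;; NACC ((V 10 [+] eN) [-] V 20)) (2 * real s)
      (\<lambda>(g, v, z). v 19 = i \<and> ?I (Suc i) (g, v(19 := Suc i), z)) (g1, v1, z1)"
      by (rule WP_sx_then[OF s1], rule WP_sx_then[OF s2], rule WP_sx_then[OF s3], rule WP_weaken[OF N])
        (use x in simp_all)
  next
    fix i g1 v1 z1 assume "?I i (g1, v1, z1)"
    then have "v1 19 = i" "\<forall>x. x \<notin> {19, 20, 22, 23, 24} \<longrightarrow> v1 x = v x" unfolding prod.case by blast+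
    then show "v1 19 = i \<and> val v1 (V 21) = s" using v by simp
  qed (use s t in auto)
  show ?thesis
    unfolding NRES_def
  proof (rule WP_sx_then[OF s0], rule WP_weaken[OF loop])
    fix s' assume I: "?I s s'"
    then show "case s' of (g', v', z') \<Rightarrow>
      arr g' (t + (n - 1) - s) s (\<lambda>i. res AL t (t + (n - 1) - s + i)) \<and>
      (\<forall>y. y < t + (n - 1) - s \<longrightarrow> g' y = g y) \<and> (\<forall>x. x \<notin> {19, 20, 22, 23, 24} \<longrightarrow> v' x = v x)"
      unfolding B_def by (cases s') simp
  qed simp
qed

end

section \<open>The digits, and the top coefficients of the residual\<close>

context remainder
begin

definition DIGITS :: "'a com" where
  "DIGITS = (14 :== V 10 ;; For 12 (Num L) (13 :== Num D [*] (V 11 [+] V 12) [+] Num 1 ;; STAGE ;;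
     14 :== V 14 [+] (V 13 [-] Num 1)))"

lemma lenj_mono: "i \<le> j \<Longrightarrow> lenj i \<le> lenj j"
  by (induction j) (auto simp: lenj_Suc le_Suc_eq)

lemma lenj_L: "lenj L \<le> n - 1"
proof (cases L)
  case 0
  then show ?thesis by (simp add: lenj_def)
next
  case (Suc j)
  then show ?thesis using aj_space(1)[of j] by (simp add: lenj_Suc)
qed

lemma WP_DIGITS:
  assumes v: "v 10 = t" "v 11 = q" and t: "t + (n - 1) \<le> LEN"
    and qs: "arr g 0 t (fps_nth (AL * iv))"
  shows "WP DIGITS (real (n + L) * \<rho> + real L * (2 * real t + (5 + 3 * real L) * real n))
    (\<lambda>(g', v', z'). (\<forall>i<L. arr g' (t + lenj i) (aj i - 1) (coeff (DS t i))) \<and> (\<forall>y<t. g' y = g y) \<and>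
      v' 14 = t + lenj L \<and> (\<forall>x. x < 12 \<or> 21 \<le> x \<and> x < 40 \<longrightarrow> v' x = v x)) (g, v, z)"
proof -
  let ?I = "\<lambda>j (g', v', z' :: nat \<Rightarrow> 'a cell). v' 12 = j \<and> (\<forall>i<j. arr g' (t + lenj i) (aj i - 1) (coeff (DS t i))) \<and>
     (\<forall>y<t. g' y = g y) \<and> v' 14 = t + lenj j \<and> (\<forall>x. x < 12 \<or> 21 \<le> x \<and> x < 40 \<longrightarrow> v' x = v x)"
  let ?C = "\<lambda>j. real (aj j) * \<rho> + 2 * real t + 2 * real n + 3 * real (aj j) + 3 * real j * real (aj j)"
  let ?body = "13 :== Num D [*] (V 11 [+] V 12) [+] Num 1 ;; STAGE ;; 14 :== V 14 [+] (V 13 [-] Num 1)"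
  have loop: "WP (For 12 (Num L) ?body) (\<Sum>j<L. ?C j) (?I L) (g, v(14 := t), z)"
  proof (rule WP_for[where I = ?I])
    show "?I 0 (g, (v(14 := t))(12 := 0), z)" unfolding prod.case by (simp add: lenj_def)
  next
    fix j g1 v1 z1 assume j: "j < L" and I: "?I j (g1, v1, z1)"
    have I': "v1 12 = j" "\<forall>i<j. arr g1 (t + lenj i) (aj i - 1) (coeff (DS t i))" "\<forall>y<t. g1 y = g y"
      "v1 14 = t + lenj j" "\<forall>x. x < 12 \<or> 21 \<le> x \<and> x < 40 \<longrightarrow> v1 x = v x" using I unfolding prod.case by blast+
    have v1: "v1 10 = t" "v1 11 = q" using I' v by simp_all
    have sp: "t + lenj j + 6 * aj j \<le> LEN" using aj_space(1)[OF j] t by simp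
    have s1: "sx (13 :== Num D [*] (V 11 [+] V 12) [+] Num 1) (g1, v1, z1) = Some (0, (g1, v1(13 := aj j), z1))"
    proof -
      have "D * (q + j) + 1 \<le> LEN" using sp by (simp add: aj_def)
      then show ?thesis using v1 I' by (simp add: aj_def)
    qed
    have st: "WP STAGE (?C j) (\<lambda>(g', v', z'). arr g' (t + lenj j) (aj j - 1) (coeff (DS t j)) \<and>
       (\<forall>y<t + lenj j. g' y = g1 y) \<and> (\<forall>x. x < 15 \<or> 21 \<le> x \<and> x < 40 \<longrightarrow> v' x = (v1(13 := aj j)) x)) (g1, v1(13 := aj j), z1)"
    proof (rule WP_STAGE)
      show "arr g1 0 t (fps_nth (AL * iv))" by (rule arr_cong[OF qs]) (use I' in auto)
    qed (use v1 I' j t in auto)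
    show "WP ?body (?C j) (\<lambda>(g, v, z). v 12 = j \<and> ?I (Suc j) (g, v(12 := Suc j), z)) (g1, v1, z1)"
    proof (rule WP_sx_then[OF s1], rule WP_weaken[where C = "?C j + 0"], rule WP_then[OF st], clarify)
      fix g2 v2 z2 assume A: "arr g2 (t + lenj j) (aj j - 1) (coeff (DS t j))" "\<forall>y<t + lenj j. g2 y = g1 y"
        "\<forall>x. x < 15 \<or> 21 \<le> x \<and> x < 40 \<longrightarrow> v2 x = (v1(13 := aj j)) x"
      have v2: "v2 14 = t + lenj j" "v2 13 = aj j" "v2 12 = j" using A(3) I' by simp_all
      have "sx (14 :== V 14 [+] (V 13 [-] Num 1)) (g2, v2, z2) = Some (0, (g2, v2(14 := t + lenj (Suc j)), z2))"
        using v2 sp by (simp add: lenj_Suc add.assoc)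
      then show "WP (14 :== V 14 [+] (V 13 [-] Num 1)) 0 (\<lambda>(g, v, z). v 12 = j \<and> ?I (Suc j) (g, v(12 := Suc j), z)) (g2, v2, z2)"
      proof (rule WP_sx)
        have "arr g2 (t + lenj i) (aj i - 1) (coeff (DS t i))" if "i < Suc j" for i
        proof (cases "i = j")
          case False
          then have i: "i < j" using that by simp
          have "lenj i + (aj i - 1) \<le> lenj j" using lenj_mono[of "Suc i" j] i by (simp add: lenj_Suc)
          then show ?thesis
            by (intro arr_cong[OF I'(2)[rule_format, OF i]]) (use A(2) in simp_all)
        qed (use A in simp)
        moreover have "\<forall>y<t. g2 y = g y" using A(2) I'(3) by simp
        moreover have "\<forall>x. x < 12 \<or> 21 \<le> x \<and> x < 40 \<longrightarrow> v2 x = v x" using A(3) I'(5) by simp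
        ultimately show "case (g2, v2(14 := t + lenj (Suc j)), z2) of (g, v, z) \<Rightarrow> v 12 = j \<and> ?I (Suc j) (g, v(12 := Suc j), z)"
          unfolding prod.case using v2 by simp
      qed simp
    qed simp_all
  next
    fix i g1 v1 z1 assume "?I i (g1, v1, z1)"
    then show "v1 12 = i \<and> val v1 (Num L) = L" by simp
  qed (use LD in auto)
  have s0: "sx (14 :== V 10) (g, v, z) = Some (0, (g, v(14 := t), z))" using v t by simp
  have C: "(\<Sum>j<L. ?C j) \<le> real (n + L) * \<rho> + real L * (2 * real t + (5 + 3 * real L) * real n)"
  proof -
    \<comment> \<open>A digit is one shorter than its modulus, so the sizes of all cyclic products
      add up to the length of the digits plus their number. This is why the whole computation is
      charged like one product of size about \<open>n\<close>.\<close>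
    have "(\<Sum>j<k. aj j) = lenj k + k" for k
    proof (induction k)
      case (Suc k)
      then show ?case using aj_ge[of k] by (simp add: lenj_Suc)
    qed (simp add: lenj_def)
    then have "(\<Sum>j<L. aj j) \<le> n + L" using lenj_L by simp
    then have "real (\<Sum>j<L. aj j) \<le> real (n + L)" by (rule of_nat_mono)
    then have "real (\<Sum>j<L. aj j) * \<rho> \<le> real (n + L) * \<rho>" using rho by (rule mult_right_mono)
    moreover have "(\<Sum>j<L. 2 * real t + 2 * real n + 3 * real (aj j) + 3 * real j * real (aj j)) \<le>
      (\<Sum>j<L. 2 * real t + (5 + 3 * real L) * real n)"
    proof (rule sum_mono)
      fix j assume j: "j \<in> {..<L}"
      then have "real (aj j) \<le> real n" using aj_space(1)[of j] by simp
      moreover have "real j * real (aj j) \<le> real L * real n" using j calculation by (intro mult_mono) auto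
      ultimately show "2 * real t + 2 * real n + 3 * real (aj j) + 3 * real j * real (aj j) \<le> 2 * real t + (5 + 3 * real L) * real n"
        by (simp add: algebra_simps)
    qed
    moreover have "(\<Sum>j<L. ?C j) = real (\<Sum>j<L. aj j) * \<rho> +
      (\<Sum>j<L. 2 * real t + 2 * real n + 3 * real (aj j) + 3 * real j * real (aj j))"
      by (simp add: sum.distrib sum_distrib_left algebra_simps)
    ultimately show ?thesis by simp
  qed
  show ?thesis
    unfolding DIGITS_def
  proof (rule WP_sx_then[OF s0], rule WP_weaken[OF loop _ C])
    fix s' assume "?I L s'"
    then show "case s' of (g', v', z') \<Rightarrow> (\<forall>i<L. arr g' (t + lenj i) (aj i - 1) (coeff (DS t i))) \<and> (\<forall>y<t. g' y = g y) \<and>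
      v' 14 = t + lenj L \<and> (\<forall>x. x < 12 \<or> 21 \<le> x \<and> x < 40 \<longrightarrow> v' x = v x)" by (cases s') simp
  qed
qed

end


context remainder
begin

definition TROW :: "'a com" where
  "TROW = (40 :== V 21 [div] Num E ;; 48 :== (V 10 [+] eN) [-] V 21 ;; 41 :== V 48 [+] V 40 ;;
     For 19 (V 40) (Move (Output, V 48 [+] V 19) (Input, (eL [-] Num 1) [-] (V 48 [+] V 19))) ;;
     For 22 ((V 21 [+] V 40 [-] Num 1) [div] V 40)
       (45 :== (V 48 [-] V 10) [+] V 22 [*] V 40 [+] Num 1 ;; 46 :== V 10 [-] (V 22 [+] Num 1) [*] V 40 ;; ACC) ;;
     21 :== V 21 [-] V 40)"

text \<open>With \<open>s\<close> coefficients missing at the end of the window, the cells reserved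
  for them are free. The next \<open>k = s div E\<close> coefficients, one product result and its
  work area take \<open>2 * k + wm k \<le> E * k \<le> s\<close> cells, so exactly this space
  suffices.\<close>

lemma WP_TROW:
  assumes v: "v 10 = t" "v 21 = s" and s: "E \<le> s" "s \<le> n - 1" "2 * s \<le> t" and t: "t + (n - 1) \<le> LEN"
    and q: "arr g 0 t (fps_nth (AL * iv))"
  shows "WP TROW (2 * real s * (Fm + 1)) (\<lambda>(g', v', z').
      arr g' (t + (n - 1) - s) (s div E) (\<lambda>i. res AL t (t + (n - 1) - s + i)) \<and>
      (\<forall>y<t + (n - 1) - s. g' y = g y) \<and> v' 21 = s - s div E \<and>
      (\<forall>x. x < 40 \<and> x \<notin> {19, 21, 22} \<longrightarrow> v' x = v x)) (g, v, z)"
proof -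
  let ?q = "fps_nth (AL * iv)"
  define k where "k = s div E"
  define X where "X = t + (n - 1) - s"
  define G where "G = (s + k - 1) div k"
  have k: "1 \<le> k" using s E by (simp add: k_def div_greater_zero_iff Suc_le_eq)
  have Ek: "E * k \<le> s" by (simp add: k_def)
  have kw: "2 * k + wm k \<le> s" using E(2)[OF k] Ek s by simp
  have X: "t \<le> X" "X + s = t + (n - 1)" using s by (simp_all add: X_def)
  have G1: "G * k \<le> s + k - 1" unfolding G_def by (rule div_times_less_eq_dividend)
  have G2: "s \<le> G * k"
  proof -
    have "s + k - 1 < k + G * k" unfolding G_def using k by (intro dividend_less_div_times) simp
    then show ?thesis using k by linarith
  qed
  have G3: "G * k \<le> t" "G \<le> LEN"
  proof -
    show "G * k \<le> t" using G1 kw s by simp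
    moreover have "G \<le> G * k" using k by simp
    ultimately show "G \<le> LEN" using t by linarith
  qed
  let ?v3 = "v(40 := k, 48 := X, 41 := X + k)"
  have s1: "sx (40 :== V 21 [div] Num E) (g, v, z) = Some (0, (g, v(40 := k), z))"
    using v s t kw by (simp add: k_def)
  have s2: "sx (48 :== (V 10 [+] eN) [-] V 21) (g, v(40 := k), z) = Some (0, (g, v(40 := k, 48 := X), z))"
    using v X t by (simp add: X_def)
  have s3: "sx (41 :== V 48 [+] V 40) (g, v(40 := k, 48 := X), z) = Some (0, (g, ?v3, z))"
    using X t kw by simp
  let ?g1 = "\<lambda>i y. if X \<le> y \<and> y < X + i then Elt (al y) else g y"
  let ?cp = "For 19 (V 40) (Move (Output, V 48 [+] V 19) (Input, (eL [-] Num 1) [-] (V 48 [+] V 19)))"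
  have c1: "WP ?cp 0 (\<lambda>s. s = (?g1 k, ?v3(19 := k), z)) (g, ?v3, z)"
  proof (rule WP_for_sx[where n = k and k = 0 and G = ?g1 and Z = "\<lambda>_. z"])
    fix i assume i: "i < k"
    then have "X + i < LEN" "X + i < m + n" using X t kw LEN by auto
    then show "sx (Move (Output, V 48 [+] V 19) (Input, (eL [-] Num 1) [-] (V 48 [+] V 19))) (?g1 i, ?v3(19 := i), z) =
      Some (0, ?g1 (Suc i), ?v3(19 := i), z)"
      using inp by (auto simp: fun_eq_iff al_def)
  qed (use kw t s in auto)
  \<comment> \<open>The dividend minus the effect of the last \<open>i * k\<close> quotient
    coefficients; the middle products reach back from \<open>t\<close> block by block.\<close>
  define Dd where "Dd i a = al (X + a) - (\<Sum>j\<in>{t - i * k..<t}. be (X + a - j) * ?q j)" for i a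
  let ?pc = "45 :== (V 48 [-] V 10) [+] V 22 [*] V 40 [+] Num 1 ;; 46 :== V 10 [-] (V 22 [+] Num 1) [*] V 40 ;; ACC"
  let ?I = "\<lambda>i (g', v', z' :: nat \<Rightarrow> 'a cell). v' 22 = i \<and> arr g' X k (Dd i) \<and> (\<forall>y<X. g' y = g y) \<and>
     v' 40 = k \<and> v' 41 = X + k \<and> v' 48 = X \<and> (\<forall>x. x < 40 \<and> x \<notin> {19, 22} \<longrightarrow> v' x = v x)"
  have c2: "WP (For 22 ((V 21 [+] V 40 [-] Num 1) [div] V 40) ?pc) (\<Sum>i<G. real k * Fm + real k) (?I G) (?g1 k, ?v3(19 := k), z)"
  proof (rule WP_for[where I = ?I])
    show "?I 0 (?g1 k, (?v3(19 := k))(22 := 0), z)"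
      unfolding prod.case by (simp add: arr_def Dd_def)
  next
    fix i g2 v2 z2 assume i: "i < G" and I: "?I i (g2, v2, z2)"
    have I': "v2 22 = i" "arr g2 X k (Dd i)" "\<forall>y<X. g2 y = g y" "v2 40 = k" "v2 41 = X + k" "v2 48 = X"
      "\<forall>x. x < 40 \<and> x \<notin> {19, 22} \<longrightarrow> v2 x = v x" using I unfolding prod.case by blast+
    have ik: "(i + 1) * k \<le> G * k" using i by (intro mult_le_mono1) simp
    have ik': "i * k + k \<le> t" using ik G3 by simp
    define p where "p = t - (i * k + k)"
    define fo where "fo = X - t + i * k + 1"
    have v2: "v2 10 = t" using I'(7) v by simp
    let ?w1 = "v2(45 := fo)" let ?w2 = "v2(45 := fo, 46 := p)"
    have fo: "fo \<le> LEN + LEN" using X t ik' k by (simp add: fo_def)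
    have fo': "fo \<le> length inp + LEN + 54" using fo LEN inp by simp
    have s4: "sx (45 :== (V 48 [-] V 10) [+] V 22 [*] V 40 [+] Num 1) (g2, v2, z2) = Some (0, (g2, ?w1, z2))"
      using v2 I' fo' by (simp add: fo_def)
    have s5: "sx (46 :== V 10 [-] (V 22 [+] Num 1) [*] V 40) (g2, ?w1, z2) = Some (0, (g2, ?w2, z2))"
      using v2 I' t by (simp add: p_def add.commute)
    have "WP ACC (real k * Fm + real k) (\<lambda>(g', v', z').
      arr g' X k (\<lambda>a. Dd i a - (\<Sum>b<k. be (fo + (k - 1) + a - b) * ?q (p + b))) \<and>
      (\<forall>y. y < X + k \<and> (y < X \<or> X + k \<le> y) \<longrightarrow> g' y = g2 y) \<and>
      (\<forall>x. x \<notin> {42, 43, 44, 47} \<longrightarrow> v' x = ?w2 x)) (g2, ?w2, z2)"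
    proof (rule WP_ACC)
      show "arr g2 p k (\<lambda>b. ?q (p + b))"
      proof (unfold arr_def, intro allI impI)
        fix b assume "b < k"
        then have "p + b < t" using ik' by (simp add: p_def)
        then show "g2 (p + b) = Elt (?q (p + b))" using I'(3) X arrD[OF q, of "p + b"] by simp
      qed
      show "k \<le> m" "3 * k \<le> length inp + 1" using kw s n inp by auto
      show "X + k + k + wm k \<le> LEN" using kw X t by linarith
    qed (use I' k ik' X in \<open>auto simp: p_def\<close>)
    moreover have "Dd i a - (\<Sum>b<k. be (fo + (k - 1) + a - b) * ?q (p + b)) = Dd (Suc i) a" for a
    proof -
      have "(\<Sum>b<k. be (fo + (k - 1) + a - b) * ?q (p + b)) = (\<Sum>b<k. be (X + a - (p + b)) * ?q (p + b))"
      proof (rule sum.cong)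
        fix b assume "b \<in> {..<k}"
        then have "fo + (k - 1) + a - b = X + a - (p + b)" using ik' X by (auto simp: fo_def p_def)
        then show "be (fo + (k - 1) + a - b) * ?q (p + b) = be (X + a - (p + b)) * ?q (p + b)" by (simp only:)
      qed simp
      also have "\<dots> = (\<Sum>j\<in>{p..<p + k}. be (X + a - j) * ?q j)"
        using sum.shift_bounds_nat_ivl[of "\<lambda>j. be (X + a - j) * ?q j" 0 p k] by (simp add: atLeast0LessThan add.commute)
      finally have e: "(\<Sum>b<k. be (fo + (k - 1) + a - b) * ?q (p + b)) = (\<Sum>j\<in>{p..<p + k}. be (X + a - j) * ?q j)" .
      have "(\<Sum>j\<in>{p..<p + k}. be (X + a - j) * ?q j) + (\<Sum>j\<in>{p + k..<t}. be (X + a - j) * ?q j) =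
        (\<Sum>j\<in>{p..<t}. be (X + a - j) * ?q j)"
        using ik' by (intro sum.atLeastLessThan_concat) (auto simp: p_def)
      moreover have "p + k = t - i * k" "p = t - Suc i * k" using ik' by (auto simp: p_def)
      ultimately show ?thesis unfolding Dd_def e by (simp add: algebra_simps)
    qed
    ultimately have ac: "WP ACC (real k * Fm + real k) (\<lambda>(g', v', z').
      arr g' X k (Dd (Suc i)) \<and> (\<forall>y. y < X + k \<and> (y < X \<or> X + k \<le> y) \<longrightarrow> g' y = g2 y) \<and>
      (\<forall>x. x \<notin> {42, 43, 44, 47} \<longrightarrow> v' x = ?w2 x)) (g2, ?w2, z2)" by (simp only:)
    show "WP ?pc (real k * Fm + real k) (\<lambda>(g, v, z). v 22 = i \<and> ?I (Suc i) (g, v(22 := Suc i), z)) (g2, v2, z2)"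
    proof (rule WP_sx_then[OF s4], rule WP_sx_then[OF s5], rule WP_weaken[OF ac])
      fix s' :: "'a state" assume A: "case s' of (g', v', z') \<Rightarrow>
        arr g' X k (Dd (Suc i)) \<and> (\<forall>y. y < X + k \<and> (y < X \<or> X + k \<le> y) \<longrightarrow> g' y = g2 y) \<and>
        (\<forall>x. x \<notin> {42, 43, 44, 47} \<longrightarrow> v' x = ?w2 x)"
      obtain g3 v3 z3 where s': "s' = (g3, v3, z3)" by (cases s')
      have A': "arr g3 X k (Dd (Suc i))" "\<forall>y. y < X + k \<and> (y < X \<or> X + k \<le> y) \<longrightarrow> g3 y = g2 y"
        "\<forall>x. x \<notin> {42, 43, 44, 47} \<longrightarrow> v3 x = ?w2 x" using A unfolding s' prod.case by blast+
      show "case s' of (g, v, z) \<Rightarrow> v 22 = i \<and> ?I (Suc i) (g, v(22 := Suc i), z)"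
        unfolding s' prod.case using A' I' by simp
    qed simp
  next
    fix i g2 v2 z2 assume "?I i (g2, v2, z2)"
    then have "v2 22 = i" "v2 40 = k" "v2 21 = s" using v unfolding prod.case by simp_all
    then show "v2 22 = i \<and> val v2 ((V 21 [+] V 40 [-] Num 1) [div] V 40) = G" by (simp add: G_def)
  qed (use G3 in auto)
  \<comment> \<open>\<open>G * k \<ge> s\<close> is far enough back: a position at or above
    \<open>t + (n - 1) - s\<close> feels only the last \<open>s\<close> quotient
    coefficients.\<close>
  have r: "Dd G a = res AL t (X + a)" for a
    unfolding Dd_def using res_direct[of t "X + a" "G * k" AL] G2 G3 X n by simp
  have fin: "WP (21 :== V 21 [-] V 40) 0 (\<lambda>(g', v', z').
      arr g' X k (\<lambda>i. res AL t (X + i)) \<and> (\<forall>y<X. g' y = g y) \<and> v' 21 = s - k \<and>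
      (\<forall>x. x < 40 \<and> x \<notin> {19, 21, 22} \<longrightarrow> v' x = v x)) s'" if "?I G s'" for s'
  proof -
    obtain g3 v3 z3 where s': "s' = (g3, v3, z3)" by (cases s')
    have I': "arr g3 X k (Dd G)" "\<forall>y<X. g3 y = g y" "v3 40 = k" "v3 21 = s"
      "\<forall>x. x < 40 \<and> x \<notin> {19, 22} \<longrightarrow> v3 x = v x" using that v unfolding s' prod.case by simp_all
    have "sx (21 :== V 21 [-] V 40) (g3, v3, z3) = Some (0, (g3, v3(21 := s - k), z3))"
      using I' s t by simp
    then show ?thesis
      unfolding s' by (rule WP_sx) (use I' r in \<open>simp_all add: arr_def\<close>)
  qed
  have C: "(\<Sum>i<G. real k * Fm + real k) \<le> 2 * real s * (Fm + 1)"
  proof -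
    have "real (G * k) \<le> real (2 * s)" using G1 kw by (intro of_nat_mono) simp
    then have "real (G * k) * (Fm + 1) \<le> real (2 * s) * (Fm + 1)" using Fm by (intro mult_right_mono) simp_all
    then show ?thesis by (simp add: algebra_simps)
  qed
  have "WP TROW (0 + ((\<Sum>i<G. real k * Fm + real k) + 0)) (\<lambda>(g', v', z').
      arr g' X k (\<lambda>i. res AL t (X + i)) \<and> (\<forall>y<X. g' y = g y) \<and> v' 21 = s - k \<and>
      (\<forall>x. x < 40 \<and> x \<notin> {19, 21, 22} \<longrightarrow> v' x = v x)) (g, v, z)"
    unfolding TROW_def
  proof (rule WP_sx_then[OF s1], rule WP_sx_then[OF s2], rule WP_sx_then[OF s3], rule WP_then[OF c1], simp only:)
    show "WP (For 22 ((V 21 [+] V 40 [-] Num 1) [div] V 40) ?pc ;; 21 :== V 21 [-] V 40)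
      ((\<Sum>i<G. real k * Fm + real k) + 0) (\<lambda>(g', v', z').
      arr g' X k (\<lambda>i. res AL t (X + i)) \<and> (\<forall>y<X. g' y = g y) \<and> v' 21 = s - k \<and>
      (\<forall>x. x < 40 \<and> x \<notin> {19, 21, 22} \<longrightarrow> v' x = v x)) (?g1 k, ?v3(19 := k), z)"
      using c2 fin by (rule WP_then)
  qed
  then show ?thesis
    unfolding X_def k_def by (rule WP_weaken) (use C k_def in simp_all)
qed

definition TAIL :: "'a com" where
  "TAIL = (21 :== (V 10 [+] eN) [-] V 14 ;; While (BNot (Less (V 21) (Num E))) TROW ;; NRES)"

text \<open>Every round settles about the fraction 1 / E of the missing coefficients, so the costs
  decrease geometrically and their sum is linear in \<open>ph\<close>. Once fewer than
  \<open>E\<close> are left, the direct method finishes with a constant number of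
  operations.\<close>

lemma WP_TAIL:
  assumes v: "v 10 = t" "v 14 = H" and H: "H + ph = t + (n - 1)" "t \<le> H" "2 * ph \<le> t" and t: "t + (n - 1) \<le> LEN"
    and q: "arr g 0 t (fps_nth (AL * iv))"
  shows "WP TAIL (4 * real E * real ph * (Fm + 1) + 2 * real E * real E) (\<lambda>(g', v', z').
      arr g' H ph (\<lambda>i. res AL t (H + i)) \<and> (\<forall>y<H. g' y = g y) \<and>
      (\<forall>x. x < 19 \<longrightarrow> v' x = v x)) (g, v, z)"
proof -
  let ?e = "t + (n - 1)"
  have ph: "ph \<le> n - 1" using H by simp
  let ?I = "\<lambda>(g', v', z' :: nat \<Rightarrow> 'a cell). v' 21 \<le> ph \<and> arr g' H (ph - v' 21) (\<lambda>i. res AL t (H + i)) \<and>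
     (\<forall>y<H. g' y = g y) \<and> (\<forall>x. x < 40 \<and> x \<notin> {19, 21, 22} \<longrightarrow> v' x = v x)"
  let ?pot = "\<lambda>(g' :: nat \<Rightarrow> 'a cell, v', z' :: nat \<Rightarrow> 'a cell). 4 * real E * real (v' 21) * (Fm + 1)"
  have s1: "sx (21 :== (V 10 [+] eN) [-] V 14) (g, v, z) = Some (0, (g, v(21 := ph), z))"
  proof -
    have "t + (n - 1) - H = ph" using H by linarith
    then show ?thesis using v t ph by simp
  qed
  have W: "WP (While (BNot (Less (V 21) (Num E))) TROW) (?pot (g, v(21 := ph), z))
     (\<lambda>s. ?I s \<and> fst (snd s) 21 < E) (g, v(21 := ph), z)"
  proof (rule WP_while_pot[where I = ?I and \<mu> = "\<lambda>s. fst (snd s) 21" and pot = ?pot])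
    show "?I (g, v(21 := ph), z)" unfolding prod.case by (simp add: arr_def)
  next
    fix g1 v1 z1 assume I: "?I (g1, v1, z1)" and b: "bval v1 (BNot (Less (V 21) (Num E)))"
    define s where "s = v1 21"
    define k where "k = s div E"
    have I': "s \<le> ph" "arr g1 H (ph - s) (\<lambda>i. res AL t (H + i))" "\<forall>y<H. g1 y = g y"
      "\<forall>x. x < 40 \<and> x \<notin> {19, 21, 22} \<longrightarrow> v1 x = v x" using I unfolding prod.case s_def by blast+
    have sE: "E \<le> s" using b by (simp add: s_def)
    have k: "1 \<le> k" "k \<le> s" using sE E by (simp_all add: k_def div_greater_zero_iff Suc_le_eq)
    have Hs: "t + (n - 1) - s = H + (ph - s)" using H I'(1) by linarith
    have "WP TROW (2 * real s * (Fm + 1)) (\<lambda>(g', v', z').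
      arr g' (t + (n - 1) - s) (s div E) (\<lambda>i. res AL t (t + (n - 1) - s + i)) \<and>
      (\<forall>y<t + (n - 1) - s. g' y = g1 y) \<and> v' 21 = s - s div E \<and>
      (\<forall>x. x < 40 \<and> x \<notin> {19, 21, 22} \<longrightarrow> v' x = v1 x)) (g1, v1, z1)"
    proof (rule WP_TROW)
      show "arr g1 0 t (fps_nth (AL * iv))" by (rule arr_cong[OF q]) (use I'(3) H in simp_all)
    qed (use v I' sE H t ph in \<open>simp_all add: s_def\<close>)
    then have row: "WP TROW (2 * real s * (Fm + 1)) (\<lambda>(g', v', z').
      arr g' (H + (ph - s)) k (\<lambda>i. res AL t (H + (ph - s) + i)) \<and>
      (\<forall>y<H + (ph - s). g' y = g1 y) \<and> v' 21 = s - k \<and>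
      (\<forall>x. x < 40 \<and> x \<notin> {19, 21, 22} \<longrightarrow> v' x = v1 x)) (g1, v1, z1)"
      unfolding Hs k_def .
    \<comment> \<open>Rounding down loses at most a factor of two, that is
      \<open>s \<le> 2 * (E * k)\<close>; the potential therefore carries the factor
      \<open>4 * E\<close>.\<close>
    have cost: "2 * real s * (Fm + 1) + 4 * real E * real (s - k) * (Fm + 1) \<le> 4 * real E * real s * (Fm + 1)"
    proof -
      have "s < E + E * k"
        unfolding k_def using dividend_less_div_times[of E s] E by (simp add: mult.commute)
      moreover have "E * 1 \<le> E * k" using k(1) by (rule mult_le_mono2)
      ultimately have "s \<le> 2 * (E * k)" by linarith
      then have "real s \<le> 2 * (real E * real k)" by (metis of_nat_le_iff of_nat_mult of_nat_numeral)
      then have "2 * real s + 4 * real E * (real s - real k) \<le> 4 * real E * real s" by (simp add: algebra_simps)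
      then have "(2 * real s + 4 * real E * (real s - real k)) * (Fm + 1) \<le> 4 * real E * real s * (Fm + 1)"
        using Fm by (intro mult_right_mono) simp_all
      then show ?thesis using k by (simp add: of_nat_diff algebra_simps)
    qed
    show "\<exists>C. WP TROW C (\<lambda>s'. ?I s' \<and> fst (snd s') 21 < fst (snd (g1, v1, z1)) 21 \<and> C + ?pot s' \<le> ?pot (g1, v1, z1)) (g1, v1, z1)"
    proof (intro exI, rule WP_weaken[OF row _ order_refl])
      fix s' :: "'a state" assume A: "case s' of (g', v', z') \<Rightarrow>
        arr g' (H + (ph - s)) k (\<lambda>i. res AL t (H + (ph - s) + i)) \<and>
        (\<forall>y<H + (ph - s). g' y = g1 y) \<and> v' 21 = s - k \<and>
        (\<forall>x. x < 40 \<and> x \<notin> {19, 21, 22} \<longrightarrow> v' x = v1 x)"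
      obtain g2 v2 z2 where s': "s' = (g2, v2, z2)" by (cases s')
      have A': "arr g2 (H + (ph - s)) k (\<lambda>i. res AL t (H + (ph - s) + i))"
        "\<forall>y<H + (ph - s). g2 y = g1 y" "v2 21 = s - k"
        "\<forall>x. x < 40 \<and> x \<notin> {19, 21, 22} \<longrightarrow> v2 x = v1 x" using A unfolding s' prod.case by blast+
      have "arr g2 H (ph - (s - k)) (\<lambda>i. res AL t (H + i))"
      proof (unfold arr_def, intro allI impI)
        fix i assume i: "i < ph - (s - k)"
        show "g2 (H + i) = Elt (res AL t (H + i))"
        proof (cases "i < ph - s")
          case True
          then show ?thesis using A'(2) arrD[OF I'(2) True] by simp
        next
          case False
          then have *: "i - (ph - s) < k" "H + (ph - s) + (i - (ph - s)) = H + i" using i k I'(1) by auto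
          show ?thesis using arrD[OF A'(1) *(1)] by (simp only: *(2))
        qed
      qed
      moreover have "\<forall>y<H. g2 y = g y" using A'(2) I'(3) by simp
      moreover have "\<forall>x. x < 40 \<and> x \<notin> {19, 21, 22} \<longrightarrow> v2 x = v x" using A'(4) I'(4) by simp
      moreover have "s - k \<le> ph" "s - k < v1 21" using I'(1) k by (simp_all add: s_def)
      ultimately show "?I s' \<and> fst (snd s') 21 < fst (snd (g1, v1, z1)) 21 \<and>
        2 * real s * (Fm + 1) + ?pot s' \<le> ?pot (g1, v1, z1)"
        unfolding s' prod.case using A'(3) cost by (simp add: s_def)
    qed
  qed (use Fm in auto)
  have N: "WP NRES (2 * real E * real E) (\<lambda>(g', v', z').
      arr g' H ph (\<lambda>i. res AL t (H + i)) \<and> (\<forall>y<H. g' y = g y) \<and> (\<forall>x. x < 19 \<longrightarrow> v' x = v x)) s1"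
    if s1: "?I s1 \<and> fst (snd s1) 21 < E" for s1
  proof -
    obtain g1 v1 z1 where s1': "s1 = (g1, v1, z1)" by (cases s1)
    define s where "s = v1 21"
    have I': "s \<le> ph" "arr g1 H (ph - s) (\<lambda>i. res AL t (H + i))" "\<forall>y<H. g1 y = g y"
      "\<forall>x. x < 40 \<and> x \<notin> {19, 21, 22} \<longrightarrow> v1 x = v x" and sE: "s < E"
      using s1 unfolding s1' prod.case s_def by auto
    have Hs: "t + (n - 1) - s = H + (ph - s)" using H I'(1) by linarith
    have "WP NRES (2 * real s * real s) (\<lambda>(g', v', z').
      arr g' (t + (n - 1) - s) s (\<lambda>i. res AL t (t + (n - 1) - s + i)) \<and>
      (\<forall>y. y < t + (n - 1) - s \<longrightarrow> g' y = g1 y) \<and> (\<forall>x. x \<notin> {19, 20, 22, 23, 24} \<longrightarrow> v' x = v1 x)) (g1, v1, z1)"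
    proof (rule WP_NRES)
      show "arr g1 0 t (fps_nth (AL * iv))" by (rule arr_cong[OF q]) (use I'(3) H in simp_all)
    qed (use v I' H t ph in \<open>simp_all add: s_def\<close>)
    then show ?thesis
      unfolding Hs s1'
    proof (rule WP_weaken)
      fix s' :: "'a state" assume A: "case s' of (g', v', z') \<Rightarrow>
        arr g' (H + (ph - s)) s (\<lambda>i. res AL t (H + (ph - s) + i)) \<and>
        (\<forall>y. y < H + (ph - s) \<longrightarrow> g' y = g1 y) \<and> (\<forall>x. x \<notin> {19, 20, 22, 23, 24} \<longrightarrow> v' x = v1 x)"
      obtain g2 v2 z2 where s': "s' = (g2, v2, z2)" by (cases s')
      have A': "arr g2 (H + (ph - s)) s (\<lambda>i. res AL t (H + (ph - s) + i))"
        "\<forall>y<H + (ph - s). g2 y = g1 y" "\<forall>x. x \<notin> {19, 20, 22, 23, 24} \<longrightarrow> v2 x = v1 x"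
        using A unfolding s' prod.case by blast+
      have "arr g2 H ph (\<lambda>i. res AL t (H + i))"
      proof (unfold arr_def, intro allI impI)
        fix i assume i: "i < ph"
        show "g2 (H + i) = Elt (res AL t (H + i))"
        proof (cases "i < ph - s")
          case True
          then show ?thesis using A'(2) arrD[OF I'(2) True] by simp
        next
          case False
          then have *: "i - (ph - s) < s" "H + (ph - s) + (i - (ph - s)) = H + i" using i I'(1) by auto
          show ?thesis using arrD[OF A'(1) *(1)] by (simp only: *(2))
        qed
      qed
      moreover have "\<forall>y<H. g2 y = g y" using A'(2) I'(3) by simp
      moreover have "\<forall>x<19. v2 x = v x" using A'(3) I'(4) by simp
      ultimately show "case s' of (g', v', z') \<Rightarrow> arr g' H ph (\<lambda>i. res AL t (H + i)) \<and> (\<forall>y<H. g' y = g y) \<and>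
        (\<forall>x. x < 19 \<longrightarrow> v' x = v x)" unfolding s' prod.case by blast
    next
      have "real s * real s \<le> real E * real E" using sE by (intro mult_mono) simp_all
      then show "2 * real s * real s \<le> 2 * real E * real E" by simp
    qed
  qed
  have "WP TAIL (?pot (g, v(21 := ph), z) + 2 * real E * real E) (\<lambda>(g', v', z').
      arr g' H ph (\<lambda>i. res AL t (H + i)) \<and> (\<forall>y<H. g' y = g y) \<and>
      (\<forall>x. x < 19 \<longrightarrow> v' x = v x)) (g, v, z)"
    unfolding TAIL_def
    by (rule WP_sx_then[OF s1], rule WP_then[OF W], rule N)
  then show ?thesis by simp
qed

end


section \<open>Recombination of the digits in place\<close>

context remainder
begin

text \<open>The coefficients beyond the reach of the digits. They exist because every stage,
  including the last one, needs cells for its arrays and its product.\<close>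

definition ph :: nat where "ph = n - 1 - lenj L"

lemma ph: "lenj L + ph = n - 1"
  using lenj_L by (simp add: ph_def)

lemma psize_U: "j \<le> L \<Longrightarrow> psize (lenj L - lenj j + ph) (U t j)"
proof (induction j)
  case 0
  have "lenj L - lenj 0 + ph = n - 1" using ph by (simp add: lenj_def)
  then show ?case by (simp only: U.simps(1) Rp_def psize_pol)
next
  case (Suc j)
  have l: "lenj L - lenj j + ph = (aj j - 1) + (lenj L - lenj (Suc j) + ph)"
    using lenj_mono[OF Suc.prems] by (simp add: lenj_Suc)
  show ?case
    by (rule psize_quot[OF _ U_DS(1)[of t j] U_DS(2)]) (use Suc aj_ge[of j] l in auto)
qed

text \<open>A digit has no coefficient at these positions, so \<open>U t j\<close> agrees there with
  \<open>SA (aj j)\<close> times the next quotient. Multiplication by X - 1 makes this a recurrence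
  for the top coefficients of the next quotient, which involves no digit.\<close>

lemma coeff_U_high:
  assumes "j < L"
  shows "coeff (U t j) (lenj L - lenj j + k) - coeff (U t j) (lenj L - lenj j + Suc k) =
    coeff (U t (Suc j)) (lenj L - lenj (Suc j) + k) - coeff (U t (Suc j)) (lenj L - lenj (Suc j) + (k + aj j))"
proof -
  let ?d = "lenj L - lenj (Suc j)" and ?a = "aj j"
  have l: "lenj L - lenj j = (?a - 1) + ?d"
    using lenj_mono[of "Suc j" L] assms by (simp add: lenj_Suc)
  have c: "coeff (U t j) ((?a - 1) + y) = coeff (SA ?a * U t (Suc j)) ((?a - 1) + y)" for y
    using U_DS(2)[of j t] by (subst U_DS(1)[of t j]) (simp add: psize_def)
  have "coeff (SA ?a * U t (Suc j)) (Suc ((?a - 1) + ?d + k)) = coeff (SA ?a * U t (Suc j)) ((?a - 1) + ?d + k) +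
     coeff (U t (Suc j)) (Suc ((?a - 1) + ?d + k)) - coeff (U t (Suc j)) (Suc ((?a - 1) + ?d + k) - ?a)"
    using aj_ge[of j] by (subst coeff_SA_mult_Suc) auto
  moreover have "Suc ((?a - 1) + ?d + k) = ?d + (k + ?a)" "Suc ((?a - 1) + ?d + k) - ?a = ?d + k"
    using aj_ge[of j] by auto
  moreover have "coeff (U t j) (lenj L - lenj j + k) = coeff (SA ?a * U t (Suc j)) ((?a - 1) + ?d + k)"
    "coeff (U t j) (lenj L - lenj j + Suc k) = coeff (SA ?a * U t (Suc j)) (Suc ((?a - 1) + ?d + k))"
    using c[of "?d + k"] c[of "?d + Suc k"] by (simp_all add: l add.assoc)
  ultimately show ?thesis by (simp only:) simp
qed

text \<open>Passes from the leading \<open>ph\<close> coefficients of \<open>U t 0\<close> to those of \<open>U t L\<close>.\<close>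

definition UTR :: "'a com" where
  "UTR = For 12 (Num L) (13 :== Num D [*] (V 11 [+] V 12) [+] Num 1 ;; SetElt (Work, Num 51) 0 ;;
     For 19 ((V 10 [+] eN) [-] V 14) (20 :== ((V 10 [+] eN) [-] Num 1) [-] V 19 ;; Move (Work, Num 52) (Output, V 20) ;;
       Arith Sub (Output, V 20) (Output, V 20) (Work, Num 51) ;;
       Cond (Less (V 20 [+] V 13) (V 10 [+] eN)) (Arith Add (Output, V 20) (Output, V 20) (Output, V 20 [+] V 13))
         (Arith Sub (Work, Num 51) (Work, Num 51) (Work, Num 51)) ;;
       Move (Work, Num 51) (Work, Num 52)))"

text \<open>From the top down, the new coefficient \<open>k\<close> requires the new one at
  \<open>k + aj j\<close>, already in place, and the old ones at \<open>k\<close> and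
  \<open>k + 1\<close>; the latter has just been overwritten and is kept in cell 51. A dummy
  subtraction equalises the operation counts of the two branches.\<close>

lemma WP_UTR:
  assumes v: "v 10 = t" "v 11 = q" "v 14 = t + lenj L" and t: "t + (n - 1) \<le> LEN"
    and h: "arr g (t + lenj L) ph (\<lambda>k. coeff (U t 0) (lenj L + k))"
  shows "WP UTR (2 * real L * real n) (\<lambda>(g', v', z'). arr g' (t + lenj L) ph (coeff (U t L)) \<and>
     (\<forall>y<t + lenj L. g' y = g y) \<and> (\<forall>x. x \<notin> {12, 13, 19, 20} \<longrightarrow> v' x = v x)) (g, v, z)"
proof -
  define h where "h = t + lenj L"
  define e where "e = t + (n - 1)"
  have e: "e = h + ph" using ph by (simp add: e_def h_def)
  have eL: "e \<le> LEN" using t by (simp add: e_def)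
  let ?H = "\<lambda>j k. coeff (U t j) (lenj L - lenj j + k)"
  let ?in = "20 :== ((V 10 [+] eN) [-] Num 1) [-] V 19 ;; Move (Work, Num 52) (Output, V 20) ;;
       Arith Sub (Output, V 20) (Output, V 20) (Work, Num 51) ;;
       Cond (Less (V 20 [+] V 13) (V 10 [+] eN)) (Arith Add (Output, V 20) (Output, V 20) (Output, V 20 [+] V 13))
         (Arith Sub (Work, Num 51) (Work, Num 51) (Work, Num 51)) ;;
       Move (Work, Num 51) (Work, Num 52)"
  let ?I = "\<lambda>j (g', v', z' :: nat \<Rightarrow> 'a cell). v' 12 = j \<and> arr g' h ph (?H j) \<and> (\<forall>y<h. g' y = g y) \<and>
     (\<forall>x. x \<notin> {12, 13, 19, 20} \<longrightarrow> v' x = v x)"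
  have "WP UTR (\<Sum>j<L. 2 * real ph) (?I L) (g, v, z)"
    unfolding UTR_def
  proof (rule WP_for[where I = ?I])
    show "?I 0 (g, v(12 := 0), z)" unfolding prod.case using assms(5) by (simp add: lenj_def h_def)
  next
    fix j g1 v1 z1 assume j: "j < L" and I: "?I j (g1, v1, z1)"
    have I': "v1 12 = j" "arr g1 h ph (?H j)" "\<forall>y<h. g1 y = g y" "\<forall>x. x \<notin> {12, 13, 19, 20} \<longrightarrow> v1 x = v x"
      using I unfolding prod.case by blast+
    let ?a = "aj j"
    have aL: "?a \<le> LEN" using aj_space(1)[OF j] t by simp
    have v1: "v1 10 = t" "v1 11 = q" "v1 14 = h" using I' v by (simp_all add: h_def)
    have s1: "sx (13 :== Num D [*] (V 11 [+] V 12) [+] Num 1) (g1, v1, z1) = Some (0, (g1, v1(13 := ?a), z1))"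
    proof -
      have "D * (q + j) + 1 \<le> LEN" using aL by (simp add: aj_def)
      then show ?thesis using v1 I' by (simp add: aj_def)
    qed
    have s2: "sx (SetElt (Work, Num 51) 0) (g1, v1(13 := ?a), z1) = Some (0, (g1, v1(13 := ?a), z1(1 := Elt 0)))"
      by simp
    let ?G = "\<lambda>i y. if e - i \<le> y \<and> y < e then Elt (?H (Suc j) (y - h)) else g1 y"
    let ?J = "\<lambda>i (g', v', z' :: nat \<Rightarrow> 'a cell). v' 19 = i \<and> g' = ?G i \<and> z' 1 = Elt (?H j (ph - i)) \<and>
       (\<forall>x. x \<notin> {19, 20} \<longrightarrow> v' x = (v1(13 := ?a)) x)"
    have inner: "WP (For 19 ((V 10 [+] eN) [-] V 14) ?in) (\<Sum>i<ph. 2) (?J ph) (g1, v1(13 := ?a), z1(1 := Elt 0))"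
    proof (rule WP_for[where I = ?J])
      have "?H j ph = 0" using psize_U[of j t] j by (simp add: psize_def)
      then show "?J 0 (g1, (v1(13 := ?a))(19 := 0), z1(1 := Elt 0))"
        unfolding prod.case by (intro conjI) (auto simp: fun_eq_iff)
    next
      fix i g2 v2 z2 assume i: "i < ph" and J: "?J i (g2, v2, z2)"
      have J': "v2 19 = i" "g2 = ?G i" "z2 1 = Elt (?H j (ph - i))" "\<forall>x. x \<notin> {19, 20} \<longrightarrow> v2 x = (v1(13 := ?a)) x"
        using J unfolding prod.case by blast+
      define k where "k = ph - Suc i"
      define y where "y = e - 1 - i"
      have ky: "y = h + k" "Suc k = ph - i" "k < ph" "y < LEN" using i e eL by (simp_all add: k_def y_def)
      have v2: "v2 10 = t" "v2 13 = ?a" using J' v1 by simp_all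
      have old: "g2 y = Elt (?H j k)"
      proof -
        have "\<not> e - i \<le> y" using i e by (simp add: y_def)
        then have "g2 y = g1 y" using J'(2) by simp
        then show ?thesis using arrD[OF I'(2) ky(3)] ky by simp
      qed
      let ?new = "?H (Suc j) k"
      have new: "?new = ?H j k - ?H j (Suc k) + ?H (Suc j) (k + ?a)"
        using coeff_U_high[OF j, of t k] by (simp add: algebra_simps)
      have z1': "z2 1 = Elt (?H j (Suc k))" using J'(3) ky by simp
      have en: "t + (n - 1) = e" by (simp add: e_def)
      have sx1: "sx (20 :== ((V 10 [+] eN) [-] Num 1) [-] V 19) (g2, v2, z2) = Some (0, (g2, v2(20 := y), z2))"
        using v2 J' en[symmetric] ky n by (simp add: y_def)
      have en2: "val (v2(20 := y)) (V 10 [+] eN) = e" using v2 n by (simp add: e_def)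
      let ?rest = "Cond (Less (V 20 [+] V 13) (V 10 [+] eN)) (Arith Add (Output, V 20) (Output, V 20) (Output, V 20 [+] V 13))
         (Arith Sub (Work, Num 51) (Work, Num 51) (Work, Num 51)) ;; Move (Work, Num 51) (Work, Num 52)"
      let ?z3 = "z2(2 := Elt (?H j k))"
      let ?g3 = "g2(y := Elt (?H j k - ?H j (Suc k)))"
      have sx2: "sx (Move (Work, Num 52) (Output, V 20)) (g2, v2(20 := y), z2) = Some (0, (g2, v2(20 := y), ?z3))"
        using ky old by simp
      have sx3: "sx (Arith Sub (Output, V 20) (Output, V 20) (Work, Num 51)) (g2, v2(20 := y), ?z3) = Some (1, (?g3, v2(20 := y), ?z3))"
        using ky old z1' by simp
      have "\<exists>z4. sx ?rest (?g3, v2(20 := y), ?z3) = Some (1, (g2(y := Elt ?new), v2(20 := y), z4)) \<and> z4 1 = Elt (?H j k)"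
      proof (cases "y + ?a < e")
        case True
        have "g2 (y + ?a) = Elt (?H (Suc j) (k + ?a))"
        proof -
          have "e - i \<le> y + ?a" "y + ?a - h = k + ?a" using ky i e aj_ge[of j] by linarith+
          then show ?thesis using J'(2) True by simp
        qed
        moreover have "y + ?a \<noteq> y" using aj_ge[of j] by simp
        ultimately have "sx ?rest (?g3, v2(20 := y), ?z3) = Some (1, (g2(y := Elt ?new), v2(20 := y), ?z3(1 := Elt (?H j k))))"
          using True v2 en2 ky eL new n by (simp add: e_def)
        then show ?thesis by auto
      next
        case False
        then have "k + ?a \<ge> ph" using ky e by simp
        then have "?H (Suc j) (k + ?a) = 0" using psize_U[of "Suc j" t] j by (simp add: psize_def)
        then have "?new = ?H j k - ?H j (Suc k)" using new by simp
        then have "sx ?rest (?g3, v2(20 := y), ?z3) = Some (1, (g2(y := Elt ?new), v2(20 := y), ?z3(1 := Elt (?H j k))))"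
          using False v2 en2 ky n z1' by (simp add: e_def)
        then show ?thesis by auto
      qed
      then obtain z4 where z4: "sx ?rest (?g3, v2(20 := y), ?z3) = Some (1, (g2(y := Elt ?new), v2(20 := y), z4))" "z4 1 = Elt (?H j k)"
        by blast
      have sx: "sx ?in (g2, v2, z2) = Some (2, (g2(y := Elt ?new), v2(20 := y), z4))"
        unfolding sx.simps(2)[of _ _ "(g2, v2, z2)"] sx1 using z4(1) sx2 sx3 by (simp del: sx.simps(3,5,8) add: sx1 sx2 sx3)
      have G: "g2(y := Elt ?new) = ?G (Suc i)"
        using J'(2) ky i e by (auto simp: fun_eq_iff y_def)
      show "WP ?in 2 (\<lambda>(g, v, z). v 19 = i \<and> ?J (Suc i) (g, v(19 := Suc i), z)) (g2, v2, z2)"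
      proof (rule WP_sx[OF sx])
        show "case (g2(y := Elt ?new), v2(20 := y), z4) of (g, v, z) \<Rightarrow> v 19 = i \<and> ?J (Suc i) (g, v(19 := Suc i), z)"
          unfolding prod.case G using J' z4(2) by (simp add: k_def)
      qed simp
    next
      fix i g2 v2 z2 assume "?J i (g2, v2, z2)"
      then have J': "v2 19 = i" "\<forall>x. x \<notin> {19, 20} \<longrightarrow> v2 x = (v1(13 := ?a)) x" unfolding prod.case by blast+
      then have "v2 10 = t" "v2 14 = h" using v1 by simp_all
      then show "v2 19 = i \<and> val v2 ((V 10 [+] eN) [-] V 14) = ph" using J' e by (simp add: e_def)
    qed (use ph eL e in auto)
    show "WP (13 :== Num D [*] (V 11 [+] V 12) [+] Num 1 ;; SetElt (Work, Num 51) 0 ;; For 19 ((V 10 [+] eN) [-] V 14) ?in)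
      (2 * real ph) (\<lambda>(g, v, z). v 12 = j \<and> ?I (Suc j) (g, v(12 := Suc j), z)) (g1, v1, z1)"
    proof (rule WP_sx_then[OF s1], rule WP_sx_then[OF s2], rule WP_weaken[OF inner])
      fix s' :: "'a state" assume J: "?J ph s'"
      obtain g2 v2 z2 where s': "s' = (g2, v2, z2)" by (cases s')
      have J': "g2 = ?G ph" "\<forall>x. x \<notin> {19, 20} \<longrightarrow> v2 x = (v1(13 := ?a)) x"
        using J unfolding s' prod.case by blast+
      have "arr g2 h ph (?H (Suc j))" unfolding J'(1) using e by (simp add: arr_def)
      moreover have "\<forall>y<h. g2 y = g y" unfolding J'(1) using e I'(3) by simp
      ultimately show "case s' of (g, v, z) \<Rightarrow> v 12 = j \<and> ?I (Suc j) (g, v(12 := Suc j), z)"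
        unfolding s' prod.case using J'(2) I' by simp
    qed simp
  next
    fix i g2 v2 z2 assume "?I i (g2, v2, z2)"
    then show "v2 12 = i \<and> val v2 (Num L) = L" by simp
  qed (use LD in auto)
  then show ?thesis
  proof (rule WP_weaken)
    have "real ph \<le> real n" using ph by simp
    then show "(\<Sum>j<L. 2 * real ph) \<le> 2 * real L * real n" by (simp add: mult_left_mono)
  next
    fix s' :: "'a state" assume I: "?I L s'"
    then show "case s' of (g', v', z') \<Rightarrow> arr g' (t + lenj L) ph (coeff (U t L)) \<and>
     (\<forall>y<t + lenj L. g' y = g y) \<and> (\<forall>x. x \<notin> {12, 13, 19, 20} \<longrightarrow> v' x = v x)"
      unfolding h_def by (cases s') simp
  qed
qed

definition HORNER :: "'a com" where
  "HORNER = (SetElt (Work, Num 53) 0 ;; For 12 (Num L) (13 :== Num D [*] (V 11 [+] (Num L [-] Num 1 [-] V 12)) [+] Num 1 ;;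
     14 :== V 14 [-] (V 13 [-] Num 1) ;; SetElt (Work, Num 50) 0 ;; SetElt (Work, Num 51) 0 ;;
     For 19 ((V 10 [+] eN) [-] V 14) (
       Move (Work, Num 52) (Output, V 14 [+] V 19) ;;
       Cond (Less (V 14 [+] V 19 [+] (V 13 [-] Num 1)) (V 10 [+] eN))
         (Arith Add (Work, Num 50) (Work, Num 50) (Output, V 14 [+] V 19 [+] (V 13 [-] Num 1)))
         (Arith Add (Work, Num 50) (Work, Num 50) (Work, Num 53)) ;;
       Arith Sub (Work, Num 50) (Work, Num 50) (Work, Num 51) ;;
       Cond (Less (V 19) (V 13 [-] Num 1))
         (Arith Add (Output, V 14 [+] V 19) (Work, Num 50) (Work, Num 52))
         (Arith Add (Output, V 14 [+] V 19) (Work, Num 50) (Work, Num 53) ;; Move (Work, Num 51) (Work, Num 52)))))"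

text \<open>The coefficients of \<open>SA (aj j) * U t (Suc j)\<close> are running window sums, kept
  in cell 50. The coefficient that enters is \<open>aj j - 1\<close> cells ahead and still intact;
  the one that leaves was stored in the cell just overwritten and waits in cell 51. Cell 53 holds
  zero, so that all branches perform the same number of operations.\<close>

lemma WP_HORNER:
  assumes v: "v 10 = t" "v 11 = q" "v 14 = t + lenj L" and t: "t + (n - 1) \<le> LEN"
    and h: "arr g (t + lenj L) ph (coeff (U t L))"
    and ds: "\<forall>i<L. arr g (t + lenj i) (aj i - 1) (coeff (DS t i))"
  shows "WP HORNER (3 * real L * real n) (\<lambda>(g', v', z'). arr g' t (n - 1) (coeff (Rp t)) \<and>
     (\<forall>y<t. g' y = g y) \<and> (\<forall>x. x \<notin> {12, 13, 14, 19} \<longrightarrow> v' x = v x)) (g, v, z)"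
proof -
  define e where "e = t + (n - 1)"
  have eL: "e \<le> LEN" using t by (simp add: e_def)
  let ?c1 = "Cond (Less (V 14 [+] V 19 [+] (V 13 [-] Num 1)) (V 10 [+] eN))
         (Arith Add (Work, Num 50) (Work, Num 50) (Output, V 14 [+] V 19 [+] (V 13 [-] Num 1)))
         (Arith Add (Work, Num 50) (Work, Num 50) (Work, Num 53))"
  let ?c2 = "Cond (Less (V 19) (V 13 [-] Num 1))
         (Arith Add (Output, V 14 [+] V 19) (Work, Num 50) (Work, Num 52))
         (Arith Add (Output, V 14 [+] V 19) (Work, Num 50) (Work, Num 53) ;; Move (Work, Num 51) (Work, Num 52))"
  let ?in = "Move (Work, Num 52) (Output, V 14 [+] V 19) ;; ?c1 ;;
       Arith Sub (Work, Num 50) (Work, Num 50) (Work, Num 51) ;; ?c2"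
  let ?I = "\<lambda>i (g', v', z' :: nat \<Rightarrow> 'a cell). v' 12 = i \<and> v' 14 = t + lenj (L - i) \<and> z' 3 = Elt 0 \<and>
     arr g' (t + lenj (L - i)) (n - 1 - lenj (L - i)) (coeff (U t (L - i))) \<and>
     (\<forall>y<t + lenj (L - i). g' y = g y) \<and> (\<forall>x. x \<notin> {12, 13, 14, 19} \<longrightarrow> v' x = v x)"
  have main: "WP (For 12 (Num L) (13 :== Num D [*] (V 11 [+] (Num L [-] Num 1 [-] V 12)) [+] Num 1 ;;
     14 :== V 14 [-] (V 13 [-] Num 1) ;; SetElt (Work, Num 50) 0 ;; SetElt (Work, Num 51) 0 ;;
     For 19 ((V 10 [+] eN) [-] V 14) ?in)) (\<Sum>i<L. 3 * real (n - 1)) (?I L) (g, v, z(3 := Elt 0))"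
  proof (rule WP_for[where I = ?I])
    show "?I 0 (g, v(12 := 0), z(3 := Elt 0))" unfolding prod.case using v h by (simp add: ph_def)
  next
    fix i g1 v1 z1 assume i: "i < L" and I: "?I i (g1, v1, z1)"
    define j where "j = L - Suc i"
    have j: "L - i = Suc j" "j < L" "L - Suc i = j" using i by (simp_all add: j_def)
    let ?a = "aj j"
    define B where "B = t + lenj j"
    define M where "M = n - 1 - lenj j"
    have I': "v1 12 = i" "v1 14 = B + (?a - 1)" "z1 3 = Elt 0" "arr g1 (B + (?a - 1)) (n - 1 - lenj (Suc j)) (coeff (U t (Suc j)))"
      "\<forall>y<B + (?a - 1). g1 y = g y" "\<forall>x. x \<notin> {12, 13, 14, 19} \<longrightarrow> v1 x = v x"
      using I unfolding prod.case j(1) B_def by (simp_all add: lenj_Suc add.assoc)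
    have lS: "lenj (Suc j) \<le> n - 1" using lenj_mono[of "Suc j" L] lenj_L j by simp
    have M: "M = (?a - 1) + (n - 1 - lenj (Suc j))" "e = B + M"
      using lS by (simp_all add: M_def B_def e_def lenj_Suc)
    have ds1: "arr g1 B (?a - 1) (coeff (DS t j))"
      by (rule arr_cong[OF ds[rule_format, OF j(2), folded B_def]]) (use I'(5) in auto)
    have aL: "?a \<le> LEN" using aj_space(1)[OF j(2)] t by simp
    have v1: "v1 10 = t" "v1 11 = q" using I' v by simp_all
    let ?v2 = "v1(13 := ?a)" let ?v3 = "v1(13 := ?a, 14 := B)"
    have s1: "sx (13 :== Num D [*] (V 11 [+] (Num L [-] Num 1 [-] V 12)) [+] Num 1) (g1, v1, z1) = Some (0, (g1, ?v2, z1))"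
    proof -
      have "D * (q + j) + 1 \<le> LEN" using aL by (simp add: aj_def)
      moreover have "L - 1 - i = j" by (simp add: j_def)
      ultimately show ?thesis using v1 I' by (simp add: aj_def)
    qed
    have s2: "sx (14 :== V 14 [-] (V 13 [-] Num 1)) (g1, ?v2, z1) = Some (0, (g1, ?v3, z1))"
      using I' eL M by simp
    have s3: "sx (SetElt (Work, Num 50) 0) (g1, ?v3, z1) = Some (0, (g1, ?v3, z1(0 := Elt 0)))" by simp
    have s4: "sx (SetElt (Work, Num 51) 0) (g1, ?v3, z1(0 := Elt 0)) = Some (0, (g1, ?v3, z1(0 := Elt 0, 1 := Elt 0)))" by simp
    let ?u = "coeff (U t (Suc j))" let ?P = "SA ?a * U t (Suc j)"
    let ?G = "\<lambda>k y. if B \<le> y \<and> y < B + k then Elt (coeff (U t j) (y - B)) else g1 y"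
    let ?J = "\<lambda>k (g', v', z' :: nat \<Rightarrow> 'a cell). v' 19 = k \<and> g' = ?G k \<and> z' 0 = Elt (if k = 0 then 0 else coeff ?P (k - 1)) \<and>
       z' 1 = Elt (if k < ?a then 0 else ?u (k - ?a)) \<and> z' 3 = Elt 0 \<and> (\<forall>x. x \<noteq> 19 \<longrightarrow> v' x = ?v3 x)"
    have u0: "?u y = 0" if "n - 1 - lenj (Suc j) \<le> y" for y
    proof -
      have "lenj L - lenj (Suc j) + ph = n - 1 - lenj (Suc j)"
        using ph lenj_mono[of "Suc j" L] j by simp
      then show ?thesis using psize_U[of "Suc j" t] j that by (simp add: psize_def)
    qed
    have inner: "WP (For 19 ((V 10 [+] eN) [-] V 14) ?in) (\<Sum>k<M. 3) (?J M) (g1, ?v3, z1(0 := Elt 0, 1 := Elt 0))"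
    proof (rule WP_for[where I = ?J])
      show "?J 0 (g1, ?v3(19 := 0), z1(0 := Elt 0, 1 := Elt 0))"
        unfolding prod.case using I'(3) aj_ge[of j] by (intro conjI) (auto simp: fun_eq_iff)
    next
      fix k g2 v2 z2 assume k: "k < M" and J: "?J k (g2, v2, z2)"
      have J': "v2 19 = k" "g2 = ?G k" "z2 0 = Elt (if k = 0 then 0 else coeff ?P (k - 1))"
        "z2 1 = Elt (if k < ?a then 0 else ?u (k - ?a))" "z2 3 = Elt 0" "\<forall>x. x \<noteq> 19 \<longrightarrow> v2 x = ?v3 x"
        using J unfolding prod.case by blast+
      have v2: "v2 10 = t" "v2 13 = ?a" "v2 14 = B" using J' v1 by simp_all
      \<comment> \<open>The cell belongs to the digit up to position \<open>aj j - 2\<close> and,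
        from there on, to the next quotient, which is stored immediately behind the digit.\<close>
      define old where "old = (if k < ?a - 1 then coeff (DS t j) k else ?u (k - (?a - 1)))"
      have o: "g2 (B + k) = Elt old"
      proof (cases "k < ?a - 1")
        case True
        then show ?thesis using J'(2) arrD[OF ds1 True] by (simp add: old_def)
      next
        case False
        then have *: "k - (?a - 1) < n - 1 - lenj (Suc j)" "B + (?a - 1) + (k - (?a - 1)) = B + k" using k unfolding M(1) by linarith+
        have "g1 (B + k) = Elt (?u (k - (?a - 1)))" using arrD[OF I'(4) *(1)] by (simp only: *(2))
        then show ?thesis using J'(2) False by (simp add: old_def)
      qed
      have BkL: "B + k < LEN" using k M eL by simp
      let ?z1 = "z2(2 := Elt old)"
      have x1: "sx (Move (Work, Num 52) (Output, V 14 [+] V 19)) (g2, v2, z2) = Some (0, (g2, v2, ?z1))"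
        using v2 J'(1) BkL o by simp
      define w0 where "w0 = (if k = 0 then 0 else coeff ?P (k - 1))"
      define w1 where "w1 = (if k < ?a then 0 else ?u (k - ?a))"
      have en: "val v2 (V 10 [+] eN) = e" using v2 n by (simp add: e_def)
      have x2: "sx ?c1 (g2, v2, ?z1) = Some (1, (g2, v2, ?z1(0 := Elt (w0 + ?u k))))"
      proof (cases "B + k + (?a - 1) < e")
        case True
        have ka: "k < n - 1 - lenj (Suc j)" using True M by simp
        have "B + (?a - 1) + k = B + k + (?a - 1)" by simp
        then have "g1 (B + k + (?a - 1)) = Elt (?u k)" using arrD[OF I'(4) ka] by (simp only:)
        moreover have "g2 (B + k + (?a - 1)) = g1 (B + k + (?a - 1))" unfolding J'(2) using aj_ge[of j] by auto
        ultimately have "g2 (B + k + (?a - 1)) = Elt (?u k)" by simp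
        then show ?thesis
          using True v2 J'(1) J'(3)[folded w0_def] en eL by simp
      next
        case False
        then have "?u k = 0" using M by (intro u0) simp
        then show ?thesis
          using False v2 J'(1) J'(3)[folded w0_def] J'(5) en by simp
      qed
      have P: "w0 + ?u k - w1 = coeff ?P k"
      proof (cases k)
        case 0
        then show ?thesis using aj_ge[of j] coeff_SA_mult[of ?a "U t (Suc j)" 0]
          by (simp add: w0_def w1_def sum.delta' Suc_le_eq)
      next
        case (Suc k')
        then show ?thesis using coeff_SA_mult_Suc[of ?a "U t (Suc j)" k'] aj_ge[of j]
          by (simp add: w0_def w1_def)
      qed
      let ?z3 = "?z1(0 := Elt (coeff ?P k))"
      have x3: "sx (Arith Sub (Work, Num 50) (Work, Num 50) (Work, Num 51)) (g2, v2, ?z1(0 := Elt (w0 + ?u k))) =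
        Some (1, (g2, v2, ?z3))"
        using J'(4)[folded w1_def] P by simp
      have cU: "coeff (U t j) k = coeff (DS t j) k + coeff ?P k" by (subst U_DS(1)[of t j]) simp
      let ?g4 = "g2(B + k := Elt (coeff (U t j) k))"
      have x4: "\<exists>z4. sx ?c2 (g2, v2, ?z3) = Some (1, (?g4, v2, z4)) \<and> z4 0 = Elt (coeff ?P k) \<and>
         z4 1 = Elt (if Suc k < ?a then 0 else ?u (Suc k - ?a)) \<and> z4 3 = Elt 0"
      proof (cases "k < ?a - 1")
        case True
        then have "k < ?a" "Suc k < ?a" by linarith+
        with True show ?thesis
          using v2 J'(1,4,5) BkL cU by (intro exI[of _ ?z3]) (simp add: old_def add.commute)
      next
        case False
        then have "coeff (DS t j) k = 0" using U_DS(2)[of j t] by (simp add: psize_def)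
        then have c: "coeff (U t j) k = coeff ?P k" using cU by simp
        have sk: "Suc k - ?a = k - (?a - 1)" "\<not> Suc k < ?a" using False aj_ge[of j] by linarith+
        have o': "old = (if Suc k < ?a then 0 else ?u (Suc k - ?a))" unfolding sk(1) using False sk(2) by (simp only: old_def if_False)
        have "sx ?c2 (g2, v2, ?z3) = Some (1, (g2(B + k := Elt (coeff ?P k)), v2, ?z3(1 := Elt old)))"
          using False v2 J'(1,5) BkL by simp
        then show ?thesis unfolding c o'[symmetric] using J'(5)
          by (intro exI[of _ "?z3(1 := Elt old)"] conjI) simp_all
      qed
      then obtain z4 where z4: "sx ?c2 (g2, v2, ?z3) = Some (1, (?g4, v2, z4))" "z4 0 = Elt (coeff ?P k)"
         "z4 1 = Elt (if Suc k < ?a then 0 else ?u (Suc k - ?a))" "z4 3 = Elt 0" by blast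
      have x: "sx ?in (g2, v2, z2) = Some (3, (?g4, v2, z4))"
        by (simp only: sx.simps(2) x1 x2 x3 z4(1) option.case prod.case) simp
      have G: "?g4 = ?G (Suc k)" using J'(2) by (auto simp: fun_eq_iff)
      show "WP ?in 3 (\<lambda>(g, v, z). v 19 = k \<and> ?J (Suc k) (g, v(19 := Suc k), z)) (g2, v2, z2)"
      proof (rule WP_sx[OF x])
        show "case (?g4, v2, z4) of (g, v, z) \<Rightarrow> v 19 = k \<and> ?J (Suc k) (g, v(19 := Suc k), z)"
          unfolding prod.case G using J'(1,6) z4(2-4) by simp
      qed simp
    next
      fix k g2 v2 z2 assume "?J k (g2, v2, z2)"
      then have J': "v2 19 = k" "\<forall>x. x \<noteq> 19 \<longrightarrow> v2 x = ?v3 x" unfolding prod.case by blast+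
      then have "v2 10 = t" "v2 14 = B" using v1 by simp_all
      then show "v2 19 = k \<and> val v2 ((V 10 [+] eN) [-] V 14) = M" using J' M(2) by (simp add: e_def)
    qed (use M eL in auto)
    show "WP (13 :== Num D [*] (V 11 [+] (Num L [-] Num 1 [-] V 12)) [+] Num 1 ;;
      14 :== V 14 [-] (V 13 [-] Num 1) ;; SetElt (Work, Num 50) 0 ;; SetElt (Work, Num 51) 0 ;;
      For 19 ((V 10 [+] eN) [-] V 14) ?in) (3 * real (n - 1))
      (\<lambda>(g, v, z). v 12 = i \<and> ?I (Suc i) (g, v(12 := Suc i), z)) (g1, v1, z1)"
    proof (rule WP_sx_then[OF s1], rule WP_sx_then[OF s2], rule WP_sx_then[OF s3], rule WP_sx_then[OF s4],
        rule WP_weaken[OF inner])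
      fix s' :: "'a state" assume J: "?J M s'"
      obtain g2 v2 z2 where s': "s' = (g2, v2, z2)" by (cases s')
      have J': "g2 = ?G M" "z2 3 = Elt 0" "\<forall>x. x \<noteq> 19 \<longrightarrow> v2 x = ?v3 x"
        using J unfolding s' prod.case by blast+
      have "arr g2 B M (coeff (U t j))" unfolding J'(1) by (simp add: arr_def)
      moreover have "\<forall>y<B. g2 y = g y" unfolding J'(1) using I'(5) by simp
      ultimately show "case s' of (g, v, z) \<Rightarrow> v 12 = i \<and> ?I (Suc i) (g, v(12 := Suc i), z)"
        unfolding s' prod.case j(3) B_def M_def using J'(2,3) I' by (simp add: B_def)
    qed (simp add: M_def)
  next
    fix i g2 v2 z2 assume "?I i (g2, v2, z2)"
    then show "v2 12 = i \<and> val v2 (Num L) = L" by simp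
  qed (use LD in auto)
  have "WP HORNER (\<Sum>i<L. 3 * real (n - 1)) (?I L) (g, v, z)"
    unfolding HORNER_def by (rule WP_sx_then[OF _ main]) simp
  then show ?thesis
  proof (rule WP_weaken)
    show "(\<Sum>i<L. 3 * real (n - 1)) \<le> 3 * real L * real n" using n by (simp add: algebra_simps)
  next
    fix s' :: "'a state" assume "?I L s'"
    then show "case s' of (g', v', z') \<Rightarrow> arr g' t (n - 1) (coeff (Rp t)) \<and>
     (\<forall>y<t. g' y = g y) \<and> (\<forall>x. x \<notin> {12, 13, 14, 19} \<longrightarrow> v' x = v x)"
      by (cases s') (simp add: lenj_def)
  qed
qed

definition REM :: "'a com" where "REM = (DIGITS ;; TAIL ;; UTR ;; HORNER)"

text \<open>The top coefficients are found and transformed in the cells from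
  \<open>t + lenj L\<close> on, so the digits below survive until the recombination.\<close>

lemma WP_REM:
  assumes v: "v 10 = t" "v 11 = q" and t: "t + (n - 1) \<le> LEN" "2 * ph \<le> t"
    and qs: "arr g 0 t (fps_nth (AL * iv))"
  shows "WP REM (real (n + L) * \<rho> + 4 * real E * real ph * (Fm + 1) +
      (real L * (2 * real t + (10 + 3 * real L) * real n) + 2 * real E * real E))
    (\<lambda>(g', v', z'). arr g' t (n - 1) (\<lambda>i. res AL t (t + i)) \<and> (\<forall>y<t. g' y = g y) \<and>
      (\<forall>x<12. v' x = v x)) (g, v, z)"
proof -
  let ?ds = "\<lambda>g'. \<forall>i<L. arr g' (t + lenj i) (aj i - 1) (coeff (DS t i))"
  have keep: "?ds g2" if "?ds g1" "\<forall>y<t + lenj L. g2 y = g1 y" for g1 g2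
  proof (intro allI impI)
    fix i assume i: "i < L"
    have "lenj i + (aj i - 1) \<le> lenj L" using lenj_mono[of "Suc i" L] i by (simp add: lenj_Suc)
    then show "arr g2 (t + lenj i) (aj i - 1) (coeff (DS t i))"
      by (intro arr_cong[OF that(1)[rule_format, OF i]]) (use that(2) in simp_all)
  qed
  have h: "res AL t (t + lenj L + k) = coeff (U t 0) (lenj L + k)" if "k < ph" for k
    using that ph by (simp add: Rp_def coeff_pol add.assoc)
  have "WP REM ((real (n + L) * \<rho> + real L * (2 * real t + (5 + 3 * real L) * real n)) +
     ((4 * real E * real ph * (Fm + 1) + 2 * real E * real E) + (2 * real L * real n + 3 * real L * real n)))
    (\<lambda>(g', v', z'). arr g' t (n - 1) (\<lambda>i. res AL t (t + i)) \<and> (\<forall>y<t. g' y = g y) \<and>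
      (\<forall>x<12. v' x = v x)) (g, v, z)"
    unfolding REM_def
  proof (rule WP_then[OF WP_DIGITS[OF v t(1) qs]], clarify)
    fix g1 v1 z1 assume 1: "?ds g1" "\<forall>y<t. g1 y = g y" "v1 14 = t + lenj L" "\<forall>x. x < 12 \<or> 21 \<le> x \<and> x < 40 \<longrightarrow> v1 x = v x"
    have v1: "v1 10 = t" "v1 11 = q" using 1 v by simp_all
    have q1: "arr g1 0 t (fps_nth (AL * iv))" by (rule arr_cong[OF qs]) (use 1 in auto)
    show "WP (TAIL ;; UTR ;; HORNER)
      ((4 * real E * real ph * (Fm + 1) + 2 * real E * real E) + (2 * real L * real n + 3 * real L * real n))
      (\<lambda>(g', v', z'). arr g' t (n - 1) (\<lambda>i. res AL t (t + i)) \<and> (\<forall>y<t. g' y = g y) \<and> (\<forall>x<12. v' x = v x)) (g1, v1, z1)"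
    proof (rule WP_then[OF WP_TAIL[OF v1(1) 1(3) _ _ t(2) t(1) q1]], simp add: ph add.assoc, simp, clarify)
      fix g2 v2 z2 assume 2: "arr g2 (t + lenj L) ph (\<lambda>i. res AL t (t + lenj L + i))" "\<forall>y<t + lenj L. g2 y = g1 y"
        "\<forall>x<19. v2 x = v1 x"
      have v2: "v2 10 = t" "v2 11 = q" "v2 14 = t + lenj L" using 2 v1 1(3) by simp_all
      have h2: "arr g2 (t + lenj L) ph (\<lambda>k. coeff (U t 0) (lenj L + k))"
        by (rule arr_cong[OF 2(1)]) (use h in auto)
      show "WP (UTR ;; HORNER) (2 * real L * real n + 3 * real L * real n)
        (\<lambda>(g', v', z'). arr g' t (n - 1) (\<lambda>i. res AL t (t + i)) \<and> (\<forall>y<t. g' y = g y) \<and> (\<forall>x<12. v' x = v x)) (g2, v2, z2)"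
      proof (rule WP_then[OF WP_UTR[OF v2 t(1) h2]], safe)
        fix g3 v3 z3 assume 3: "arr g3 (t + lenj L) ph (coeff (U t L))" "\<forall>y<t + lenj L. g3 y = g2 y"
          "\<forall>x. x \<notin> {12, 13, 19, 20} \<longrightarrow> v3 x = v2 x"
        have v3: "v3 10 = t" "v3 11 = q" "v3 14 = t + lenj L" using 3 v2 by simp_all
        show "WP HORNER (3 * real L * real n)
          (\<lambda>(g', v', z'). arr g' t (n - 1) (\<lambda>i. res AL t (t + i)) \<and> (\<forall>y<t. g' y = g y) \<and> (\<forall>x<12. v' x = v x)) (g3, v3, z3)"
        proof (rule WP_weaken[OF WP_HORNER[OF v3 t(1) 3(1) keep[OF keep[OF 1(1) 2(2)] 3(2)]]])
          fix s' :: "'a state" assume A: "case s' of (g', v', z') \<Rightarrow> arr g' t (n - 1) (coeff (Rp t)) \<and>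
            (\<forall>y<t. g' y = g3 y) \<and> (\<forall>x. x \<notin> {12, 13, 14, 19} \<longrightarrow> v' x = v3 x)"
          obtain g4 v4 z4 where s': "s' = (g4, v4, z4)" by (cases s')
          have A': "arr g4 t (n - 1) (coeff (Rp t))" "\<forall>y<t. g4 y = g3 y" "\<forall>x. x \<notin> {12, 13, 14, 19} \<longrightarrow> v4 x = v3 x"
            using A unfolding s' prod.case by blast+
          have "arr g4 t (n - 1) (\<lambda>i. res AL t (t + i))"
            by (rule arr_cong[OF A'(1)]) (auto simp: Rp_def coeff_pol)
          moreover have "\<forall>y<t. g4 y = g y" using A'(2) 3(2) 2(2) 1(2) by simp
          moreover have "\<forall>x<12. v4 x = v x" using A'(3) 3(3) 2(3) 1(4) by simp
          ultimately show "case s' of (g', v', z') \<Rightarrow> arr g' t (n - 1) (\<lambda>i. res AL t (t + i)) \<and> (\<forall>y<t. g' y = g y) \<and> (\<forall>x<12. v' x = v x)"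
            unfolding s' prod.case by blast
        qed simp
      qed
    qed
  qed
  then show ?thesis
  proof (rule WP_weaken)
    show "(real (n + L) * \<rho> + real L * (2 * real t + (5 + 3 * real L) * real n)) +
     ((4 * real E * real ph * (Fm + 1) + 2 * real E * real E) + (2 * real L * real n + 3 * real L * real n))
     \<le> real (n + L) * \<rho> + 4 * real E * real ph * (Fm + 1) +
      (real L * (2 * real t + (10 + 3 * real L) * real n) + 2 * real E * real E)"
      by (simp add: algebra_simps)
  qed
qed

end


section \<open>Product loads and space of one phase\<close>

text \<open>Total size of the middle products in a phase with \<open>p\<close> blocks of size
  \<open>k\<close> for a divisor of degree \<open>N\<close>. The leading \<open>real k\<close> is
  the share of the inversion.\<close>

definition mp_load :: "nat \<Rightarrow> nat \<Rightarrow> nat \<Rightarrow> real" where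
  "mp_load N p k = real k + (\<Sum>i<p. real (min i ((N + k - 1) div k)) * real k)"

definition sp_load :: "nat \<Rightarrow> nat \<Rightarrow> real" where
  "sp_load p k = real k + real p * real k"

text \<open>A phase finds \<open>l\<close> coefficients while \<open>w\<close> further ones remain
  for later, so \<open>l + w + N\<close> cells are free at its start. Besides the blocks these must
  hold the inverse, one product result and the work area: \<open>k + k + (c - 2) * k\<close> cells,
  up to constants.\<close>

definition fits :: "real \<Rightarrow> real \<Rightarrow> nat \<Rightarrow> nat \<Rightarrow> nat \<Rightarrow> nat \<Rightarrow> nat \<Rightarrow> bool" where
  "fits c d N l w p k \<longleftrightarrow> 1 \<le> p \<and> 1 \<le> k \<and> l \<le> p * k \<and>
     real p * real k + c * real k + 1 + d \<le> real l + real w + real N"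

text \<open>\<open>X\<close> and \<open>Y\<close> are the loads of the two products,
  \<open>r\<close> is the number of recomputations of the residual. If a cyclic product costs the
  minimum of \<open>Fm\<close> and \<open>2 * Fs\<close> per coefficient, the desired bound is
  piecewise linear in the two rates with a break at \<open>Fm = 2 * Fs\<close>. It is decided by the
  rate pairs (1, 0), (0, 1) and (2, 1); the last condition is divided by two.
  \<open>\<mu> * real N\<close> is the slack for lower-order terms.\<close>

definition load_ok :: "real \<Rightarrow> real \<Rightarrow> nat \<Rightarrow> nat \<Rightarrow> nat \<Rightarrow> real \<Rightarrow> real \<Rightarrow> bool" where
  "load_ok c \<mu> N R r X Y \<longleftrightarrow>
     X \<le> (c / 2 + 1 / 2 + 1 / c) * real R - \<mu> * real N \<and> Y \<le> (2 + 1 / c) * real R - \<mu> * real N \<and>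
     X + Y / 2 + real r * real N \<le> (c / 2 + 3 / 2 + 3 / (2 * c)) * real R - \<mu> * real N"

lemma load_ok_bound:
  assumes "load_ok c \<mu> N R r X Y" and F: "0 \<le> Fm" "0 \<le> Fs" "\<rho> \<le> Fm" "\<rho> \<le> 2 * Fs" and mu: "0 \<le> \<mu>"
  shows "Fm * X + Fs * Y + \<rho> * (real r * real N) \<le>
    Fm * ((c / 2 + 1 / 2 + 1 / c) * real R - \<mu> * real N / 2) + Fs * ((2 + 1 / c) * real R - \<mu> * real N / 2)"
proof -
  define b where "b = (c / 2 + 1 / 2 + 1 / c) * real R - \<mu> * real N / 2"
  define g where "g = (2 + 1 / c) * real R - \<mu> * real N / 2"
  have "0 \<le> \<mu> * real N" using mu by simp
  then have h: "X \<le> b" "Y \<le> g" "X + Y / 2 + real r * real N \<le> b + g / 2"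
  proof -
    define ic where "ic = 1 / c"
    have e: "3 / (2 * c) = 3 / 2 * ic" by (simp add: ic_def)
    note A = assms(1)[unfolded load_ok_def e ic_def[symmetric]] and b_def = b_def[folded ic_def] and g_def = g_def[folded ic_def]
    show "X \<le> b" "Y \<le> g" using A \<open>0 \<le> \<mu> * real N\<close> unfolding b_def g_def by linarith+
    have "b + g / 2 = (c / 2 + 3 / 2 + 3 / 2 * ic) * real R - 3 / 4 * (\<mu> * real N)"
      unfolding b_def g_def by (simp add: field_simps)
    then show "X + Y / 2 + real r * real N \<le> b + g / 2" using A \<open>0 \<le> \<mu> * real N\<close> by linarith
  qed
  have "Fm * X + Fs * Y + \<rho> * (real r * real N) \<le> Fm * b + Fs * g"
  \<comment> \<open>On either side of the break the rates are a nonnegative combination of (2, 1)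
    and one of the two axes.\<close>
  proof (cases "Fm \<le> 2 * Fs")
    case True
    have "Fm * (X + Y / 2 + real r * real N) \<le> Fm * (b + g / 2)" by (rule mult_left_mono) (use h F in auto)
    moreover have "(Fs - Fm / 2) * Y \<le> (Fs - Fm / 2) * g" by (rule mult_left_mono) (use h True in auto)
    moreover have "\<rho> * (real r * real N) \<le> Fm * (real r * real N)" by (rule mult_right_mono) (use F in auto)
    ultimately show ?thesis by (simp add: algebra_simps)
  next
    case False
    have "2 * Fs * (X + Y / 2 + real r * real N) \<le> 2 * Fs * (b + g / 2)" by (rule mult_left_mono) (use h F in auto)
    moreover have "(Fm - 2 * Fs) * X \<le> (Fm - 2 * Fs) * b" by (rule mult_left_mono) (use h False in auto)
    moreover have "\<rho> * (real r * real N) \<le> 2 * Fs * (real r * real N)" by (rule mult_right_mono) (use F in auto)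
    ultimately show ?thesis by (simp add: algebra_simps)
  qed
  then show ?thesis by (simp add: b_def g_def)
qed

lemma ceil_div:
  fixes l p :: nat
  assumes "1 \<le> p"
  shows "l \<le> p * ((l + p - 1) div p)" and "p * ((l + p - 1) div p) \<le> l + p - 1"
    and "real ((l + p - 1) div p) \<le> real l / real p + 1" and "real l / real p \<le> real ((l + p - 1) div p)"
proof -
  let ?k = "(l + p - 1) div p"
  have e: "p * ?k + (l + p - 1) mod p = l + p - 1" "(l + p - 1) mod p < p" using assms by simp_all
  show 1: "l \<le> p * ?k" using e by linarith
  show 2: "p * ?k \<le> l + p - 1" using e by linarith
  have "real p * real ?k \<le> real l + real p" "real l \<le> real p * real ?k"
    using 1 2 of_nat_mono[OF 1, where 'a = real] of_nat_mono[OF 2, where 'a = real] assms by (simp_all add: of_nat_diff)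
  then show "real ?k \<le> real l / real p + 1" "real l / real p \<le> real ?k"
    using assms by (simp_all add: field_simps)
qed

lemma floor_div:
  fixes a b :: nat
  assumes "0 < b"
  shows "real (a div b + 1) \<le> real a / real b + 1" and "real a / real b < real (a div b + 1)"
proof -
  have "b * (a div b) \<le> a" "a < b * (a div b) + b"
    using assms mult_div_mod_eq[of b a] mod_less_divisor[OF assms, of a] by linarith+
  then have "real b * real (a div b) \<le> real a" "real a < real b * real (a div b) + real b"
    by (metis of_nat_le_iff of_nat_mult, metis of_nat_less_iff of_nat_mult of_nat_add)
  then show "real (a div b + 1) \<le> real a / real b + 1" "real a / real b < real (a div b + 1)"
    using assms by (simp_all add: field_simps)
qed

lemma sum_real_lessThan: "(\<Sum>i<p. real i) = real p * (real p - 1) / 2"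
  by (induction p) (auto simp: field_simps)

lemma mp_load_le: "mp_load N p k \<le> real k * (1 + real p * (real p - 1) / 2)"
proof -
  have "(\<Sum>i<p. real (min i ((N + k - 1) div k)) * real k) \<le> (\<Sum>i<p. real i * real k)"
    by (intro sum_mono mult_right_mono) auto
  also have "\<dots> = real p * (real p - 1) / 2 * real k"
    by (simp only: sum_distrib_right[symmetric] sum_real_lessThan)
  finally show ?thesis by (simp add: mp_load_def algebra_simps)
qed

text \<open>The quantity X + Y / 2 per quotient coefficient in a phase with \<open>p\<close> blocks:
  p (p - 1) / 2 history products, one inversion, and (p + 1) / 2 for the short products, divided by
  \<open>p\<close>.\<close>

definition \<psi> :: "nat \<Rightarrow> real" where "\<psi> p = 3 / 2 / real p + real p / 2"

lemma step_load:
  assumes p: "1 \<le> p" and k: "k = (l + p - 1) div p"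
  shows "mp_load N p k + sp_load p k / 2 \<le> real l * \<psi> p + (3 / 2 + real p * real p / 2)"
    and "mp_load N p k \<le> real l / real p + real l * (real p - 1) / 2 + (1 + real p * real p)"
    and "sp_load p k \<le> real l / real p + real l + (1 + real p)"
    and "real l \<le> sp_load p k"
proof -
  have k': "real k \<le> real l / real p + 1" "real l / real p \<le> real k" using ceil_div[OF p] k by simp_all
  have p0: "0 < real p" using p by simp
  have "mp_load N p k + sp_load p k / 2 \<le> real k * (3 / 2 + real p * real p / 2)"
    using mp_load_le[of N p k] by (simp add: sp_load_def algebra_simps add_divide_distrib diff_divide_distrib)
  also have "\<dots> \<le> (real l / real p + 1) * (3 / 2 + real p * real p / 2)"
    by (rule mult_right_mono[OF k'(1)]) simp
  also have "\<dots> = real l * \<psi> p + (3 / 2 + real p * real p / 2)"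
    using p0 by (simp add: \<psi>_def field_simps)
  finally show "mp_load N p k + sp_load p k / 2 \<le> real l * \<psi> p + (3 / 2 + real p * real p / 2)" .
  have "mp_load N p k \<le> (real l / real p + 1) * (1 + real p * (real p - 1) / 2)"
    by (rule order_trans[OF mp_load_le mult_right_mono[OF k'(1)]]) (use p in simp)
  also have "\<dots> = real l / real p + real l * (real p - 1) / 2 + (1 + real p * (real p - 1) / 2)"
    using p0 by (simp add: field_simps)
  also have "\<dots> \<le> real l / real p + real l * (real p - 1) / 2 + (1 + real p * real p)"
    by (simp add: algebra_simps)
  finally show "mp_load N p k \<le> real l / real p + real l * (real p - 1) / 2 + (1 + real p * real p)" .
  have "real p * real k \<le> real p * (real l / real p + 1)" by (rule mult_left_mono[OF k'(1)]) simp
  moreover have "real p * (real l / real p) \<le> real p * real k" by (rule mult_left_mono[OF k'(2)]) simp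
  ultimately show "sp_load p k \<le> real l / real p + real l + (1 + real p)" "real l \<le> sp_load p k"
    using k'(1) p0 by (simp_all add: sp_load_def algebra_simps)
qed

lemma step_fits:
  assumes p: "p = qa * l div (qb * (w + N)) + 1" and k: "k = (l + p - 1) div p" and l: "1 \<le> l" and N: "1 \<le> N" "1 \<le> qb"
    and q: "q = real qa / real qb" "0 \<le> c" "c < q" and big: "(c + real p + 1 + d) * q \<le> real N * (q - c)"
  shows "fits c d N l w p k" and "q * real l / (real w + real N) < real p"
    and "real p \<le> q * real l / (real w + real N) + 1"
proof -
  have p1: "1 \<le> p" by (simp add: p)
  have pb: "q * real l / (real w + real N) < real p" "real p \<le> q * real l / (real w + real N) + 1"
    using floor_div[of "qb * (w + N)" "qa * l"] N by (simp_all add: p q)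
  then show "q * real l / (real w + real N) < real p" "real p \<le> q * real l / (real w + real N) + 1" by blast+
  have k': "real k \<le> real l / real p + 1" "l \<le> p * k" "p * k \<le> l + p - 1" using ceil_div[OF p1] k by simp_all
  have k1: "1 \<le> k" using k'(2) l by (cases k) auto
  have W: "0 < real w + real N" using N by simp
  have q0: "0 < q" using q by simp
  have "q * real l < real p * (real w + real N)" using pb(1) W by (simp add: field_simps)
  then have "real l / real p \<le> (real w + real N) / q" using p1 q0 by (simp add: field_simps)
  then have "c * real k \<le> c * ((real w + real N) / q + 1)" using k'(1) q by (intro mult_left_mono) auto
  moreover have "real p * real k \<le> real l + real p"
    using k'(3) p1 of_nat_mono[OF k'(3), where 'a = real] by (simp add: of_nat_diff)
  moreover have "c * ((real w + real N) / q) + c + real p + 1 + d \<le> real w + real N"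
  proof -
    have "(c + real p + 1 + d) * q \<le> (real w + real N) * (q - c)"
      by (rule order_trans[OF big mult_right_mono]) (use q(3) in simp_all)
    then have "c * (real w + real N) + (c + real p + 1 + d) * q \<le> (real w + real N) * q" by (simp add: algebra_simps)
    then have "(c * (real w + real N) + (c + real p + 1 + d) * q) / q \<le> real w + real N"
      using q0 by (simp add: pos_divide_le_eq)
    moreover have "(c + real p + 1 + d) * q / q = c + real p + 1 + d" using q0 by simp
    ultimately show ?thesis unfolding add_divide_distrib[of "c * (real w + real N)"] by simp
  qed
  ultimately show "fits c d N l w p k" using p1 k1 k'(2) by (simp add: fits_def algebra_simps)
qed

text \<open>The function on the right is convex and homogeneous; its tangent along
  \<open>y = \<theta> * s\<close> is linear in both variables and thus within reach of linear
  arithmetic.\<close>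

lemma sq_div_ge: "0 < (s::real) \<Longrightarrow> 2 * \<theta> * y - \<theta> * \<theta> * s \<le> y * y / s"
proof -
  assume s: "0 < s"
  have "0 \<le> (y - \<theta> * s) * (y - \<theta> * s)" by simp
  then have "(2 * \<theta> * y - \<theta> * \<theta> * s) * s \<le> y * y" by (simp add: algebra_simps)
  then show ?thesis using s by (simp add: pos_le_divide_eq)
qed

lemma psi_ge: "x < real p \<Longrightarrow> real p \<le> x + 1 \<Longrightarrow> r \<le> real p \<Longrightarrow> 0 < r \<Longrightarrow> \<psi> p \<le> 3 / 2 / r + (x + 1) / 2"
proof -
  assume "real p \<le> x + 1" "r \<le> real p" "0 < r"
  then have "3 / 2 / real p \<le> 3 / 2 / r" by (intro divide_left_mono) auto
  then show ?thesis using \<open>real p \<le> x + 1\<close> unfolding \<psi>_def by (intro add_mono) simp_all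
qed

text \<open>Lengths are measured in units of the divisor: \<open>y\<close> for the total,
  \<open>b\<close> and \<open>a\<close> for the two phases. The summand 2 stands for two
  recomputations of the residual and 1/100 for the slack. Block numbers are known only up to
  rounding, so small ones are treated by cases and the rest by tangents.\<close>

lemma two_phase_small:
  fixes y q a b :: real
  assumes y: "1 \<le> y" "y \<le> 5/2" and q: "3 \<le> q" "4 \<le> q * y" and ab: "y = a + b" "a \<le> 2/5 * y" "79/200 * y \<le> a"
    and p1: "q * b / (1 + a) < real p1" "real p1 \<le> q * b / (1 + a) + 1"
    and p2: "q * a < real p2" "real p2 \<le> q * a + 1"
  shows "b * \<psi> p1 + a * \<psi> p2 + 2 + 1/100 \<le> y * (q / 2 + 3 / 2 + 3 / (2 * q))"
proof -
  \<comment> \<open>In terms of \<open>s\<close> and \<open>y\<close>, apart from the quotient by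
    \<open>1 + a\<close>, only \<open>s * y\<close>, \<open>y * y\<close> and
    \<open>y * y / s\<close> are nonlinear.\<close>
  define s where "s = q * y"
  have s: "4 \<le> s" "3 * y \<le> s" "0 < s" using q y by (simp_all add: s_def)
  have q0: "0 < q" using q by simp
  have a: "0 < a" "0 \<le> b" "a \<le> 1" "3/5 * y \<le> b" "b \<le> 121/200 * y" using ab y by auto
  have rhs: "y * (q / 2 + 3 / 2 + 3 / (2 * q)) = s / 2 + 3/2 * y + 3/2 * (y * y / s)"
    using q0 y by (simp add: s_def field_simps)
  have qb: "3/5 * s \<le> q * b" "q * b \<le> 121/200 * s" "q * a \<le> 2/5 * s" "79/200 * s \<le> q * a"
    using mult_left_mono[OF a(4), of q] mult_left_mono[OF a(5), of q] mult_left_mono[OF ab(2), of q] mult_left_mono[OF ab(3), of q] q0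
    by (simp_all add: s_def)
  have p1_2: "2 \<le> p1"
  proof -
    have "1 * (1 + a) \<le> q * b" using qb s a by simp
    then have "1 \<le> q * b / (1 + a)" using a by (simp add: pos_le_divide_eq)
    then show ?thesis using p1 by linarith
  qed
  have p2_2: "2 \<le> p2" using qb s p2 by linarith
  show ?thesis
  \<comment> \<open>\<open>\<psi> 2 = 7/4\<close> is exact here, whereas the general estimate of the
    rounding would be too coarse for two blocks in both phases.\<close>
  proof (cases "p1 = 2 \<and> p2 = 2")
    case True
    have "3/2 * (y * y / s) \<ge> 3/2 * (2 * (1/4) * y - (1/4) * (1/4) * s)" using sq_div_ge[OF s(3), of "1/4" y] by simp
    moreover have "b * \<psi> p1 + a * \<psi> p2 = 7/4 * y" using True ab by (simp add: \<psi>_def algebra_simps)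
    ultimately show ?thesis unfolding rhs using s y by simp
  next
    case False
    let ?x1 = "q * b / (1 + a)" and ?x2 = "q * a"
    have T2: "a * ?x2 / 2 \<le> 2/25 * (s * y)"
    proof -
      have "a * ?x2 \<le> (2/5 * y) * (2/5 * s)" by (rule mult_mono) (use ab qb a s q0 y in auto)
      then show ?thesis by (simp add: ac_simps)
    qed
    \<comment> \<open>\<open>y / (1 + 79/200 * y)\<close> is concave, so any tangent
      \<open>\<alpha> + \<beta> * y\<close> bounds it from above; 79/200 is the lower bound for
      \<open>a / y\<close>.\<close>
    have T1: "b * ?x1 / 2 \<le> 14641/80000 * s * (\<alpha> + \<beta> * y)" if t: "y \<le> (\<alpha> + \<beta> * y) * (1 + 79/200 * y)" and al: "0 \<le> \<alpha>" "0 \<le> \<beta>" for \<alpha> \<beta>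
    proof -
      have n0: "0 \<le> \<alpha> + \<beta> * y" using al y by simp
      have a1: "0 < 1 + a" using a by simp
      have "(\<alpha> + \<beta> * y) * (1 + 79/200 * y) \<le> (\<alpha> + \<beta> * y) * (1 + a)" by (rule mult_left_mono) (use ab n0 in auto)
      then have 1: "y \<le> (\<alpha> + \<beta> * y) * (1 + a)" using t by linarith
      have "b * (q * b) \<le> (121/200 * y) * (121/200 * s)" by (rule mult_mono) (use a qb s q0 y in auto)
      also have "\<dots> = 14641/40000 * s * y" by simp
      also have "\<dots> \<le> 14641/40000 * s * ((\<alpha> + \<beta> * y) * (1 + a))" by (rule mult_left_mono[OF 1]) (use s in simp)
      finally have "b * (q * b) / (1 + a) \<le> 14641/40000 * s * (\<alpha> + \<beta> * y)" 
        unfolding pos_divide_le_eq[OF a1] by (simp only: mult.assoc)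
      moreover have "b * ?x1 = b * (q * b) / (1 + a)" by simp
      ultimately have "b * ?x1 \<le> 14641/40000 * s * (\<alpha> + \<beta> * y)" by simp
      then have "b * ?x1 / 2 \<le> 14641/40000 * s * (\<alpha> + \<beta> * y) / 2" by (rule divide_right_mono) simp
      then show ?thesis by simp
    qed
    \<comment> \<open>The tangent at \<open>y = 12/10\<close>, rounded up; it serves the smaller
      values of \<open>y\<close>.\<close>
    have t1: "b * ?x1 / 2 \<le> 14641/80000 * s * (263/1000 + 4603/10000 * y)"
    proof (rule T1)
      have "0 \<le> (y - 12/10) * (y - 12/10)" by simp
      moreover have "(y - 12/10) * (y - 12/10) = y * y - 24/10 * y + 144/100" by (simp add: algebra_simps)
      moreover have "(263/1000 + 4603/10000 * y) * (1 + 79/200 * y) = 263/1000 + 564185/1000000 * y + 363637/2000000 * (y * y)"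
        by (simp add: field_simps)
      ultimately show "y \<le> (263/1000 + 4603/10000 * y) * (1 + 79/200 * y)" using y by linarith
    qed auto
    \<comment> \<open>The tangent at \<open>y = 2\<close>, rounded up, for the larger
      values.\<close>
    have t2: "b * ?x1 / 2 \<le> 14641/80000 * s * (494/1000 + 3121/10000 * y)"
    proof (rule T1)
      have "0 \<le> (y - 2) * (y - 2)" by simp
      moreover have "(y - 2) * (y - 2) = y * y - 4 * y + 4" by (simp add: algebra_simps)
      moreover have "(494/1000 + 3121/10000 * y) * (1 + 79/200 * y) = 494/1000 + 50723/100000 * y + 246559/2000000 * (y * y)"
        by (simp add: field_simps)
      ultimately show "y \<le> (494/1000 + 3121/10000 * y) * (1 + 79/200 * y)" using y by linarith
    qed auto
    have e3: "x * (3 / 2 / 3 + (u + 1) / 2) = x + x * u / 2" and e2: "x * (3 / 2 / 2 + (u + 1) / 2) = 5/4 * x + x * u / 2" for x u :: real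
      by (simp_all add: field_simps)
    \<comment> \<open>A third block in the first phase lowers the bound on \<open>\<psi> p1\<close>
      and, by the rounding rule for \<open>p1\<close>, also forces \<open>s\<close> to be
      large.\<close>
    have c1: "b * \<psi> p1 + a * \<psi> p2 \<le> b * ?x1 / 2 + a * ?x2 / 2 + 11/10 * y \<and> (2 + 79/100 * y) * (200/121) \<le> s" if "3 \<le> p1"
    proof -
      have 1: "b * \<psi> p1 \<le> b * (3 / 2 / 3 + (?x1 + 1) / 2)" by (rule mult_left_mono[OF psi_ge[OF p1]]) (use that a in auto)
      have 2: "a * \<psi> p2 \<le> a * (3 / 2 / 2 + (?x2 + 1) / 2)" by (rule mult_left_mono[OF psi_ge[OF p2]]) (use p2_2 a in auto)
      have "2 \<le> ?x1" using p1 that by linarith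
      then have "2 * (1 + a) \<le> q * b" using a by (simp add: pos_le_divide_eq)
      then have 3: "2 + 2 * (79/200 * y) \<le> 121/200 * s" using qb(2) ab(3) by simp
      have "(2 + 79/100 * y) * (200/121) \<le> s" using 3 by simp
      moreover have "b * \<psi> p1 + a * \<psi> p2 \<le> b * ?x1 / 2 + a * ?x2 / 2 + 11/10 * y" using 1[unfolded e3] 2[unfolded e2] ab(1,2) by linarith
      ultimately show ?thesis by blast
    qed
    have c2: "b * \<psi> p1 + a * \<psi> p2 \<le> b * ?x1 / 2 + a * ?x2 / 2 + 115125/100000 * y \<and> 5 \<le> s" if "3 \<le> p2"
    proof -
      have 1: "b * \<psi> p1 \<le> b * (3 / 2 / 2 + (?x1 + 1) / 2)" by (rule mult_left_mono[OF psi_ge[OF p1]]) (use p1_2 a in auto)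
      have 2: "a * \<psi> p2 \<le> a * (3 / 2 / 3 + (?x2 + 1) / 2)" by (rule mult_left_mono[OF psi_ge[OF p2]]) (use that a in auto)
      have "2 \<le> ?x2" using p2 that by linarith
      then have 3: "5 \<le> s" using qb by linarith
      have "b * \<psi> p1 + a * \<psi> p2 \<le> b * ?x1 / 2 + a * ?x2 / 2 + 115125/100000 * y" using 1[unfolded e2] 2[unfolded e3] ab(1,3) by linarith
      with 3 show ?thesis by blast
    qed
    have c: "3 \<le> p1 \<or> 3 \<le> p2" using False p1_2 p2_2 by linarith
    show ?thesis
    proof (cases "y \<le> 8/5")
      case True
      \<comment> \<open>What remains of the coefficient of \<open>s\<close> after all terms are
        collected, rounded down. A lower bound for \<open>s * K\<close> now decides.\<close>
      define K where "K = 35810/100000 - 16430/100000 * y"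
      have K: "0 \<le> K" using True by (simp add: K_def)
      have sq: "3/2 * (2 * (1/4) * y - (1/4) * (1/4) * s) \<le> 3/2 * (y * y / s)" using sq_div_ge[OF s(3), of "1/4" y] by simp
      have sK: "s * K = 35810/100000 * s - 16430/100000 * (s * y)" by (simp add: K_def algebra_simps)
      have T: "b * ?x1 / 2 + a * ?x2 / 2 \<le> 3850583/80000000 * s + 131392523/800000000 * (s * y)"
        
      proof -
        have "14641/80000 * s * (263/1000 + 4603/10000 * y) = 3850583/80000000 * s + 67392523/800000000 * (s * y)" by (simp add: field_simps)
        then show ?thesis using t1 T2 by linarith
      qed
      have sy: "0 \<le> s * y" using s y by simp
      from c show ?thesis
      proof
        assume "3 \<le> p1"
        then have h: "b * \<psi> p1 + a * \<psi> p2 \<le> b * ?x1 / 2 + a * ?x2 / 2 + 11/10 * y" "(2 + 79/100 * y) * (200/121) \<le> s" using c1 by blast+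
        have "(2 + 79/100 * y) * (200/121) * K = 14324000/12100000 - 914020/12100000 * y - 2595940/12100000 * (y * y)"
          unfolding K_def by (simp add: field_simps)
        then have 1: "14324000/12100000 - 914020/12100000 * y - 2595940/12100000 * (y * y) \<le> s * K" using mult_right_mono[OF h(2) K] by simp
        have "(y - 1) * (8/5 - y) = 13/5 * y - 8/5 - y * y" by (simp add: field_simps)
        moreover have "0 \<le> (y - 1) * (8/5 - y)" using True y by simp
        ultimately have 2: "y * y \<le> 13/5 * y - 8/5" by linarith
        have "2 + 1/100 \<le> s * K + 115/100 * y" using 1 2 y True by linarith
        then show ?thesis unfolding rhs using h(1) T sq sK sy s by (linarith | argo | smt (verit))
      next
        assume "3 \<le> p2"
        then have h: "b * \<psi> p1 + a * \<psi> p2 \<le> b * ?x1 / 2 + a * ?x2 / 2 + 115125/100000 * y" "5 \<le> s" using c2 by blast+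
        have "5 * K \<le> s * K" by (rule mult_right_mono[OF h(2) K])
        then have "2 + 1/100 \<le> s * K + 109875/100000 * y" using y by (simp add: K_def)
        then show ?thesis unfolding rhs using h(1) T sq sK sy s by (linarith | argo | smt (verit))
      qed
    next
      case False
      define K where "K = 34959/100000 - 13712/100000 * y"
      have K: "0 \<le> K" using y by (simp add: K_def)
      have sq: "3/2 * (2 * (1/5) * y - (1/5) * (1/5) * s) \<le> 3/2 * (y * y / s)" using sq_div_ge[OF s(3), of "1/5" y] by simp
      have sK: "s * K = 34959/100000 * s - 13712/100000 * (s * y)" by (simp add: K_def algebra_simps)
      have T: "b * ?x1 / 2 + a * ?x2 / 2 \<le> 7232654/80000000 * s + 109694561/800000000 * (s * y)"
        
      proof -
        have "14641/80000 * s * (494/1000 + 3121/10000 * y) = 7232654/80000000 * s + 45694561/800000000 * (s * y)" by (simp add: field_simps)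
        then show ?thesis using t2 T2 by linarith
      qed
      have sy: "0 \<le> s * y" using s y by simp
      have h: "b * \<psi> p1 + a * \<psi> p2 \<le> b * ?x1 / 2 + a * ?x2 / 2 + 115125/100000 * y" using c c1 c2 y by fastforce
      have "3 * y * K = 104877/100000 * y - 41136/100000 * (y * y)" unfolding K_def by (simp add: field_simps)
      then have 1: "104877/100000 * y - 41136/100000 * (y * y) \<le> s * K" using mult_right_mono[OF s(2) K] by simp
      have "(y - 8/5) * (5/2 - y) = 41/10 * y - 4 - y * y" by (simp add: field_simps)
      moreover have "0 \<le> (y - 8/5) * (5/2 - y)" using False y by simp
      ultimately have 2: "y * y \<le> 41/10 * y - 4" by linarith
      have "2 + 1/100 \<le> s * K + 94875/100000 * y" using 1 2 y False by linarith
      moreover have "3/5 * y - 6/100 * s \<le> 3/2 * (y * y / s)" using sq by (simp add: field_simps)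
      moreover have gen: "B + 2 + 1/100 \<le> s / 2 + 3/2 * y + w" if "2 + 1/100 \<le> sK + 94875/100000 * y" "3/5 * y - 6/100 * s \<le> w"
        "B \<le> t + 115125/100000 * y" "t \<le> 7232654/80000000 * s + 109694561/800000000 * sy"
        "sK = 34959/100000 * s - 13712/100000 * sy" "0 \<le> sy" "0 < s" for B w sK t sy s :: real
        using that by linarith
      ultimately show ?thesis unfolding rhs using gen[OF _ _ h T sK sy s(3)] by blast
    qed
  qed
qed

text \<open>The right-hand side is the exact sum when \<open>w\<close> is an integer; between
  integers it errs on the safe side.\<close>

lemma sum_min_le: "0 \<le> w \<Longrightarrow> w \<le> real p \<Longrightarrow> (\<Sum>i<p. min (real i) w) \<le> w * (2 * real p - 1 - w) / 2"
proof (induction p)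
  case (Suc p)
  show ?case
  proof (cases "w \<le> real p")
    case True
    then show ?thesis using Suc by (simp add: algebra_simps)
  next
    case False
    have "(\<Sum>i<Suc p. min (real i) w) = (\<Sum>i<Suc p. real i)" using False by (intro sum.cong) auto
    also have "\<dots> = real (Suc p) * (real (Suc p) - 1) / 2" by (rule sum_real_lessThan)
    also have "\<dots> \<le> w * (2 * real (Suc p) - 1 - w) / 2"
      using mult_nonneg_nonneg[of "w - real p" "real (Suc p) - w"] False Suc.prems by (simp add: field_simps)
    finally show ?thesis .
  qed
qed simp

text \<open>When the phase is longer than the divisor, histories stop growing at about N / k blocks.
  Counting \<open>i\<close> history blocks for every row would give a load that grows with the
  square of \<open>l\<close>.\<close>

lemma mp_load_large:
  assumes N: "1 \<le> N" and l: "3 * N \<le> 2 * l" and q: "3 \<le> q"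
    and p: "q * real l / (2 * real N) < real p" "real p \<le> q * real l / (2 * real N) + 1" and k: "k = (l + p - 1) div p"
  shows "mp_load N p k \<le> real l * (q / 2 + 1) - q * real N / 4 - real N / 2 + 1 + real p * real p"
proof -
  have l0: "0 < real l" "0 < real N" "3 * real N \<le> 2 * real l" using N l by linarith+
  have "9/4 \<le> q * real l / (2 * real N)"
  proof -
    have "3 * (3 * real N) \<le> q * (2 * real l)" by (rule mult_mono) (use q l0 in auto)
    then show ?thesis using l0 by (simp add: field_simps)
  qed
  then have p3: "3 \<le> p" using p by linarith
  then have p1: "1 \<le> p" by simp
  define r where "r = real l / real p"
  have p0: "0 < real p" using p1 by simp
  have r: "0 < r" "r * real p = real l" using l0 p0 by (simp_all add: r_def)
  have k': "real k \<le> r + 1" "r \<le> real k" using ceil_div[OF p1] k by (simp_all add: r_def)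
  have k1: "1 \<le> k" using k'(2) r by (cases k) auto
  \<comment> \<open>The row at which the history covers the whole divisor, with one unit for
    rounding up; \<open>r\<close> approximates the block size.\<close>
  define w where "w = real N / r + 1"
  have w: "0 \<le> w" "r * w = real N + r" using r l0 by (simp_all add: w_def field_simps)
  have wp: "w \<le> real p"
  proof -
    have "3 * real N * real p \<le> 2 * real l * real p" by (rule mult_right_mono) (use l0 p0 in auto)
    moreover have "3 * real l \<le> real l * real p" using p3 l0 by simp
    ultimately have "real N * real p + real l \<le> real l * real p" by linarith
    then show ?thesis using r l0 p0 by (simp add: w_def r_def field_simps)
  qed
  have row: "real (min i ((N + k - 1) div k)) * real k \<le> r * min (real i) w + real p" if "i < p" for i
  proof -
    have c: "real ((N + k - 1) div k) * real k \<le> real N + real k - 1"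
      using ceil_div(2)[OF k1, of N] of_nat_mono[OF ceil_div(2)[OF k1, of N], where 'a = real] k1 by (simp add: of_nat_diff mult.commute)
    have 1: "real (min i ((N + k - 1) div k)) * real k \<le> real i * real k" by (rule mult_right_mono) auto
    have 2: "real (min i ((N + k - 1) div k)) * real k \<le> real N + r"
      by (rule order_trans[OF mult_right_mono[of _ "real ((N + k - 1) div k)"]]) (use c k' in auto)
    have "real i * real k \<le> real i * (r + 1)" by (rule mult_left_mono[OF k'(1)]) simp
    then have "real i * real k \<le> r * real i + real p" using that by (simp add: algebra_simps)
    then show ?thesis using 1 2 w p0 by (cases "real i \<le> w") (auto simp: min_def)
  qed
  have "mp_load N p k \<le> (r + 1) + (\<Sum>i<p. r * min (real i) w + real p)"
    unfolding mp_load_def by (intro add_mono sum_mono row k') auto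
  also have "(\<Sum>i<p. r * min (real i) w + real p) = r * (\<Sum>i<p. min (real i) w) + real p * real p"
    by (simp add: sum.distrib sum_distrib_left)
  also have "r * (\<Sum>i<p. min (real i) w) \<le> r * (w * (2 * real p - 1 - w) / 2)"
    by (rule mult_left_mono[OF sum_min_le[OF w(1) wp]]) (use r in simp)
  also have "r * (w * (2 * real p - 1 - w) / 2) = real N * real p * (1 - real N / (2 * real l)) + real l - r - 3/2 * real N"
  proof -
    have "r * (w * (2 * real p - 1 - w) / 2) = (real N + r) * (2 * real p - 2 - real N / r) / 2"
      using w(2) by (simp add: w_def flip: mult.assoc)
    also have "\<dots> = real N * real p + r * real p - real N - r - real N * (real N / r) / 2 - real N / 2"
      using r(1) by (simp add: field_simps)
    also have "real N / r = real N * real p / real l" by (simp add: r_def)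
    finally show ?thesis using r(2) l0 by (simp add: field_simps)
  qed
  also have "real N * real p * (1 - real N / (2 * real l)) \<le> (q * real l / 2 + real N) * (1 - real N / (2 * real l))"
  proof (rule mult_right_mono)
    have "real N * real p \<le> real N * (q * real l / (2 * real N) + 1)" by (rule mult_left_mono[OF p(2)]) simp
    moreover have "real N * (q * real l / (2 * real N) + 1) = q * real l / 2 + real N" using l0 by (simp add: field_simps)
    ultimately show "real N * real p \<le> q * real l / 2 + real N" by linarith
    show "0 \<le> 1 - real N / (2 * real l)" using l0 by (simp add: field_simps)
  qed
  also have "(q * real l / 2 + real N) * (1 - real N / (2 * real l)) = q * real l / 2 - q * real N / 4 + real N - real N * real N / (2 * real l)"
    using l0 by (simp add: field_simps)
  also have "\<dots> \<le> q * real l / 2 - q * real N / 4 + real N" using l0 by simp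
  finally show ?thesis by (simp add: algebra_simps)
qed


section \<open>Choice of phases and block numbers\<close>

text \<open>The least integer above \<open>q * l / (w + N)\<close> for \<open>q = qa / qb\<close>;
  an integer expression, so that the program computes the very number used in the estimates.\<close>

definition pieces :: "nat \<Rightarrow> nat \<Rightarrow> nat \<Rightarrow> nat \<Rightarrow> nat \<Rightarrow> nat" where
  "pieces qa qb N l w = qa * l div (qb * (w + N)) + 1"

definition cdiv :: "nat \<Rightarrow> nat \<Rightarrow> nat" where "cdiv l p = (l + p - 1) div p"

context
  fixes c d \<mu> q P :: real and qa qb C N :: nat
  assumes c: "3 \<le> c" and q: "q = real qa / real qb" "c < q" "q < c + 1/1000" and qb: "1 \<le> qb"
    and C: "q < real C" "real C \<le> c + 1"
    and mu: "0 < \<mu>" "\<mu> \<le> 1/1000" "2 * \<mu> \<le> 1 / c - 1 / real C"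
    and P: "8 * q + 1 \<le> P" and NP: "10 * (P * P) \<le> \<mu> * real N" "(c + P + 1 + d) * q \<le> real N * (q - c)"
begin

lemma N_large: "1 \<le> N" "25 \<le> P" "P \<le> P * P" "200 \<le> real N"
proof -
  show 1: "25 \<le> P" using P c q by linarith
  show 2: "P \<le> P * P" using 1 by simp
  have "\<mu> * real N \<le> 1/1000 * real N" by (rule mult_right_mono) (use mu in auto)
  then have "250 \<le> 1/1000 * real N" using 1 2 NP by linarith
  then show "200 \<le> real N" "1 \<le> N" by simp_all
qed

lemma ic: "1 / c \<le> 1/3" "0 < 1 / c" "26/10 \<le> c / 4 + 7 * (1 / c)" "2 * \<mu> \<le> 1 / c"
proof -
  show "1 / c \<le> 1/3" "0 < 1 / c" using c by (auto simp: field_simps)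
  \<comment> \<open>52/10 is close to the square root of 28, where
    \<open>c / 4 + 7 * (1 / c)\<close> attains its minimum, the square root of 7.\<close>
  have "0 \<le> (c - 52/10) * (c - 52/10)" by simp
  then have "104/10 * c \<le> c * c + 28" by (simp add: algebra_simps)
  then show "26/10 \<le> c / 4 + 7 * (1 / c)" using c by (simp add: field_simps)
  have "0 \<le> 1 / real C" by simp
  then show "2 * \<mu> \<le> 1 / c" using mu by linarith
qed

text \<open>Since \<open>l\<close> is at most \<open>8 * N\<close>, no phase has more than about
  \<open>8 * q\<close> blocks. Hence the single constant \<open>P\<close> dominates all rounding
  terms, and \<open>N\<close> only has to be large compared with it.\<close>

lemma pieces_fit:
  assumes l: "1 \<le> l" "l \<le> 8 * N" and p: "p = pieces qa qb N l w" and k: "k = cdiv l p"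
  shows "fits c d N l w p k" "q * real l / (real w + real N) < real p" "real p \<le> q * real l / (real w + real N) + 1"
    "1 \<le> p" "real p \<le> P" "real p * real p \<le> P * P" "real l / real p \<le> (real w + real N) * (1 / c)"
proof -
  have N: "1 \<le> N" using N_large by simp
  have q0: "0 < q" "0 \<le> c" using q c by simp_all
  note p' = p[unfolded pieces_def] and k' = k[unfolded cdiv_def]
  have fl: "q * real l / (real w + real N) < real p" "real p \<le> q * real l / (real w + real N) + 1"
    using floor_div[of "qb * (w + N)" "qa * l"] N qb by (simp_all add: p' q(1))
  show "q * real l / (real w + real N) < real p" "real p \<le> q * real l / (real w + real N) + 1" by (fact fl)+
  show p1: "1 \<le> p" by (simp add: p')
  have "real l \<le> 8 * real N" using of_nat_mono[OF l(2), where 'a = real] by simp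
  then have W: "0 < real w + real N" "real l \<le> 8 * (real w + real N)" using N of_nat_0_le_iff[of w, where 'a = real] by simp_all
  have "q * real l \<le> q * (8 * (real w + real N))" by (rule mult_left_mono) (use W q0 in auto)
  then have "q * real l / (real w + real N) \<le> 8 * q" using W(1) by (simp add: pos_divide_le_eq algebra_simps)
  then show pP: "real p \<le> P" using fl P by linarith
  show "real p * real p \<le> P * P" by (rule mult_mono) (use pP in auto)
  have "(c + real p + 1 + d) * q \<le> (c + P + 1 + d) * q" by (rule mult_right_mono) (use pP q0 in auto)
  then have "(c + real p + 1 + d) * q \<le> real N * (q - c)" using NP by linarith
  then show "fits c d N l w p k" by (rule step_fits(1)[OF p' k' l(1) N qb q(1) q0(2) q(2)])
  have "c * real l \<le> q * real l" by (rule mult_right_mono) (use q in auto)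
  also have "q * real l \<le> real p * (real w + real N)" using fl(1) W by (simp add: pos_divide_less_eq less_imp_le)
  finally show "real l / real p \<le> (real w + real N) * (1 / c)" using p1 c by (simp add: field_simps)
qed

text \<open>The hypotheses force exactly \<open>C\<close> blocks. As \<open>C \<le> c + 1\<close>
  and the one recomputation costs \<open>N \<le> R\<close>, the third condition reduces to comparing
  3/2 R / C with 3/2 R / c. The gap between these is the slack, which explains the bound on
  \<open>\<mu>\<close>.\<close>

lemma one_phase:
  assumes R: "N < R" "qa * R < C * qb * N" and p: "p = pieces qa qb N R 0" and k: "k = cdiv R p"
  shows "fits c d N R 0 p k \<and> load_ok c \<mu> N R 1 (mp_load N p k) (sp_load p k)"
proof -
  have N0: "0 < real N" using N_large by simp
  have "real qa * real R < real C * real qb * real N" using R(2) by (metis of_nat_less_iff of_nat_mult)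
  then have qR: "q * real R < real C * real N" using qb by (simp add: q(1) field_simps)
  have "c * real R \<le> q * real R" by (rule mult_right_mono) (use q in auto)
  moreover have "real C * real N \<le> (c + 1) * real N" by (rule mult_right_mono) (use C in auto)
  moreover have "real N < real R" using R by simp
  ultimately have "c * (real R - real N) < real N" using qR unfolding right_diff_distrib distrib_right by linarith
  moreover have "3 * (real R - real N) \<le> c * (real R - real N)" by (rule mult_right_mono) (use c R in auto)
  ultimately have "3 * (real R - real N) < real N" by (rule le_less_trans[rotated])
  then have "real R \<le> 8 * real N" using N0 by (simp add: algebra_simps)
  then have R8: "R \<le> 8 * N" by simp
  have R1: "1 \<le> R" using R by simp
  note F = pieces_fit[OF R1 R8 p k]
  have "q * real R / real N < real C" using qR N0 by (simp add: pos_divide_less_eq)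
  then have "real p < real C + 1" using F(3) by simp
  moreover have "q * 1 \<le> q * (real R / real N)" by (rule mult_left_mono) (use R N0 q c in auto)
  then have "real C < real p + 1" using F(2) C q by simp
  ultimately have pC: "p = C" by linarith
  note S = step_load(1,2)[OF F(4) k[unfolded cdiv_def], of N] and S' = step_load(3,4)[OF F(4) k[unfolded cdiv_def]]
  have f: "real C * real C \<le> P * P" "real C \<le> P" using F(5,6) pC by simp_all
  have iC: "real R / real p = real R * (1 / real C)" "1 / real C \<le> 1 / c" "real R * (1 / real C) \<le> real R * (1 / c)"
  proof -
    have "1 / real C \<le> 1 / c" using mu by linarith
    then show "1 / real C \<le> 1 / c" "real R * (1 / real C) \<le> real R * (1 / c)" by (simp, intro mult_left_mono) simp_all
    show "real R / real p = real R * (1 / real C)" using pC by simp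
  qed
  have l1: "real R * (real p - 1) / 2 \<le> c / 2 * real R"
    using mult_left_mono[of "real C - 1" c "real R"] C pC by (simp add: mult.commute)
  have mN: "\<mu> * real N \<le> 1/1000 * real N" by (rule mult_right_mono) (use mu in auto)
  have RN: "real N \<le> real R" using R by simp
  define i where "i = 1 / c"
  define j where "j = 1 / real C"
  have rp: "real R / real p = real R * j" "real R * j \<le> real R * i" using iC by (simp_all add: i_def j_def)
  have b3: "(c / 2 + 3 / 2 + 3 / (2 * c)) * real R = c / 2 * real R + 3/2 * real R + 3/2 * (real R * i)" by (simp add: i_def algebra_simps)
  have b1: "(c / 2 + 1 / 2 + 1 / c) * real R = c / 2 * real R + 1/2 * real R + real R * i" by (simp add: i_def algebra_simps)
  have b2: "(2 + 1 / c) * real R = 2 * real R + real R * i" by (simp add: i_def algebra_simps)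
  have PP: "10 * (P * P) \<le> \<mu> * real N" "P \<le> P * P" "25 \<le> P" "200 \<le> real N" using NP(1) N_large by simp_all
  have x1: "mp_load N p k \<le> (c / 2 + 1 / 2 + 1 / c) * real R - \<mu> * real N"
    unfolding b1 using S(2) rp l1 F(6) mN RN PP by linarith
  have x2: "sp_load p k \<le> (2 + 1 / c) * real R - \<mu> * real N"
    unfolding b2 using S'(1) rp F(5) mN RN PP by linarith
  have x3: "mp_load N p k + sp_load p k / 2 + real 1 * real N \<le> (c / 2 + 3 / 2 + 3 / (2 * c)) * real R - \<mu> * real N"
  proof -
    have "2 * \<mu> * real R \<le> (i - j) * real R" by (rule mult_right_mono) (use mu in \<open>auto simp: i_def j_def\<close>)
    then have m: "2 * (\<mu> * real R) \<le> real R * i - real R * j" by (simp add: algebra_simps)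
    have m2: "\<mu> * real N \<le> \<mu> * real R" by (rule mult_left_mono) (use RN mu in auto)
    have e: "real R * \<psi> p = 3/2 * (real R * j) + real R * real C / 2" by (simp add: \<psi>_def pC j_def algebra_simps)
    have rc: "real R * real C / 2 \<le> c / 2 * real R + 1/2 * real R" using mult_left_mono[OF C(2), of "real R"] by (simp add: algebra_simps)
    have "mp_load N p k + sp_load p k / 2 + real N \<le> c / 2 * real R + 3/2 * real R + 3/2 * (real R * i) - \<mu> * real N"
      using S(1)[unfolded e] rc m m2 F(6) PP RN by linarith
    then show ?thesis unfolding b3 by simp
  qed
  show ?thesis using F(1) x1 x2 x3 by (simp add: load_ok_def)
qed

text \<open>The room of the \<open>l2\<close> coefficients left for later permits larger blocks in
  the earlier phase. About two fifths are left, but never more than \<open>N\<close>. Below the cap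
  the estimate is \<open>two_phase_small\<close>; at the cap the earlier phase exceeds the divisor
  in length and its bounded histories are used.\<close>

lemma two_phases:
  assumes R: "C * qb * N \<le> qa * R" "R \<le> 8 * N" and l2: "l2 = min N (2 * R div 5)" and l1: "l1 = R - l2"
    and p1: "p1 = pieces qa qb N l1 l2" and k1: "k1 = cdiv l1 p1" and p2: "p2 = pieces qa qb N l2 0" and k2: "k2 = cdiv l2 p2"
  shows "fits c d N l1 l2 p1 k1 \<and> fits c d N l2 0 p2 k2 \<and>
    load_ok c \<mu> N R 2 (mp_load N p1 k1 + mp_load N p2 k2) (sp_load p1 k1 + sp_load p2 k2)"
proof -
  have N0: "0 < real N" "200 \<le> real N" using N_large by simp_all
  have q0: "0 < q" "3 \<le> q" using c q by simp_all
  have "real C * real qb * real N \<le> real qa * real R" using R(1) by (metis of_nat_le_iff of_nat_mult)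
  then have qR: "real C * real N \<le> q * real R" using qb by (simp add: q(1) field_simps)
  have "q * real N \<le> real C * real N" by (rule mult_right_mono) (use C in auto)
  then have "q * real N \<le> q * real R" using qR by linarith
  then have RN: "real N \<le> real R" using q0 by simp
  have "3 < real C" using C q c by linarith
  then have "4 \<le> C" by simp
  then have "4 \<le> real C" by simp
  then have "4 * real N \<le> real C * real N" by (intro mult_right_mono) auto
  then have qR4: "4 * real N \<le> q * real R" using qR by linarith
  have l2_le: "real l2 \<le> real N" "5 * real l2 \<le> 2 * real R" using l2 by linarith+
  have R200: "200 \<le> real R" using RN N0 by linarith
  have l2_ge: "real l2 = real N \<or> 79/200 * real R \<le> real l2" using l2 R200 by linarith
  have sum: "real l1 + real l2 = real R" using l1 l2_le by linarith
  have l2_1: "1 \<le> l2" using l2_ge R200 N0 by linarith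
  have l1_1: "1 \<le> l1" using sum l2_le R200 by linarith
  have l8: "l1 \<le> 8 * N" "l2 \<le> 8 * N" using R l1 l2 by linarith+
  note F1 = pieces_fit[OF l1_1 l8(1) p1 k1] and F2 = pieces_fit[OF l2_1 l8(2) p2 k2]
  note S1 = step_load(1,2)[OF F1(4) k1[unfolded cdiv_def], of N] and S1' = step_load(3,4)[OF F1(4) k1[unfolded cdiv_def]] and S2 = step_load(1,2)[OF F2(4) k2[unfolded cdiv_def], of N] and S2' = step_load(3,4)[OF F2(4) k2[unfolded cdiv_def]]
  define i where "i = 1 / c"
  have i: "i \<le> 1/3" "0 < i" "26/10 \<le> c / 4 + 7 * i" "2 * \<mu> \<le> i" using ic by (simp_all add: i_def)
  have mN: "\<mu> * real N \<le> 1/1000 * real N" by (rule mult_right_mono) (use mu in auto)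
  have const: "10 * (P * P) \<le> \<mu> * real N" "P \<le> P * P" "25 \<le> P" using NP N_large by simp_all
  have iN: "2 * (\<mu> * real N) \<le> i * real N" using mult_right_mono[OF i(4), of "real N"] by simp
  have iRN: "i * real N \<le> i * real R" by (rule mult_left_mono) (use RN i in auto)
  have i3: "i * real N \<le> real N / 3" using mult_right_mono[OF i(1), of "real N"] by simp
  have f1: "real l1 / real p1 \<le> i * real l2 + i * real N" using F1(7) by (simp add: i_def algebra_simps)
  have f2: "real l2 / real p2 \<le> i * real N" using F2(7) by (simp add: i_def algebra_simps)
  have il2: "i * real l2 \<le> i * real N" by (rule mult_left_mono) (use l2_le i in auto)
  have b3: "(c / 2 + 3 / 2 + 3 / (2 * c)) * real R = c / 2 * real R + 3/2 * real R + 3/2 * (i * real R)" by (simp add: i_def algebra_simps)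
  have b1: "(c / 2 + 1 / 2 + 1 / c) * real R = c / 2 * real R + 1/2 * real R + i * real R" by (simp add: i_def algebra_simps)
  have b2: "(2 + 1 / c) * real R = 2 * real R + i * real R" by (simp add: i_def algebra_simps)
  let ?X = "mp_load N p1 k1 + mp_load N p2 k2" and ?Y = "sp_load p1 k1 + sp_load p2 k2"
  have Y: "?Y \<le> 3 * (i * real N) + real R + 3 * (P * P)" using S1'(1) S2'(1) f1 f2 il2 sum F1(5) F2(5) const by linarith
  have x2: "?Y \<le> (2 + 1 / c) * real R - \<mu> * real N" unfolding b2 using Y i3 iN iRN const RN by linarith
  have cq: "q / 2 * real R \<le> c / 2 * real R + real R / 2000"
    using mult_right_mono[of q "c + 1/1000" "real R"] q by (simp add: algebra_simps)
  have "?X \<le> (c / 2 + 1 / 2 + 1 / c) * real R - \<mu> * real N \<and>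
    ?X + ?Y / 2 + real 2 * real N \<le> (c / 2 + 3 / 2 + 3 / (2 * c)) * real R - \<mu> * real N"
  proof (cases "l2 = N")
    case True
    have R5: "5 * real N \<le> 2 * real R" using l2_le True by simp
    have d1: "2 * real N = real l2 + real N" using True by simp
    have X1: "mp_load N p1 k1 \<le> real l1 * (q / 2 + 1) - q * real N / 4 - real N / 2 + 1 + real p1 * real p1"
      by (rule mp_load_large[OF _ _ q0(2) _ _ k1[unfolded cdiv_def]])
        (use N_large R5 sum True F1(2,3) in \<open>auto simp flip: d1\<close>)
    have "real N * (real p2 - 1) \<le> real N * q" by (rule mult_left_mono) (use F2(3) True N0 in auto)
    then have X2: "mp_load N p2 k2 \<le> i * real N + q * real N / 2 + 1 + real p2 * real p2"
    proof -
      assume "real N * (real p2 - 1) \<le> real N * q"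
      then have "real N * (real p2 - 1) / 2 \<le> q * real N / 2" by (simp add: mult.commute)
      then show ?thesis using S2(2) f2 unfolding True by linarith
    qed
    have e: "real l1 * (q / 2 + 1) = q / 2 * real R + real R - q * real N / 2 - real N"
      using sum True by (simp add: algebra_simps add_divide_distrib diff_divide_distrib flip: sum)
    have cN: "c * real N \<le> q * real N" by (rule mult_right_mono) (use q in auto)
    have X: "?X \<le> c / 2 * real R + real R / 2000 + real R - c * real N / 4 - 3/2 * real N + i * real N + 2 + 2 * (P * P)"
      using X1 X2 e cq cN F1(6) F2(6) by linarith
    have R8: "real R \<le> 8 * real N" using R by linarith
    have "real R * (1/2 - i) \<le> 8 * real N * (1/2 - i)" by (rule mult_right_mono[OF R8]) (use i in simp)
    moreover have "26/10 * real N \<le> (c / 4 + 7 * i) * real N" by (rule mult_right_mono[OF i(3)]) simp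
    ultimately have "1/2 * real R - i * real R + 26/10 * real N \<le> 4 * real N + c * real N / 4 - i * real N"
      by (simp add: algebra_simps)
    then have x1: "?X \<le> (c / 2 + 1 / 2 + 1 / c) * real R - \<mu> * real N" unfolding b1 using X const mN R8 by linarith
    have "3 * real N \<le> c * real N" by (rule mult_right_mono) (use c in auto)
    moreover have "5/2 * (i * real N) \<le> i * real R" using mult_left_mono[OF R5, of i] i by simp
    ultimately have x3: "?X + ?Y / 2 + real 2 * real N \<le> (c / 2 + 3 / 2 + 3 / (2 * c)) * real R - \<mu> * real N"
    proof -
      assume A: "3 * real N \<le> c * real N" "5/2 * (i * real N) \<le> i * real R"
      have gen: "X + Y / 2 + 2 * N \<le> cR / 2 + 3/2 * R + 3/2 * iR - m"
        if "3 * N \<le> cN" "5/2 * iN \<le> iR" "X \<le> cR / 2 + R / 2000 + R - cN / 4 - 3/2 * N + iN + 2 + 2 * PP"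
          "Y \<le> 3 * iN + R + 3 * PP" "10 * PP \<le> m" "25 \<le> PP" "m \<le> 1/1000 * N" "R \<le> 8 * N" "2 * m \<le> iN"
        for X Y N R cR cN iN iR m PP :: real using that by linarith
      have "?X + ?Y / 2 + 2 * real N \<le> (c * real R) / 2 + 3/2 * real R + 3/2 * (i * real R) - \<mu> * real N"
        by (rule gen[OF A _ Y const(1) _ mN R8 iN]) (use X order_trans[OF const(3,2)] in simp_all)
      then show ?thesis unfolding b3 by simp
    qed
    show ?thesis using x1 x3 by blast
  next
    case False
    then have l2': "79/200 * real R \<le> real l2" using l2_ge by simp
    have R5: "2 * real R \<le> 5 * real N" using False l2 by linarith
    \<comment> \<open>Division by \<open>N\<close> brings the lengths into the form of
      \<open>two_phase_small\<close>.\<close>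
    define y where "y = real R / real N"
    define a where "a = real l2 / real N"
    define b where "b = real l1 / real N"
    have "b * \<psi> p1 + a * \<psi> p2 + 2 + 1/100 \<le> y * (q / 2 + 3 / 2 + 3 / (2 * q))"
    proof (rule two_phase_small)
      have e: "q * b / (1 + a) = q * real l1 / (real l2 + real N)" using N0 by (simp add: a_def b_def field_simps)
      show "q * b / (1 + a) < real p1" "real p1 \<le> q * b / (1 + a) + 1" unfolding e using F1(2,3) by simp_all
      show "q * a < real p2" "real p2 \<le> q * a + 1" using F2(2,3) by (simp_all add: a_def)
      show "4 \<le> q * y" using qR4 N0 by (simp add: y_def field_simps)
      show "y = a + b" using sum by (simp add: y_def a_def b_def add_divide_distrib[symmetric] add.commute)
    qed (use RN R5 q0 N0 l2' l2_le in \<open>simp_all add: y_def a_def field_simps\<close>)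
    then have "real N * (b * \<psi> p1 + a * \<psi> p2 + 2 + 1/100) \<le> real N * (y * (q / 2 + 3 / 2 + 3 / (2 * q)))"
      by (rule mult_left_mono) (use N0 in simp)
    moreover have "real N * y = real R" "real N * a = real l2" "real N * b = real l1" using N0 by (simp_all add: y_def a_def b_def)
    ultimately have "real l1 * \<psi> p1 + real l2 * \<psi> p2 + 2 * real N + real N / 100 \<le> real R * (q / 2 + 3 / 2 + 3 / (2 * q))"
      by (simp add: distrib_left flip: mult.assoc)
    moreover have "real R * (3 / (2 * q)) \<le> real R * (3 / (2 * c))"
      using q(2) c q0 by (intro mult_left_mono divide_left_mono mult_pos_pos) linarith+
    moreover have "real R * (q / 2 + 3 / 2 + 3 / (2 * q)) = q / 2 * real R + 3/2 * real R + real R * (3 / (2 * q))"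
      by (simp add: algebra_simps)
    moreover have "real R * (3 / (2 * c)) = 3/2 * (i * real R)" by (simp add: i_def)
    ultimately have A: "real l1 * \<psi> p1 + real l2 * \<psi> p2 + 2 * real N + real N / 100 \<le> q / 2 * real R + 3/2 * real R + 3/2 * (i * real R)"
      by linarith
    have "?X + ?Y / 2 + 2 * real N \<le> c / 2 * real R + 3/2 * real R + 3/2 * (i * real R) - \<mu> * real N"
    proof -
      have gen: "X1 + X2 + (Y1 + Y2) / 2 + 2 * N \<le> cR + 3/2 * R + 3/2 * iR - m"
        if "L1 + L2 + 2 * N + N / 100 \<le> qR + 3/2 * R + 3/2 * iR" "X1 + Y1 / 2 \<le> L1 + (3/2 + p1 / 2)"
          "X2 + Y2 / 2 \<le> L2 + (3/2 + p2 / 2)" "p1 \<le> PP" "p2 \<le> PP" "qR \<le> cR + R / 2000" "2 * R \<le> 5 * N"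
          "10 * PP \<le> m" "25 \<le> PP" "m \<le> 1/1000 * N"
        for X1 X2 Y1 Y2 N R cR iR m L1 L2 qR p1 p2 PP :: real using that by (argo | smt (verit))
      show ?thesis
        by (rule gen[OF A S1(1) S2(1) F1(6) F2(6) cq R5 const(1) order_trans[OF const(3,2)] mN])
    qed
    then have x3: "?X + ?Y / 2 + real 2 * real N \<le> (c / 2 + 3 / 2 + 3 / (2 * c)) * real R - \<mu> * real N"
      unfolding b3 by simp
    have "i * real R \<le> real R / 3" using mult_right_mono[OF i(1), of "real R"] by simp
    then have "?X \<le> (c / 2 + 1 / 2 + 1 / c) * real R - \<mu> * real N"
      unfolding b1 using \<open>?X + ?Y / 2 + 2 * real N \<le> _\<close> S1'(2) S2'(2) sum R5 N0(1) by (linarith | argo | smt (verit))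
    with x3 show ?thesis by blast
  qed
  then show ?thesis using F1(1) F2(1) x2 by (simp add: load_ok_def)
qed

text \<open>All but the last \<open>4 * N\<close> coefficients are found in one phase with blocks of
  about N / z. The cells kept for the rest, together with the \<open>N\<close> residual cells, make
  \<open>5 * N\<close>; this exceeds \<open>(c + 1) * k\<close> since
  \<open>z > (c + 1) / 5\<close>. Histories are at most \<open>z\<close> blocks long, so the load
  stays linear in \<open>l\<close>.\<close>

lemma prefix_phase:
  assumes z: "1 \<le> z" "(c + 1) / 5 < real z" "real z \<le> (c + 1) / 5 + 1" and Nz: "(c + 1) * (real N / real z + 1) + d \<le> 5 * real N"
    and T: "8 * N \<le> T" and l: "l = T - 4 * N" and k: "k = cdiv N z" and p: "p = cdiv l k"
  shows "fits c d N l (4 * N) p k \<and> load_ok c \<mu> N l 1 (mp_load N p k) (sp_load p k)"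
proof -
  have N0: "1 \<le> N" "200 \<le> real N" using N_large by simp_all
  note K = ceil_div[OF z(1), of N, folded cdiv_def k]
  have k1: "1 \<le> k" using K(1) N0 z by (cases k) auto
  note Q = ceil_div[OF k1, of l, folded cdiv_def p]
  have l4: "4 * real N \<le> real l" using T l by linarith
  have p1: "1 \<le> p" using Q(1) l4 N0 by (cases p) auto
  have pk: "real p * real k \<le> real l + real k - 1"
    using of_nat_mono[OF Q(2), where 'a = real] k1 by (simp add: of_nat_diff mult.commute)
  have fit: "fits c d N l (4 * N) p k"
  proof -
    have "(c + 1) * real k \<le> (c + 1) * (real N / real z + 1)" by (rule mult_left_mono[OF K(3)]) (use c in simp)
    then show ?thesis using Nz pk p1 k1 Q(1) by (simp add: fits_def algebra_simps)
  qed
  have zk: "real z * real k \<le> real N + real z"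
    using of_nat_mono[OF K(2), where 'a = real] z by (simp add: of_nat_diff)
  have rows: "(N + k - 1) div k \<le> z"
  proof -
    have "N + k - 1 < (z + 1) * k" using K(1) k1 by (simp add: algebra_simps)
    then show ?thesis using less_mult_imp_div_less[of "N + k - 1" "z + 1" k] by simp
  qed
  have "(\<Sum>i<p. real (min i ((N + k - 1) div k)) * real k) \<le> (\<Sum>i<p. real z * real k)"
    by (intro sum_mono mult_right_mono) (use rows in auto)
  also have "\<dots> = real z * (real p * real k)" by simp
  also have "\<dots> \<le> real z * (real l + real k)" by (rule mult_left_mono) (use pk in auto)
  finally have X: "mp_load N p k \<le> real k + real z * real l + real N + real z" using zk by (simp add: mp_load_def algebra_simps)
  have Y: "sp_load p k \<le> real l + 2 * real k" using pk by (simp add: sp_load_def)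
  define G where "G = c / 2 + 1 / 2 - real z"
  have mN: "\<mu> * real N \<le> 1/1000 * real N" by (rule mult_right_mono) (use mu in auto)
  have zN: "real z \<le> real N / 100" "real k \<le> real N + 1"
  proof -
    have "10000 * P \<le> real N" using NP(1) mN N_large(3) by linarith
    moreover have "real z \<le> P" using z(3) P q(2) c by (simp add: add_divide_distrib)
    ultimately show "real z \<le> real N / 100" using N_large(2) by linarith
    have "real N / real z \<le> real N / 1" by (rule divide_left_mono) (use z in auto)
    then show "real k \<le> real N + 1" using K(3) by simp
  qed
  have main: "real k + real N + real z + 1 + \<mu> * real N \<le> G * real l"
  proof (cases "z = 1")
    case True
    have "1 * real l \<le> G * real l" by (rule mult_right_mono) (use c True in \<open>auto simp: G_def\<close>)
    then show ?thesis using l4 zN mN N0 by linarith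
  next
    case False
    then have z2: "2 \<le> z" using z by simp
    then have "2 \<le> real z" by simp
    then have c4: "4 \<le> c" using z(3) by (simp add: add_divide_distrib)
    have "1/2 \<le> G" using z(3) c4 unfolding G_def by (simp add: add_divide_distrib)
    then have "1/2 * real l \<le> G * real l" by (rule mult_right_mono) simp
    moreover have "real N / real z \<le> real N / 2" by (rule divide_left_mono) (use z2 in auto)
    ultimately show ?thesis using l4 zN(1) mN N0 K(3) by linarith
  qed
  have g: "(c / 2 + 1 / 2) * real l = G * real l + real z * real l" by (simp add: G_def algebra_simps)
  have i0: "0 \<le> real l / c" using c by simp
  have x1: "mp_load N p k \<le> (c / 2 + 1 / 2 + 1 / c) * real l - \<mu> * real N"
  proof -
    have "(c / 2 + 1 / 2 + 1 / c) * real l = (c / 2 + 1 / 2) * real l + real l / c" by (simp add: distrib_right)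
    then show ?thesis using X main g i0 by linarith
  qed
  have x2: "sp_load p k \<le> (2 + 1 / c) * real l - \<mu> * real N"
  proof -
    have "(2 + 1 / c) * real l = 2 * real l + real l / c" by (simp add: distrib_right)
    then show ?thesis using Y zN mN l4 N0 i0 by linarith
  qed
  have x3: "mp_load N p k + sp_load p k / 2 + real 1 * real N \<le> (c / 2 + 3 / 2 + 3 / (2 * c)) * real l - \<mu> * real N"
  proof -
    have "(c / 2 + 3 / 2 + 3 / (2 * c)) * real l = (c / 2 + 1 / 2) * real l + real l + 3/2 * (real l / c)" by (simp add: distrib_right)
    then show ?thesis using X Y main g i0 zN l4 by simp
  qed
  show ?thesis using fit x1 x2 x3 by (simp add: load_ok_def)
qed

end


section \<open>Reversal in place and initialisation\<close>

context machine
begin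

definition REV :: "iexp \<Rightarrow> iexp \<Rightarrow> 'a com" where
  "REV b e = For 4 (e [div] Num 2) (Move (Work, Num 50) (Output, b [+] V 4) ;;
     Move (Output, b [+] V 4) (Output, b [+] (e [-] Num 1 [-] V 4)) ;;
     Move (Output, b [+] (e [-] Num 1 [-] V 4)) (Work, Num 50))"

lemma WP_REV:
  assumes ok: "okx b" "okx e" "\<And>i. val (v(4 := i)) b = B" "\<And>i. val (v(4 := i)) e = K" and LEN: "B + K \<le> LEN"
    and Q: "\<And>v' z'. \<forall>x. x \<noteq> 4 \<longrightarrow> v' x = v x \<Longrightarrow>
      Q (\<lambda>y. if B \<le> y \<and> y < B + K then g (2 * B + K - 1 - y) else g y, v', z')"
  shows "WP (REV b e) 0 Q (g, v, z)"
  unfolding REV_def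
proof (rule WP_for_sx[where n = "K div 2" and k = 0 and
      Z = "\<lambda>i. if i = 0 then z else z(0 := g (B + (i - 1)))" and
      G = "\<lambda>i y. if (B \<le> y \<and> y < B + i) \<or> (B + K - i \<le> y \<and> y < B + K) then g (2 * B + K - 1 - y) else g y"])
  fix i assume i: "i < K div 2"
  have a: "B + i < LEN" "B + (K - 1 - i) < LEN" using i LEN by auto
  have ne: "B + i \<noteq> B + (K - 1 - i)" "B + i < B + K - i" "\<not> B + (K - 1 - i) < B + i" "B + (K - 1 - i) < B + K - i" using i by auto
  define G where "G = (\<lambda>i y. if (B \<le> y \<and> y < B + i) \<or> (B + K - i \<le> y \<and> y < B + K) then g (2 * B + K - 1 - y) else g y)"
  have g1: "G i (B + i) = g (B + i)" "G i (B + (K - 1 - i)) = g (B + (K - 1 - i))" using ne by (auto simp: G_def)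
  have upd: "(G i)(B + i := g (B + (K - 1 - i)), B + (K - 1 - i) := g (B + i)) = G (Suc i)"
  proof
    fix y
    have e: "2 * B + K - 1 - (B + i) = B + (K - 1 - i)" "2 * B + K - 1 - (B + (K - 1 - i)) = B + i" using i by linarith+
    have in1: "B \<le> B + i \<and> B + i < B + Suc i" "B + K - Suc i \<le> B + (K - 1 - i) \<and> B + (K - 1 - i) < B + K" using i by linarith+
    consider "y = B + i" | "y = B + (K - 1 - i)" | "y \<noteq> B + i" "y \<noteq> B + (K - 1 - i)" by blast
    then show "((G i)(B + i := g (B + (K - 1 - i)), B + (K - 1 - i) := g (B + i))) y = G (Suc i) y"
    proof cases
      case 1
      show ?thesis unfolding 1 using ne(1) in1(1) by (simp only: G_def fun_upd_apply if_True if_False e simp_thms)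
    next
      case 2
      show ?thesis unfolding 2 using in1(2) by (simp only: G_def fun_upd_apply if_True if_False e simp_thms)
    next
      case 3
      have "((B \<le> y \<and> y < B + Suc i) \<or> (B + K - Suc i \<le> y \<and> y < B + K)) = ((B \<le> y \<and> y < B + i) \<or> (B + K - i \<le> y \<and> y < B + K))"
        using 3 i by linarith
      then show ?thesis using 3 by (simp only: G_def fun_upd_apply if_False)
    qed
  qed
  let ?v = "v(4 := i)"
  define w where "w = (if i = 0 then z else z(0 := g (B + (i - 1))))"
  have 1: "sx (Move (Work, Num 50) (Output, b [+] V 4)) (G i, ?v, w) = Some (0, (G i, ?v, w(0 := g (B + i))))"
    using ok a(1) g1(1) by simp
  have 2: "sx (Move (Output, b [+] V 4) (Output, b [+] (e [-] Num 1 [-] V 4))) (G i, ?v, w(0 := g (B + i))) =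
    Some (0, ((G i)(B + i := g (B + (K - 1 - i))), ?v, w(0 := g (B + i))))"
    using ok a g1(2) by simp
  have 3: "sx (Move (Output, b [+] (e [-] Num 1 [-] V 4)) (Work, Num 50)) ((G i)(B + i := g (B + (K - 1 - i))), ?v, w(0 := g (B + i))) =
    Some (0, (G (Suc i), ?v, w(0 := g (B + i))))"
    using ok a upd by simp
  have w: "w(0 := g (B + i)) = (if Suc i = 0 then z else z(0 := g (B + (Suc i - 1))))" by (simp add: w_def fun_eq_iff)
  have fin: "sx (Move (Work, Num 50) (Output, b [+] V 4) ;; Move (Output, b [+] V 4) (Output, b [+] (e [-] Num 1 [-] V 4)) ;;
      Move (Output, b [+] (e [-] Num 1 [-] V 4)) (Work, Num 50)) (G i, ?v, w) =
    Some (0, G (Suc i), ?v, if Suc i = 0 then z else z(0 := g (B + (Suc i - 1))))"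
    by (simp only: sx.simps(2) 1 2 3 option.case prod.case add_0_left) (simp only: w)
  show "sx (Move (Work, Num 50) (Output, b [+] V 4) ;; Move (Output, b [+] V 4) (Output, b [+] (e [-] Num 1 [-] V 4)) ;;
      Move (Output, b [+] (e [-] Num 1 [-] V 4)) (Work, Num 50))
      (\<lambda>y. if (B \<le> y \<and> y < B + i) \<or> (B + K - i \<le> y \<and> y < B + K) then g (2 * B + K - 1 - y) else g y, ?v,
       if i = 0 then z else z(0 := g (B + (i - 1)))) =
    Some (0, \<lambda>y. if (B \<le> y \<and> y < B + Suc i) \<or> (B + K - Suc i \<le> y \<and> y < B + K) then g (2 * B + K - 1 - y) else g y, ?v,
       if Suc i = 0 then z else z(0 := g (B + (Suc i - 1))))"
    by (rule fin[unfolded G_def w_def])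
next
  have "(\<lambda>y. if (B \<le> y \<and> y < B + K div 2) \<or> (B + K - K div 2 \<le> y \<and> y < B + K) then g (2 * B + K - 1 - y) else g y) =
     (\<lambda>y. if B \<le> y \<and> y < B + K then g (2 * B + K - 1 - y) else g y)"
  proof
    fix y
    have "2 * B + K - 1 - y = y" if "B + K div 2 \<le> y" "y < B + K - K div 2" using that by linarith
    then show "(if (B \<le> y \<and> y < B + K div 2) \<or> (B + K - K div 2 \<le> y \<and> y < B + K) then g (2 * B + K - 1 - y) else g y) =
      (if B \<le> y \<and> y < B + K then g (2 * B + K - 1 - y) else g y)"
      by (cases "B + K div 2 \<le> y \<and> y < B + K - K div 2") auto
  qed
  then show "Q (\<lambda>y. if (B \<le> y \<and> y < B + K div 2) \<or> (B + K - K div 2 \<le> y \<and> y < B + K) then g (2 * B + K - 1 - y) else g y,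
     v(4 := K div 2), if K div 2 = 0 then z else z(0 := g (B + (K div 2 - 1))))"
    using Q[of "v(4 := K div 2)"] by simp
qed (use ok LEN in auto)

text \<open>The work registers start with arbitrary contents, possibly ring elements, on which index
  expressions have no value. Clearing the first 50 brings the memory into the form
  \<open>conc\<close>.\<close>

fun CLEAR :: "nat \<Rightarrow> 'a com" where
  "CLEAR 0 = Skip"
| "CLEAR (Suc k) = (CLEAR k ;; k :== Num 0)"

lemma exec_CLEAR: "k \<le> length wk \<Longrightarrow> exec ps inp (CLEAR k) (out, wk) 0 (out, map (\<lambda>_. Idx 0) [0..<k] @ drop k wk)"
proof (induction k)
  case 0
  then show ?case by (auto intro: exec.Skip)
next
  case (Suc k)
  let ?w = "map (\<lambda>_. Idx 0) [0..<k] @ drop k wk"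
  have "?w[k := Idx 0] = map (\<lambda>_. Idx 0) [0..<Suc k] @ drop (Suc k) wk"
    using Suc.prems by (intro nth_equalityI) (auto simp: nth_append nth_list_update less_Suc_eq)
  moreover have "k < length ?w" using Suc.prems by simp
  ultimately have "exec ps inp (k :== Num 0) (out, ?w) 0 (out, map (\<lambda>_. Idx 0) [0..<Suc k] @ drop (Suc k) wk)"
    by (intro exec.SetIdx[of _ _ _ _ 0]) (simp_all add: store_def)
  then show ?case using exec.Seq[OF Suc.IH, of "k :== Num 0" 0] Suc.prems by simp
qed

lemma computes_WP:
  assumes "\<And>g z. WP c C (\<lambda>(g', v', z'). \<exists>f. arr g' 0 LEN f \<and> P (map f [0..<LEN])) (g, \<lambda>_. 0, z)"
  shows "computes (CLEAR 50 ;; c) ps inp LEN 54 C P"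
  unfolding computes_def
proof (intro allI impI)
  fix out wk :: "'a cell list"
  assume l: "length out = LEN" "length wk = 54"
  let ?z = "\<lambda>i. wk ! (50 + i)"
  have "map (\<lambda>_. Idx 0) [0..<50] @ drop 50 wk = map (\<lambda>x. Idx 0) [0..<50] @ map ?z [0..<4]"
    using l by (intro arg_cong2[where f = append] refl nth_equalityI) simp_all
  moreover have "out = map (nth out) [0..<LEN]" using l by (metis map_nth)
  ultimately have e: "(out, map (\<lambda>_. Idx 0) [0..<50] @ drop 50 wk) = conc (nth out, \<lambda>_. 0, ?z)"
    by (simp only: conc.simps)
  have 1: "exec ps inp (CLEAR 50) (out, wk) 0 (conc (nth out, \<lambda>_. 0, ?z))"
    using exec_CLEAR[of 50 wk out] l unfolding e by simp
  obtain t s' where 2: "exec ps inp c (conc (nth out, \<lambda>_. 0, ?z)) t (conc s')" "real t \<le> C"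
    "(\<lambda>(g', v', z'). \<exists>f. arr g' 0 LEN f \<and> P (map f [0..<LEN])) s'"
    using assms[of "nth out" ?z] unfolding WP_def by blast
  obtain g' v' z' where s': "s' = (g', v', z')" by (cases s')
  obtain f where f: "arr g' 0 LEN f" "P (map f [0..<LEN])" using 2(3) unfolding s' prod.case by blast
  have "map g' [0..<LEN] = map Elt (map f [0..<LEN])" using f(1) by (simp add: arr_def)
  then have "conc s' = (map Elt (map f [0..<LEN]), snd (conc s'))" by (simp add: s' conc.simps)
  then show "\<exists>t ys work'. exec ps inp (CLEAR 50 ;; c) (out, wk) t (map Elt ys, work') \<and> real t \<le> C \<and> P ys"
    using exec.Seq[OF 1 2(1)] 2(2) f(2) by (metis add_0)
qed

end

section \<open>Loading, schoolbook division, and the return to ordinary coefficient order\<close>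

context division
begin

lemma res_high: "t + (n - 1) \<le> x \<Longrightarrow> res AL t x = al x"
proof -
  assume x: "t + (n - 1) \<le> x"
  have "(\<Sum>i<t. be (x - i) * (AL * iv) $ i) = 0"
  proof (rule sum.neutral, rule ballI)
    fix i assume "i \<in> {..<t}"
    then have "n \<le> x - i" using x n by auto
    then show "be (x - i) * (AL * iv) $ i = 0" by simp
  qed
  then show ?thesis using x n by (simp add: res_eq)
qed

definition stInv :: "nat \<Rightarrow> (nat \<Rightarrow> 'a cell) \<Rightarrow> bool" where
  "stInv t g \<longleftrightarrow> arr g 0 t (fps_nth (AL * iv)) \<and> arr g t (LEN - t) (\<lambda>i. res AL t (t + i))"

definition LOAD :: "'a com" where
  "LOAD = For 4 eL (Move (Output, V 4) (Input, (eL [-] Num 1) [-] V 4))"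

lemma WP_LOAD: "WP LOAD 0 (\<lambda>(g', v', z'). stInv 0 g' \<and> (\<forall>x. x \<noteq> 4 \<longrightarrow> v' x = v x)) (g, v, z)"
  unfolding LOAD_def
proof (rule WP_for_sx[where n = "m + n" and k = 0 and Z = "\<lambda>_. z" and G = "\<lambda>i y. if y < i then Elt (al y) else g y"])
  fix i assume i: "i < m + n"
  then have "inp ! (m + n - 1 - i) = al i" "m + n - 1 - i < length inp" using inp by (simp_all add: al_def)
  then show "sx (Move (Output, V 4) (Input, (eL [-] Num 1) [-] V 4)) (\<lambda>y. if y < i then Elt (al y) else g y, v(4 := i), z) =
    Some (0, \<lambda>y. if y < Suc i then Elt (al y) else g y, v(4 := i), z)"
  proof -
    have "i < LEN" using i by (simp add: LEN)
    then show ?thesis using i \<open>inp ! (m + n - 1 - i) = al i\<close> \<open>m + n - 1 - i < length inp\<close> by (auto simp: fun_eq_iff less_Suc_eq)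
  qed
next
  show "case (\<lambda>y. if y < m + n then Elt (al y) else g y, v(4 := m + n), z) of (g', v', z') \<Rightarrow> stInv 0 g' \<and> (\<forall>x. x \<noteq> 4 \<longrightarrow> v' x = v x)"
  proof -
    have "i < m + n" if "i < LEN" for i using that LEN by simp
    then show ?thesis by (simp add: stInv_def arr_def)
  qed
qed (use inp LEN in auto)

text \<open>Schoolbook division for divisors below a fixed threshold; its cost is then linear in
  \<open>m\<close>.\<close>

definition NAIVE :: "'a com" where
  "NAIVE = (For 19 eT (20 :== V 19 ;; 23 :== Num 0 ;; 24 :== V 19 ;;
      Cond (Less (V 20) eN) (NACC (V 20)) (NACC eN) ;;
      Arith Div (Output, V 20) (Output, V 20) (Input, eL [+] eN)) ;;
    10 :== eT ;; 21 :== eN ;; NRES)"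

text \<open>This is the value that the \<open>Div\<close> instruction returns when the next quotient
  coefficient is found: the residual at its own position, divided by the leading coefficient. At
  most \<open>n - 1\<close> earlier coefficients matter.\<close>

lemma quot_step: "(THE z. z * be 0 = AL $ x - (\<Sum>e<min x (n - 1). be (0 + e + 1) * (AL * iv) $ (x - 1 - e))) = (AL * iv) $ x"
proof -
  have r: "AL $ x - (\<Sum>e<min x (n - 1). be (0 + e + 1) * (AL * iv) $ (x - 1 - e)) = res AL x x"
  proof -
    have "(\<Sum>e<min x (n - 1). be (x - (x - 1 - e)) * (AL * iv) $ (x - 1 - e)) =
        (\<Sum>j\<in>{x - min x (n - 1)..<x}. be (x - j) * (AL * iv) $ j)"
      by (rule sum_tail_eq) simp
    moreover have "(\<Sum>e<min x (n - 1). be (x - (x - 1 - e)) * (AL * iv) $ (x - 1 - e)) =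
      (\<Sum>e<min x (n - 1). be (0 + e + 1) * (AL * iv) $ (x - 1 - e))"
      by (rule sum.cong) (auto intro!: arg_cong[of _ _ be])
    moreover have "res AL x x = AL $ x - (\<Sum>j\<in>{x - min x (n - 1)..<x}. be (x - j) * (AL * iv) $ j)"
    proof (cases "x \<le> n - 1")
      case True
      then show ?thesis by (simp add: res_eq atLeast0LessThan)
    next
      case False
      then show ?thesis using n by (intro res_direct) auto
    qed
    ultimately show ?thesis by simp
  qed
  have q: "iv $ 0 * res AL x x = (AL * iv) $ x" using res_quot[of 0 AL x] by simp
  then have q': "(AL * iv) $ x * be 0 = res AL x x" using ib by (simp add: iv_0 mult.assoc mult.commute[of "res AL x x"] flip: q) (metis mult.assoc mult.commute mult_1)
  show ?thesis unfolding r
  proof (rule the_equality)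
    show "(AL * iv) $ x * be 0 = res AL x x" by (fact q')
    fix w assume "w * be 0 = res AL x x"
    then have "ib * (w * be 0) = (AL * iv) $ x" using q by (simp add: iv_0)
    then show "w = (AL * iv) $ x" using ib by (metis mult.assoc mult.commute mult_1)
  qed
qed

lemma WP_NAIVE:
  assumes h: "stInv 0 g"
  shows "WP NAIVE (real (m + 1) * (2 * real n + 1) + 2 * real n * real n)
    (\<lambda>(g', v', z'). stInv (m + 1) g') (g, v, z)"
proof -
  have a0: "arr g 0 LEN al" using h by (simp add: stInv_def)
  let ?u = "fps_nth (AL * iv)"
  let ?body = "20 :== V 19 ;; 23 :== Num 0 ;; 24 :== V 19 ;;
      Cond (Less (V 20) eN) (NACC (V 20)) (NACC eN) ;; Arith Div (Output, V 20) (Output, V 20) (Input, eL [+] eN)"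
  let ?I = "\<lambda>i (g', v' :: nat \<Rightarrow> nat, z' :: nat \<Rightarrow> 'a cell). v' 19 = i \<and> arr g' 0 i ?u \<and> (\<forall>y. i \<le> y \<longrightarrow> g' y = g y)"
  have bb: "inp ! (m + n + (n - 1)) = be 0" "m + n + (n - 1) < length inp" "be 0 dvd 1" using n inp lead by (simp_all add: be_def)
  have loop: "WP (For 19 eT ?body) (\<Sum>i<m + 1. 2 * real n + 1) (?I (m + 1)) (g, v, z)"
  proof (rule WP_for[where I = ?I])
    show "?I 0 (g, v(19 := 0), z)" by (simp add: arr_def)
  next
    fix x g1 v1 z1 assume x: "x < m + 1" and I: "?I x (g1, v1, z1)"
    have I': "v1 19 = x" "arr g1 0 x ?u" "\<And>y. x \<le> y \<Longrightarrow> g1 y = g y" using I unfolding prod.case by blast+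
    have xL: "x < LEN" using x LEN n by simp
    let ?v2 = "v1(20 := x, 23 := 0, 24 := x)"
    define cnt where "cnt = min x (n - 1)"
    define d where "d = AL $ x - (\<Sum>e<cnt. be (0 + e + 1) * ?u (x - 1 - e))"
    have gx: "g1 x = Elt (al x)" using I'(3)[of x] arrD[OF a0 xL] by simp
    have dv: "(THE w. w * be 0 = d) = ?u x" unfolding d_def cnt_def by (rule quot_step)
    let ?P = "\<lambda>(g2, v2 :: nat \<Rightarrow> nat, z2 :: nat \<Rightarrow> 'a cell). g2 = g1(x := Elt d) \<and> v2 20 = x \<and> v2 19 = x"
    have nacc: "WP (NACC e) (2 * real n) ?P (g1, ?v2, z1)"
      if "okx e" "\<And>i. val (?v2(22 := i)) e = cnt" for e
    proof (rule WP_weaken[OF WP_NACC[where x = x and lo = 0 and hi = x and cnt = cnt and u = ?u and d = "al x" and Q = ?P]])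
      have "cnt \<le> n" unfolding cnt_def by linarith
      then show "2 * real cnt \<le> 2 * real n" by simp
      show "?P (g1(x := Elt (al x - (\<Sum>e<cnt. be (0 + e + 1) * ?u (x - 1 - e)))), ?v2(22 := cnt), z')" for z'
        using I'(1) by (simp add: d_def)
    qed (use that I' xL gx in \<open>auto simp: cnt_def\<close>)
    have c: "WP (Cond (Less (V 20) eN) (NACC (V 20)) (NACC eN)) (2 * real n) ?P (g1, ?v2, z1)"
    proof (rule WP_cond)
      show "okb (Less (V 20) eN)" by simp
      show "WP (NACC (V 20)) (2 * real n) ?P (g1, ?v2, z1)" if "bval ?v2 (Less (V 20) eN)"
        by (rule nacc) (use that in \<open>auto simp: cnt_def\<close>)
      show "WP (NACC eN) (2 * real n) ?P (g1, ?v2, z1)" if "\<not> bval ?v2 (Less (V 20) eN)"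
        by (rule nacc) (use that in \<open>auto simp: cnt_def\<close>)
    qed
    have s: "sx (20 :== V 19) (g1, v1, z1) = Some (0, (g1, v1(20 := x), z1))"
      "sx (23 :== Num 0) (g1, v1(20 := x), z1) = Some (0, (g1, v1(20 := x, 23 := 0), z1))"
      "sx (24 :== V 19) (g1, v1(20 := x, 23 := 0), z1) = Some (0, (g1, ?v2, z1))" using I' xL by simp_all
    show "WP ?body (2 * real n + 1) (\<lambda>(g, v, z). v 19 = x \<and> ?I (Suc x) (g, v(19 := Suc x), z)) (g1, v1, z1)"
    proof (rule WP_sx_then[OF s(1)], rule WP_sx_then[OF s(2)], rule WP_sx_then[OF s(3)], rule WP_then[OF c])
      fix s2 :: "'a state" assume P2: "?P s2"
      let ?g = "g1(x := Elt d)"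
      obtain g2 v2 z2 where s2': "s2 = (g2, v2, z2)" by (cases s2)
      have P: "v2 20 = x" "v2 19 = x" and g2: "g2 = ?g" using P2 unfolding s2' prod.case by blast+
      have sd: "sx (Arith Div (Output, V 20) (Output, V 20) (Input, eL [+] eN)) (?g, v2, z2) = Some (1, (?g(x := Elt (?u x)), v2, z2))"
        using P xL bb dv by simp
      show "WP (Arith Div (Output, V 20) (Output, V 20) (Input, eL [+] eN)) 1
        (\<lambda>(g, v, z). v 19 = x \<and> ?I (Suc x) (g, v(19 := Suc x), z)) s2"
        unfolding s2' g2
      proof (rule WP_sx[OF sd])
        have "arr (g1(x := Elt (?u x))) 0 (Suc x) ?u" using I'(2) by (auto simp: arr_def less_Suc_eq)
        then show "case (?g(x := Elt (?u x)), v2, z2) of (g, v, z) \<Rightarrow> v 19 = x \<and> ?I (Suc x) (g, v(19 := Suc x), z)"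
          using P I'(3) by simp
      qed simp
    qed
  next
    fix i g2 v2 z2 assume "?I i (g2, v2, z2)"
    then show "v2 19 = i \<and> val v2 eT = m + 1" by simp
  qed (use LEN n in auto)
  have "WP NAIVE ((\<Sum>i<m + 1. 2 * real n + 1) + 2 * real (n - 1) * real (n - 1)) (\<lambda>(g', v', z'). stInv (m + 1) g') (g, v, z)"
    unfolding NAIVE_def
  proof (rule WP_then[OF loop])
    fix s1 :: "'a state" assume I: "?I (m + 1) s1"
    obtain g1 v1 z1 where s1: "s1 = (g1, v1, z1)" by (cases s1)
    have g1: "arr g1 0 (m + 1) ?u" using I unfolding s1 prod.case by blast
    have s: "sx (10 :== eT) (g1, v1, z1) = Some (0, (g1, v1(10 := m + 1), z1))"
      "sx (21 :== eN) (g1, v1(10 := m + 1), z1) = Some (0, (g1, v1(10 := m + 1, 21 := n - 1), z1))"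
    proof -
      have "m + 1 \<le> LEN" "n - 1 \<le> LEN" using LEN n by simp_all
      then show "sx (10 :== eT) (g1, v1, z1) = Some (0, (g1, v1(10 := m + 1), z1))"
        "sx (21 :== eN) (g1, v1(10 := m + 1), z1) = Some (0, (g1, v1(10 := m + 1, 21 := n - 1), z1))" by simp_all
    qed
    show "WP (10 :== eT ;; 21 :== eN ;; NRES) (2 * real (n - 1) * real (n - 1)) (\<lambda>(g', v', z'). stInv (m + 1) g') s1"
      unfolding s1
    proof (rule WP_sx_then[OF s(1)], rule WP_sx_then[OF s(2)], rule WP_weaken[OF WP_NRES[where t = "m + 1" and s = "n - 1"]])
      fix s' :: "'a state"
      assume A: "case s' of (g', v', z') \<Rightarrow> arr g' (m + 1 + (n - 1) - (n - 1)) (n - 1) (\<lambda>i. res AL (m + 1) (m + 1 + (n - 1) - (n - 1) + i)) \<and>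
        (\<forall>y. y < m + 1 + (n - 1) - (n - 1) \<longrightarrow> g' y = g1 y) \<and>
        (\<forall>x. x \<notin> {19, 20, 22, 23, 24} \<longrightarrow> v' x = (v1(10 := m + 1, 21 := n - 1)) x)"
      obtain g2 v2 z2 where s': "s' = (g2, v2, z2)" by (cases s')
      have A': "arr g2 (m + 1) (n - 1) (\<lambda>i. res AL (m + 1) (m + 1 + i))" "\<forall>y. y < m + 1 \<longrightarrow> g2 y = g1 y"
        using A unfolding s' prod.case diff_add_inverse2 by blast+
      have "LEN - (m + 1) = n - 1" using LEN n by simp
      moreover have "arr g2 0 (m + 1) ?u" by (rule arr_cong[OF g1]) (use A'(2) in auto)
      ultimately show "case s' of (g', v', z') \<Rightarrow> stInv (m + 1) g'" unfolding s' prod.case stInv_def using A'(1) by simp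
    qed (use g1 n LEN in auto)
  qed
  then show ?thesis
  proof (rule WP_weaken)
    have "real (n - 1) * real (n - 1) \<le> real n * real n" by (rule mult_mono) auto
    then show "(\<Sum>i<m + 1. 2 * real n + 1) + 2 * real (n - 1) * real (n - 1) \<le> real (m + 1) * (2 * real n + 1) + 2 * real n * real n"
      by simp
  qed
qed

text \<open>Coefficient \<open>k\<close> of a polynomial of size \<open>m + n\<close> is the power
  series coefficient \<open>m + n - 1 - k\<close>. At positions up to \<open>m\<close> the residual
  vanishes, which makes the quotient exact there; at the later positions it is the
  remainder.\<close>

lemma division_correct:
  fixes A B :: "'a poly"
  assumes inp': "inp = coeff_list (m + n) A @ coeff_list n B" and A: "poly_of_size (m + n) A" and B: "poly_of_size n B"
  defines "Q \<equiv> pol (m + 1) (\<lambda>i. (AL * iv) $ (m - i))" and "R \<equiv> pol (n - 1) (\<lambda>j. res AL (m + 1) (m + 1 + (n - 2 - j)))"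
  shows "A = B * Q + R" "poly_of_size (m + 1) Q" "poly_of_size (n - 1) R"
proof -
  let ?u = "fps_nth (AL * iv)"
  have al: "al x = coeff A (m + n - 1 - x)" if "x < m + n" for x
  proof -
    have "inp ! (m + n - 1 - x) = coeff A (m + n - 1 - x)"
      unfolding inp' using that n by (simp add: coeff_list_def nth_append del: upt_Suc)
    then show ?thesis using that by (simp only: al_def if_True)
  qed
  have be: "be x = coeff B (n - 1 - x)" if "x < n" for x
  proof -
    have "inp ! (m + n + (n - 1) - x) = coeff B (n - 1 - x)"
    proof -
      have "m + n + (n - 1) - x = m + n + (n - 1 - x)" using that by simp
      then have "inp ! (m + n + (n - 1) - x) = coeff_list n B ! (n - 1 - x)"
        unfolding inp' using nth_append_length_plus[of "coeff_list (m + n) A" "coeff_list n B" "n - 1 - x"] by (simp add: coeff_list_def)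
      then show ?thesis using that by (simp add: coeff_list_def del: upt_Suc)
    qed
    then show ?thesis using that by (simp only: be_def if_True)
  qed
  have A0: "coeff A k = 0" if "m + n \<le> k" for k using A that unfolding poly_of_size_def by (auto intro: coeff_eq_0)
  have B0: "coeff B k = 0" if "n \<le> k" for k using B that unfolding poly_of_size_def by (auto intro: coeff_eq_0)
  show "A = B * Q + R"
  proof (rule poly_eqI)
    fix k
    have mult: "coeff (B * Q) k = (\<Sum>j\<in>{j. j \<le> k \<and> j \<le> m \<and> k - j < n}. ?u (m - j) * coeff B (k - j))"
    proof -
      have "coeff (Q * B) k = (\<Sum>j\<le>k. coeff Q j * coeff B (k - j))" by (rule coeff_mult)
      also have "\<dots> = (\<Sum>j\<in>{j. j \<le> k \<and> j \<le> m \<and> k - j < n}. ?u (m - j) * coeff B (k - j))"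
        by (rule sum.mono_neutral_cong_right) (auto simp: Q_def coeff_pol B0 not_less)
      finally show ?thesis by (simp add: mult.commute)
    qed
    show "coeff A k = coeff (B * Q + R) k"
    proof (cases "k < m + n")
      case False
      have e: "{j. j \<le> k \<and> j \<le> m \<and> k - j < n} = {}" using False by auto
      have "coeff (B * Q) k = 0" by (simp only: mult e sum.empty)
      then show ?thesis using False A0 by (simp add: R_def coeff_pol)
    next
      case True
      define x where "x = m + n - 1 - k"
      have k: "k = m + n - 1 - x" "x < m + n" using True by (simp_all add: x_def)
      have "(\<Sum>j\<in>{j. j \<le> k \<and> j \<le> m \<and> k - j < n}. ?u (m - j) * coeff B (k - j)) =
        (\<Sum>i\<in>{i. i \<le> m \<and> i \<le> x \<and> x - i < n}. ?u i * be (x - i))"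
      proof (rule sum.reindex_bij_witness[of _ "\<lambda>i. m - i" "\<lambda>j. m - j"])
        fix j assume "j \<in> {j. j \<le> k \<and> j \<le> m \<and> k - j < n}"
        then have j: "j \<le> k" "j \<le> m" "k - j < n" by auto
        have "x - (m - j) = n - 1 - (k - j)" "m - j \<le> x" "x - (m - j) < n" using j k n by auto
        then show "m - j \<in> {i. i \<le> m \<and> i \<le> x \<and> x - i < n}" "?u (m - j) * be (x - (m - j)) = ?u (m - j) * coeff B (k - j)"
          using be[of "x - (m - j)"] j by simp_all
        show "m - (m - j) = j" using j by simp
      next
        fix i assume "i \<in> {i. i \<le> m \<and> i \<le> x \<and> x - i < n}"
        then have i: "i \<le> m" "i \<le> x" "x - i < n" by auto
        show "m - (m - i) = i" using i by simp
        show "m - i \<in> {j. j \<le> k \<and> j \<le> m \<and> k - j < n}" using i k n by auto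
      qed
      also have "\<dots> = (\<Sum>i\<in>{i. i < m + 1 \<and> i \<le> x}. be (x - i) * ?u i)"
        by (rule sum.mono_neutral_cong_left) (auto simp: mult.commute less_Suc_eq_le not_less)
      finally have m: "coeff (B * Q) k = (\<Sum>i\<in>{i. i < m + 1 \<and> i \<le> x}. be (x - i) * ?u i)" using mult by simp
      show ?thesis
      proof (cases "m + 1 \<le> x")
        case True
        have "{i. i < m + 1 \<and> i \<le> x} = {..<m + 1}" using True by auto
        then have "res AL (m + 1) x = al x - coeff (B * Q) k" using m True by (simp add: res_eq)
        moreover have "k < n - 1" "m + 1 + (n - 2 - k) = x" using k True by auto
        then have "coeff R k = res AL (m + 1) x" by (simp add: R_def coeff_pol)
        ultimately show ?thesis using al[OF k(2)] k by simp
      next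
        case False
        have "{i. i < m + 1 \<and> i \<le> x} = {..<Suc x}" using False by auto
        then have "res AL (Suc x) x = al x - coeff (B * Q) k" using m by (simp add: res_eq)
        moreover have "res AL (Suc x) x = 0" by (rule res_less) simp
        moreover have "\<not> k < n - 1" using k False by auto
        then have "coeff R k = 0" by (simp add: R_def coeff_pol)
        ultimately show ?thesis using al[OF k(2)] k by simp
      qed
    qed
  qed
  have pd: "p = 0 \<or> degree p < a" if "psize a p" for a and p :: "'a poly"
    using that unfolding psize_def by (metis leading_coeff_0_iff not_less)
  show "poly_of_size (m + 1) Q" "poly_of_size (n - 1) R"
    unfolding poly_of_size_def Q_def R_def by (rule pd[OF psize_pol])+
qed

definition FINISH :: "'a com" where "FINISH = (REV (Num 0) eT ;; REV eT eN)"

lemma WP_FINISH: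
  fixes A B :: "'a poly"
  assumes inp': "inp = coeff_list (m + n) A @ coeff_list n B" and A: "poly_of_size (m + n) A" and B: "poly_of_size n B"
    and h: "stInv (m + 1) g"
  shows "WP FINISH 0 (\<lambda>(g', v', z'). \<exists>f. arr g' 0 LEN f \<and> (\<exists>Q R. poly_of_size (m + 1) Q \<and> poly_of_size (n - 1) R \<and>
     A = B * Q + R \<and> map f [0..<LEN] = coeff_list (m + 1) Q @ coeff_list (n - 1) R)) (g, v, z)"
proof -
  define f where "f y = (if y < m + 1 then (AL * iv) $ (m - y) else res AL (m + 1) (m + 1 + (n - 2 - (y - (m + 1)))))" for y
  let ?Q = "pol (m + 1) (\<lambda>i. (AL * iv) $ (m - i))" and ?R = "pol (n - 1) (\<lambda>j. res AL (m + 1) (m + 1 + (n - 2 - j)))"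
  have L: "LEN = m + 1 + (n - 1)" "LEN - (m + 1) = n - 1" using LEN n by simp_all
  let ?g1 = "\<lambda>y. if 0 \<le> y \<and> y < 0 + (m + 1) then g (2 * 0 + (m + 1) - 1 - y) else g y"
  let ?g2 = "\<lambda>y. if m + 1 \<le> y \<and> y < m + 1 + (n - 1) then ?g1 (2 * (m + 1) + (n - 1) - 1 - y) else ?g1 y"
  have g: "g y = Elt ((AL * iv) $ y)" if "y < m + 1" for y using h that unfolding stInv_def arr_def by simp
  have g': "g (m + 1 + y) = Elt (res AL (m + 1) (m + 1 + y))" if "y < n - 1" for y
    using h that unfolding stInv_def arr_def L(2) by simp
  have "arr ?g2 0 LEN f"
    unfolding arr_def
  proof (intro allI impI)
    fix y assume y: "y < LEN"
    show "?g2 (0 + y) = Elt (f y)"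
    proof (cases "y < m + 1")
      case True
      then show ?thesis using g[of "m - y"] by (simp add: f_def)
    next
      case False
      define j where "j = y - (m + 1)"
      have j: "y = m + 1 + j" "j < n - 1" using False y L by (auto simp: j_def)
      have "2 * (m + 1) + (n - 1) - 1 - y = m + 1 + (n - 2 - j)" using j by simp
      then have e: "2 * (m + 1) + (n - 1) - 1 - (0 + y) = m + 1 + (n - 2 - j)" by simp
      have c: "(m + 1 \<le> 0 + y \<and> 0 + y < m + 1 + (n - 1)) = True"
        "(0 \<le> m + 1 + (n - 2 - j) \<and> m + 1 + (n - 2 - j) < 0 + (m + 1)) = False" using j by auto
      have "?g2 (0 + y) = g (m + 1 + (n - 2 - j))" by (simp only: e c if_True if_False)
      also have "\<dots> = Elt (res AL (m + 1) (m + 1 + (n - 2 - j)))" by (rule g') (use j in simp)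
      finally show ?thesis using False by (simp add: f_def j_def)
    qed
  qed
  moreover have "map f [0..<LEN] = coeff_list (m + 1) ?Q @ coeff_list (n - 1) ?R"
    unfolding L(1) coeff_list_def by (rule nth_equalityI) (auto simp: nth_append f_def coeff_pol simp del: upt_Suc)
  ultimately have fin: "\<exists>f. arr ?g2 0 LEN f \<and> (\<exists>Q R. poly_of_size (m + 1) Q \<and> poly_of_size (n - 1) R \<and>
     A = B * Q + R \<and> map f [0..<LEN] = coeff_list (m + 1) Q @ coeff_list (n - 1) R)"
    using division_correct[OF inp' A B] by blast
  have "WP FINISH (0 + 0) (\<lambda>(g', v', z'). \<exists>f. arr g' 0 LEN f \<and> (\<exists>Q R. poly_of_size (m + 1) Q \<and> poly_of_size (n - 1) R \<and>
     A = B * Q + R \<and> map f [0..<LEN] = coeff_list (m + 1) Q @ coeff_list (n - 1) R)) (g, v, z)"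
    unfolding FINISH_def
  proof (rule WP_seq, rule WP_REV[where B = 0 and K = "m + 1"])
    fix v1 z1 assume "\<forall>x. x \<noteq> 4 \<longrightarrow> v1 x = v x"
    show "WP (REV eT eN) 0 (\<lambda>(g', v', z'). \<exists>f. arr g' 0 LEN f \<and> (\<exists>Q R. poly_of_size (m + 1) Q \<and> poly_of_size (n - 1) R \<and>
     A = B * Q + R \<and> map f [0..<LEN] = coeff_list (m + 1) Q @ coeff_list (n - 1) R)) (?g1, v1, z1)"
      by (rule WP_REV[where B = "m + 1" and K = "n - 1"]) (use fin L in \<open>simp_all\<close>)
  qed (use L in auto)
  then show ?thesis by simp
qed

end

section \<open>One phase of the division\<close>

context remainder
begin

definition STEP :: "'a com" where
  "STEP = (30 :== V 10 ;; 31 :== V 3 ;; 32 :== V 2 ;; CHUNK ;; 10 :== V 10 [+] V 1 ;; REM ;;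
    For 4 (eT [-] V 10) (Move (Output, V 10 [+] eN [+] V 4) (Input, (eL [-] Num 1) [-] (V 10 [+] eN [+] V 4))))"

definition step_cost :: "nat \<Rightarrow> nat \<Rightarrow> real" where
  "step_cost p k = Fm * (mp_load (n - 1) p k + real (lg k) + 4 * real E * real ph) + Fs * (sp_load p k + real (lg k)) +
     \<rho> * real (n + L) + (mp_load (n - 1) p k + real (lg k) + 1 + 4 * real E * real ph +
     (real L * (2 * real (m + 1) + (10 + 3 * real L) * real n) + 2 * real E * real E))"

lemma WP_STEP:
  assumes h: "stInv t g" and v: "v 10 = t" "v 11 = q" "v 1 = l" "v 2 = p" "v 3 = k"
    and k: "1 \<le> k" "1 \<le> p" "l \<le> p * k" and t: "t + l \<le> m + 1" "2 * ph \<le> t + l"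
    and sp: "\<And>e. 1 \<le> e \<Longrightarrow> e \<le> k \<Longrightarrow> t + p * k + k + 1 + e + wm e \<le> LEN \<and> t + p * k + k + 1 + e + ws e \<le> LEN"
  shows "WP STEP (step_cost p k) (\<lambda>(g', v', z'). stInv (t + l) g' \<and> v' 10 = t + l \<and> v' 11 = q \<and>
    (\<forall>x<10. x \<noteq> 4 \<longrightarrow> v' x = v x)) (g, v, z)"
proof -
  have s: "t + p * k + k + 1 + k \<le> LEN" using sp[of k] k by simp
  have pk: "k \<le> p * k" "p \<le> p * k" using k by simp_all
  have k': "k \<le> m" "3 * k \<le> length inp" "p \<le> LEN" using s pk LEN inp n by linarith+
  have lT: "LEN = m + 1 + (n - 1)" using LEN n by simp
  let ?u = "fps_nth (AL * iv)"
  have h': "arr g 0 t ?u" "arr g t (LEN - t) (\<lambda>i. res AL t (t + i))" using h by (simp_all add: stInv_def)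
  let ?v3 = "v(30 := t, 31 := k, 32 := p)"
  have s1: "sx (30 :== V 10) (g, v, z) = Some (0, (g, v(30 := t), z))"
    "sx (31 :== V 3) (g, v(30 := t), z) = Some (0, (g, v(30 := t, 31 := k), z))"
    "sx (32 :== V 2) (g, v(30 := t, 31 := k), z) = Some (0, (g, ?v3, z))"
    using v k' s by simp_all
  have ch: "WP CHUNK ((real k + real (lg k)) * (Fm + Fs + 1) + 1 +
      (\<Sum>i<p. real (min i ((n - 1 + k - 1) div k)) * (real k * Fm + real k) + real k * Fs))
    (\<lambda>(g', v', z'). arr g' t (p * k) (\<lambda>i. ?u (t + i)) \<and> (\<forall>y<t. g' y = g y) \<and>
      (\<forall>x. x < 29 \<or> x \<in> {30, 31, 32} \<longrightarrow> v' x = ?v3 x)) (g, ?v3, z)"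
  proof (rule WP_CHUNK[OF _ _ _ k(1) k'(1,2,3) sp])
    show "arr g t (p * k) (\<lambda>i. res AL t (t + i))" using h'(2) s by (auto simp: arr_def)
  qed simp_all
  let ?rest = "For 4 (eT [-] V 10) (Move (Output, V 10 [+] eN [+] V 4) (Input, (eL [-] Num 1) [-] (V 10 [+] eN [+] V 4)))"
  let ?Q = "\<lambda>(g', v', z' :: nat \<Rightarrow> 'a cell). stInv (t + l) g' \<and> v' 10 = t + l \<and> v' 11 = q \<and> (\<forall>x<10. x \<noteq> 4 \<longrightarrow> v' x = v x)"
  let ?t = "t + l"
  \<comment> \<open>Products have used the cells behind the new residual window as scratch. The
    residual equals the dividend there, so these cells are refilled from the input without any
    operation.\<close>
  have copy: "WP ?rest 0 ?Q (g2, v2, z2)" if g2: "arr g2 0 ?t ?u" "arr g2 ?t (n - 1) (\<lambda>i. res AL ?t (?t + i))"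
    and v2: "v2 10 = ?t" "v2 11 = q" "\<forall>x<10. v2 x = v x" for g2 v2 z2
  proof (rule WP_for_sx[where n = "m + 1 - ?t" and k = 0 and Z = "\<lambda>_. z2" and
        G = "\<lambda>i y. if ?t + (n - 1) \<le> y \<and> y < ?t + (n - 1) + i then Elt (al y) else g2 y"])
    fix i assume i: "i < m + 1 - ?t"
    let ?y = "?t + (n - 1) + i"
    have y: "?y < LEN" "?y < m + n" using i lT LEN by linarith+
    have "inp ! (m + n - 1 - ?y) = al ?y" "m + n - 1 - ?y < length inp" using y inp by (simp_all add: al_def)
    then show "sx (Move (Output, V 10 [+] eN [+] V 4) (Input, (eL [-] Num 1) [-] (V 10 [+] eN [+] V 4)))
        (\<lambda>y. if ?t + (n - 1) \<le> y \<and> y < ?t + (n - 1) + i then Elt (al y) else g2 y, v2(4 := i), z2) =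
      Some (0, \<lambda>y. if ?t + (n - 1) \<le> y \<and> y < ?t + (n - 1) + Suc i then Elt (al y) else g2 y, v2(4 := i), z2)"
      using v2 y by (auto simp: fun_eq_iff)
  next
    let ?g3 = "\<lambda>y. if ?t + (n - 1) \<le> y \<and> y < ?t + (n - 1) + (m + 1 - ?t) then Elt (al y) else g2 y"
    have "arr ?g3 0 ?t ?u" by (rule arr_cong[OF g2(1)]) auto
    moreover have "arr ?g3 ?t (LEN - ?t) (\<lambda>i. res AL ?t (?t + i))"
      unfolding arr_def
    proof (intro allI impI)
      fix i assume i: "i < LEN - ?t"
      show "?g3 (?t + i) = Elt (res AL ?t (?t + i))"
      proof (cases "i < n - 1")
        case True
        then have "(?t + (n - 1) \<le> ?t + i \<and> ?t + i < ?t + (n - 1) + (m + 1 - ?t)) = False" by auto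
        then show ?thesis using arrD[OF g2(2) True] by (simp only: if_False)
      next
        case False
        then have "?t + (n - 1) \<le> ?t + i" "?t + i < ?t + (n - 1) + (m + 1 - ?t)" using i lT by linarith+
        then show ?thesis by (simp only: res_high if_True simp_thms)
      qed
    qed
    ultimately show "?Q (?g3, v2(4 := m + 1 - ?t), z2)" using v2 by (simp add: stInv_def)
  qed (use v2 lT in auto)
  let ?rc = "real (n + L) * \<rho> + 4 * real E * real ph * (Fm + 1) + (real L * (2 * real ?t + (10 + 3 * real L) * real n) + 2 * real E * real E)"
  have tail: "WP (10 :== V 10 [+] V 1 ;; REM ;; ?rest) (?rc + 0) ?Q (g1, v1, z1)"
    if g1: "arr g1 t (p * k) (\<lambda>i. ?u (t + i))" "\<forall>y<t. g1 y = g y" "\<forall>x. x < 29 \<or> x \<in> {30, 31, 32} \<longrightarrow> v1 x = ?v3 x" for g1 v1 z1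
  proof -
    have v1: "v1 10 = t" "v1 1 = l" "v1 11 = q" using g1(3) v by simp_all
    have s4: "sx (10 :== V 10 [+] V 1) (g1, v1, z1) = Some (0, (g1, v1(10 := ?t), z1))"
    proof -
      have "?t \<le> LEN" using t lT by linarith
      then show ?thesis using v1 by simp
    qed
    have q1: "arr g1 0 ?t ?u"
      unfolding arr_def
    proof (intro allI impI)
      fix i assume i: "i < ?t"
      show "g1 (0 + i) = Elt (?u i)"
      proof (cases "i < t")
        case True
        then show ?thesis using g1(2) arrD[OF h'(1) True] by simp
      next
        case False
        then have "i - t < p * k" "t + (i - t) = i" using i k by linarith+
        then show ?thesis using arrD[OF g1(1), of "i - t"] by simp
      qed
    qed
    have rem: "WP REM ?rc (\<lambda>(g', v', z'). arr g' ?t (n - 1) (\<lambda>i. res AL ?t (?t + i)) \<and> (\<forall>y<?t. g' y = g1 y) \<and>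
      (\<forall>x<12. v' x = (v1(10 := ?t)) x)) (g1, v1(10 := ?t), z1)"
      by (rule WP_REM) (use v1 t lT q1 in auto)
    show ?thesis
    proof (rule WP_sx_then[OF s4], rule WP_then[OF rem])
      fix s2 :: "'a state"
      assume A: "case s2 of (g', v', z') \<Rightarrow> arr g' ?t (n - 1) (\<lambda>i. res AL ?t (?t + i)) \<and> (\<forall>y<?t. g' y = g1 y) \<and>
        (\<forall>x<12. v' x = (v1(10 := ?t)) x)"
      obtain g2 v2 z2 where s2: "s2 = (g2, v2, z2)" by (cases s2)
      have A': "arr g2 ?t (n - 1) (\<lambda>i. res AL ?t (?t + i))" "\<forall>y<?t. g2 y = g1 y" "\<forall>x<12. v2 x = (v1(10 := ?t)) x"
        using A unfolding s2 prod.case by blast+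
      have "arr g2 0 ?t ?u" by (rule arr_cong[OF q1]) (use A'(2) in auto)
      then show "WP ?rest 0 ?Q s2" unfolding s2 by (rule copy) (use A' v1 g1(3) in auto)
    qed
  qed
  have "WP STEP (((real k + real (lg k)) * (Fm + Fs + 1) + 1 +
      (\<Sum>i<p. real (min i ((n - 1 + k - 1) div k)) * (real k * Fm + real k) + real k * Fs)) + (?rc + 0)) ?Q (g, v, z)"
    unfolding STEP_def
  proof (rule WP_sx_then[OF s1(1)], rule WP_sx_then[OF s1(2)], rule WP_sx_then[OF s1(3)], rule WP_then[OF ch])
    fix s' :: "'a state"
    assume A: "case s' of (g', v', z') \<Rightarrow> arr g' t (p * k) (\<lambda>i. ?u (t + i)) \<and> (\<forall>y<t. g' y = g y) \<and>
      (\<forall>x. x < 29 \<or> x \<in> {30, 31, 32} \<longrightarrow> v' x = ?v3 x)"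
    obtain g1 v1 z1 where s': "s' = (g1, v1, z1)" by (cases s')
    show "WP (10 :== V 10 [+] V 1 ;; REM ;; ?rest) (?rc + 0) ?Q s'" unfolding s' by (rule tail) (use A[unfolded s' prod.case] in blast)+
  qed
  then show ?thesis
  proof (rule WP_weaken)
    define S where "S = (\<Sum>i<p. real (min i ((n - 1 + k - 1) div k)) * real k)"
    have "(\<Sum>i<p. real (min i ((n - 1 + k - 1) div k)) * (real k * Fm + real k) + real k * Fs) = S * (Fm + 1) + real p * real k * Fs"
    proof -
      have "(\<Sum>i<p. real (min i ((n - 1 + k - 1) div k)) * (real k * Fm + real k) + real k * Fs) =
        (\<Sum>i<p. real (min i ((n - 1 + k - 1) div k)) * real k * (Fm + 1)) + real p * real k * Fs"
        by (simp only: sum.distrib sum_constant card_lessThan distrib_left mult.assoc mult_1_right)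
      then show ?thesis by (simp only: S_def sum_distrib_right)
    qed
    moreover have "mp_load (n - 1) p k = real k + S" by (simp add: mp_load_def S_def)
    moreover have "real L * (2 * real ?t) \<le> real L * (2 * real (m + 1))" using t(1) by (intro mult_left_mono) simp_all
    ultimately show "((real k + real (lg k)) * (Fm + Fs + 1) + 1 +
      (\<Sum>i<p. real (min i ((n - 1 + k - 1) div k)) * (real k * Fm + real k) + real k * Fs)) + (?rc + 0) \<le> step_cost p k"
      by (simp add: step_cost_def sp_load_def algebra_simps)
  qed
qed

end


section \<open>The sequence of phases and its total cost\<close>

definition SETP :: "nat \<Rightarrow> nat \<Rightarrow> iexp \<Rightarrow> 'a com" where
  "SETP qa qb w = (2 :== (Num qa [*] V 1) [div] (Num qb [*] (w [+] eN)) [+] Num 1 ;;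
     3 :== (V 1 [+] V 2 [-] Num 1) [div] V 2)"

context remainder
begin

definition PREFIX :: "nat \<Rightarrow> 'a com" where
  "PREFIX zz = (1 :== eT [-] Num 4 [*] eN ;; 3 :== (eN [+] Num zz [-] Num 1) [div] Num zz ;;
     2 :== (V 1 [+] V 3 [-] Num 1) [div] V 3 ;; STEP)"

definition FIRST :: "nat \<Rightarrow> nat \<Rightarrow> 'a com" where
  "FIRST qa qb = (5 :== (Num 2 [*] (eT [-] V 10)) [div] Num 5 ;; Cond (Less eN (V 5)) (5 :== eN) Skip ;;
     1 :== (eT [-] V 10) [-] V 5 ;; SETP qa qb (V 5) ;; STEP)"

definition LAST :: "nat \<Rightarrow> nat \<Rightarrow> 'a com" where
  "LAST qa qb = (1 :== eT [-] V 10 ;; SETP qa qb (Num 0) ;; STEP)"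

text \<open>The tests decide the case distinctions of the load estimates in integer arithmetic:
  whether at least eight divisor lengths have to be found, and whether
  \<open>q * R < C * N\<close>.\<close>

definition PHASES :: "nat \<Rightarrow> nat \<Rightarrow> nat \<Rightarrow> nat \<Rightarrow> 'a com" where
  "PHASES qa qb Cc zz = (Cond (Less eT (Num 8 [*] eN)) Skip (PREFIX zz) ;;
     Cond (Less (Num qa [*] (eT [-] V 10)) (Num (Cc * qb) [*] eN)) Skip (FIRST qa qb) ;; LAST qa qb)"

definition MAIN :: "nat \<Rightarrow> nat \<Rightarrow> nat \<Rightarrow> nat \<Rightarrow> nat \<Rightarrow> 'a com" where
  "MAIN qa qb Cc zz dq = (LOAD ;; 10 :== Num 0 ;; 11 :== eN [div] Num dq ;; PHASES qa qb Cc zz)"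

definition ready :: "nat \<Rightarrow> 'a state \<Rightarrow> bool" where
  "ready t = (\<lambda>(g, v, z). stInv t g \<and> v 10 = t \<and> v 11 = q)"

text \<open>Here the inequality \<open>fits\<close> between reals becomes a count of cells: inverse
  \<open>k\<close>, result \<open>e\<close> and work area \<open>(c - 2) * e + d\<close> of any
  product with \<open>e \<le> k\<close> sum to at most \<open>c * k + d\<close>.\<close>

lemma WP_phase:
  assumes h: "ready t (g, v, z)" and v: "v 1 = l" "v 2 = p" "v 3 = k" and f: "fits c d (n - 1) l w p k"
    and t: "t + l + w = m + 1" "2 * ph \<le> t + l"
    and wm: "\<And>e. real (wm e) \<le> (c - 2) * real e + d" "\<And>e. real (ws e) \<le> (c - 2) * real e + d" and c: "2 \<le> c"
  shows "WP STEP (step_cost p k) (ready (t + l)) (g, v, z)"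
proof -
  have f': "1 \<le> p" "1 \<le> k" "l \<le> p * k" "real p * real k + c * real k + 1 + d \<le> real l + real w + real (n - 1)"
    using f by (auto simp: fits_def)
  have L: "real LEN = real t + (real l + real w + real (n - 1))"
  proof -
    have "LEN = t + l + w + (n - 1)" using LEN n t(1) by simp
    then show ?thesis by simp
  qed
  have sp: "t + p * k + k + 1 + e + x \<le> LEN" if "e \<le> k" "real x \<le> (c - 2) * real e + d" for e x
  proof -
    have "(c - 2) * real e \<le> (c - 2) * real k" by (rule mult_left_mono) (use that c in auto)
    then have "real e + (c - 2) * real e \<le> c * real k - real k" using that(1) by (simp add: algebra_simps)
    then have "real t + real p * real k + real k + 1 + real e + real x \<le> real LEN" using that(2) f'(4) L by linarith
    then have "real (t + p * k + k + 1 + e + x) \<le> real LEN" by simp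
    then show ?thesis by (simp only: of_nat_le_iff)
  qed
  have "WP STEP (step_cost p k) (\<lambda>(g', v', z'). stInv (t + l) g' \<and> v' 10 = t + l \<and> v' 11 = q \<and>
    (\<forall>x<10. x \<noteq> 4 \<longrightarrow> v' x = v x)) (g, v, z)"
    by (rule WP_STEP) (use h v f' t sp wm in \<open>auto simp: ready_def\<close>)
  then show ?thesis by (rule WP_weaken) (auto simp: ready_def split: prod.splits)
qed

text \<open>The space condition bounds \<open>p * k\<close> by the number of output cells, so both
  numbers may be stored as indices.\<close>

lemma sx_SETP:
  assumes v: "v 1 = l" and w: "okx we" "val v we = W" and f: "fits c d (n - 1) l W p k" "l + W + (n - 1) \<le> LEN" "0 \<le> c" "0 \<le> d"
    and p: "p = pieces qa qb (n - 1) l W" and k: "k = cdiv l p"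
  shows "sx (SETP qa qb we) (g, v, z) = Some (0, (g, v(2 := p, 3 := k), z))"
proof -
  have f': "1 \<le> p" "1 \<le> k" "real p * real k + c * real k + 1 + d \<le> real l + real W + real (n - 1)" using f(1) by (auto simp: fits_def)
  have "0 \<le> c * real k" using f by simp
  then have "real p * real k \<le> real l + real W + real (n - 1)" using f'(3) f(4) by linarith
  then have "real (p * k) \<le> real (l + W + (n - 1))" by (simp only: of_nat_mult of_nat_add)
  then have pk: "p * k \<le> LEN" using f(2) by (simp only: of_nat_le_iff)
  have le: "p \<le> LEN" "k \<le> LEN" using f' pk order_trans[of p "p * k" LEN] order_trans[of k "p * k" LEN] by simp_all
  have 1: "sx (2 :== (Num qa [*] V 1) [div] (Num qb [*] (we [+] eN)) [+] Num 1) (g, v, z) = Some (0, (g, v(2 := p), z))"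
    using v w le(1) p by (simp add: pieces_def)
  have 2: "sx (3 :== (V 1 [+] V 2 [-] Num 1) [div] V 2) (g, v(2 := p), z) = Some (0, (g, v(2 := p, 3 := k), z))"
    using v le(2) k by (simp add: cdiv_def)
  show ?thesis unfolding SETP_def by (simp only: sx.simps(2) 1 2 option.case prod.case add_0_left)
qed

context
  fixes c d \<mu> qq P e :: real and qa qb Cc zz :: nat
  assumes c: "3 \<le> c" and qq: "qq = real qa / real qb" "c < qq" "qq < c + 1/1000" and qb: "1 \<le> qb"
    and C: "qq < real Cc" "real Cc \<le> c + 1"
    and mu: "0 < \<mu>" "\<mu> \<le> 1/1000" "2 * \<mu> \<le> 1 / c - 1 / real Cc"
    and P: "8 * qq + 1 \<le> P" and NP: "10 * (P * P) \<le> \<mu> * real (n - 1)" "(c + P + 1 + d) * qq \<le> real (n - 1) * (qq - c)"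
    and zz: "1 \<le> zz" "(c + 1) / 5 < real zz" "real zz \<le> (c + 1) / 5 + 1"
    and Nz: "(c + 1) * (real (n - 1) / real zz + 1) + d \<le> 5 * real (n - 1)"
    and d: "0 \<le> d" and wmc: "\<And>x. real (wm x) \<le> (c - 2) * real x + d" "\<And>x. real (ws x) \<le> (c - 2) * real x + d"
    and ph4: "4 * ph \<le> n - 1" and e: "\<And>k. k \<le> 6 * (n - 1) \<Longrightarrow> real (lg k) + 4 * real E * real ph + real L + 1 \<le> e"
    and rhoF: "\<rho> \<le> Fm" "\<rho> \<le> 2 * Fs"
begin

text \<open>Operations of a phase that are not charged to a product rate, apart from those counted
  by \<open>mp_load\<close>.\<close>

definition extra :: real where "extra = e + (real L * (2 * real (m + 1) + (10 + 3 * real L) * real n) + 2 * real E * real E)"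

lemma e0: "0 \<le> e" "0 \<le> extra"
proof -
  show "0 \<le> e" using e[of 0] by (smt (verit) of_nat_0_le_iff mult_nonneg_nonneg zero_le)
  then show "0 \<le> extra" by (simp add: extra_def)
qed

lemma step_cost_le: "k \<le> 6 * (n - 1) \<Longrightarrow> step_cost p k \<le> Fm * (mp_load (n - 1) p k + e) + Fs * (sp_load p k + e) +
    \<rho> * real (n - 1) + mp_load (n - 1) p k + extra"
proof -
  assume "k \<le> 6 * (n - 1)"
  then have h: "real (lg k) + 4 * real E * real ph + real L + 1 \<le> e" by (rule e)
  have h2: "real (lg k) \<le> e" "real (lg k) + 1 + 4 * real E * real ph \<le> e" using h by (auto simp: add_increasing intro: order_trans[rotated])
  have "Fm * (real (lg k) + 4 * real E * real ph + real L + 1) \<le> Fm * e" by (rule mult_left_mono[OF h Fm])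
  moreover have "Fs * real (lg k) \<le> Fs * e" by (rule mult_left_mono[OF h2(1) Fs])
  moreover have "\<rho> * (real L + 1) \<le> Fm * (real L + 1)" by (rule mult_right_mono[OF rhoF(1)]) simp
  moreover have "\<rho> * real (n + L) = \<rho> * real (n - 1) + \<rho> * (real L + 1)"
  proof -
    have "real (n + L) = real (n - 1) + (real L + 1)" using n by simp
    then show ?thesis by (simp only: distrib_left)
  qed
  ultimately show ?thesis using h2 unfolding step_cost_def extra_def by (simp add: distrib_left)
qed

text \<open>\<open>r\<close> phases for \<open>R\<close> coefficients: every phase adds
  \<open>e\<close> to the products of either kind, while the slack is credited once. The last terms,
  without a rate, are the additions that accompany the products.\<close>

definition budget :: "nat \<Rightarrow> nat \<Rightarrow> real" where
  "budget r R = Fm * ((c / 2 + 1 / 2 + 1 / c) * real R - \<mu> * real (n - 1) / 2 + real r * e) +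
     Fs * ((2 + 1 / c) * real R - \<mu> * real (n - 1) / 2 + real r * e) + (c / 2 + 1 / 2 + 1 / c) * real R + real r * extra"

lemma load_budget:
  assumes "load_ok c \<mu> (n - 1) R r X Y"
  shows "Fm * (X + real r * e) + Fs * (Y + real r * e) + \<rho> * (real r * real (n - 1)) + X + real r * extra \<le> budget r R"
proof -
  have "X \<le> (c / 2 + 1 / 2 + 1 / c) * real R - \<mu> * real (n - 1)" using assms by (simp add: load_ok_def)
  moreover have "0 \<le> \<mu> * real (n - 1)" using mu by simp
  ultimately have "X \<le> (c / 2 + 1 / 2 + 1 / c) * real R" by linarith
  then show ?thesis
    using load_ok_bound[OF assms Fm Fs rhoF less_imp_le[OF mu(1)]] unfolding budget_def by (simp add: distrib_left)
qed

lemmas P11 = c qq qb C mu P NP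
lemmas N_big = N_large[OF P11]

lemma fits_k: "fits c d (n - 1) l w p k \<Longrightarrow> l + w \<le> 8 * (n - 1) \<Longrightarrow> k \<le> 6 * (n - 1)"
proof -
  assume f: "fits c d (n - 1) l w p k" and l: "l + w \<le> 8 * (n - 1)"
  have "real k \<le> real p * real k" "3 * real k \<le> c * real k" using f c by (auto simp: fits_def mult_right_mono)
  moreover have "real p * real k + c * real k + 1 + d \<le> real l + real w + real (n - 1)" using f by (simp add: fits_def)
  moreover have "real l + real w \<le> 8 * real (n - 1)" using of_nat_mono[OF l, where 'a = real] by simp
  ultimately have "real k \<le> 6 * real (n - 1)" using d by linarith
  then have "real k \<le> real (6 * (n - 1))" by simp
  then show ?thesis by (simp only: of_nat_le_iff)
qed

lemma WP_LAST:
  assumes h: "ready t (g, v, z)" and R: "t + R = m + 1" "1 \<le> R" "R \<le> 8 * (n - 1)" and p: "p = pieces qa qb (n - 1) R 0" and k: "k = cdiv R p"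
  shows "WP (LAST qa qb) (step_cost p k) (ready (m + 1)) (g, v, z)"
proof -
  have v: "v 10 = t" using h by (simp add: ready_def)
  have T: "m + 1 - t = R" "LEN = m + 1 + (n - 1)" using R LEN n by simp_all
  have f: "fits c d (n - 1) R 0 p k" by (rule pieces_fit[OF P11 R(2,3) p k])
  have s1: "sx (1 :== eT [-] V 10) (g, v, z) = Some (0, (g, v(1 := R), z))"
  proof -
    have "R \<le> LEN" using R T by linarith
    then show ?thesis using v T(1) by simp
  qed
  have s2: "sx (SETP qa qb (Num 0)) (g, v(1 := R), z) = Some (0, (g, v(1 := R, 2 := p, 3 := k), z))"
    by (rule sx_SETP[OF _ _ _ f _ _ d p k]) (use T R c in auto)
  have "WP STEP (step_cost p k) (ready (t + R)) (g, v(1 := R, 2 := p, 3 := k), z)"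
    by (rule WP_phase[OF _ _ _ _ f]) (use h R wmc c ph4 n in \<open>auto simp: ready_def\<close>)
  then show ?thesis unfolding LAST_def R(1) by (intro WP_sx_then[OF s1] WP_sx_then[OF s2])
qed

lemma WP_tail_phases:
  assumes h: "ready t (g, v, z)" and R: "t + R = m + 1" "n - 1 < R" "R \<le> 8 * (n - 1)"
  shows "WP (Cond (Less (Num qa [*] (eT [-] V 10)) (Num (Cc * qb) [*] eN)) Skip (FIRST qa qb) ;; LAST qa qb) (budget 2 R)
    (ready (m + 1)) (g, v, z)"
proof -
  have v: "v 10 = t" using h by (simp add: ready_def)
  have T: "m + 1 - t = R" "LEN = m + 1 + (n - 1)" using R LEN n by simp_all
  have bv: "bval v (Less (Num qa [*] (eT [-] V 10)) (Num (Cc * qb) [*] eN)) \<longleftrightarrow> qa * R < Cc * qb * (n - 1)"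
    using v T(1) by simp
  show ?thesis
  proof (cases "qa * R < Cc * qb * (n - 1)")
    case True
    define p where "p = pieces qa qb (n - 1) R 0"
    define k where "k = cdiv R p"
    have A: "fits c d (n - 1) R 0 p k \<and> load_ok c \<mu> (n - 1) R 1 (mp_load (n - 1) p k) (sp_load p k)"
      by (rule one_phase[OF P11 R(2) True p_def k_def])
    have l: "load_ok c \<mu> (n - 1) R 1 (mp_load (n - 1) p k) (sp_load p k)" using A by blast
    have k6: "k \<le> 6 * (n - 1)" by (rule fits_k[of R 0 p]) (use A R in auto)
    have "step_cost p k \<le> budget 1 R" using load_budget[OF l] step_cost_le[OF k6, of p] by simp
    also have "budget 1 R \<le> budget 2 R"
      using mult_nonneg_nonneg[OF Fm e0(1)] mult_nonneg_nonneg[OF Fs e0(1)] e0 unfolding budget_def by (simp add: distrib_left)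
    finally have cost: "step_cost p k \<le> budget 2 R" .
    have "WP (LAST qa qb) (step_cost p k) (ready (m + 1)) (g, v, z)"
      by (rule WP_LAST[OF h R(1) _ R(3) p_def k_def]) (use R in simp)
    then have "WP (LAST qa qb) (budget 2 R) (ready (m + 1)) (g, v, z)" by (rule WP_weaken) (use cost in auto)
    moreover have "sx (Cond (Less (Num qa [*] (eT [-] V 10)) (Num (Cc * qb) [*] eN)) Skip (FIRST qa qb)) (g, v, z) = Some (0, (g, v, z))"
      using bv True by simp
    ultimately show ?thesis by (rule WP_sx_then[rotated])
  next
    case False
    define l2 where "l2 = min (n - 1) (2 * R div 5)"
    define l1 where "l1 = R - l2"
    define p1 where "p1 = pieces qa qb (n - 1) l1 l2"
    define k1 where "k1 = cdiv l1 p1"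
    define p2 where "p2 = pieces qa qb (n - 1) l2 0"
    define k2 where "k2 = cdiv l2 p2"
    have A: "fits c d (n - 1) l1 l2 p1 k1 \<and> fits c d (n - 1) l2 0 p2 k2 \<and>
        load_ok c \<mu> (n - 1) R 2 (mp_load (n - 1) p1 k1 + mp_load (n - 1) p2 k2) (sp_load p1 k1 + sp_load p2 k2)"
      by (rule two_phases[OF P11 _ R(3) l2_def l1_def p1_def k1_def p2_def k2_def]) (use False in simp)
    have l: "l1 + l2 = R" "l2 \<le> n - 1" "5 * l2 \<le> 2 * R" using l1_def l2_def by linarith+
    have k6: "k1 \<le> 6 * (n - 1)" "k2 \<le> 6 * (n - 1)"
      using fits_k[of l1 l2 p1 k1] fits_k[of l2 0 p2 k2] A R l by auto
    have ld: "load_ok c \<mu> (n - 1) R 2 (mp_load (n - 1) p1 k1 + mp_load (n - 1) p2 k2) (sp_load p1 k1 + sp_load p2 k2)" using A by blast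
    have cost: "step_cost p1 k1 + step_cost p2 k2 \<le> budget 2 R"
      using load_budget[OF ld] step_cost_le[OF k6(1), of p1] step_cost_le[OF k6(2), of p2] by (simp add: distrib_left)
    have "200 \<le> real (n - 1)" using N_big by blast
    then have "200 \<le> n - 1" by simp
    then have l2_1: "1 \<le> l2" using R l2_def by linarith
    have s1: "sx (5 :== (Num 2 [*] (eT [-] V 10)) [div] Num 5) (g, v, z) = Some (0, (g, v(5 := 2 * R div 5), z))"
    proof -
      have "2 * R div 5 \<le> LEN" using R T by linarith
      then show ?thesis using v T(1) by simp
    qed
    have s2: "sx (Cond (Less eN (V 5)) (5 :== eN) Skip) (g, v(5 := 2 * R div 5), z) = Some (0, (g, v(5 := l2), z))"
    proof -
      have nL: "n - 1 \<le> LEN" using T(2) by simp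
      show ?thesis
      proof (cases "n - 1 < 2 * R div 5")
        case True
        then have "l2 = n - 1" by (simp add: l2_def)
        then show ?thesis using True nL by simp
      next
        case False
        then have "l2 = 2 * R div 5" by (simp add: l2_def)
        then show ?thesis using False by simp
      qed
    qed
    have s3: "sx (1 :== (eT [-] V 10) [-] V 5) (g, v(5 := l2), z) = Some (0, (g, v(5 := l2, 1 := l1), z))"
    proof -
      have "l1 \<le> LEN" using R T l by linarith
      then show ?thesis using v T(1) by (simp add: l1_def)
    qed
    have s4: "sx (SETP qa qb (V 5)) (g, v(5 := l2, 1 := l1), z) = Some (0, (g, v(5 := l2, 1 := l1, 2 := p1, 3 := k1), z))"
      by (rule sx_SETP[OF _ _ _ conjunct1[OF A] _ _ d p1_def k1_def]) (use T R l c in auto)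
    have st: "WP STEP (step_cost p1 k1) (ready (t + l1)) (g, v(5 := l2, 1 := l1, 2 := p1, 3 := k1), z)"
    proof (rule WP_phase[OF _ _ _ _ conjunct1[OF A]])
      show "2 * ph \<le> t + l1" using ph4 R l by linarith
    qed (use h R wmc c l in \<open>auto simp: ready_def\<close>)
    have FIRST: "WP (FIRST qa qb) (step_cost p1 k1) (ready (t + l1)) (g, v, z)"
      unfolding FIRST_def by (intro WP_sx_then[OF s1] WP_sx_then[OF s2] WP_sx_then[OF s3] WP_sx_then[OF s4] st)
    have c1: "WP (Cond (Less (Num qa [*] (eT [-] V 10)) (Num (Cc * qb) [*] eN)) Skip (FIRST qa qb)) (step_cost p1 k1) (ready (t + l1)) (g, v, z)"
    proof (rule WP_cond)
      show "okb (Less (Num qa [*] (eT [-] V 10)) (Num (Cc * qb) [*] eN))" by simp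
    qed (use bv False FIRST in blast)+
    have "WP (Cond (Less (Num qa [*] (eT [-] V 10)) (Num (Cc * qb) [*] eN)) Skip (FIRST qa qb) ;; LAST qa qb)
       (step_cost p1 k1 + step_cost p2 k2) (ready (m + 1)) (g, v, z)"
    proof (rule WP_then[OF c1])
      fix s' assume r: "ready (t + l1) s'"
      obtain g' v' z' where s': "s' = (g', v', z')" by (cases s')
      show "WP (LAST qa qb) (step_cost p2 k2) (ready (m + 1)) s'"
        unfolding s' by (rule WP_LAST[OF r[unfolded s'] _ l2_1 _ p2_def k2_def]) (use R l in auto)
    qed
    then show ?thesis by (rule WP_weaken) (use cost in auto)
  qed
qed

lemma WP_PHASES:
  assumes h: "ready 0 (g, v, z)"
  shows "WP (PHASES qa qb Cc zz) (budget 3 (m + 1)) (ready (m + 1)) (g, v, z)"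
proof -
  have v: "v 10 = 0" using h by (simp add: ready_def)
  have T: "LEN = m + 1 + (n - 1)" using LEN n by simp
  define \<nu> where "\<nu> = \<mu> * real (n - 1) / 2"
  have nu: "0 \<le> \<nu>" using mu by (simp add: \<nu>_def)
  have N1: "1 \<le> n - 1" using N_big by blast
  note nn = mult_nonneg_nonneg[OF Fm e0(1)] mult_nonneg_nonneg[OF Fs e0(1)] mult_nonneg_nonneg[OF Fm nu] mult_nonneg_nonneg[OF Fs nu] e0
  show ?thesis
  proof (cases "m + 1 < 8 * (n - 1)")
    case True
    have s: "sx (Cond (Less eT (Num 8 [*] eN)) Skip (PREFIX zz)) (g, v, z) = Some (0, (g, v, z))" using True by simp
    have "WP (PHASES qa qb Cc zz) (budget 2 (m + 1)) (ready (m + 1)) (g, v, z)"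
      unfolding PHASES_def by (rule WP_sx_then[OF s WP_tail_phases[OF h]]) (use True n in auto)
    then show ?thesis
    proof (rule WP_weaken)
      show "budget 2 (m + 1) \<le> budget 3 (m + 1)" using nn unfolding budget_def by (simp add: distrib_left)
    qed
  next
    case False
    define l where "l = m + 1 - 4 * (n - 1)"
    define k where "k = cdiv (n - 1) zz"
    define p where "p = cdiv l k"
    have T8: "8 * (n - 1) \<le> m + 1" using False by simp
    have A: "fits c d (n - 1) l (4 * (n - 1)) p k \<and> load_ok c \<mu> (n - 1) l 1 (mp_load (n - 1) p k) (sp_load p k)"
      by (rule prefix_phase[OF P11 zz Nz T8 l_def k_def p_def])
    have l: "l + 4 * (n - 1) = m + 1" using T8 by (simp add: l_def)
    have k1: "1 \<le> k" using A by (simp add: fits_def)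
    have kN: "k \<le> n - 1"
    proof -
      have "n - 1 + zz - 1 < (n - 1 + 1) * zz" 
      proof -
        have "n - 1 \<le> (n - 1) * zz" using zz(1) by simp
        moreover have "(n - 1 + 1) * zz = (n - 1) * zz + zz" by (simp only: distrib_right mult_1)
        ultimately show ?thesis using zz(1) by linarith
      qed
      then have "k < n - 1 + 1" unfolding k_def cdiv_def by (rule less_mult_imp_div_less)
      then show ?thesis by simp
    qed
    have ld: "load_ok c \<mu> (n - 1) l 1 (mp_load (n - 1) p k) (sp_load p k)" using A by blast
    have k6: "k \<le> 6 * (n - 1)" using kN by simp
    have cost1: "step_cost p k \<le> budget 1 l" using load_budget[OF ld] step_cost_le[OF k6, of p] by simp
    have pl: "p \<le> LEN"
    proof -
      have "p * k \<le> l + k - 1" using ceil_div(2)[OF k1, of l] by (simp add: p_def cdiv_def mult.commute)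
      moreover have "p \<le> p * k" using k1 by simp
      ultimately show ?thesis using kN l T by linarith
    qed
    have s1: "sx (1 :== eT [-] Num 4 [*] eN) (g, v, z) = Some (0, (g, v(1 := l), z))"
    proof -
      have "l \<le> LEN" using l T by linarith
      then show ?thesis by (simp add: l_def)
    qed
    have s2: "sx (3 :== (eN [+] Num zz [-] Num 1) [div] Num zz) (g, v(1 := l), z) = Some (0, (g, v(1 := l, 3 := k), z))"
    proof -
      have "k \<le> LEN" using kN T by linarith
      then show ?thesis by (simp add: k_def cdiv_def)
    qed
    have s3: "sx (2 :== (V 1 [+] V 3 [-] Num 1) [div] V 3) (g, v(1 := l, 3 := k), z) = Some (0, (g, v(1 := l, 3 := k, 2 := p), z))"
      using pl by (simp add: p_def cdiv_def)
    have st: "WP STEP (step_cost p k) (ready (0 + l)) (g, v(1 := l, 3 := k, 2 := p), z)"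
    proof (rule WP_phase[OF _ _ _ _ conjunct1[OF A]])
      show "2 * ph \<le> 0 + l" using ph4 l T8 by linarith
    qed (use h wmc c l in \<open>auto simp: ready_def\<close>)
    have PRE: "WP (PREFIX zz) (step_cost p k) (ready l) (g, v, z)"
      unfolding PREFIX_def using WP_sx_then[OF s1 WP_sx_then[OF s2 WP_sx_then[OF s3 st]]] by simp
    have c1: "WP (Cond (Less eT (Num 8 [*] eN)) Skip (PREFIX zz)) (step_cost p k) (ready l) (g, v, z)"
    proof (rule WP_cond)
      show "okb (Less eT (Num 8 [*] eN))" by simp
    qed (use False PRE in auto)
    have "WP (PHASES qa qb Cc zz) (step_cost p k + budget 2 (4 * (n - 1))) (ready (m + 1)) (g, v, z)"
      unfolding PHASES_def
    proof (rule WP_then[OF c1])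
      fix s' assume r: "ready l s'"
      obtain g' v' z' where s': "s' = (g', v', z')" by (cases s')
      show "WP (Cond (Less (Num qa [*] (eT [-] V 10)) (Num (Cc * qb) [*] eN)) Skip (FIRST qa qb) ;; LAST qa qb)
        (budget 2 (4 * (n - 1))) (ready (m + 1)) s'"
        unfolding s' by (rule WP_tail_phases[OF r[unfolded s'] l]) (use N1 in auto)
    qed
    then show ?thesis
    proof (rule WP_weaken)
      \<comment> \<open>The prefix and the remaining phases each bring a slack; one of the two
        credits is given up.\<close>
      have "real (m + 1) = real l + real (4 * (n - 1))" using l by (metis of_nat_add)
      then have "budget 1 l + budget 2 (4 * (n - 1)) \<le> budget 3 (m + 1)"
        using nn unfolding budget_def \<nu>_def[symmetric] by (simp only:) (simp add: algebra_simps)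
      then show "step_cost p k + budget 2 (4 * (n - 1)) \<le> budget 3 (m + 1)" using cost1 by linarith
    qed
  qed
qed

text \<open>The slack pays for the term \<open>e\<close> of up to three phases and for passing from
  \<open>m + 1\<close> quotient coefficients to \<open>m\<close> in the leading terms.\<close>

lemma WP_MAIN:
  assumes dq: "q = (n - 1) div dq" and ee: "3 * e + (c / 2 + 1 / 2 + 1 / c) + (2 + 1 / c) \<le> \<mu> * real (n - 1) / 2"
  shows "WP (MAIN qa qb Cc zz dq) (Fm * ((c / 2 + 1 / 2 + 1 / c) * real m) + Fs * ((2 + 1 / c) * real m) +
      (c / 2 + 1 / 2 + 1 / c) * real (m + 1) + 3 * extra) (\<lambda>(g', v', z'). stInv (m + 1) g') (g, v, z)"
proof -
  have "WP (MAIN qa qb Cc zz dq) (0 + budget 3 (m + 1)) (ready (m + 1)) (g, v, z)"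
    unfolding MAIN_def
  proof (rule WP_then[OF WP_LOAD])
    fix s' :: "'a state" assume A: "case s' of (g', v', z') \<Rightarrow> stInv 0 g' \<and> (\<forall>x. x \<noteq> 4 \<longrightarrow> v' x = v x)"
    obtain g1 v1 z1 where s': "s' = (g1, v1, z1)" by (cases s')
    have g1: "stInv 0 g1" using A unfolding s' prod.case by blast
    have s1: "sx (10 :== Num 0) (g1, v1, z1) = Some (0, (g1, v1(10 := 0), z1))" by simp
    have "q \<le> LEN" unfolding dq LEN by (rule order_trans[OF div_le_dividend]) simp
    then have s2: "sx (11 :== eN [div] Num dq) (g1, v1(10 := 0), z1) = Some (0, (g1, v1(10 := 0, 11 := q), z1))"
      by (simp add: dq)
    show "WP (10 :== Num 0 ;; 11 :== eN [div] Num dq ;; PHASES qa qb Cc zz) (budget 3 (m + 1)) (ready (m + 1)) s'"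
      unfolding s' by (rule WP_sx_then[OF s1], rule WP_sx_then[OF s2], rule WP_PHASES) (simp add: ready_def g1)
  qed
  then show ?thesis
  proof (rule WP_weaken)
    have i: "0 \<le> c / 2 + 1 / 2 + 1 / c" "0 \<le> 2 + 1 / c" using c by simp_all
    have "Fm * ((c / 2 + 1 / 2 + 1 / c) * real (m + 1) - \<mu> * real (n - 1) / 2 + real 3 * e) \<le> Fm * ((c / 2 + 1 / 2 + 1 / c) * real m)"
      by (rule mult_left_mono[OF _ Fm]) (use ee i in \<open>simp add: distrib_left\<close>)
    moreover have "Fs * ((2 + 1 / c) * real (m + 1) - \<mu> * real (n - 1) / 2 + real 3 * e) \<le> Fs * ((2 + 1 / c) * real m)"
      by (rule mult_left_mono[OF _ Fs]) (use ee i in \<open>simp add: distrib_left\<close>)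
    ultimately show "0 + budget 3 (m + 1) \<le> Fm * ((c / 2 + 1 / 2 + 1 / c) * real m) + Fs * ((2 + 1 / c) * real m) +
      (c / 2 + 1 / 2 + 1 / c) * real (m + 1) + 3 * extra" unfolding budget_def by simp
  qed (auto simp: ready_def split: prod.splits)
qed

lemmas WP_MAIN_explicit = WP_MAIN[unfolded extra_def]

end

end


section \<open>Constants that depend only on the given product programs\<close>

lemma eventually_linear: "0 < b \<Longrightarrow> \<exists>n0. \<forall>N\<ge>n0. (a::real) \<le> b * real N"
proof -
  assume b: "0 < b"
  obtain n0 where "a / b \<le> real n0" using real_arch_simple by blast
  then have "a \<le> b * real n0" using b by (simp add: field_simps)
  then have "a \<le> b * real N" if "n0 \<le> N" for N
    using order_trans[of a "b * real n0" "b * real N"] that b by simp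
  then show ?thesis by blast
qed

lemma sq_le_pow2: "j * j \<le> 4 * 2 ^ (j::nat)"
proof (induction j rule: less_induct)
  case (less j)
  show ?case
  proof (cases "j < 4")
    case True
    then have "j = 0 \<or> j = 1 \<or> j = 2 \<or> j = 3" by auto
    then show ?thesis by auto
  next
    case False
    then obtain i where i: "j = Suc i" "3 \<le> i" by (cases j) auto
    have "3 * i \<le> i * i" using i by simp
    moreover have "Suc i * Suc i = i * i + 2 * i + 1" by simp
    ultimately have "j * j \<le> 2 * (i * i)" using i(2) unfolding i(1) by linarith
    also have "\<dots> \<le> 2 * (4 * 2 ^ i)" using less[of i] i by simp
    finally show ?thesis by (simp add: i(1))
  qed
qed

text \<open>With \<open>s\<close> at one's disposal the logarithm falls below any linear function
  with positive slope, up to a constant: a square is below a power of two, and the square (j - s)^2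
  is nonnegative.\<close>

lemma lg_le:
  fixes s :: real
  assumes k: "k \<le> 6 * N" and s: "0 < s"
  shows "real (lg k) \<le> 12 / s * real N + s / 2 + 1"
proof (cases "lg k")
  case 0
  then show ?thesis using s by simp
next
  case (Suc j)
  have "2 ^ j < k" by (rule lg_less) (simp add: Suc)
  then have "j * j \<le> 24 * N" using sq_le_pow2[of j] k by linarith
  then have jj: "real j * real j \<le> 24 * real N" using of_nat_mono[of "j * j" "24 * N", where 'a = real] by simp
  have "0 \<le> (real j - s) * (real j - s)" by simp
  then have "2 * s * real j \<le> real j * real j + s * s" by (simp add: algebra_simps)
  then have "2 * s * real j \<le> 24 * real N + s * s" using jj by linarith
  then have "real j \<le> 12 / s * real N + s / 2" using s by (simp add: field_simps)
  then show ?thesis by (simp add: Suc)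
qed

text \<open>\<open>c\<close> determines the rational \<open>qq\<close> and the slack
  \<open>\<mu>\<close>; the slack determines the number \<open>L\<close> of moduli, and
  \<open>L\<close> determines \<open>D\<close> and \<open>dq\<close>. Each modulus has size about N
  / (L + C0), so \<open>L\<close> digits leave about \<open>C0\<close> modulus sizes of room for the
  last stage. A large \<open>L\<close> makes this uncovered part small compared with
  \<open>\<mu> * N\<close>.\<close>

lemma constants:
  fixes c d :: real and E :: nat
  assumes c: "3 \<le> c" and d: "0 \<le> d" and E: "2 \<le> E"
  obtains qa qb Cc zz L D dq N0 :: nat and qq \<mu> P :: real where
    "qq = real qa / real qb" "c < qq" "qq < c + 1/1000" "1 \<le> qb" "qq < real Cc" "real Cc \<le> c + 1"
    "0 < \<mu>" "\<mu> \<le> 1/1000" "2 * \<mu> \<le> 1 / c - 1 / real Cc" "8 * qq + 1 \<le> P" "1 \<le> zz" "(c + 1) / 5 < real zz" "real zz \<le> (c + 1) / 5 + 1"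
    "0 < D" "\<And>i j. i < j \<Longrightarrow> j < L \<Longrightarrow> j - i dvd D"
    "\<And>N. N0 \<le> N \<Longrightarrow> 10 * (P * P) \<le> \<mu> * real N"
    "\<And>N. N0 \<le> N \<Longrightarrow> (c + P + 1 + d) * qq \<le> real N * (qq - c)"
    "\<And>N. N0 \<le> N \<Longrightarrow> (c + 1) * (real N / real zz + 1) + d \<le> 5 * real N"
    "\<And>N. N0 \<le> N \<Longrightarrow> 3 * (\<mu> * real N / 12) + (c / 2 + 1 / 2 + 1 / c) + (2 + 1 / c) \<le> \<mu> * real N / 2"
    "\<And>N. N0 \<le> N \<Longrightarrow> 0 < N div dq \<and> L \<le> N"
    "\<And>N j x. N0 \<le> N \<Longrightarrow> j < L \<Longrightarrow> real x \<le> (c - 2) * real (D * (N div dq + j) + 1) + d \<Longrightarrow>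
      (\<Sum>i<j. D * (N div dq + i)) + 6 * (D * (N div dq + j) + 1) + x \<le> N"
    "\<And>N. N0 \<le> N \<Longrightarrow> 4 * (N - (\<Sum>i<L. D * (N div dq + i))) \<le> N"
    "\<And>N k. N0 \<le> N \<Longrightarrow> k \<le> 6 * N \<Longrightarrow>
      real (lg k) + 4 * real E * real (N - (\<Sum>i<L. D * (N div dq + i))) + real L + 1 \<le> \<mu> * real N / 12"
proof -
  \<comment> \<open>The least integer strictly above \<open>c\<close>, also when \<open>c\<close> is
    an integer, so that 1 / c - 1 / Cc is positive.\<close>
  define Cc where "Cc = nat \<lfloor>c\<rfloor> + 1"
  have Cc: "c < real Cc" "real Cc \<le> c + 1" using c unfolding Cc_def by linarith+
  obtain qq where qq: "qq \<in> \<rat>" "c < qq" "qq < min (c + 1/1000) (real Cc)"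
    using Rats_dense_in_real[of c "min (c + 1/1000) (real Cc)"] Cc by auto
  obtain qa qb where qab: "qb \<noteq> 0" "\<bar>qq\<bar> = real qa / real qb" using Rats_abs_nat_div_natE[OF qq(1)] by metis
  have qv: "qq = real qa / real qb" "1 \<le> qb" "qq < c + 1/1000" "qq < real Cc" using qab qq c by auto
  define \<mu> where "\<mu> = min (1/1000) ((1 / c - 1 / real Cc) / 2)"
  have "1 / real Cc < 1 / c" using Cc c by (intro divide_strict_left_mono) auto
  then have mu: "0 < \<mu>" "\<mu> \<le> 1/1000" "2 * \<mu> \<le> 1 / c - 1 / real Cc"
  proof -
    assume h: "1 / real Cc < 1 / c"
    show "0 < \<mu>" using h by (simp add: \<mu>_def)
    have "\<mu> \<le> (1 / c - 1 / real Cc) / 2" "\<mu> \<le> 1/1000" unfolding \<mu>_def by (rule min.cobounded2, rule min.cobounded1)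
    moreover have "2 * x \<le> y" if "x \<le> y / 2" for x y :: real using that by simp
    ultimately show "\<mu> \<le> 1/1000" "2 * \<mu> \<le> 1 / c - 1 / real Cc" by blast+
  qed
  define P where "P = 8 * qq + 1"
  define zz where "zz = nat \<lfloor>(c + 1) / 5\<rfloor> + 1"
  have z: "1 \<le> zz" "(c + 1) / 5 < real zz" "real zz \<le> (c + 1) / 5 + 1"
  proof -
    have "0 \<le> \<lfloor>(c + 1) / 5\<rfloor>" using c by simp
    then have e: "real zz = of_int \<lfloor>(c + 1) / 5\<rfloor> + 1" by (simp add: zz_def)
    show "1 \<le> zz" by (simp add: zz_def)
    show "(c + 1) / 5 < real zz" unfolding e by (rule real_of_int_floor_add_one_gt)
    show "real zz \<le> (c + 1) / 5 + 1" unfolding e by (simp only: add_le_cancel_right of_int_floor_le)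
  qed
  \<comment> \<open>A stage needs six arrays and at most about \<open>c - 2\<close> more sizes for
    its work area, that is \<open>c + 4\<close>; the rest absorbs the lower-order terms.\<close>
  define C0 where "C0 = nat \<lceil>c\<rceil> + 7"
  have C0: "c + 7 \<le> real C0" unfolding C0_def using c by linarith
  \<comment> \<open>The uncovered part is about \<open>C0 * N / L\<close>; with this
    \<open>L\<close> its main contribution \<open>4 * E * C0 * N / L\<close> is at most
    \<open>\<mu> * N / 48\<close>.\<close>
  define L where "L = nat \<lceil>192 * real E * real C0 / \<mu>\<rceil> + 1"
  have "192 * real E * real C0 / \<mu> \<le> real L" unfolding L_def by linarith
  then have L: "192 * (real E * real C0) \<le> \<mu> * real L" using mu by (simp add: field_simps)
  define D :: nat where "D = fact L"
  have D: "0 < D" "\<And>i j. i < j \<Longrightarrow> j < L \<Longrightarrow> j - i dvd D" by (auto simp: D_def intro!: dvd_fact)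
  define W where "W = D * (L + C0)"
  have W0: "0 < W" using D(1) C0 c by (simp add: W_def C0_def)
  define K1 where "K1 = (real L + 3 + c) * real (D * L) + c + 4 + d"
  define Kn where "Kn = nat \<lceil>K1\<rceil> + 1"
  have Kn: "K1 \<le> real Kn" "1 \<le> Kn" unfolding Kn_def by linarith+
  \<comment> \<open>Chosen so that 12 / s equals \<open>\<mu> / 96\<close>.\<close>
  define s where "s = 1152 / \<mu>"
  have s: "0 < s" using mu by (simp add: s_def)
  have ex: "\<exists>n0. \<forall>N\<ge>n0. 10 * (P * P) \<le> \<mu> * real N" "\<exists>n0. \<forall>N\<ge>n0. (c + P + 1 + d) * qq \<le> (qq - c) * real N"
    "\<exists>n0. \<forall>N\<ge>n0. c + 1 + d \<le> (5 - (c + 1) / real zz) * real N"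
    "\<exists>n0. \<forall>N\<ge>n0. (c / 2 + 1 / 2 + 1 / c) + (2 + 1 / c) \<le> (\<mu> / 4) * real N"
    "\<exists>n0. \<forall>N\<ge>n0. real L + 1 \<le> (\<mu> / 48) * real N" "\<exists>n0. \<forall>N\<ge>n0. 4 * real E * real (L * D) \<le> (\<mu> / 48) * real N"
    "\<exists>n0. \<forall>N\<ge>n0. real (W * Kn) \<le> 1 * real N" "\<exists>n0. \<forall>N\<ge>n0. s / 2 + 1 \<le> (\<mu> / 96) * real N"
  proof -
    have "(c + 1) / real zz < 5" using z by (simp add: field_simps)
    then show "\<exists>n0. \<forall>N\<ge>n0. c + 1 + d \<le> (5 - (c + 1) / real zz) * real N" by (intro eventually_linear) simp
  qed (rule eventually_linear, use mu qq in simp)+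
  obtain n1 where n0_1: "\<forall>N\<ge>n1. 10 * (P * P) \<le> \<mu> * real N" using ex(1) by blast
  obtain n2 where n0_2: "\<forall>N\<ge>n2. (c + P + 1 + d) * qq \<le> (qq - c) * real N" using ex(2) by blast
  obtain n3 where n0_3: "\<forall>N\<ge>n3. c + 1 + d \<le> (5 - (c + 1) / real zz) * real N" using ex(3) by blast
  obtain n4 where n0_4: "\<forall>N\<ge>n4. (c / 2 + 1 / 2 + 1 / c) + (2 + 1 / c) \<le> (\<mu> / 4) * real N" using ex(4) by blast
  obtain n5 where n0_5: "\<forall>N\<ge>n5. real L + 1 \<le> (\<mu> / 48) * real N" using ex(5) by blast
  obtain n6 where n0_6: "\<forall>N\<ge>n6. 4 * real E * real (L * D) \<le> (\<mu> / 48) * real N" using ex(6) by blast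
  obtain n7 where n0_7: "\<forall>N\<ge>n7. real (W * Kn) \<le> 1 * real N" using ex(7) by blast
  obtain n8 where n0_8: "\<forall>N\<ge>n8. s / 2 + 1 \<le> (\<mu> / 96) * real N" using ex(8) by blast
  define N0 where "N0 = n1 + n2 + n3 + n4 + n5 + n6 + n7 + n8"
  have b: "10 * (P * P) \<le> \<mu> * real N" "(c + P + 1 + d) * qq \<le> (qq - c) * real N"
    "c + 1 + d \<le> (5 - (c + 1) / real zz) * real N"
    "(c / 2 + 1 / 2 + 1 / c) + (2 + 1 / c) \<le> (\<mu> / 4) * real N"
    "real L + 1 \<le> (\<mu> / 48) * real N" "4 * real E * real (L * D) \<le> (\<mu> / 48) * real N"
    "real (W * Kn) \<le> 1 * real N" "s / 2 + 1 \<le> (\<mu> / 96) * real N" if "N0 \<le> N" for N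
  proof -
    have ge: "n1 \<le> N" "n2 \<le> N" "n3 \<le> N" "n4 \<le> N" "n5 \<le> N" "n6 \<le> N" "n7 \<le> N" "n8 \<le> N"
      using that unfolding N0_def by linarith+
    show "10 * (P * P) \<le> \<mu> * real N" "(c + P + 1 + d) * qq \<le> (qq - c) * real N"
      "c + 1 + d \<le> (5 - (c + 1) / real zz) * real N"
      "(c / 2 + 1 / 2 + 1 / c) + (2 + 1 / c) \<le> (\<mu> / 4) * real N"
      "real L + 1 \<le> (\<mu> / 48) * real N" "4 * real E * real (L * D) \<le> (\<mu> / 48) * real N"
      "real (W * Kn) \<le> 1 * real N" "s / 2 + 1 \<le> (\<mu> / 96) * real N"
      by (rule n0_1[rule_format, OF ge(1)], rule n0_2[rule_format, OF ge(2)], rule n0_3[rule_format, OF ge(3)],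
          rule n0_4[rule_format, OF ge(4)], rule n0_5[rule_format, OF ge(5)], rule n0_6[rule_format, OF ge(6)],
          rule n0_7[rule_format, OF ge(7)], rule n0_8[rule_format, OF ge(8)])
  qed
  have muN: "\<mu> * real N \<le> 1/1000 * real N" for N by (rule mult_right_mono) (use mu in auto)
  have qN: "Kn \<le> N div W" if "N0 \<le> N" for N
  proof -
    have "W * Kn \<le> N" using b(7)[OF that] by (simp only: mult_1 of_nat_le_iff)
    then have "W * Kn div W \<le> N div W" by (rule div_le_mono)
    then show ?thesis using W0 by simp
  qed
  \<comment> \<open>Multiplying by \<open>L + C0\<close> clears the denominator of the modulus size
    N / (L + C0).\<close>
  have lenL: "real (N - (\<Sum>i<L. D * (N div W + i))) * real (L + C0) \<le> real C0 * real N + real (L * D) * real (L + C0)" if "N0 \<le> N" for N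
  proof -
    have "(\<Sum>i<L. D * (N div W)) \<le> (\<Sum>i<L. D * (N div W + i))" by (intro sum_mono) simp
    then have "L * (D * (N div W)) \<le> (\<Sum>i<L. D * (N div W + i))" by simp
    then have "N - (\<Sum>i<L. D * (N div W + i)) \<le> N - L * (D * (N div W))" by simp
    then have "(N - (\<Sum>i<L. D * (N div W + i))) * (L + C0) \<le> (N - L * (D * (N div W))) * (L + C0)" by (rule mult_right_mono) simp
    also have "\<dots> = N * (L + C0) - L * (W * (N div W))" 
    proof -
      define r where "r = N div W"
      have "L * (D * r) * (L + C0) = L * (W * r)" by (simp add: W_def ac_simps)
      then show ?thesis by (simp only: diff_mult_distrib flip: r_def)
    qed
    also have "\<dots> \<le> C0 * N + L * W"
    proof -
      have "N < W * (N div W) + W" using W0 mult_div_mod_eq[of W N] mod_less_divisor[OF W0, of N] by linarith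
      then have "L * N \<le> L * (W * (N div W) + W)" by (intro mult_left_mono) simp_all
      then show ?thesis by (simp add: algebra_simps)
    qed
    finally have "real ((N - (\<Sum>i<L. D * (N div W + i))) * (L + C0)) \<le> real (C0 * N + L * W)" by (simp only: of_nat_le_iff)
    then show ?thesis by (simp only: of_nat_mult of_nat_add W_def mult.assoc)
  qed
  have phE: "4 * real E * real (N - (\<Sum>i<L. D * (N div W + i))) \<le> \<mu> * real N / 24" if N: "N0 \<le> N" for N
  proof -
    define h where "h = real (N - (\<Sum>i<L. D * (N div W + i)))"
    define S where "S = real (L + C0)"
    have S0: "0 < S" using C0 c by (simp add: S_def)
    have "4 * real E * (h * S) \<le> 4 * real E * (real C0 * real N + real (L * D) * S)"
      using lenL[OF N] by (intro mult_left_mono) (simp_all add: h_def S_def)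
    also have "\<dots> = 4 * (real E * real C0) * real N + (4 * real E * real (L * D)) * S" by (simp add: algebra_simps)
    also have "\<dots> \<le> (\<mu> / 48) * S * real N + ((\<mu> / 48) * real N) * S"
    proof (intro add_mono mult_right_mono)
      have "\<mu> * real L \<le> \<mu> * S" using mu by (intro mult_left_mono) (simp_all add: S_def)
      then show "4 * (real E * real C0) \<le> (\<mu> / 48) * S" using L by simp
      show "4 * real E * real (L * D) \<le> (\<mu> / 48) * real N" by (rule b(6)[OF N])
    qed (use S0 in simp_all)
    finally have "(4 * real E * h) * S \<le> (\<mu> * real N / 24) * S" by (simp add: algebra_simps)
    then show ?thesis using S0 by (simp add: h_def)
  qed
  show ?thesis
  proof (rule that[where P = P and ?N0.0 = N0 and dq = W, OF qv(1) qq(2) qv(3,2,4) Cc(2) mu _ z D])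
    show "8 * qq + 1 \<le> P" by (simp add: P_def)
  next
    fix N assume N: "N0 \<le> N"
    show "10 * (P * P) \<le> \<mu> * real N" by (rule b(1)[OF N])
    show "(c + P + 1 + d) * qq \<le> real N * (qq - c)" using b(2)[OF N] by (simp only: mult.commute)
    show "(c + 1) * (real N / real zz + 1) + d \<le> 5 * real N" using b(3)[OF N] by (simp add: algebra_simps)
    show "3 * (\<mu> * real N / 12) + (c / 2 + 1 / 2 + 1 / c) + (2 + 1 / c) \<le> \<mu> * real N / 2" using b(4)[OF N] by linarith
    have "real L \<le> real N" using b(5)[OF N] muN[of N] by linarith
    then show "0 < N div W \<and> L \<le> N" using qN[OF N] Kn by simp
    have "4 * real (N - (\<Sum>i<L. D * (N div W + i))) \<le> 4 * real E * real (N - (\<Sum>i<L. D * (N div W + i)))"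
      using E by (intro mult_right_mono) simp_all
    then have "real (4 * (N - (\<Sum>i<L. D * (N div W + i)))) \<le> real N" using phE[OF N] muN[of N] by simp
    then show "4 * (N - (\<Sum>i<L. D * (N div W + i))) \<le> N" by (simp only: of_nat_le_iff)
    fix k assume k: "k \<le> 6 * N"
    have e: "12 / s = \<mu> / 96" by (simp add: s_def)
    have "real (lg k) \<le> \<mu> / 96 * real N + (s / 2 + 1)" using lg_le[OF k s, unfolded e] by (simp only: add.assoc)
    then show "real (lg k) + 4 * real E * real (N - (\<Sum>i<L. D * (N div W + i))) + real L + 1 \<le> \<mu> * real N / 12"
      using b(8)[OF N] phE[OF N] b(5)[OF N] by (linarith | argo | smt (verit))
  next
    fix N j x assume N: "N0 \<le> N" and j: "j < L" and x: "real x \<le> (c - 2) * real (D * (N div W + j) + 1) + d"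
    define q where "q = N div W"
    define A where "A = real (D * (q + L))"
    have "(\<Sum>i<j. D * (q + i)) \<le> (\<Sum>i<j. D * (q + L))" by (intro sum_mono mult_left_mono) (use j in auto)
    then have "real (\<Sum>i<j. D * (q + i)) \<le> real (j * (D * (q + L)))" by (simp only: of_nat_le_iff) simp
    then have S: "real (\<Sum>i<j. D * (q + i)) \<le> real j * A" by (simp add: A_def)
    have a: "real (D * (q + j)) \<le> A" unfolding A_def using j by (simp only: of_nat_le_iff) simp
    have A0: "0 \<le> A" by (simp add: A_def)
    have x': "real x \<le> (c - 2) * (A + 1) + d"
    proof -
      have "(c - 2) * real (D * (q + j) + 1) \<le> (c - 2) * (A + 1)" by (rule mult_left_mono) (use a c in auto)
      then show ?thesis using x by (simp only: q_def)
    qed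
    have jA: "real j * A \<le> (real L - 1) * A" using j A0 by (intro mult_right_mono) linarith+
    have tot: "real (\<Sum>i<j. D * (q + i)) + 6 * (real (D * (q + j)) + 1) + real x \<le> (real L + 3 + c) * A + c + 4 + d"
      using S a x' jA by (simp add: algebra_simps)
    have "(real L + 3 + c) * A = (real L + 3 + c) * real (D * q) + (real L + 3 + c) * real (D * L)" by (simp add: A_def algebra_simps)
    moreover have "(real L + 3 + c + 4) * real (D * q) \<le> real (L + C0) * real (D * q)" by (rule mult_right_mono) (use C0 in auto)
    moreover have "real (L + C0) * real (D * q) = real (W * q)" by (simp add: W_def algebra_simps)
    moreover have "W * q \<le> N" by (simp add: q_def)
    then have "real (W * q) \<le> real N" by (simp only: of_nat_le_iff)
    moreover have "K1 \<le> real (D * q)"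
    proof -
      have "Kn \<le> D * q" using qN[OF N] D(1) order_trans[of Kn q "D * q"] by (simp add: q_def)
      then have "real Kn \<le> real (D * q)" by (simp only: of_nat_le_iff)
      then show ?thesis using Kn by linarith
    qed
    moreover have "0 \<le> real (D * q)" by simp
    ultimately have "(real L + 3 + c) * A + c + 4 + d \<le> real N" 
    proof -
      assume h: "(real L + 3 + c) * A = (real L + 3 + c) * real (D * q) + (real L + 3 + c) * real (D * L)"
        "(real L + 3 + c + 4) * real (D * q) \<le> real (L + C0) * real (D * q)" "real (L + C0) * real (D * q) = real (W * q)"
        "real (W * q) \<le> real N" "K1 \<le> real (D * q)" "0 \<le> real (D * q)"
      have x: "(real L + 3 + c + 4) * real (D * q) = (real L + 3 + c) * real (D * q) + 4 * real (D * q)" by (rule distrib_right)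
      have gen: "AA + c + 4 + d \<le> NN" if "AA = a1 + a2" "x \<le> y" "y = w" "w \<le> NN" "a2 + c + 4 + d \<le> Q" "0 \<le> Q" "x = a1 + 4 * Q"
        for AA a1 a2 x y w NN Q :: real using that by linarith
      show ?thesis by (rule gen[OF h(1,2,3,4) h(5)[unfolded K1_def] h(6) x])
    qed
    then have "real ((\<Sum>i<j. D * (q + i)) + 6 * (D * (q + j) + 1) + x) \<le> real N" using tot by simp
    then show "(\<Sum>i<j. D * (N div W + i)) + 6 * (D * (N div W + j) + 1) + x \<le> N" by (simp only: of_nat_le_iff q_def)
  qed
qed

section \<open>The given products on coefficient functions, and constant divisors\<close>

lemma computes_mono: "computes a ps inp k w T Q \<Longrightarrow> T \<le> T' \<Longrightarrow> (\<And>ys. Q ys \<Longrightarrow> Q' ys) \<Longrightarrow> computes a ps inp k w T' Q'"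
  unfolding computes_def by (metis order_trans)

lemma computes_nonneg: "computes a ps inp k w T Q \<Longrightarrow> 0 \<le> T"
  unfolding computes_def by (metis length_replicate of_nat_0_le_iff order_trans)

lemma poly_of_size_pol: "poly_of_size k (pol k f)"
  using psize_pol[of k f] unfolding poly_of_size_def psize_def by (metis leading_coeff_0_iff not_less)

lemma coeff_list_pol: "coeff_list k (pol k f) = map f [0..<k]"
  by (simp add: coeff_list_def coeff_pol)

lemma middle_product_pol:
  assumes "1 \<le> k"
  shows "coeff_list k (middle_product k k (pol (2 * k - 1) f) (pol k u)) = map (\<lambda>a. \<Sum>b<k. f (k - 1 + a - b) * u b) [0..<k]"
proof -
  have "coeff (pol k u * pol (2 * k - 1) f) (a + (k - 1)) = (\<Sum>b<k. f (k - 1 + a - b) * u b)" if "a < k" for a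
    unfolding coeff_mult using that
    by (intro sum.mono_neutral_cong_right) (auto simp: coeff_pol mult.commute add.commute)
  then show ?thesis
    by (simp add: coeff_list_def middle_product_def coeff_poly_cutoff coeff_poly_shift mult.commute)
qed

lemma short_product_pol:
  "coeff_list k (short_product k (pol k f) (pol k u)) = map (\<lambda>a. \<Sum>b\<le>a. f (a - b) * u b) [0..<k]"
proof -
  have "coeff (pol k u * pol k f) a = (\<Sum>b\<le>a. f (a - b) * u b)" if "a < k" for a
    unfolding coeff_mult using that by (intro sum.cong) (auto simp: coeff_pol mult.commute)
  then show ?thesis
    by (simp add: coeff_list_def short_product_def coeff_poly_cutoff mult.commute)
qed

text \<open>The case \<open>n = 1\<close>: the divisor is a unit, and the quotient is found
  coefficient by coefficient with an empty remainder.\<close>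

definition SCALE :: "'a com" where
  "SCALE = For 4 eT (Arith Div (Output, V 4) (Input, V 4) (Input, eL))"

lemma (in machine) WP_SCALE:
  fixes A B :: "'a poly"
  assumes ps: "ps = [m, 1]" and inp: "inp = coeff_list (m + 1) A @ coeff_list 1 B" and LEN: "LEN = m + 1"
    and A: "poly_of_size (m + 1) A" and B: "poly_of_size 1 B" and u: "coeff B 0 dvd 1"
  shows "WP SCALE (real m + 1) (\<lambda>(g', v', z'). \<exists>f. arr g' 0 LEN f \<and> (\<exists>Q R. poly_of_size (m + 1) Q \<and> poly_of_size (1 - 1) R \<and>
     A = B * Q + R \<and> map f [0..<LEN] = coeff_list (m + 1) Q @ coeff_list (1 - 1) R)) (g, v, z)"
proof -
  define b where "b = coeff B 0"
  define f where "f i = (THE w. w * b = coeff A i)" for i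
  obtain w where w: "1 = b * w" using u unfolding b_def by (auto simp: dvd_def)
  have f: "f i * b = coeff A i" for i
    unfolding f_def
  proof (rule theI[of _ "coeff A i * w"])
    show "coeff A i * w * b = coeff A i" 
    proof -
      have "coeff A i * w * b = coeff A i * (b * w)" by (simp only: ac_simps)
      then show ?thesis using w by simp
    qed
    fix x assume "x * b = coeff A i"
    then have "coeff A i * w = x * (b * w)" by (metis mult.assoc)
    then show "x = coeff A i * w" using w by simp
  qed
  have B': "B = [:b:]" using B unfolding poly_of_size_def b_def by (auto simp: degree_eq_zeroE dest!: degree0_coeffs)
  let ?Q = "pol (m + 1) f"
  have "A = B * ?Q + 0"
  proof (rule poly_eqI)
    fix k
    show "coeff A k = coeff (B * ?Q + 0) k"
    proof (cases "k < m + 1")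
      case True
      then show ?thesis using f[of k] by (simp add: B' coeff_pol mult.commute)
    next
      case False
      then have "coeff A k = 0" using A unfolding poly_of_size_def by (auto intro: coeff_eq_0)
      then show ?thesis using False by (simp add: B' coeff_pol)
    qed
  qed
  moreover have "map f [0..<LEN] = coeff_list (m + 1) ?Q @ coeff_list (1 - 1) 0"
    by (simp only: coeff_list_pol LEN) (simp add: coeff_list_def)
  moreover have "poly_of_size (1 - 1) (0 :: 'a poly)" by (simp add: poly_of_size_def)
  ultimately have fin: "\<exists>Q R. poly_of_size (m + 1) Q \<and> poly_of_size (1 - 1) R \<and> A = B * Q + R \<and>
      map f [0..<LEN] = coeff_list (m + 1) Q @ coeff_list (1 - 1) R" using poly_of_size_pol by blast
  have i1: "inp ! i = coeff A i" if "i < m + 1" for i unfolding inp using that by (simp add: coeff_list_def nth_append del: upt_Suc)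
  have i2: "inp ! (m + 1) = b" unfolding inp using nth_append_length[of "coeff_list (m + 1) A"] by (simp add: coeff_list_def b_def)
  have psv: "ps ! 0 = m" "ps ! Suc 0 = 1" "length ps = 2" by (simp_all add: ps)
  have len: "length inp = m + 2" unfolding inp by (simp add: coeff_list_def)
  show ?thesis
    unfolding SCALE_def
  proof (rule WP_for_sx[where n = "m + 1" and k = 1 and Z = "\<lambda>_. z" and G = "\<lambda>i y. if y < i then Elt (f y) else g y"])
    fix i assume i: "i < m + 1"
    have "i < LEN" using i LEN by simp
    then show "sx (Arith Div (Output, V 4) (Input, V 4) (Input, eL)) (\<lambda>y. if y < i then Elt (f y) else g y, v(4 := i), z) =
      Some (1, \<lambda>y. if y < Suc i then Elt (f y) else g y, v(4 := i), z)"
      using i i1[OF i] i2 len u psv by (auto simp: fun_eq_iff less_Suc_eq f_def b_def)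
  next
    have "arr (\<lambda>y. if y < m + 1 then Elt (f y) else g y) 0 LEN f" by (simp add: arr_def LEN)
    then show "case (\<lambda>y. if y < m + 1 then Elt (f y) else g y, v(4 := m + 1), z) of (g', v', z') \<Rightarrow>
      \<exists>f. arr g' 0 LEN f \<and> (\<exists>Q R. poly_of_size (m + 1) Q \<and> poly_of_size (1 - 1) R \<and>
        A = B * Q + R \<and> map f [0..<LEN] = coeff_list (m + 1) Q @ coeff_list (1 - 1) R)" using fin by auto
  qed (use LEN len psv in auto)
qed


text \<open>The program uses 54 registers. Everything outside the leading terms is bounded by a
  constant times \<open>m\<close>; the maximum with 1 keeps the error term positive at
  \<open>n = 1\<close>.\<close>

theorem theorem2p8:
  fixes M :: "nat \<Rightarrow> real"
    and mul mp sp :: "'a::comm_ring_1 com"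
    and lam_m c_m lam_s c_s c :: real
  assumes "superlinear M"
    and "multiplication_algorithm mul M"
    and "middle_product_algorithm mp M lam_m c_m"
    and "short_product_algorithm sp M lam_s c_s"
    and "c = max (c_m + 3) (c_s + 2)"
  shows "\<exists>(alg :: 'a com) (w :: nat) (C :: real). \<forall>m n. 1 \<le> n \<and> n \<le> m \<longrightarrow>
    divides_within alg m n w
      ((lam_m * ((c + 1) / 2 + 1 / c) + lam_s * (2 + 1 / c)) * M m
        + C * (real m * max 1 (log 2 (real n))))"
proof -
  obtain d1 where d1: "\<forall>k\<ge>1. \<exists>w. real w \<le> c_m * real k + d1 \<and>
      (\<forall>F G. poly_of_size (2 * k - 1) F \<longrightarrow> poly_of_size k G \<longrightarrow>
         computes mp [k] (coeff_list (2 * k - 1) F @ coeff_list k G) k w (lam_m * M k)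
           (\<lambda>ys. ys = coeff_list k (middle_product k k F G)))"
    using assms(3) unfolding middle_product_algorithm_def by blast
  obtain d2 where d2: "\<forall>k\<ge>1. \<exists>w. real w \<le> c_s * real k + d2 \<and>
      (\<forall>F G. poly_of_size k F \<longrightarrow> poly_of_size k G \<longrightarrow>
         computes sp [k] (coeff_list k F @ coeff_list k G) k w (lam_s * M k)
           (\<lambda>ys. ys = coeff_list k (short_product k F G)))"
    using assms(4) unfolding short_product_algorithm_def by blast
  have choice: "\<exists>f. \<forall>k\<ge>1. Q k (f k)" if "\<forall>k\<ge>1. \<exists>w. Q k w" for Q :: "nat \<Rightarrow> nat \<Rightarrow> bool"
    using that by (intro exI[of _ "\<lambda>k. SOME w. Q k w"]) (meson someI_ex)
  obtain w1 where w1: "\<And>k. 1 \<le> k \<Longrightarrow> real (w1 k) \<le> c_m * real k + d1"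
    "\<And>k F G. 1 \<le> k \<Longrightarrow> poly_of_size (2 * k - 1) F \<Longrightarrow> poly_of_size k G \<Longrightarrow>
       computes mp [k] (coeff_list (2 * k - 1) F @ coeff_list k G) k (w1 k) (lam_m * M k)
         (\<lambda>ys. ys = coeff_list k (middle_product k k F G))"
    using choice[OF d1] by blast
  obtain w2 where w2: "\<And>k. 1 \<le> k \<Longrightarrow> real (w2 k) \<le> c_s * real k + d2"
    "\<And>k F G. 1 \<le> k \<Longrightarrow> poly_of_size k F \<Longrightarrow> poly_of_size k G \<Longrightarrow>
       computes sp [k] (coeff_list k F @ coeff_list k G) k (w2 k) (lam_s * M k)
         (\<lambda>ys. ys = coeff_list k (short_product k F G))"
    using choice[OF d2] by blast
  define d where "d = max 0 (max d1 d2)"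
  have d: "0 \<le> d" "d1 \<le> d" "d2 \<le> d" by (auto simp: d_def)
  \<comment> \<open>A negative slope would give a negative number of registers for large sizes.
    Consequently \<open>c\<close> is at least 3, on which the estimates rest.\<close>
  have cm: "0 \<le> c_m"
  proof (rule ccontr)
    assume "\<not> 0 \<le> c_m"
    then have "0 < - c_m" by simp
    from eventually_linear[OF this] obtain n0 where h: "\<forall>N\<ge>n0. d1 + 1 \<le> - c_m * real N" by blast
    have "d1 + 1 \<le> - c_m * real (n0 + 1)" by (rule h[rule_format]) simp
    moreover have "0 \<le> c_m * real (n0 + 1) + d1" using order_trans[OF of_nat_0_le_iff w1(1)[of "n0 + 1"]] by simp
    moreover have "- c_m * real (n0 + 1) = - (c_m * real (n0 + 1))" by simp
    ultimately show False by linarith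
  qed
  have c: "3 \<le> c" "c_m \<le> c - 2" "c_s \<le> c - 2" using assms(5) cm by auto
  \<comment> \<open>Size 0 is outside the specification of the products; the default 0 makes the
    linear bound valid at every size.\<close>
  define wm where "wm k = (if k = 0 then 0 else w1 k)" for k :: nat
  define ws where "ws k = (if k = 0 then 0 else w2 k)" for k :: nat
  have wmc: "real (wm k) \<le> (c - 2) * real k + d" "real (ws k) \<le> (c - 2) * real k + d" for k
  proof -
    have 1: "c_m * real k \<le> (c - 2) * real k" by (rule mult_right_mono[OF c(2)]) simp
    have 2: "c_s * real k \<le> (c - 2) * real k" by (rule mult_right_mono[OF c(3)]) simp
    have "(real (wm k) \<le> (c - 2) * real k + d) \<and> (real (ws k) \<le> (c - 2) * real k + d)"
    proof (cases "k = 0")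
      case True
      then show ?thesis using d(1) by (simp add: wm_def ws_def)
    next
      case False
      then have k: "1 \<le> k" "wm k = w1 k" "ws k = w2 k" by (simp_all add: wm_def ws_def)
      show ?thesis unfolding k(2,3) using w1(1)[OF k(1)] w2(1)[OF k(1)] 1 2 d by linarith
    qed
    then show "real (wm k) \<le> (c - 2) * real k + d" "real (ws k) \<le> (c - 2) * real k + d" by blast+
  qed
  \<comment> \<open>The constant part of the work area is charged per coefficient, so that
    \<open>E * k\<close> cells suffice even for \<open>k = 1\<close>.\<close>
  define E where "E = nat \<lceil>c_m + d\<rceil> + 2"
  have Ec: "2 \<le> E" "c_m + d + 2 \<le> real E" using cm d unfolding E_def by linarith+
  have wmE: "2 * k + wm k \<le> E * k" if "1 \<le> k" for k
  proof -
    have "d * 1 \<le> d * real k" by (rule mult_left_mono) (use that d in auto)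
    moreover have "(c_m + d + 2) * real k = c_m * real k + d * real k + 2 * real k" by (simp add: algebra_simps)
    moreover have "real (2 * k + wm k) = 2 * real k + real (w1 k)" using that by (simp add: wm_def)
    ultimately have "real (2 * k + wm k) \<le> (c_m + d + 2) * real k" using w1(1)[OF that] d by linarith
    also have "\<dots> \<le> real E * real k" by (rule mult_right_mono[OF Ec(2)]) simp
    finally have "real (2 * k + wm k) \<le> real (E * k)" by simp
    then show ?thesis by (simp only: of_nat_le_iff)
  qed
  have z: "poly_of_size k (0 :: 'a poly)" for k by (simp add: poly_of_size_def)
  have M0: "0 \<le> M k" if k: "1 \<le> k" for k
    using assms(2) k computes_nonneg z unfolding multiplication_algorithm_def by metis
  have lm0: "0 \<le> lam_m * M k" if "1 \<le> k" for k using w1(2)[OF that z z] by (rule computes_nonneg)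
  have ls0: "0 \<le> lam_s * M k" if "1 \<le> k" for k using w2(2)[OF that z z] by (rule computes_nonneg)
  \<comment> \<open>Superlinearity with \<alpha> = m / k. For a negative factor the left-hand side
    is at most zero, as \<open>M\<close> is nonnegative, and the right-hand side is nonnegative
    because it is built from a cost.\<close>
  have lin: "lam * M k \<le> real k * (lam * M m / real m)" if l: "\<And>j. 1 \<le> j \<Longrightarrow> 0 \<le> lam * M j" and k: "1 \<le> k" "k \<le> m" for lam k m
  proof (cases "0 \<le> lam")
    case True
    have "real m / real k * M k \<le> M m"
      using assms(1)[unfolded superlinear_def, rule_format, of "real m / real k" k m] k by simp
    then have "M k \<le> real k * M m / real m" using k by (simp add: field_simps)
    then have "lam * M k \<le> lam * (real k * M m / real m)" by (rule mult_left_mono[OF _ True])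
    then show ?thesis by (simp add: ac_simps)
  next
    case False
    then have "lam \<le> 0" by simp
    then have "lam * M k \<le> 0" by (rule mult_nonpos_nonneg[OF _ M0[OF k(1)]])
    moreover have "0 \<le> real k * (lam * M m / real m)"
      by (rule mult_nonneg_nonneg[OF _ divide_nonneg_nonneg[OF l[OF order_trans[OF k]]]]) simp_all
    ultimately show ?thesis by linarith
  qed
  \<comment> \<open>The cheaper cyclic product is selected by the two constants alone, so the
    program is the same for all sizes.\<close>
  define CYC :: "'a com" where "CYC = (if lam_m \<le> 2 * lam_s then division.CYC_MP mp else division.CYC_SP sp)"
  obtain qa qb Cc zz L D dq N0 :: nat and qq \<mu> P :: real where K:
    "qq = real qa / real qb" "c < qq" "qq < c + 1/1000" "1 \<le> qb" "qq < real Cc" "real Cc \<le> c + 1"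
    "0 < \<mu>" "\<mu> \<le> 1/1000" "2 * \<mu> \<le> 1 / c - 1 / real Cc" "8 * qq + 1 \<le> P" "1 \<le> zz" "(c + 1) / 5 < real zz" "real zz \<le> (c + 1) / 5 + 1"
    and D: "0 < D" "\<And>i j. i < j \<Longrightarrow> j < L \<Longrightarrow> j - i dvd D"
    and Nc: "\<And>N. N0 \<le> N \<Longrightarrow> 10 * (P * P) \<le> \<mu> * real N"
    "\<And>N. N0 \<le> N \<Longrightarrow> (c + P + 1 + d) * qq \<le> real N * (qq - c)"
    "\<And>N. N0 \<le> N \<Longrightarrow> (c + 1) * (real N / real zz + 1) + d \<le> 5 * real N"
    "\<And>N. N0 \<le> N \<Longrightarrow> 3 * (\<mu> * real N / 12) + (c / 2 + 1 / 2 + 1 / c) + (2 + 1 / c) \<le> \<mu> * real N / 2"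
    "\<And>N. N0 \<le> N \<Longrightarrow> 0 < N div dq \<and> L \<le> N"
    and spc: "\<And>N j x. N0 \<le> N \<Longrightarrow> j < L \<Longrightarrow> real x \<le> (c - 2) * real (D * (N div dq + j) + 1) + d \<Longrightarrow>
      (\<Sum>i<j. D * (N div dq + i)) + 6 * (D * (N div dq + j) + 1) + x \<le> N"
    and phc: "\<And>N. N0 \<le> N \<Longrightarrow> 4 * (N - (\<Sum>i<L. D * (N div dq + i))) \<le> N"
    "\<And>N k. N0 \<le> N \<Longrightarrow> k \<le> 6 * N \<Longrightarrow>
      real (lg k) + 4 * real E * real (N - (\<Sum>i<L. D * (N div dq + i))) + real L + 1 \<le> \<mu> * real N / 12"
  proof (rule constants[OF c(1) d(1) Ec(1)], goal_cases)
    case 1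
    show ?case by (rule 1(1)[OF 1(2-24)])
  qed
  define body :: "'a com" where "body = Cond (Less (Param 1) (Num 2)) SCALE
    (Cond (Less eN (Num N0)) (division.LOAD ;; division.NAIVE ;; division.FINISH)
      (remainder.MAIN mp sp CYC L D E qa qb Cc zz dq ;; division.FINISH))"
  define \<beta> where "\<beta> = c / 2 + 1 / 2 + 1 / c"
  have beta0: "0 \<le> \<beta>" using c by (simp add: \<beta>_def)
  define Z where "Z = 1 + real L * (14 + 3 * real L) + 2 * real E * real E"
  have Z0: "0 \<le> Z" by (simp add: Z_def)
  define Cs where "Cs = 6 * real N0 + 8 + 2 * \<beta> + 3 * Z"
  have Cs_ge: "2 \<le> Cs" "6 * real N0 + 2 \<le> Cs" "2 * \<beta> + 3 * Z \<le> Cs"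
    using Z0 beta0 of_nat_0_le_iff[of N0, where 'a = real] unfolding Cs_def by linarith+
  have "divides_within (machine.CLEAR 50 ;; body) m n 54 ((lam_m * ((c + 1) / 2 + 1 / c) + lam_s * (2 + 1 / c)) * M m
        + Cs * (real m * max 1 (log 2 (real n))))" if mn: "1 \<le> n" "n \<le> m" for m n
    unfolding divides_within_def
  proof (intro allI impI)
    fix A B :: "'a poly"
    assume A: "poly_of_size (m + n) A" and B: "poly_of_size n B" and u: "coeff B (n - 1) dvd 1"
    define inp where "inp = coeff_list (m + n) A @ coeff_list n B"
    have len: "length inp = m + n + n" by (simp add: inp_def coeff_list_def)
    have LEN: "m + 1 + (n - 1) = m + n" using mn by simp
    let ?T = "(lam_m * ((c + 1) / 2 + 1 / c) + lam_s * (2 + 1 / c)) * M m + Cs * (real m * max 1 (log 2 (real n)))"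
    have m1: "1 \<le> real m" "1 \<le> m" "real n \<le> real m" using mn by auto
    have be: "(c + 1) / 2 + 1 / c = \<beta>" by (simp add: \<beta>_def add_divide_distrib)
    have Cs0: "0 \<le> Cs" using Cs_ge by linarith
    \<comment> \<open>As the maximum is at least 1, everything of order \<open>m\<close> may be
      charged to the error term.\<close>
    have "real m * 1 \<le> real m * max 1 (log 2 (real n))" by (rule mult_left_mono) simp_all
    then have "real m \<le> real m * max 1 (log 2 (real n))" by (simp only: mult_1_right)
    then have mx: "Cs * real m \<le> Cs * (real m * max 1 (log 2 (real n)))" by (rule mult_left_mono[OF _ Cs0])
    have e: "(lam_m * \<beta> + lam_s * (2 + 1 / c)) * M m = lam_m * M m * \<beta> + lam_s * M m * (2 + 1 / c)" by (simp add: algebra_simps)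
    have T: "lam_m * M m * \<beta> + lam_s * M m * (2 + 1 / c) + Cs * real m \<le> ?T" unfolding be e by (rule add_left_mono[OF mx])
    have "0 \<le> 2 + 1 / c" using c by simp
    then have T0: "0 \<le> lam_m * M m * \<beta>" "0 \<le> lam_s * M m * (2 + 1 / c)"
      using mult_nonneg_nonneg[OF lm0[OF m1(2)] beta0] mult_nonneg_nonneg[OF ls0[OF m1(2)]] by blast+
    have T1: "Cs * real m \<le> ?T" by (rule order_trans[OF _ T]) (use T0 in linarith)
    have lead: "inp ! (m + n + (n - 1)) = coeff B (n - 1)"
      unfolding inp_def using nth_append_length_plus[of "coeff_list (m + n) A" "coeff_list n B" "n - 1"] mn
      by (simp add: coeff_list_def)
    define Fm where "Fm = lam_m * M m / real m"
    define Fs where "Fs = lam_s * M m / real m"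
    have F0: "0 \<le> Fm" "0 \<le> Fs" unfolding Fm_def Fs_def
      by (rule divide_nonneg_nonneg[OF lm0[OF m1(2)]], simp, rule divide_nonneg_nonneg[OF ls0[OF m1(2)]], simp)
    interpret machine "[m, n]" inp "m + n" .
    let ?Q = "\<lambda>(g', v' :: nat \<Rightarrow> nat, z' :: nat \<Rightarrow> 'a cell). \<exists>f. arr g' 0 (m + n) f \<and> (\<exists>Q R. poly_of_size (m + 1) Q \<and> poly_of_size (n - 1) R \<and>
       A = B * Q + R \<and> map f [0..<m + n] = coeff_list (m + 1) Q @ coeff_list (n - 1) R)"
    have small: "WP SCALE ?T ?Q (g, v, z)" if n1: "n = 1" for g v z
    proof (rule WP_weaken)
      show "WP SCALE (real m + 1) ?Q (g, v, z)"
        using WP_SCALE[of m A B g v z] n1 A B u inp_def by simp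
      have "2 * real m \<le> Cs * real m" by (rule mult_right_mono[OF Cs_ge(1)]) simp
      then have "real m + 1 \<le> Cs * real m" using m1 by linarith
      then show "real m + 1 \<le> ?T" by (rule order_trans[OF _ T1])
    qed
    have rest: "WP (Cond (Less eN (Num N0)) (division.LOAD ;; division.NAIVE ;; division.FINISH)
      (remainder.MAIN mp sp CYC L D E qa qb Cc zz dq ;; division.FINISH)) ?T ?Q (g, v, z)" if n2: "2 \<le> n" for g v z
    proof -
      interpret division "[m, n]" inp "m + n" m n mp sp Fm Fs wm ws
      proof (unfold_locales)
        fix k :: nat and f u :: "nat \<Rightarrow> 'a" assume k: "1 \<le> k" "k \<le> m"
        show "computes mp [k] (map f [0..<2 * k - 1] @ map u [0..<k]) k (wm k) (real k * Fm)
          (\<lambda>ys. ys = map (\<lambda>a. \<Sum>b<k. f (k - 1 + a - b) * u b) [0..<k])"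
        proof -
          have w: "wm k = w1 k" using k by (simp add: wm_def)
          show ?thesis unfolding w Fm_def
            by (rule computes_mono[OF w1(2)[OF k(1) poly_of_size_pol poly_of_size_pol, of f u, unfolded coeff_list_pol middle_product_pol[OF k(1)]] lin[OF lm0 k]])
        qed
        show "computes sp [k] (map f [0..<k] @ map u [0..<k]) k (ws k) (real k * Fs)
          (\<lambda>ys. ys = map (\<lambda>a. \<Sum>b\<le>a. f (a - b) * u b) [0..<k])"
        proof -
          have w: "ws k = w2 k" using k by (simp add: ws_def)
          show ?thesis unfolding w Fs_def
            by (rule computes_mono[OF w2(2)[OF k(1) poly_of_size_pol poly_of_size_pol, of f u, unfolded coeff_list_pol short_product_pol] lin[OF ls0 k]])
        qed
      qed (use n2 mn len lead u F0 in auto)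
      have FIN: "WP FINISH 0 ?Q s" if "(\<lambda>(g', v', z'). stInv (m + 1) g') s" for s
      proof -
        obtain g' v' z' where s: "s = (g', v', z')" by (cases s)
        have "stInv (m + 1) g'" using that unfolding s prod.case .
        then show ?thesis unfolding s by (rule WP_FINISH[OF inp_def A B])
      qed
      have naive: "WP (LOAD ;; NAIVE ;; FINISH) ?T ?Q (g, v, z)" if nN: "n - 1 < N0"
      proof (rule WP_weaken)
        show "WP (LOAD ;; NAIVE ;; FINISH) (0 + ((real (m + 1) * (2 * real n + 1) + 2 * real n * real n) + 0)) ?Q (g, v, z)"
        proof (rule WP_then[OF WP_LOAD])
          fix s :: "'a state" assume h: "case s of (g', v', z') \<Rightarrow> stInv 0 g' \<and> (\<forall>x. x \<noteq> 4 \<longrightarrow> v' x = v x)"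
          obtain g' v' z' where s: "s = (g', v', z')" by (cases s)
          have "stInv 0 g'" using h unfolding s prod.case by blast
          from WP_then[OF WP_NAIVE[OF this] FIN]
          show "WP (NAIVE ;; FINISH) ((real (m + 1) * (2 * real n + 1) + 2 * real n * real n) + 0) ?Q s" unfolding s .
        qed
        have nr: "real n \<le> real N0" using nN n2 by simp
        have "real (m + 1) * (2 * real n + 1) \<le> (2 * real m) * (2 * real N0 + 1)" by (rule mult_mono) (use m1 nr in auto)
        moreover have "real n * real n \<le> real N0 * real m" by (rule mult_mono) (use m1 nr in auto)
        moreover have "(6 * real N0 + 2) * real m \<le> Cs * real m" by (rule mult_right_mono[OF Cs_ge(2)]) simp
        moreover have "(2 * real m) * (2 * real N0 + 1) = 4 * (real N0 * real m) + 2 * real m"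
          "(6 * real N0 + 2) * real m = 6 * (real N0 * real m) + 2 * real m" by (simp_all add: algebra_simps)
        moreover have gen: "x + 2 * y \<le> w" if "x \<le> t" "y \<le> a" "u \<le> w" "t = 4 * a + 2 * b" "u = 6 * a + 2 * b" for x y w t a u b :: real
          using that by linarith
        ultimately have "real (m + 1) * (2 * real n + 1) + 2 * (real n * real n) \<le> Cs * real m" by blast
        then have "0 + ((real (m + 1) * (2 * real n + 1) + 2 * real n * real n) + 0) \<le> Cs * real m" by (simp only: add_0_left add_0_right mult.assoc)
        then show "0 + ((real (m + 1) * (2 * real n + 1) + 2 * real n * real n) + 0) \<le> ?T" by (rule order_trans[OF _ T1])
      qed
      have main: "WP (remainder.MAIN mp sp CYC L D E qa qb Cc zz dq ;; FINISH) ?T ?Q (g, v, z)" if nN: "N0 \<le> n - 1"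
      proof -
        \<comment> \<open>The rate of the selected cyclic product. The selection by constants agrees
          with the smaller of \<open>Fm\<close> and \<open>2 * Fs\<close>, since both contain the
          same factor \<open>M m / real m\<close>.\<close>
        define \<rho> where "\<rho> = (if lam_m \<le> 2 * lam_s then Fm else 2 * Fs)"
        have rhoc: "0 \<le> \<rho>" "\<rho> \<le> Fm" "\<rho> \<le> 2 * Fs"
        proof -
          have "Fm \<le> 2 * Fs" if "lam_m \<le> 2 * lam_s"
          proof -
            have "2 * Fs = 2 * lam_s * M m / real m" by (simp add: Fs_def)
            then show ?thesis unfolding Fm_def by (simp only:) (rule divide_right_mono[OF mult_right_mono[OF that M0[OF m1(2)]]], simp)
          qed
          moreover have "2 * Fs \<le> Fm" if "2 * lam_s \<le> lam_m"
          proof -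
            have "2 * Fs = 2 * lam_s * M m / real m" by (simp add: Fs_def)
            then show ?thesis unfolding Fm_def by (simp only:) (rule divide_right_mono[OF mult_right_mono[OF that M0[OF m1(2)]]], simp)
          qed
          ultimately show "0 \<le> \<rho>" "\<rho> \<le> Fm" "\<rho> \<le> 2 * Fs" using F0 by (auto simp: \<rho>_def)
        qed
        have cyc: "cyc_spec CYC \<rho>" using cyc_spec_MP cyc_spec_SP by (simp add: CYC_def \<rho>_def)
        interpret remainder "[m, n]" inp "m + n" m n mp sp Fm Fs wm ws CYC \<rho> L D E "(n - 1) div dq"
        proof (unfold_locales)
          show "L \<le> m + n" using Nc(5)[OF nN] by linarith
          show "(\<Sum>i<j. D * ((n - 1) div dq + i)) + 6 * (D * ((n - 1) div dq + j) + 1) + wm (D * ((n - 1) div dq + j) + 1) \<le> n - 1"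
            "(\<Sum>i<j. D * ((n - 1) div dq + i)) + 6 * (D * ((n - 1) div dq + j) + 1) + ws (D * ((n - 1) div dq + j) + 1) \<le> n - 1" if "j < L" for j
            by (rule spc[OF nN that wmc(1)], rule spc[OF nN that wmc(2)])
        qed (use cyc rhoc D Ec wmE Nc(5)[OF nN] in blast)+
        have phe: "ph = n - 1 - (\<Sum>i<L. D * ((n - 1) div dq + i))" unfolding ph_def lenj_def aj_def by simp
        define e where "e = \<mu> * real (n - 1) / 12"
        have W: "WP (MAIN qa qb Cc zz dq) (Fm * ((c / 2 + 1 / 2 + 1 / c) * real m) + Fs * ((2 + 1 / c) * real m) +
            (c / 2 + 1 / 2 + 1 / c) * real (m + 1) + 3 * (e + (real L * (2 * real (m + 1) + (10 + 3 * real L) * real n) + 2 * real E * real E))) (\<lambda>(g', v', z'). stInv (m + 1) g') (g, v, z)"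
          by (rule WP_MAIN_explicit[OF c(1) K(1-10) Nc(1,2)[OF nN] K(11-13) Nc(3)[OF nN] d(1) wmc phc(1)[OF nN, folded phe]
                phc(2)[OF nN, folded phe e_def] rhoc(2,3) refl Nc(4)[OF nN, folded e_def]])
        show ?thesis
        proof (rule WP_weaken[OF WP_then[OF W FIN]])
          have 1: "Fm * ((c / 2 + 1 / 2 + 1 / c) * real m) = lam_m * M m * \<beta>" "Fs * ((2 + 1 / c) * real m) = lam_s * M m * (2 + 1 / c)"
            using m1 by (simp_all add: Fm_def Fs_def \<beta>_def)
          have 2: "(c / 2 + 1 / 2 + 1 / c) * real (m + 1) \<le> 2 * \<beta> * real m"
            unfolding \<beta>_def[symmetric] using mult_left_mono[of "real (m + 1)" "2 * real m" \<beta>] m1 beta0 by simp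
          have "\<mu> * real (n - 1) \<le> 1 * real (n - 1)" by (rule mult_right_mono) (use K in auto)
          also have "1 * real (n - 1) \<le> real m" using mn by simp
          finally have "\<mu> * real (n - 1) \<le> real m" .
          then have 3: "e \<le> real m" using m1 unfolding e_def by linarith
          have "2 * real (m + 1) + (10 + 3 * real L) * real n \<le> 4 * real m + (10 + 3 * real L) * real m"
            using m1 by (intro add_mono mult_left_mono) auto
          then have "real L * (2 * real (m + 1) + (10 + 3 * real L) * real n) \<le> real L * ((14 + 3 * real L) * real m)"
            by (intro mult_left_mono) (simp_all add: algebra_simps)
          moreover have "2 * real E * real E \<le> 2 * real E * real E * real m" using mult_left_mono[OF m1(1), of "2 * real E * real E"] by simp
          ultimately have "(e + (real L * (2 * real (m + 1) + (10 + 3 * real L) * real n) + 2 * real E * real E)) \<le> real m + (real L * ((14 + 3 * real L) * real m) + 2 * real E * real E * real m)"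
            by (intro add_mono 3)
          also have "\<dots> = Z * real m" by (simp add: Z_def algebra_simps)
          finally have 4: "(e + (real L * (2 * real (m + 1) + (10 + 3 * real L) * real n) + 2 * real E * real E)) \<le> Z * real m" .
          have 5: "2 * \<beta> * real m + 3 * (Z * real m) \<le> Cs * real m"
            using mult_right_mono[OF Cs_ge(3), of "real m"] by (simp add: algebra_simps)
          have gen: "a + b + p + 3 * x + 0 \<le> t" if "p \<le> u" "x \<le> y" "u + 3 * y \<le> w" "a + b + w \<le> t" for a b p x t u y w :: real
            using that by linarith
          show "Fm * ((c / 2 + 1 / 2 + 1 / c) * real m) + Fs * ((2 + 1 / c) * real m) +
            (c / 2 + 1 / 2 + 1 / c) * real (m + 1) + 3 * (e + (real L * (2 * real (m + 1) + (10 + 3 * real L) * real n) + 2 * real E * real E)) + 0 \<le> ?T"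
            unfolding 1 by (rule gen[OF 2 4 5 T])
        qed
      qed
      show ?thesis
      proof (rule WP_cond)
        show "okb (Less eN (Num N0))" by simp
      qed (use naive main in auto)
    qed
    have "computes (CLEAR 50 ;; body) [m, n] inp (m + n) 54 ?T
       (\<lambda>ys. \<exists>Q R. poly_of_size (m + 1) Q \<and> poly_of_size (n - 1) R \<and> A = B * Q + R \<and> ys = coeff_list (m + 1) Q @ coeff_list (n - 1) R)"
    proof (rule computes_WP)
      fix g z
      show "WP body ?T ?Q (g, \<lambda>_. 0, z)"
        unfolding body_def
      proof (rule WP_cond)
        show "okb (Less (Param 1) (Num 2))" by simp
      qed (use small rest mn in auto)
    qed
    then show "computes (CLEAR 50 ;; body) [m, n] (coeff_list (m + n) A @ coeff_list n B) (m + 1 + (n - 1)) 54 ?T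
       (\<lambda>ys. \<exists>Q R. poly_of_size (m + 1) Q \<and> poly_of_size (n - 1) R \<and> A = B * Q + R \<and> ys = coeff_list (m + 1) Q @ coeff_list (n - 1) R)"
      unfolding LEN inp_def .
  qed
  then show ?thesis by blast
qed

end
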